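(* Let $(M,h_0)$ be an $n$-dimensional Riemannian manifold and let $V\subset M$ be an open subset. Suppose that $$\boldsymbol{\nu}(V,h_0,\tau_0)\ge 0$$ for some $\tau_0>0$, where $\boldsymbol{\nu}$ is the local Perelman $\nu$-entropy. Then $V$ is flat.
   Context: $M$ is a smooth manifold with smooth Riemannian metric; it is not assumed complete. For a Riemannian metric $g$ on $M$ with scalar curvature $R$, an open set $V\subset M$, $s>0$ and a function $\varphi$ in $$\mathcal{S}(V):=\Big\{\varphi \ :\ \varphi\in W_0^{1,2}(V),\ \varphi\ge 0,\ \int_V\varphi^2\,d\mathrm{vol}_g=1\Big\},$$ set $$\mathcal{W}(V,g,\varphi,s)=-n-\frac n2\log(4\pi s)+\int_V\Big\{s\big(R\varphi^2+4|\nabla\varphi|^2\big)-2\varphi^2\log\varphi\Big\}\,d\mathrm{vol}_g$$ (with $0\log 0=0$). The local Perelman $\nu$-entropy is $$\boldsymbol{\nu}(V,g,\tau):=\inf_{s\in(0,\tau]}\ \inf_{\varphi\in\mathcal{S}(V)}\mathcal{W}(V,g,\varphi,s).$$ "$V$ is flat" means the Riemann curvature tensor of the metric vanishes identically on $V$. *)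

theory Defs
  imports "HOL-Analysis.Analysis"
begin

section \<open>Smooth functions on open subsets of Euclidean space\<close>

definition partial_deriv :: "'n::finite \<Rightarrow> (real^'n \<Rightarrow> 'b::real_normed_vector) \<Rightarrow> real^'n \<Rightarrow> 'b"
  where "partial_deriv i f y = frechet_derivative f (at y) (axis i 1)"

text \<open>Only meant for open \<open>S\<close>.\<close>

primrec Ck_on :: "nat \<Rightarrow> (real^'n::finite) set \<Rightarrow> (real^'n \<Rightarrow> 'b::real_normed_vector) \<Rightarrow> bool"
  where
    "Ck_on 0 S f \<longleftrightarrow> continuous_on S f"
  | "Ck_on (Suc k) S f \<longleftrightarrow> (\<forall>y\<in>S. f differentiable (at y)) \<and> (\<forall>i. Ck_on k S (partial_deriv i f))"

definition smooth_on :: "(real^'n::finite) set \<Rightarrow> (real^'n \<Rightarrow> 'b::real_normed_vector) \<Rightarrow> bool"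
  where "smooth_on S f \<longleftrightarrow> (\<forall>k. Ck_on k S f)"


section \<open>Smooth manifolds\<close>

text \<open>
  A chart is a coordinate neighbourhood \<open>U\<close> together with a coordinate map, of which only the
  values on \<open>U\<close> matter. A manifold is an open subset \<open>M\<close> of a second countable Hausdorff space
  with a (not necessarily maximal) smooth atlas; its dimension is \<open>CARD('n)\<close>.
\<close>

type_synonym ('m, 'n) chart = "'m set \<times> ('m \<Rightarrow> real^'n)"

abbreviation chart_dom :: "('m, 'n::finite) chart \<Rightarrow> 'm set"
  where "chart_dom c \<equiv> fst c"

abbreviation chart_map :: "('m, 'n::finite) chart \<Rightarrow> 'm \<Rightarrow> real^'n"
  where "chart_map c \<equiv> snd c"

definition chart_inv :: "('m, 'n::finite) chart \<Rightarrow> real^'n \<Rightarrow> 'm"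
  where "chart_inv c = inv_into (chart_dom c) (chart_map c)"

definition is_chart :: "('m::topological_space, 'n::finite) chart \<Rightarrow> bool"
  where "is_chart c \<longleftrightarrow>
    open (chart_dom c) \<and> open (chart_map c ` chart_dom c) \<and> inj_on (chart_map c) (chart_dom c) \<and>
    continuous_on (chart_dom c) (chart_map c) \<and>
    continuous_on (chart_map c ` chart_dom c) (chart_inv c)"

definition smooth_manifold ::
    "'m::{t2_space, second_countable_topology} set \<Rightarrow> ('m, 'n::finite) chart set \<Rightarrow> bool"
  where "smooth_manifold M A \<longleftrightarrow>
    (\<forall>c\<in>A. is_chart c) \<and> (\<Union>c\<in>A. chart_dom c) = M \<and>
    (\<forall>c\<in>A. \<forall>c'\<in>A. smooth_on (chart_map c ` (chart_dom c \<inter> chart_dom c')) (chart_map c' \<circ> chart_inv c))"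

text \<open>
  The Jacobian matrix, at \<open>p\<close>, of the coordinates of \<open>c'\<close> with respect to those of \<open>c\<close>; its
  \<open>(j, i)\<close> entry is \<open>\<partial>x'\<^sup>j / \<partial>x\<^sup>i\<close>.
\<close>

definition transition_jacobian ::
    "('m, 'n::finite) chart \<Rightarrow> ('m, 'n) chart \<Rightarrow> 'm \<Rightarrow> real^'n^'n"
  where "transition_jacobian c c' p = jacobian (chart_map c' \<circ> chart_inv c) (at (chart_map c p))"

text \<open>Some chart of \<open>A\<close> around \<open>p\<close>, used to evaluate expressions that do not depend on the chart.\<close>

definition chart_at :: "('m, 'n::finite) chart set \<Rightarrow> 'm \<Rightarrow> ('m, 'n) chart"
  where "chart_at A p = (SOME c. c \<in> A \<and> p \<in> chart_dom c)"

definition test_functions :: "('m::topological_space, 'n::finite) chart set \<Rightarrow> 'm set \<Rightarrow> ('m \<Rightarrow> real) set"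
  where "test_functions A V = {f.
    (\<forall>c\<in>A. smooth_on (chart_map c ` chart_dom c) (f \<circ> chart_inv c)) \<and>
    (\<exists>K. compact K \<and> K \<subseteq> V \<and> (\<forall>p. p \<notin> K \<longrightarrow> f p = 0))}"


section \<open>Riemannian metrics, curvature and volume\<close>

text \<open>
  Tensor fields are given by their components in every chart of the atlas, subject to the
  tensorial transformation law: \<open>g c p\<close> is the matrix of the \<open>g\<^sub>i\<^sub>j\<close> in the chart \<open>c\<close> at \<open>p\<close>.
\<close>

type_synonym ('m, 'n) metric = "('m, 'n) chart \<Rightarrow> 'm \<Rightarrow> real^'n^'n"

definition metric_in_chart ::
    "('m, 'n::finite) metric \<Rightarrow> ('m, 'n) chart \<Rightarrow> real^'n \<Rightarrow> real^'n^'n"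
  where "metric_in_chart g c y = g c (chart_inv c y)"

definition riemannian_metric :: "('m, 'n::finite) chart set \<Rightarrow> ('m, 'n) metric \<Rightarrow> bool"
  where "riemannian_metric A g \<longleftrightarrow>
    (\<forall>c\<in>A. smooth_on (chart_map c ` chart_dom c) (metric_in_chart g c)) \<and>
    (\<forall>c\<in>A. \<forall>p\<in>chart_dom c. transpose (g c p) = g c p \<and> (\<forall>v. v \<noteq> 0 \<longrightarrow> v \<bullet> (g c p *v v) > 0)) \<and>
    (\<forall>c\<in>A. \<forall>c'\<in>A. \<forall>p\<in>chart_dom c \<inter> chart_dom c'.
       g c p = transpose (transition_jacobian c c' p) ** g c' p ** transition_jacobian c c' p)"

text \<open>The Christoffel symbol \<open>\<Gamma>\<^sup>k\<^sub>i\<^sub>j\<close> in the chart \<open>c\<close>, as a function of the coordinates.\<close>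

definition christoffel ::
    "('m, 'n::finite) metric \<Rightarrow> ('m, 'n) chart \<Rightarrow> 'n \<Rightarrow> 'n \<Rightarrow> 'n \<Rightarrow> real^'n \<Rightarrow> real"
  where "christoffel g c k i j y =
    (1/2) * (\<Sum>l\<in>UNIV. matrix_inv (metric_in_chart g c y) $ k $ l *
      (partial_deriv i (\<lambda>z. metric_in_chart g c z $ j $ l) y
       + partial_deriv j (\<lambda>z. metric_in_chart g c z $ i $ l) y
       - partial_deriv l (\<lambda>z. metric_in_chart g c z $ i $ j) y))"

text \<open>
  The component \<open>R\<^sup>l\<^sub>k\<^sub>i\<^sub>j\<close> of the Riemann tensor of the Levi-Civita connection, with the convention
  \<open>R(\<partial>\<^sub>i, \<partial>\<^sub>j) \<partial>\<^sub>k = \<nabla>\<^sub>i \<nabla>\<^sub>j \<partial>\<^sub>k - \<nabla>\<^sub>j \<nabla>\<^sub>i \<partial>\<^sub>k = R\<^sup>l\<^sub>k\<^sub>i\<^sub>j \<partial>\<^sub>l\<close>. The scalar curvature below is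
  \<open>g\<^sup>j\<^sup>k R\<^sup>i\<^sub>k\<^sub>i\<^sub>j\<close>, which is positive on round spheres.
\<close>

definition riemann_component ::
    "('m, 'n::finite) metric \<Rightarrow> ('m, 'n) chart \<Rightarrow> 'n \<Rightarrow> 'n \<Rightarrow> 'n \<Rightarrow> 'n \<Rightarrow> real^'n \<Rightarrow> real"
  where "riemann_component g c l k i j y =
    partial_deriv i (christoffel g c l j k) y - partial_deriv j (christoffel g c l i k) y
    + (\<Sum>m\<in>UNIV. christoffel g c l i m y * christoffel g c m j k y
                  - christoffel g c l j m y * christoffel g c m i k y)"

definition ricci_component ::
    "('m, 'n::finite) metric \<Rightarrow> ('m, 'n) chart \<Rightarrow> 'n \<Rightarrow> 'n \<Rightarrow> real^'n \<Rightarrow> real"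
  where "ricci_component g c j k y = (\<Sum>i\<in>UNIV. riemann_component g c i k i j y)"

definition scalar_curvature ::
    "('m, 'n::finite) chart set \<Rightarrow> ('m, 'n) metric \<Rightarrow> 'm \<Rightarrow> real"
  where "scalar_curvature A g p =
    (let c = chart_at A p; y = chart_map c p in
      \<Sum>j\<in>UNIV. \<Sum>k\<in>UNIV. matrix_inv (metric_in_chart g c y) $ j $ k * ricci_component g c j k y)"

definition flat_on :: "('m, 'n::finite) chart set \<Rightarrow> ('m, 'n) metric \<Rightarrow> 'm set \<Rightarrow> bool"
  where "flat_on A g V \<longleftrightarrow>
    (\<forall>c\<in>A. \<forall>p\<in>V \<inter> chart_dom c. \<forall>l k i j. riemann_component g c l k i j (chart_map c p) = 0)"

text \<open>
  The Riemannian volume: the unique Borel measure carried by the manifold that is given by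
  \<open>sqrt (det g) dx\<close> in every chart.
\<close>

definition riemannian_volume ::
    "('m::{t2_space, second_countable_topology}, 'n::finite) chart set \<Rightarrow> ('m, 'n) metric \<Rightarrow> 'm measure"
  where "riemannian_volume A g = (THE \<mu>. sets \<mu> = sets borel \<and>
    (\<forall>c\<in>A. \<forall>B\<in>sets borel. B \<subseteq> chart_dom c \<longrightarrow>
       emeasure \<mu> B
         = (\<integral>\<^sup>+ y\<in>chart_map c ` B. ennreal (sqrt (det (metric_in_chart g c y))) \<partial>lborel)) \<and>
    emeasure \<mu> (- (\<Union>c\<in>A. chart_dom c)) = 0)"


section \<open>The Sobolev space with zero boundary values\<close>

definition weak_partial_deriv ::
    "(real^'n::finite) set \<Rightarrow> (real^'n \<Rightarrow> real) \<Rightarrow> 'n \<Rightarrow> (real^'n \<Rightarrow> real) \<Rightarrow> bool"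
  where "weak_partial_deriv S u i w \<longleftrightarrow>
    (\<forall>K. compact K \<and> K \<subseteq> S \<longrightarrow> set_integrable lborel K u \<and> set_integrable lborel K w) \<and>
    (\<forall>\<eta>. smooth_on UNIV \<eta> \<and> (\<exists>K. compact K \<and> K \<subseteq> S \<and> (\<forall>y. y \<notin> K \<longrightarrow> \<eta> y = 0)) \<longrightarrow>
       (LINT y:S|lborel. u y * partial_deriv i \<eta> y) = - (LINT y:S|lborel. w y * \<eta> y))"

text \<open>A covector field, by its components in every chart.\<close>

type_synonym ('m, 'n) covector_field = "('m, 'n) chart \<Rightarrow> 'm \<Rightarrow> real^'n"

definition is_weak_differential ::
    "('m, 'n::finite) chart set \<Rightarrow> 'm set \<Rightarrow> ('m \<Rightarrow> real) \<Rightarrow> ('m, 'n) covector_field \<Rightarrow> bool"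
  where "is_weak_differential A V \<phi> \<omega> \<longleftrightarrow>
    (\<forall>c\<in>A. \<forall>c'\<in>A. \<forall>p\<in>V \<inter> chart_dom c \<inter> chart_dom c'.
       \<omega> c p = transpose (transition_jacobian c c' p) *v \<omega> c' p) \<and>
    (\<forall>c\<in>A. \<forall>i. weak_partial_deriv (chart_map c ` (V \<inter> chart_dom c))
       (\<lambda>y. \<phi> (chart_inv c y)) i (\<lambda>y. \<omega> c (chart_inv c y) $ i))"

text \<open>Determined by \<open>\<phi>\<close> up to null sets, if it exists.\<close>

definition weak_differential ::
    "('m, 'n::finite) chart set \<Rightarrow> 'm set \<Rightarrow> ('m \<Rightarrow> real) \<Rightarrow> ('m, 'n) covector_field"
  where "weak_differential A V \<phi> = (SOME \<omega>. is_weak_differential A V \<phi> \<omega>)"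

text \<open>\<open>|\<nabla>\<phi>|\<^sup>2 = g\<^sup>i\<^sup>j \<partial>\<^sub>i\<phi> \<partial>\<^sub>j\<phi>\<close>, the squared length of the gradient being that of the differential.\<close>

definition grad_norm_sq ::
    "('m, 'n::finite) chart set \<Rightarrow> ('m, 'n) metric \<Rightarrow> 'm set \<Rightarrow> ('m \<Rightarrow> real) \<Rightarrow> 'm \<Rightarrow> real"
  where "grad_norm_sq A g V \<phi> p =
    (let c = chart_at A p; \<omega> = weak_differential A V \<phi> c p in \<omega> \<bullet> (matrix_inv (g c p) *v \<omega>))"

definition sobolev_norm_sq ::
    "('m::{t2_space, second_countable_topology}, 'n::finite) chart set \<Rightarrow> ('m, 'n) metric \<Rightarrow> 'm set
      \<Rightarrow> ('m \<Rightarrow> real) \<Rightarrow> ennreal"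
  where "sobolev_norm_sq A g V \<phi> =
    (\<integral>\<^sup>+ p\<in>V. ennreal ((\<phi> p)\<^sup>2 + grad_norm_sq A g V \<phi> p) \<partial>riemannian_volume A g)"

definition W12 ::
    "('m::{t2_space, second_countable_topology}, 'n::finite) chart set \<Rightarrow> ('m, 'n) metric \<Rightarrow> 'm set
      \<Rightarrow> ('m \<Rightarrow> real) set"
  where "W12 A g V = {\<phi>. set_borel_measurable borel V \<phi> \<and>
    (\<exists>\<omega>. is_weak_differential A V \<phi> \<omega>) \<and> sobolev_norm_sq A g V \<phi> < \<infinity>}"

definition W12_0 ::
    "('m::{t2_space, second_countable_topology}, 'n::finite) chart set \<Rightarrow> ('m, 'n) metric \<Rightarrow> 'm set
      \<Rightarrow> ('m \<Rightarrow> real) set"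
  where "W12_0 A g V = {\<phi> \<in> W12 A g V.
    \<forall>\<epsilon>>0. \<exists>f\<in>test_functions A V. sobolev_norm_sq A g V (\<lambda>p. \<phi> p - f p) < \<epsilon>}"


section \<open>The local entropy\<close>

definition entropy_test_functions ::
    "('m::{t2_space, second_countable_topology}, 'n::finite) chart set \<Rightarrow> ('m, 'n) metric \<Rightarrow> 'm set
      \<Rightarrow> ('m \<Rightarrow> real) set"
  where "entropy_test_functions A g V = {\<phi> \<in> W12_0 A g V.
    (AE p in riemannian_volume A g. p \<in> V \<longrightarrow> \<phi> p \<ge> 0) \<and>
    (\<integral>\<^sup>+ p\<in>V. ennreal ((\<phi> p)\<^sup>2) \<partial>riemannian_volume A g) = 1}"

text \<open>
  For a test function in \<open>W\<^sub>0\<^sup>1\<^sup>,\<^sup>2(V)\<close> the integrand of the entropy need not be integrable, so the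
  integral is taken in the extended reals. Where it is not defined at all, both parts being
  infinite, \<open>\<infinity> - \<infinity> = \<infinity>\<close> in type \<^typ>\<open>ereal\<close>, so such a test function does not contribute
  to the infimum.
\<close>

definition extended_integral :: "'m measure \<Rightarrow> 'm set \<Rightarrow> ('m \<Rightarrow> real) \<Rightarrow> ereal"
  where "extended_integral \<mu> V f =
    enn2ereal (\<integral>\<^sup>+ p\<in>V. ennreal (f p) \<partial>\<mu>) - enn2ereal (\<integral>\<^sup>+ p\<in>V. ennreal (- f p) \<partial>\<mu>)"

text \<open>\<open>0 log 0 = 0\<close> holds automatically below.\<close>

definition W_entropy ::
    "('m::{t2_space, second_countable_topology}, 'n::finite) chart set \<Rightarrow> 'm set \<Rightarrow> ('m, 'n) metric
      \<Rightarrow> ('m \<Rightarrow> real) \<Rightarrow> real \<Rightarrow> ereal"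
  where "W_entropy A V g \<phi> s =
    ereal (- real CARD('n) - real CARD('n) / 2 * ln (4 * pi * s))
    + extended_integral (riemannian_volume A g) V
        (\<lambda>p. s * (scalar_curvature A g p * (\<phi> p)\<^sup>2 + 4 * grad_norm_sq A g V \<phi> p)
             - 2 * (\<phi> p)\<^sup>2 * ln (\<phi> p))"

definition nu_entropy ::
    "('m::{t2_space, second_countable_topology}, 'n::finite) chart set \<Rightarrow> 'm set \<Rightarrow> ('m, 'n) metric
      \<Rightarrow> real \<Rightarrow> ereal"
  where "nu_entropy A V g \<tau> =
    (INF s\<in>{0<..\<tau>}. INF \<phi>\<in>entropy_test_functions A g V. W_entropy A V g \<phi> s)"

end

theory Submission
  imports Defs "HOL-Probability.Distributions" "HOL-Computational_Algebra.Polynomial"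
begin

text \<open>
  The Gaussian is the optimal test function for the entropy of Euclidean space, where its entropy
  is zero. Near a point \<open>p\<close> of \<open>V\<close> we test with \<open>\<phi> = q (det g)\<^sup>-\<^sup>1\<^sup>/\<^sup>4\<close>, where \<open>q\<^sup>2\<close> is a truncated
  Gaussian of variance \<open>2 s = 2 \<delta>\<^sup>2\<close> in normal coordinates, and expand for \<open>\<delta> \<rightarrow> 0\<close>. Removing a divergence,
  the energy becomes \<open>\<integral> g\<^sup>i\<^sup>j (2 q\<^sub>i q\<^sub>j - 2 q q\<^sub>i\<^sub>j) + q\<^sup>2 g\<^sup>i\<^sup>j tr (\<Gamma>\<^sub>i \<Gamma>\<^sub>j)\<close>, so that, up to exponentially small terms,
  the entropy is the Gaussian mean of \<open>(tr g\<^sup>-\<^sup>1 + ln det g - n)/2 + s g\<^sup>i\<^sup>j tr (\<Gamma>\<^sub>i \<Gamma>\<^sub>j)\<close> for the rescaled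
  metric. This is of order \<open>\<delta>\<^sup>4\<close>, and in normal coordinates its leading coefficient is
  \<open>- 1/2 \<Sum> (\<partial>\<^sub>k \<partial>\<^sub>l g\<^sub>i\<^sub>j(p))\<^sup>2\<close>. As the entropy is nonnegative, the second derivatives of the metric vanish at \<open>p\<close>,
  and with them the curvature.
\<close>

text \<open>Two terms compete at order \<delta>^4. As \<open>tr g^-1 + ln det g - n\<close> has no
  part linear in \<open>H = g - 1\<close>, it gives \<open>tr (H H) / 2\<close>, which is
  nonnegative; only the connection term can be negative. Normal coordinates alone do not decide the
  sign, since the square of the Gaussian mean of the second order part of the metric would enter
  positively. A further linear map, close to the identity (\<open>shear\<close>), removes this mean.
  What is left of \<open>H\<close> is the variance of a quadratic form, worth \<open>1/2\<close> of
  the sum of the squared second derivatives, against \<open>-1\<close> times the same sum from the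
  connection. This last value rests on coordinates that are normal to third order, where the
  derivatives of the Christoffel symbols have vanishing cyclic sums. Neither tails nor
  normalizations are computed. On the tails four powers of \<open>norm y\<close> are traded for
  \<delta>^4, and a mass \<open>m <= 1\<close> enters only through \<open>m * ln m <= 0\<close>. The
  exponent -1/4 is the one for which the mass of the test function is the Euclidean integral of
  \<open>q^2\<close>, whatever the metric.\<close>

abbreviation pd :: "'n::finite \<Rightarrow> (real^'n \<Rightarrow> 'b::real_normed_vector) \<Rightarrow> real^'n \<Rightarrow> 'b"
  where "pd \<equiv> partial_deriv"

type_synonym 'n mfield = "(real, 'n) vec \<Rightarrow> ((real, 'n) vec, 'n) vec"

abbreviation sum_all :: "('i \<Rightarrow> 'a::comm_monoid_add) \<Rightarrow> 'a"  (binder "SUM " 10)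
  where "sum_all f \<equiv> sum f UNIV"

named_theorems smooth_intros

section \<open>Rules for partial derivatives\<close>

lemma pd_eq:
  "(f has_derivative f') (at y) \<Longrightarrow> pd i f y = f' (axis i 1)"
  unfolding partial_deriv_def by (metis frechet_derivative_at)

lemma differentiable_has_derivative:
  "f differentiable (at y) \<Longrightarrow> (f has_derivative frechet_derivative f (at y)) (at y)"
  using frechet_derivative_works by blast

lemma pd_cong_open:
  assumes "open S" "y \<in> S" "\<And>x. x \<in> S \<Longrightarrow> f x = g x" "f differentiable (at y)"
  shows "pd i g y = pd i f y"
  unfolding partial_deriv_def
  using frechet_derivative_transform_within_open[OF assms(4,1,2), of g] assms(3) by simp

lemma differentiable_cong_open:
  assumes "open S" "y \<in> S" "\<And>x. x \<in> S \<Longrightarrow> f x = g x" "f differentiable (at y)"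
  shows "g differentiable (at y)"
  using assms has_derivative_transform_within_open unfolding differentiable_def by metis

lemma has_derivative_partial_sum:
  fixes f :: "real^'n::finite \<Rightarrow> 'b::real_normed_vector"
  assumes "(f has_derivative f') (at y)"
  shows "f' v = (SUM i. v $ i *\<^sub>R pd i f y)"
proof -
  have l: "linear f'" using assms has_derivative_linear by blast
  have "f' v = f' (SUM i. v $ i *\<^sub>R axis i 1)"
    using basis_expansion[of v] by (simp add: scalar_mult_eq_scaleR)
  also have "\<dots> = (SUM i. v $ i *\<^sub>R f' (axis i 1))"
    by (simp add: linear_sum[OF l] linear_cmul[OF l])
  finally show ?thesis using pd_eq[OF assms] by simp
qed

lemma pd_const [simp]: "pd i (\<lambda>x. c) = (\<lambda>x. 0)"
  by (simp add: partial_deriv_def fun_eq_iff)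

lemma pd_add:
  assumes "f differentiable (at y)" "g differentiable (at y)"
  shows "pd i (\<lambda>x. f x + g x) y = pd i f y + pd i g y"
proof -
  have "((\<lambda>x. f x + g x) has_derivative (\<lambda>v. frechet_derivative f (at y) v + frechet_derivative g (at y) v)) (at y)"
    by (intro has_derivative_add differentiable_has_derivative assms)
  from pd_eq[OF this] show ?thesis by (simp add: partial_deriv_def)
qed

lemma pd_linear:
  assumes "bounded_linear L" "f differentiable (at y)"
  shows "pd i (\<lambda>x. L (f x)) y = L (pd i f y)"
proof -
  have "((\<lambda>x. L (f x)) has_derivative (\<lambda>v. L (frechet_derivative f (at y) v))) (at y)"
    by (intro bounded_linear.has_derivative[OF assms(1)] differentiable_has_derivative assms)
  from pd_eq[OF this] show ?thesis by (simp add: partial_deriv_def)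
qed

lemma pd_bilinear:
  assumes "bounded_bilinear B" "f differentiable (at y)" "g differentiable (at y)"
  shows "pd i (\<lambda>x. B (f x) (g x)) y = B (f y) (pd i g y) + B (pd i f y) (g y)"
proof -
  have "((\<lambda>x. B (f x) (g x)) has_derivative (\<lambda>v. B (f y) (frechet_derivative g (at y) v) + B (frechet_derivative f (at y) v) (g y))) (at y)"
    by (intro bounded_bilinear.FDERIV[OF assms(1)] differentiable_has_derivative assms)
  from pd_eq[OF this] show ?thesis by (simp add: partial_deriv_def)
qed

lemma differentiable_bilinear:
  assumes "bounded_bilinear B" "f differentiable (at y)" "g differentiable (at y)"
  shows "(\<lambda>x. B (f x) (g x)) differentiable (at y)"
proof -
  have "((\<lambda>x. B (f x) (g x)) has_derivative (\<lambda>v. B (f y) (frechet_derivative g (at y) v) + B (frechet_derivative f (at y) v) (g y))) (at y)"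
    by (intro bounded_bilinear.FDERIV[OF assms(1)] differentiable_has_derivative assms)
  then show ?thesis unfolding differentiable_def by blast
qed

lemma differentiable_bounded_linear:
  assumes "bounded_linear L" "f differentiable (at y)"
  shows "(\<lambda>x. L (f x)) differentiable (at y)"
  using assms bounded_linear.has_derivative unfolding differentiable_def by blast

lemmas pd_mult = pd_bilinear[OF bounded_bilinear_mult]
lemmas pd_scaleR = pd_bilinear[OF bounded_bilinear_scaleR]
lemmas pd_component = pd_linear[OF bounded_linear_vec_nth]

lemma pd_uminus:
  "f differentiable (at y) \<Longrightarrow> pd i (\<lambda>x. - f x) y = - pd i f y"
  by (rule pd_linear) (simp_all add: bounded_linear_minus)

lemma pd_diff:
  assumes "f differentiable (at y)" "g differentiable (at y)"
  shows "pd i (\<lambda>x. f x - g x) y = pd i f y - pd i g y"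
  using pd_add[OF assms(1), of "\<lambda>x. - g x" i] assms(2) by (simp add: pd_uminus)

lemma pd_sum:
  assumes "finite I" "\<And>j. j \<in> I \<Longrightarrow> f j differentiable (at y)"
  shows "pd i (\<lambda>x. \<Sum>j\<in>I. f j x) y = (\<Sum>j\<in>I. pd i (f j) y)"
  using assms
proof (induction I rule: finite_induct)
  case (insert a F)
  have "(\<lambda>x. \<Sum>j\<in>F. f j x) differentiable (at y)"
    using insert by (intro differentiable_sum) auto
  then show ?case using insert by (simp add: pd_add)
qed simp

lemma pd_compose:
  fixes \<psi> :: "real^'n::finite \<Rightarrow> real^'m::finite" and f :: "real^'m \<Rightarrow> 'b::real_normed_vector"
  assumes "\<psi> differentiable (at y)" "f differentiable (at (\<psi> y))"
  shows "pd i (\<lambda>x. f (\<psi> x)) y = (SUM j. (pd i \<psi> y $ j) *\<^sub>R pd j f (\<psi> y))"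
proof -
  have 1: "(\<psi> has_derivative frechet_derivative \<psi> (at y)) (at y)"
    and 2: "(f has_derivative frechet_derivative f (at (\<psi> y))) (at (\<psi> y))"
    using assms frechet_derivative_works by blast+
  have "((\<lambda>x. f (\<psi> x)) has_derivative (\<lambda>v. frechet_derivative f (at (\<psi> y)) (frechet_derivative \<psi> (at y) v))) (at y)"
    using has_derivative_compose[OF 1 2] .
  from pd_eq[OF this]
  have "pd i (\<lambda>x. f (\<psi> x)) y = frechet_derivative f (at (\<psi> y)) (pd i \<psi> y)"
    by (simp add: partial_deriv_def)
  also have "\<dots> = (SUM j. (pd i \<psi> y $ j) *\<^sub>R pd j f (\<psi> y))"
    by (rule has_derivative_partial_sum[OF 2])
  finally show ?thesis .
qed

lemma pd_compose_real:
  fixes h :: "real \<Rightarrow> real"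
  assumes "f differentiable (at y)" "(h has_real_derivative h') (at (f y))"
  shows "pd i (\<lambda>x. h (f x)) y = h' * pd i f y"
    and "(\<lambda>x. h (f x)) differentiable (at y)"
proof -
  have 1: "(f has_derivative frechet_derivative f (at y)) (at y)"
    using assms frechet_derivative_works by blast
  have d: "((\<lambda>x. h (f x)) has_derivative (\<lambda>v. h' * (frechet_derivative f (at y) v))) (at y)"
    using has_derivative_compose[OF 1 assms(2)[unfolded has_field_derivative_def]] .
  from pd_eq[OF this] show "pd i (\<lambda>x. h (f x)) y = h' * pd i f y"
    by (simp add: partial_deriv_def)
  show "(\<lambda>x. h (f x)) differentiable (at y)" using d unfolding differentiable_def by blast
qed

lemma has_real_derivative_line:
  fixes f :: "real^'n::finite \<Rightarrow> real"
  assumes "f differentiable (at (y + t *\<^sub>R axis i 1))"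
  shows "((\<lambda>t. f (y + t *\<^sub>R axis i 1)) has_real_derivative pd i f (y + t *\<^sub>R axis i 1)) (at t)"
proof -
  let ?D = "frechet_derivative f (at (y + t *\<^sub>R axis i 1))"
  have 1: "(f has_derivative ?D) (at (y + t *\<^sub>R axis i 1))"
    using assms frechet_derivative_works by blast
  have 2: "((\<lambda>t. y + t *\<^sub>R axis i (1::real)) has_derivative (\<lambda>h. h *\<^sub>R axis i 1)) (at t)"
    by (auto intro!: derivative_eq_intros)
  have 3: "((\<lambda>t. f (y + t *\<^sub>R axis i 1)) has_derivative (\<lambda>h. ?D (h *\<^sub>R axis i 1))) (at t)"
    using has_derivative_compose[OF 2 1] .
  have "?D (h *\<^sub>R axis i 1) = pd i f (y + t *\<^sub>R axis i 1) * h" for h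
    using linear_cmul[OF has_derivative_linear[OF 1]] by (simp add: partial_deriv_def)
  with 3 show ?thesis unfolding has_field_derivative_def by simp
qed

section \<open>Closure properties of the classes C^k and of smooth functions on open sets\<close>

lemma Ck_on_cong:
  assumes "open S" "\<And>x. x \<in> S \<Longrightarrow> f x = g x" "Ck_on k S f"
  shows "Ck_on k S g"
  using assms(2,3)
proof (induction k arbitrary: f g)
  case 0
  then show ?case by (metis Ck_on.simps(1) continuous_on_cong)
next
  case (Suc k)
  have d: "\<And>y. y \<in> S \<Longrightarrow> f differentiable (at y)" using Suc by simp
  have "Ck_on k S (pd i g)" for i
  proof (rule Suc.IH)
    show "Ck_on k S (pd i f)" using Suc.prems by simp
    show "pd i f y = pd i g y" if "y \<in> S" for y
      using pd_cong_open[OF assms(1) that Suc.prems(1)] d[OF that] by simp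
  qed
  moreover have "\<forall>y\<in>S. g differentiable (at y)"
    by (intro ballI differentiable_cong_open[OF assms(1) _ Suc.prems(1)] d)
  ultimately show ?case by simp
qed

lemma smooth_on_cong:
  assumes "open S" "\<And>x. x \<in> S \<Longrightarrow> f x = g x" "smooth_on S f"
  shows "smooth_on S g"
  unfolding smooth_on_def
proof
  show "Ck_on k S g" for k
    by (rule Ck_on_cong[OF assms(1), of f]) (use assms(2,3) in \<open>auto simp: smooth_on_def\<close>)
qed

lemma Ck_on_subset: "Ck_on k S f \<Longrightarrow> T \<subseteq> S \<Longrightarrow> Ck_on k T f"
  by (induction k arbitrary: f) (auto intro: continuous_on_subset)

lemma smooth_on_subset: "smooth_on S f \<Longrightarrow> T \<subseteq> S \<Longrightarrow> smooth_on T f"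
  unfolding smooth_on_def using Ck_on_subset by blast

lemma Ck_on_SucD: "Ck_on (Suc k) S f \<Longrightarrow> Ck_on k S f"
proof (induction k arbitrary: f)
  case 0
  then show ?case
    by (auto intro!: continuous_at_imp_continuous_on simp: differentiable_imp_continuous_within)
qed auto

text \<open>The induction step shared by the closure lemmas: a differentiation rule holds only at
  points of \<open>S\<close>, so the partial derivative merely has to agree on \<open>S\<close> with
  some function \<open>p\<close> of class C^k.\<close>

lemma Ck_on_Suc_cong:
  assumes "open S" "\<And>y. y \<in> S \<Longrightarrow> f differentiable (at y)"
    "\<And>i. \<exists>p. (\<forall>y\<in>S. pd i f y = p y) \<and> Ck_on k S p"
  shows "Ck_on (Suc k) S f"
proof -
  have "Ck_on k S (pd i f)" for i
  proof -
    obtain p where p: "\<forall>y\<in>S. pd i f y = p y" "Ck_on k S p" using assms(3) by blast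
    show ?thesis by (rule Ck_on_cong[OF assms(1) _ p(2)]) (use p(1) in auto)
  qed
  then show ?thesis using assms(2) by simp
qed

lemma Ck_on_const: "Ck_on k S (\<lambda>x. c)"
  by (induction k arbitrary: c) auto

lemma smooth_on_const [smooth_intros, simp]: "smooth_on S (\<lambda>x. c)"
  by (simp add: smooth_on_def Ck_on_const)

lemma Ck_on_linear:
  assumes "open S" "bounded_linear L" "Ck_on k S f"
  shows "Ck_on k S (\<lambda>x. L (f x))"
  using assms(3)
proof (induction k arbitrary: f)
  case 0
  then show ?case using assms(2) bounded_linear.continuous_on by (metis Ck_on.simps(1))
next
  case (Suc k)
  show ?case
  proof (rule Ck_on_Suc_cong[OF assms(1)])
    show "(\<lambda>x. L (f x)) differentiable (at y)" if "y \<in> S" for y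
      by (rule differentiable_bounded_linear[OF assms(2)]) (use Suc that in auto)
    show "\<exists>p. (\<forall>y\<in>S. pd i (\<lambda>x. L (f x)) y = p y) \<and> Ck_on k S p" for i
      by (rule exI[of _ "\<lambda>x. L (pd i f x)"])
        (use Suc in \<open>auto intro!: pd_linear[OF assms(2)]\<close>)
  qed
qed

lemma Ck_on_add:
  assumes "open S" "Ck_on k S f" "Ck_on k S g"
  shows "Ck_on k S (\<lambda>x. f x + g x)"
  using assms(2,3)
proof (induction k arbitrary: f g)
  case 0
  then show ?case by (auto intro: continuous_on_add)
next
  case (Suc k)
  show ?case
  proof (rule Ck_on_Suc_cong[OF assms(1)])
    show "(\<lambda>x. f x + g x) differentiable (at y)" if "y \<in> S" for y
      using Suc that by (auto intro: differentiable_add)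
    show "\<exists>p. (\<forall>y\<in>S. pd i (\<lambda>x. f x + g x) y = p y) \<and> Ck_on k S p" for i
      by (rule exI[of _ "\<lambda>x. pd i f x + pd i g x"])
        (use Suc in \<open>auto intro!: pd_add\<close>)
  qed
qed

text \<open>For an arbitrary bounded bilinear map, so that products of reals, scalar multiples,
  matrix products and matrix-vector products are all instances.\<close>

lemma Ck_on_bilinear:
  assumes "open S" "bounded_bilinear B" "Ck_on k S f" "Ck_on k S g"
  shows "Ck_on k S (\<lambda>x. B (f x) (g x))"
  using assms(3,4)
proof (induction k arbitrary: f g)
  case 0
  then show ?case using assms(2) bounded_bilinear.continuous_on by (metis Ck_on.simps(1))
next
  case (Suc k)
  show ?case
  proof (rule Ck_on_Suc_cong[OF assms(1)])
    show "(\<lambda>x. B (f x) (g x)) differentiable (at y)" if "y \<in> S" for y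
      by (rule differentiable_bilinear[OF assms(2)]) (use Suc that in auto)
    show "\<exists>p. (\<forall>y\<in>S. pd i (\<lambda>x. B (f x) (g x)) y = p y) \<and> Ck_on k S p" for i
      by (rule exI[of _ "\<lambda>x. B (f x) (pd i g x) + B (pd i f x) (g x)"])
        (use Suc Ck_on_SucD[of k S f] Ck_on_SucD[of k S g]
          in \<open>auto intro!: Ck_on_add[OF assms(1)] pd_bilinear[OF assms(2)]\<close>)
  qed
qed

lemma smooth_on_linear: "bounded_linear L \<Longrightarrow> open S \<Longrightarrow> smooth_on S f \<Longrightarrow> smooth_on S (\<lambda>x. L (f x))"
  unfolding smooth_on_def using Ck_on_linear by blast

lemma smooth_on_bilinear: "bounded_bilinear B \<Longrightarrow> open S \<Longrightarrow> smooth_on S f \<Longrightarrow> smooth_on S g \<Longrightarrow> smooth_on S (\<lambda>x. B (f x) (g x))"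
  unfolding smooth_on_def using Ck_on_bilinear by blast

lemma smooth_on_add [smooth_intros]: "open S \<Longrightarrow> smooth_on S f \<Longrightarrow> smooth_on S g \<Longrightarrow> smooth_on S (\<lambda>x. f x + g x)"
  unfolding smooth_on_def using Ck_on_add by blast

lemmas smooth_on_mult [smooth_intros] = smooth_on_bilinear[OF bounded_bilinear_mult]
lemmas smooth_on_scaleR [smooth_intros] = smooth_on_bilinear[OF bounded_bilinear_scaleR]
lemmas smooth_on_component [smooth_intros] = smooth_on_linear[OF bounded_linear_vec_nth]

lemma smooth_on_uminus [smooth_intros]: "open S \<Longrightarrow> smooth_on S f \<Longrightarrow> smooth_on S (\<lambda>x. - f x)"
  using smooth_on_linear[OF bounded_linear_minus[OF bounded_linear_ident]] by blast

lemma smooth_on_diff [smooth_intros]: "open S \<Longrightarrow> smooth_on S f \<Longrightarrow> smooth_on S g \<Longrightarrow> smooth_on S (\<lambda>x. f x - g x)"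
  using smooth_on_add[of S f "\<lambda>x. - g x"] smooth_on_uminus by auto

lemma smooth_on_sum [smooth_intros]:
  assumes "open S" "\<And>j. j \<in> I \<Longrightarrow> smooth_on S (f j)"
  shows "smooth_on S (\<lambda>x. \<Sum>j\<in>I. f j x)"
proof (cases "finite I")
  case True
  then show ?thesis using assms(2)
    by (induction I rule: finite_induct) (auto intro!: smooth_on_add[OF assms(1)])
qed simp

lemma smooth_on_prod [smooth_intros]:
  fixes f :: "'a \<Rightarrow> real^'n::finite \<Rightarrow> real"
  assumes "open S" "\<And>j. j \<in> I \<Longrightarrow> smooth_on S (f j)"
  shows "smooth_on S (\<lambda>x. \<Prod>j\<in>I. f j x)"
proof (cases "finite I")
  case True
  then show ?thesis using assms(2)
    by (induction I rule: finite_induct) (auto intro!: smooth_on_mult[OF assms(1)])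
qed simp

lemma smooth_on_power [smooth_intros]:
  fixes f :: "real^'n::finite \<Rightarrow> real"
  assumes "open S" "smooth_on S f"
  shows "smooth_on S (\<lambda>x. f x ^ k)"
  using smooth_on_prod[OF assms(1), of "{..<k}" "\<lambda>_. f"] assms(2) by simp

lemma smooth_on_id [smooth_intros]:
  "open S \<Longrightarrow> smooth_on S (\<lambda>x::real^'n::finite. x)"
proof -
  assume "open S"
  have "Ck_on k S (\<lambda>x::real^'n. x)" for k
  proof (cases k)
    case 0
    then show ?thesis by (simp add: continuous_on_id)
  next
    case (Suc j)
    have "pd i (\<lambda>x::real^'n. x) = (\<lambda>x. axis i 1)" for i
      using pd_eq[OF has_derivative_ident] by blast
    then show ?thesis using Suc by (simp add: Ck_on_const)
  qed
  then show ?thesis by (simp add: smooth_on_def)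
qed

lemma bounded_linear_axis: "bounded_linear (\<lambda>x::'b::real_normed_vector. axis i x :: 'b^'m::finite)"
proof
  show "axis i (x + y) = axis i x + axis i y" for x y :: 'b by (simp add: vec_eq_iff axis_def)
  show "axis i (r *\<^sub>R x) = r *\<^sub>R axis i x" for r and x :: 'b by (simp add: vec_eq_iff axis_def)
  have "norm (axis i x :: 'b^'m) \<le> norm x" for x :: 'b
  proof -
    have "norm (axis i x :: 'b^'m) = L2_set (\<lambda>j. if j = i then norm x else 0) UNIV"
      unfolding norm_vec_def by (rule L2_set_cong) (auto simp: axis_def)
    also have "\<dots> = norm x" by (simp add: L2_set_def if_distrib[of "\<lambda>z. z\<^sup>2"] cong: if_cong)
    finally show ?thesis by simp
  qed
  then show "\<exists>K. \<forall>x. norm (axis i x :: 'b^'m) \<le> norm x * K" by (intro exI[of _ 1]) simp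
qed

text \<open>Reduces smoothness of vectors and matrices given by entries to finite sums of linear
  images of the entries.\<close>

lemma vec_lambda_sum_axis: "(\<chi> i. f i) = (SUM i. axis i (f i :: 'b::real_normed_vector))"
  by (simp add: vec_eq_iff axis_def)

lemma smooth_on_vec_lambda [smooth_intros]:
  fixes f :: "'m::finite \<Rightarrow> real^'n::finite \<Rightarrow> 'b::real_normed_vector"
  assumes "open S" "\<And>i. smooth_on S (f i)"
  shows "smooth_on S (\<lambda>x. \<chi> i. f i x)"
  unfolding vec_lambda_sum_axis
  by (intro smooth_on_sum smooth_on_linear[OF bounded_linear_axis] assms)

lemma smooth_on_partial [smooth_intros]: "smooth_on S f \<Longrightarrow> smooth_on S (pd i f)"
  unfolding smooth_on_def by (metis Ck_on.simps(2))

lemma smooth_onD: "smooth_on S f \<Longrightarrow> y \<in> S \<Longrightarrow> f differentiable (at y)"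
  unfolding smooth_on_def by (metis Ck_on.simps(2))

lemma smooth_on_continuous: "smooth_on S f \<Longrightarrow> continuous_on S f"
  unfolding smooth_on_def by (metis Ck_on.simps(1))

text \<open>\<open>H\<close> lists the successive derivatives of the outer function. Leaving
  \<open>j\<close> free in the induction is what makes it work: differentiating
  \<open>H j (f x)\<close> produces \<open>H (Suc j) (f x)\<close> with one order of smoothness less
  to prove. The exponential, real powers and the flat exponential are instances.\<close>

lemma Ck_on_compose_real:
  fixes f :: "real^'n::finite \<Rightarrow> real"
  assumes "open S" "\<And>j t. t \<in> T \<Longrightarrow> (H j has_real_derivative H (Suc j) t) (at t)"
    "f ` S \<subseteq> T" "Ck_on k S f"
  shows "Ck_on k S (\<lambda>x. H j (f x))"
  using assms(4)
proof (induction k arbitrary: j)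
  case 0
  have "continuous_on T (H j)"
    using assms(2) by (meson DERIV_isCont continuous_at_imp_continuous_on)
  with 0 show ?case using assms(3) by (auto intro: continuous_on_compose2)
next
  case (Suc k)
  have d: "f differentiable (at y)" "f y \<in> T" if "y \<in> S" for y using Suc that assms(3) by auto
  show ?case
  proof (rule Ck_on_Suc_cong[OF assms(1)])
    show "(\<lambda>x. H j (f x)) differentiable (at y)" if "y \<in> S" for y
      using pd_compose_real(2) assms(2) d that by blast
    show "\<exists>p. (\<forall>y\<in>S. pd i (\<lambda>x. H j (f x)) y = p y) \<and> Ck_on k S p" for i
      by (rule exI[of _ "\<lambda>x. H (Suc j) (f x) * pd i f x"])
        (use Suc d assms(2) Ck_on_SucD[of k S f]
          in \<open>auto intro!: Ck_on_bilinear[OF assms(1) bounded_bilinear_mult] pd_compose_real(1)\<close>)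
  qed
qed

lemma smooth_on_compose_real:
  fixes f :: "real^'n::finite \<Rightarrow> real"
  assumes "open S" "\<And>j t. t \<in> T \<Longrightarrow> (H j has_real_derivative H (Suc j) t) (at t)"
    "f ` S \<subseteq> T" "smooth_on S f"
  shows "smooth_on S (\<lambda>x. H j (f x))"
  using assms Ck_on_compose_real[of S T H f _ j] unfolding smooth_on_def by blast

lemma smooth_on_exp [smooth_intros]:
  fixes f :: "real^'n::finite \<Rightarrow> real"
  shows "open S \<Longrightarrow> smooth_on S f \<Longrightarrow> smooth_on S (\<lambda>x. exp (f x))"
  using smooth_on_compose_real[of S UNIV "\<lambda>_. exp" f 0] DERIV_exp by blast

lemma smooth_on_powr:
  fixes f :: "real^'n::finite \<Rightarrow> real"
  assumes "open S" "smooth_on S f" "\<And>x. x \<in> S \<Longrightarrow> f x > 0"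
  shows "smooth_on S (\<lambda>x. f x powr a)"
proof -
  \<comment> \<open>The \<open>j\<close>-th derivative of \<open>t powr a\<close>, with the falling
    factorial of \<open>a\<close> as coefficient.\<close>
  define H where "H = (\<lambda>j t. (\<Prod>i<j. a - real i) * t powr (a - real j))"
  have "(H j has_real_derivative H (Suc j) t) (at t)" if "t \<in> {0<..}" for j t
  proof -
    have "((\<lambda>t. t powr (a - real j)) has_real_derivative (a - real j) * t powr (a - real j - 1)) (at t)"
      using that by (auto intro!: derivative_eq_intros)
    from DERIV_cmult[OF this, of "\<Prod>i<j. a - real i"] show ?thesis
      unfolding H_def by (simp add: algebra_simps)
  qed
  then have "smooth_on S (\<lambda>x. H 0 (f x))"
    using smooth_on_compose_real[of S "{0<..}" H f 0] assms by (metis (no_types, lifting) greaterThan_iff image_subsetI)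
  then show ?thesis by (simp add: H_def)
qed

lemma smooth_on_inverse:
  fixes f :: "real^'n::finite \<Rightarrow> real"
  assumes "open S" "smooth_on S f" "\<And>x. x \<in> S \<Longrightarrow> f x \<noteq> 0"
  shows "smooth_on S (\<lambda>x. inverse (f x))"
proof -
  \<comment> \<open>Real powers need a positive base, so \<open>1 / f\<close> is written as
    \<open>f / f^2\<close>; this covers both signs of \<open>f\<close>.\<close>
  have "smooth_on S (\<lambda>x. f x * (f x ^ 2) powr (-1))"
    by (intro smooth_intros assms(1,2) smooth_on_powr) (use assms(3) in auto)
  moreover have "f x * (f x ^ 2) powr (-1) = inverse (f x)" if "x \<in> S" for x
    using assms(3)[OF that] by (simp add: powr_minus field_simps power2_eq_square)
  ultimately show ?thesis by (rule smooth_on_cong[OF assms(1), rotated])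
qed

lemma smooth_on_divide:
  fixes f :: "real^'n::finite \<Rightarrow> real"
  assumes "open S" "smooth_on S f" "smooth_on S g" "\<And>x. x \<in> S \<Longrightarrow> g x \<noteq> 0"
  shows "smooth_on S (\<lambda>x. f x / g x)"
  unfolding divide_inverse by (intro smooth_intros smooth_on_inverse assms)

lemma Ck_on_compose:
  fixes \<psi> :: "real^'n::finite \<Rightarrow> real^'m::finite" and f :: "real^'m \<Rightarrow> 'b::real_normed_vector"
  assumes "open S" "open T" "\<psi> ` S \<subseteq> T" "Ck_on k S \<psi>" "Ck_on k T f"
  shows "Ck_on k S (\<lambda>x. f (\<psi> x))"
  using assms(4,5)
proof (induction k arbitrary: f)
  case 0
  then show ?case using assms(3) by (auto intro: continuous_on_compose2)
next
  case (Suc k)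
  have d: "\<psi> differentiable (at y)" "f differentiable (at (\<psi> y))" if "y \<in> S" for y
    using Suc that assms(3) by auto
  have s: "Ck_on k S (\<lambda>x. \<Sum>j\<in>J. (pd i \<psi> x $ j) *\<^sub>R pd j f (\<psi> x))" if "finite J" for i J
    using that
  proof (induction J rule: finite_induct)
    case empty
    then show ?case by (simp add: Ck_on_const)
  next
    case (insert a F)
    have "Ck_on k S (\<lambda>x. (pd i \<psi> x $ a) *\<^sub>R pd a f (\<psi> x))"
      using Suc.prems Ck_on_SucD[of k S \<psi>] Suc.IH[of "pd a f"]
      by (intro Ck_on_bilinear[OF assms(1) bounded_bilinear_scaleR] Ck_on_linear[OF assms(1) bounded_linear_vec_nth]) auto
    then show ?case using insert Ck_on_add[OF assms(1)] by simp
  qed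
  show ?case
  proof (rule Ck_on_Suc_cong[OF assms(1)])
    show "(\<lambda>x. f (\<psi> x)) differentiable (at y)" if "y \<in> S" for y
      using differentiable_chain_at[of \<psi> y f] d that by (simp add: o_def)
    show "\<exists>p. (\<forall>y\<in>S. pd i (\<lambda>x. f (\<psi> x)) y = p y) \<and> Ck_on k S p" for i
    proof (intro exI conjI ballI)
      show "Ck_on k S (\<lambda>x. SUM j. (pd i \<psi> x $ j) *\<^sub>R pd j f (\<psi> x))"
        by (rule s) simp
      show "pd i (\<lambda>x. f (\<psi> x)) y = (SUM j. (pd i \<psi> y $ j) *\<^sub>R pd j f (\<psi> y))"
        if "y \<in> S" for y using pd_compose d that by blast
    qed
  qed
qed

lemma smooth_on_compose:
  fixes \<psi> :: "real^'n::finite \<Rightarrow> real^'m::finite" and f :: "real^'m \<Rightarrow> 'b::real_normed_vector"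
  assumes "open S" "open T" "\<psi> ` S \<subseteq> T" "smooth_on S \<psi>" "smooth_on T f"
  shows "smooth_on S (\<lambda>x. f (\<psi> x))"
  using assms Ck_on_compose[of S T \<psi>] unfolding smooth_on_def by blast

text \<open>The second difference over a small square is symmetric in the two directions. Two
  applications of the mean value theorem turn it into \<open>h^2\<close> times a mixed derivative at
  a point within distance \<open>2 * h\<close> of \<open>y\<close>, once for each order of
  differentiation, and continuity of both mixed derivatives at \<open>y\<close> forces them to
  agree.\<close>

lemma pd_commute_real:
  fixes f :: "real^'n::finite \<Rightarrow> real"
  assumes "open S" "smooth_on S f" "y \<in> S"
  shows "pd i (pd j f) y = pd j (pd i f) y"
proof -
  define E :: "'n \<Rightarrow> real^'n" where "E i = axis i 1" for i
  obtain r where r: "r > 0" "ball y r \<subseteq> S" using assms(1,3) open_contains_ball by blast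
  have key: "\<exists>z. dist z y \<le> 2*h \<and> f (y + h *\<^sub>R E a + h *\<^sub>R E b) - f (y + h *\<^sub>R E a) - f (y + h *\<^sub>R E b) + f y
      = h^2 * pd b (pd a f) z" if h: "0 < h" "2*h < r" for h a b
  proof -
    have inS: "y + s *\<^sub>R E a + t *\<^sub>R E b \<in> S" "dist (y + s *\<^sub>R E a + t *\<^sub>R E b) y \<le> 2*h"
      if "0 \<le> s" "s \<le> h" "0 \<le> t" "t \<le> h" for s t
    proof -
      have "norm (s *\<^sub>R E a + t *\<^sub>R E b) \<le> norm (s *\<^sub>R E a) + norm (t *\<^sub>R E b)" by (rule norm_triangle_ineq)
      also have "\<dots> \<le> 2*h" using that by (simp add: E_def)
      finally show *: "dist (y + s *\<^sub>R E a + t *\<^sub>R E b) y \<le> 2*h" by (simp add: dist_norm add.assoc)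
      then show "y + s *\<^sub>R E a + t *\<^sub>R E b \<in> S" using r h by (auto simp: dist_commute)
    qed
    define \<phi> where "\<phi> = (\<lambda>s. f (y + h *\<^sub>R E b + s *\<^sub>R E a) - f (y + s *\<^sub>R E a))"
    have der: "(\<phi> has_real_derivative (pd a f (y + h *\<^sub>R E b + s *\<^sub>R E a) - pd a f (y + s *\<^sub>R E a))) (at s)"
      if "0 \<le> s" "s \<le> h" for s
      unfolding \<phi>_def E_def
    proof (intro DERIV_diff has_real_derivative_line)
      show "f differentiable at (y + h *\<^sub>R axis b 1 + s *\<^sub>R axis a 1)"
      proof -
        have "y + h *\<^sub>R E b + s *\<^sub>R E a \<in> S" using inS(1)[of s h] that h by (simp add: add.commute add.left_commute)
        then show ?thesis using smooth_onD[OF assms(2)] unfolding E_def by blast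
      qed
      show "f differentiable at (y + s *\<^sub>R axis a 1)"
        using inS[of s 0] that h smooth_onD[OF assms(2)] by (simp add: E_def)
    qed
    obtain s where s: "0 < s" "s < h" "\<phi> h - \<phi> 0 = (h - 0) * (pd a f (y + h *\<^sub>R E b + s *\<^sub>R E a) - pd a f (y + s *\<^sub>R E a))"
      using MVT2[OF h(1) der] by blast
    have der2: "((\<lambda>t. pd a f (y + s *\<^sub>R E a + t *\<^sub>R E b)) has_real_derivative pd b (pd a f) (y + s *\<^sub>R E a + t *\<^sub>R E b)) (at t)"
      if "0 \<le> t" "t \<le> h" for t
      unfolding E_def
      by (rule has_real_derivative_line)
       (use inS[of s t] that s smooth_onD[OF smooth_on_partial[OF assms(2)]] in \<open>simp add: E_def\<close>)
    obtain t where t: "0 < t" "t < h" "pd a f (y + s *\<^sub>R E a + h *\<^sub>R E b) - pd a f (y + s *\<^sub>R E a + 0 *\<^sub>R E b)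
        = (h - 0) * pd b (pd a f) (y + s *\<^sub>R E a + t *\<^sub>R E b)"
      using MVT2[OF h(1) der2] by blast
    have "f (y + h *\<^sub>R E a + h *\<^sub>R E b) - f (y + h *\<^sub>R E a) - f (y + h *\<^sub>R E b) + f y = \<phi> h - \<phi> 0"
      by (simp add: \<phi>_def algebra_simps)
    also have "\<dots> = h * (h * pd b (pd a f) (y + s *\<^sub>R E a + t *\<^sub>R E b))"
      using s(3) t(3) by (simp add: algebra_simps)
    finally show ?thesis using inS(2)[of s t] s t by (intro exI[of _ "y + s *\<^sub>R E a + t *\<^sub>R E b"]) (auto simp: power2_eq_square)
  qed
  show ?thesis
  proof (rule ccontr)
    let ?A = "pd i (pd j f)" and ?B = "pd j (pd i f)"
    assume "?A y \<noteq> ?B y"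
    define e where "e = \<bar>?A y - ?B y\<bar> / 2"
    have e: "e > 0" using \<open>?A y \<noteq> ?B y\<close> by (simp add: e_def)
    have "isCont ?A y" "isCont ?B y"
      using assms smooth_on_continuous[OF smooth_on_partial[OF smooth_on_partial[OF assms(2)]]]
        continuous_on_eq_continuous_at by blast+
    then obtain d1 d2 where d: "d1 > 0" "\<And>z. dist z y < d1 \<Longrightarrow> dist (?A z) (?A y) < e"
       "d2 > 0" "\<And>z. dist z y < d2 \<Longrightarrow> dist (?B z) (?B y) < e"
      using e unfolding continuous_at_eps_delta by metis
    define h where "h = min r (min d1 d2) / 4"
    have h: "0 < h" "2*h < r" "2*h < d1" "2*h < d2" using r d by (auto simp: h_def)
    obtain z1 where z1: "dist z1 y \<le> 2*h" "f (y + h *\<^sub>R E j + h *\<^sub>R E i) - f (y + h *\<^sub>R E j) - f (y + h *\<^sub>R E i) + f y = h^2 * ?A z1"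
      using key[OF h(1,2), of j i] by blast
    obtain z2 where z2: "dist z2 y \<le> 2*h" "f (y + h *\<^sub>R E i + h *\<^sub>R E j) - f (y + h *\<^sub>R E i) - f (y + h *\<^sub>R E j) + f y = h^2 * ?B z2"
      using key[OF h(1,2), of i j] by blast
    have "h^2 * ?A z1 = h^2 * ?B z2"
      unfolding z1(2)[symmetric] z2(2)[symmetric] by (simp add: algebra_simps)
    then have "?A z1 = ?B z2" using h by simp
    moreover have "dist (?A z1) (?A y) < e" "dist (?B z2) (?B y) < e" using d z1 z2 h by auto
    ultimately show False by (auto simp: e_def dist_real_def abs_if split: if_splits)
  qed
qed

lemma pd_partial_component:
  assumes "open S" "smooth_on S f" "y \<in> S"
  shows "pd a (pd b (\<lambda>x. f x $ k)) y = pd a (pd b f) y $ k"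
proof -
  have "pd a (pd b (\<lambda>x. f x $ k)) y = pd a (\<lambda>x. pd b f x $ k) y"
  proof (rule pd_cong_open[OF assms(1,3)])
    show "pd b f x $ k = pd b (\<lambda>x. f x $ k) x" if "x \<in> S" for x
      using pd_component[OF smooth_onD[OF assms(2) that]] by simp
    show "(\<lambda>x. pd b f x $ k) differentiable at y"
      by (intro smooth_onD[OF _ assms(3)] smooth_intros assms)
  qed
  also have "\<dots> = pd a (pd b f) y $ k"
    by (rule pd_component[OF smooth_onD[OF smooth_on_partial[OF assms(2)] assms(3)]])
  finally show ?thesis .
qed

lemma pd_commute_vec:
  fixes f :: "real^'n::finite \<Rightarrow> real^'m::finite"
  assumes "open S" "smooth_on S f" "y \<in> S"
  shows "pd i (pd j f) y = pd j (pd i f) y"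
  using pd_commute_real[OF assms(1) smooth_on_component[OF assms(1,2)] assms(3)]
  by (simp add: vec_eq_iff flip: pd_partial_component[OF assms])

section \<open>Matrices\<close>

lemma matrix_inv_right: "invertible (A::real^'n^'n::finite) \<Longrightarrow> A ** matrix_inv A = mat 1"
  and matrix_inv_left: "invertible (A::real^'n^'n::finite) \<Longrightarrow> matrix_inv A ** A = mat 1"
  unfolding invertible_def matrix_inv_def by (rule someI2_ex; blast)+

lemma matrix_inv_unique:
  fixes A B :: "real^'n^'n::finite"
  assumes "A ** B = mat 1"
  shows "matrix_inv A = B" "invertible A"
proof -
  have 2: "B ** A = mat 1" using assms matrix_left_right_inverse by blast
  then show "invertible A" using assms invertible_def by blast
  have "matrix_inv A = (matrix_inv A ** A) ** B"
    using assms by (simp flip: matrix_mul_assoc)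
  then show "matrix_inv A = B" using matrix_inv_left[OF \<open>invertible A\<close>] by simp
qed

lemma matrix_inv_mult:
  fixes A B :: "real^'n^'n::finite"
  assumes "invertible A" "invertible B"
  shows "matrix_inv (A ** B) = matrix_inv B ** matrix_inv A"
proof (rule matrix_inv_unique)
  have "A ** B ** (matrix_inv B ** matrix_inv A) = A ** (B ** matrix_inv B) ** matrix_inv A"
    by (simp add: matrix_mul_assoc)
  then show "A ** B ** (matrix_inv B ** matrix_inv A) = mat 1"
    using assms by (simp add: matrix_inv_right)
qed

lemma matrix_inv_transpose:
  fixes A :: "real^'n^'n::finite"
  assumes "invertible A"
  shows "matrix_inv (transpose A) = transpose (matrix_inv A)"
  by (rule matrix_inv_unique)
    (simp add: matrix_transpose_mul[symmetric] matrix_inv_left[OF assms] transpose_mat)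

lemma matrix_inv_mat_1: "matrix_inv (mat 1 :: real^'n^'n::finite) = mat 1"
  by (rule matrix_inv_unique) simp

lemma posdef_invertible:
  fixes A :: "real^'n^'n::finite"
  assumes "\<And>v. v \<noteq> 0 \<Longrightarrow> v \<bullet> (A *v v) > 0"
  shows "invertible A"
proof -
  have "\<forall>x. A *v x = 0 \<longrightarrow> x = 0" using assms by (metis inner_zero_right less_irrefl)
  then show ?thesis using matrix_left_invertible_ker invertible_left_inverse by metis
qed

lemma continuous_on_det: "continuous_on S (det :: real^'n^'n::finite \<Rightarrow> real)"
  unfolding det_def by (intro continuous_intros)

text \<open>On the segment from the identity to \<open>A\<close> all matrices are positive definite,
  hence invertible, so the determinant cannot change sign along it.\<close>

lemma posdef_det_pos:
  fixes A :: "real^'n^'n::finite"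
  assumes "\<And>v. v \<noteq> 0 \<Longrightarrow> v \<bullet> (A *v v) > 0"
  shows "det A > 0"
proof (rule ccontr)
  assume neg: "\<not> det A > 0"
  define f where "f = (\<lambda>t::real. det ((1 - t) *\<^sub>R mat 1 + t *\<^sub>R A))"
  have "continuous_on {0..1} f" unfolding f_def
    by (rule continuous_on_compose2[OF continuous_on_det[of UNIV]]) (auto intro!: continuous_intros)
  moreover have "f 1 \<le> 0" "0 \<le> f 0" using neg by (simp_all add: f_def)
  ultimately obtain t where t: "0 \<le> t" "t \<le> 1" "f t = 0"
    using IVT2'[of f 1 0 0] by auto
  have "invertible ((1 - t) *\<^sub>R mat 1 + t *\<^sub>R A)"
  proof (rule posdef_invertible)
    fix v :: "real^'n" assume v: "v \<noteq> 0"
    have "v \<bullet> (((1 - t) *\<^sub>R mat 1 + t *\<^sub>R A) *v v) = (1 - t) * (v \<bullet> v) + t * (v \<bullet> (A *v v))"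
      by (simp add: matrix_vector_mult_add_rdistrib scaleR_matrix_vector_assoc[symmetric] inner_add_right)
    moreover have "\<dots> > 0"
    proof (cases "t = 0")
      case True then show ?thesis using v by simp
    next
      case False
      then have "t * (v \<bullet> (A *v v)) > 0" using assms[OF v] t by simp
      then show ?thesis using t by (simp add: add_nonneg_pos)
    qed
    ultimately show "v \<bullet> (((1 - t) *\<^sub>R mat 1 + t *\<^sub>R A) *v v) > 0" by simp
  qed
  then show False using t invertible_det_nz by (auto simp: f_def)
qed

lemma bounded_bilinear_matrix_mult:
  "bounded_bilinear ((**) :: real^'k::finite^'n::finite \<Rightarrow> real^'m::finite^'k \<Rightarrow> real^'m^'n)"
  unfolding bilinear_conv_bounded_bilinear[symmetric] bilinear_def
  by (auto intro!: linearI simp: vec_eq_iff matrix_matrix_mult_def sum_distrib_left sum.distrib algebra_simps)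

lemma bounded_bilinear_matrix_vector_mult:
  "bounded_bilinear ((*v) :: real^'k::finite^'n::finite \<Rightarrow> real^'k \<Rightarrow> real^'n)"
  unfolding bilinear_conv_bounded_bilinear[symmetric] bilinear_def
  by (auto intro!: linearI simp: vec_eq_iff matrix_vector_mult_def sum_distrib_left sum.distrib algebra_simps)

lemma bounded_linear_transpose:
  "bounded_linear (transpose :: real^'k::finite^'n::finite \<Rightarrow> real^'n^'k)"
  unfolding linear_conv_bounded_linear[symmetric]
  by (auto intro!: linearI simp: vec_eq_iff transpose_def)

lemma bounded_linear_trace: "bounded_linear (trace :: real^'n::finite^'n \<Rightarrow> real)"
  unfolding linear_conv_bounded_linear[symmetric]
  by (auto intro!: linearI simp: trace_def sum.distrib sum_distrib_left)

lemmas smooth_on_matrix_mult [smooth_intros] = smooth_on_bilinear[OF bounded_bilinear_matrix_mult]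
lemmas smooth_on_matrix_vector_mult [smooth_intros] = smooth_on_bilinear[OF bounded_bilinear_matrix_vector_mult]
lemmas smooth_on_transpose [smooth_intros] = smooth_on_linear[OF bounded_linear_transpose]
lemmas smooth_on_trace [smooth_intros] = smooth_on_linear[OF bounded_linear_trace]
lemmas pd_matrix_mult = pd_bilinear[OF bounded_bilinear_matrix_mult]
lemmas differentiable_matrix_mult = differentiable_bilinear[OF bounded_bilinear_matrix_mult]

lemma smooth_on_det [smooth_intros]:
  fixes A :: "real^'n::finite \<Rightarrow> real^'k^'k::finite"
  assumes "open S" "smooth_on S A"
  shows "smooth_on S (\<lambda>x. det (A x))"
  unfolding det_def by (intro smooth_intros assms)

text \<open>Exhibits the entries of the inverse as quotients of polynomials in the entries of
  \<open>A\<close>; this is how smoothness of the inverse is obtained.\<close>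

lemma matrix_inv_cramer:
  fixes A :: "real^'n^'n::finite"
  assumes "invertible A"
  shows "matrix_inv A $ k $ l = det (\<chi> i j. if j = k then (if i = l then 1 else 0) else A$i$j) / det A"
proof -
  have "A *v (matrix_inv A *v axis l 1) = axis l 1"
    by (simp add: matrix_vector_mul_assoc matrix_inv_right[OF assms])
  then have "matrix_inv A *v axis l 1 = (\<chi> k. det(\<chi> i j. if j=k then axis l 1$i else A$i$j) / det A)"
    using cramer[of A] assms invertible_det_nz by blast
  then have "(matrix_inv A *v axis l 1) $ k = det(\<chi> i j. if j=k then axis l 1$i else A$i$j) / det A" by simp
  moreover have "(matrix_inv A *v axis l 1) $ k = matrix_inv A $ k $ l"
    by (simp add: matrix_vector_mul_component inner_axis)
  moreover have "(\<chi> i j. if j=k then axis l 1$i else A$i$j) = (\<chi> i j. if j = k then (if i = l then 1 else 0) else A$i$j)"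
    by (auto simp: vec_eq_iff axis_def)
  ultimately show ?thesis by simp
qed

lemma smooth_on_matrix_inv [smooth_intros]:
  fixes A :: "real^'n::finite \<Rightarrow> real^'k^'k::finite"
  assumes "open S" "smooth_on S A" "\<And>x. x \<in> S \<Longrightarrow> invertible (A x)"
  shows "smooth_on S (\<lambda>x. matrix_inv (A x))"
proof -
  have "smooth_on S (\<lambda>x. \<chi> k l. det (\<chi> i j. if j = k then (if i = l then 1 else 0) else A x $i$j) / det (A x))"
  proof (intro smooth_intros smooth_on_divide assms(1,2))
    fix k l i j
    show "smooth_on S (\<lambda>x. if j = k then (if i = l then 1 else 0) else A x $ i $ j)"
      by (cases "j = k"; simp; intro smooth_intros assms)
  qed (use assms(3) invertible_det_nz in auto)
  then show ?thesis
    by (rule smooth_on_cong[OF assms(1), rotated]) (use assms(3) in \<open>simp add: vec_eq_iff matrix_inv_cramer\<close>)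
qed

text \<open>A bootstrap: the derivative of \<open>\<Phi>\<close> at \<open>y\<close> is the inverse
  Jacobian of \<open>\<psi>\<close> at \<open>\<Phi> y\<close>, so if \<open>\<Phi>\<close> is of
  class C^k then so is its derivative.\<close>

lemma smooth_on_inverse_map:
  fixes \<psi> \<Phi> :: "real^'n::finite \<Rightarrow> real^'n"
  assumes "open S" "open T" "smooth_on S \<psi>" "\<And>y. y \<in> T \<Longrightarrow> \<Phi> y \<in> S" "\<And>y. y \<in> T \<Longrightarrow> \<psi> (\<Phi> y) = y"
    "\<And>y. y \<in> T \<Longrightarrow> \<Phi> differentiable (at y)"
    "\<And>x. x \<in> S \<Longrightarrow> invertible (\<chi> a b. pd b \<psi> x $ a)"
  shows "smooth_on T \<Phi>"
proof -
  define J where "J = (\<lambda>x. \<chi> a b. pd b \<psi> x $ a)"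
  have sJ: "smooth_on S (\<lambda>x. matrix_inv (J x))" unfolding J_def
    by (intro smooth_intros assms)
  have pd: "pd i \<Phi> y = matrix_inv (J (\<Phi> y)) *v axis i 1" if "y \<in> T" for y i
  proof -
    have "axis i 1 = pd i (\<lambda>y. y) y"
      using pd_eq[OF has_derivative_ident] by metis
    also have "\<dots> = pd i (\<lambda>y. \<psi> (\<Phi> y)) y"
      by (rule pd_cong_open[OF assms(2) that, symmetric])
       (use assms that smooth_onD[OF assms(3)] differentiable_chain_at[of \<Phi> y \<psi>] in \<open>auto simp: o_def\<close>)
    also have "\<dots> = (SUM j. (pd i \<Phi> y $ j) *\<^sub>R pd j \<psi> (\<Phi> y))"
      by (rule pd_compose) (use assms that smooth_onD[OF assms(3)] in auto)
    also have "\<dots> = J (\<Phi> y) *v pd i \<Phi> y"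
      by (simp add: J_def vec_eq_iff matrix_vector_mult_def mult.commute)
    finally have "matrix_inv (J (\<Phi> y)) *v axis i 1 = matrix_inv (J (\<Phi> y)) *v (J (\<Phi> y) *v pd i \<Phi> y)" by simp
    also have "\<dots> = pd i \<Phi> y"
      using assms(4,7)[of "\<Phi> y"] assms(4)[OF that] by (simp add: matrix_vector_mul_assoc matrix_inv_left J_def)
    finally show ?thesis by simp
  qed
  have "Ck_on k T \<Phi>" for k
  proof (induction k)
    case 0
    then show ?case using assms(6)
      by (auto intro!: continuous_at_imp_continuous_on differentiable_imp_continuous_within)
  next
    case (Suc k)
    show ?case
    proof (rule Ck_on_Suc_cong[OF assms(2)])
      show "\<exists>p. (\<forall>y\<in>T. pd i \<Phi> y = p y) \<and> Ck_on k T p" for i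
      proof (intro exI conjI ballI)
        show "pd i \<Phi> y = matrix_inv (J (\<Phi> y)) *v axis i 1" if "y \<in> T" for y using pd that .
        have "Ck_on k T (\<lambda>y. matrix_inv (J (\<Phi> y)))"
          by (rule Ck_on_compose[OF assms(2,1) _ Suc]) (use sJ assms(4) in \<open>auto simp: smooth_on_def\<close>)
        then show "Ck_on k T (\<lambda>y. matrix_inv (J (\<Phi> y)) *v axis i 1)"
          by (intro Ck_on_bilinear[OF assms(2) bounded_bilinear_matrix_vector_mult] Ck_on_const)
      qed
    qed (rule assms)
  qed
  then show ?thesis by (simp add: smooth_on_def)
qed

text \<open>With \<open>H = M ** A\<close>, each row of \<open>H\<close> is a combination of rows of
  \<open>A\<close>, and after replacing row \<open>i\<close> only the multiple of row
  \<open>i\<close> itself survives in the determinant. The left side is the derivative of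
  \<open>det\<close> expanded row by row, so this is Jacobi's formula.\<close>

lemma det_replace_rows_sum:
  fixes A H :: "real^'n^'n::finite"
  assumes "invertible A"
  shows "(SUM i. det (\<chi> j. if j = i then H$i else A$j)) = det A * trace (matrix_inv A ** H)"
proof -
  define M where "M = H ** matrix_inv A"
  have H: "H = M ** A"
    by (simp add: M_def matrix_mul_assoc[symmetric] matrix_inv_left[OF assms])
  have "det (\<chi> j. if j = i then H$i else A$j) = M$i$i * det A" for i
  proof -
    have "H$i = (SUM k. M$i$k *s A$k)"
      unfolding H by (simp add: vec_eq_iff matrix_matrix_mult_def)
    then have "det (\<chi> j. if j = i then H$i else A$j) = (SUM k. det (\<chi> j. if j = i then M$i$k *s A$k else A$j))"
      using det_linear_row_sum[of UNIV i "\<lambda>_ k. M$i$k *s A$k" "\<lambda>j. A$j"] by (simp only: finite)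
    also have "\<dots> = (SUM k. M$i$k * det (\<chi> j. if j = i then A$k else A$j))"
      using det_row_mul[of i _ "\<lambda>_. _" "\<lambda>j. A$j"] by simp
    also have "\<dots> = (SUM k. if k = i then M$i$i * det A else 0)"
    proof (rule sum.cong[OF refl])
      fix k
      show "M$i$k * det (\<chi> j. if j = i then A$k else A$j) = (if k = i then M$i$i * det A else 0)"
      proof (cases "k = i")
        case True
        have "(\<chi> j. if j = i then A$k else A$j) = A" using True by (auto simp: vec_eq_iff)
        then show ?thesis using True by simp
      next
        case False
        have "det (\<chi> j. if j = i then A$k else A$j) = 0"
          by (rule det_identical_rows[OF False]) (use False in \<open>simp add: row_def vec_eq_iff\<close>)
        then show ?thesis using False by simp
      qed
    qed
    finally show ?thesis by simp
  qed
  then have "(SUM i. det (\<chi> j. if j = i then H$i else A$j)) = det A * trace M"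
    by (simp add: trace_def sum_distrib_left mult.commute)
  then show ?thesis unfolding M_def using trace_mul_sym by metis
qed

lemma has_derivative_det:
  fixes A :: "real^'n^'n::finite"
  assumes "invertible A"
  shows "(det has_derivative (\<lambda>H. det A * trace (matrix_inv A ** H))) (at A)"
proof -
  have c: "((\<lambda>A::real^'n^'n. A$i$j) has_derivative (\<lambda>H. H$i$j)) (at A)" for i j
    by (rule bounded_linear.has_derivative[OF bounded_linear_vec_nth
        bounded_linear.has_derivative[OF bounded_linear_vec_nth has_derivative_ident]])
  have 1: "(det has_derivative (\<lambda>H. \<Sum>p\<in>{p. p permutes UNIV}. of_int (sign p) * (SUM i. H$i$p i * (\<Prod>j\<in>UNIV-{i}. A$j$p j)))) (at A)"
    unfolding det_def[abs_def] by (intro has_derivative_sum has_derivative_mult_right has_derivative_prod c)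
  have "(\<Sum>p\<in>{p. p permutes UNIV}. of_int (sign p) * (SUM i. H$i$p i * (\<Prod>j\<in>UNIV-{i}. A$j$p j)))
      = (SUM i. det (\<chi> j. if j = i then H$i else A$j))" for H
  proof -
    have "(\<Prod>j\<in>UNIV. (if j = i then H$i else A$j)$p j) = H$i$p i * (\<Prod>j\<in>UNIV-{i}. A$j$p j)" for i p
      by (subst prod.remove[of UNIV i]) auto
    then show ?thesis unfolding det_def
      by (simp add: sum_distrib_left) (rule sum.swap)
  qed
  with 1 show ?thesis by (simp add: det_replace_rows_sum[OF assms])
qed

lemma pd_det:
  fixes A :: "real^'n::finite \<Rightarrow> real^'k^'k::finite"
  assumes "A differentiable (at y)" "invertible (A y)"
  shows "pd i (\<lambda>x. det (A x)) y = det (A y) * trace (matrix_inv (A y) ** pd i A y)"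
  using pd_eq[OF has_derivative_compose[OF differentiable_has_derivative[OF assms(1)] has_derivative_det[OF assms(2)]]]
  by (simp add: partial_deriv_def)

lemma pd_matrix_inv:
  fixes A :: "real^'n::finite \<Rightarrow> real^'k^'k::finite"
  assumes "open S" "y \<in> S" "smooth_on S A" "\<And>x. x \<in> S \<Longrightarrow> invertible (A x)"
  shows "pd i (\<lambda>x. matrix_inv (A x)) y = - (matrix_inv (A y) ** pd i A y ** matrix_inv (A y))"
proof -
  let ?P = "\<lambda>x. matrix_inv (A x)"
  have d: "A differentiable (at y)" "?P differentiable (at y)"
    using smooth_onD[OF assms(3,2)] smooth_onD[OF smooth_on_matrix_inv[OF assms(1,3,4)] assms(2)] by auto
  have "A y ** pd i ?P y + pd i A y ** ?P y = pd i (\<lambda>x. A x ** ?P x) y"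
    using pd_matrix_mult[OF d] by simp
  also have "\<dots> = pd i (\<lambda>x. mat 1 :: real^'k^'k) y"
    by (rule pd_cong_open[OF assms(1,2)]) (simp_all add: matrix_inv_right assms)
  finally have "A y ** pd i ?P y = - (pd i A y ** ?P y)"
    by (simp add: eq_neg_iff_add_eq_0)
  then have "?P y ** (A y ** pd i ?P y) = ?P y ** (- (pd i A y ** ?P y))" by simp
  moreover have "?P y ** (- (pd i A y ** ?P y)) = - (?P y ** (pd i A y ** ?P y))"
    using bounded_bilinear.minus_right[OF bounded_bilinear_matrix_mult] .
  ultimately show ?thesis using assms by (simp add: matrix_mul_assoc matrix_inv_left)
qed

text \<open>\<open>trace (matrix_inv (mat 1 + H))\<close> starts with \<open>n - trace H\<close> and
  the logarithm of the determinant with \<open>trace H\<close>. The linear terms cancel, and the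
  quadratic ones, \<open>1\<close> and \<open>-1/2\<close> times \<open>trace (H ** H)\<close>,
  leave one half. One constant \<open>C\<close> serves all four estimates.\<close>

lemma logdet_expansion:
  "\<exists>\<epsilon>>0. \<exists>C\<ge>0. \<forall>H::real^'n^'n::finite. norm H \<le> \<epsilon> \<longrightarrow>
     det (mat 1 + H) > 0 \<and> norm (matrix_inv (mat 1 + H)) \<le> C \<and>
     norm (matrix_inv (mat 1 + H) - mat 1) \<le> C * norm H \<and>
     \<bar>trace (matrix_inv (mat 1 + H)) + ln (det (mat 1 + H)) - real CARD('n) - trace (H ** H) / 2\<bar> \<le> C * norm H ^ 3"
proof -
  define I where "I = (mat 1 :: real^'n^'n)"
  obtain K where K: "K > 0" "\<And>(A::real^'n^'n) (B::real^'n^'n). norm (A ** B) \<le> norm A * norm B * K"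
    using bounded_bilinear.pos_bounded[OF bounded_bilinear_matrix_mult] by blast
  obtain Tr where Tr: "Tr > 0" "\<And>A :: real^'n^'n. norm (trace A) \<le> norm A * Tr"
    using bounded_linear.pos_bounded[OF bounded_linear_trace] by blast
  have "isCont (det :: real^'n^'n \<Rightarrow> real) I"
    using continuous_on_det[of UNIV] continuous_on_eq_continuous_at by blast
  then obtain d where d: "d > 0" "\<And>A. dist A I < d \<Longrightarrow> dist (det A) (det I) < 1"
    unfolding continuous_at_eps_delta by (meson zero_less_one)
  \<comment> \<open>An absorption: with \<open>P\<close> the inverse of \<open>I + H\<close>,
    \<open>P = I - P ** H\<close> gives \<open>norm P <= norm I + norm P / 2\<close> as soon as
    \<open>K * norm H <= 1/2\<close>, which is the second condition on \<open>\<epsilon>\<close>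
    below.\<close>
  define N where "N = 2 * norm I"
  define \<epsilon> where "\<epsilon> = min (d/2) (1 / (2*K))"
  have \<epsilon>: "\<epsilon> > 0" "\<epsilon> < d" "K * \<epsilon> \<le> 1/2" using d K by (auto simp: \<epsilon>_def min_def field_simps)
  have N0: "N \<ge> 0" by (simp add: N_def)
  have I: "det (I + H) > 0" "invertible (I + H)" "norm (matrix_inv (I + H)) \<le> N"
    "matrix_inv (I + H) - I = - (matrix_inv (I + H) ** H)"
    "norm (matrix_inv (I + H) - I) \<le> N * K * norm H"
    if "norm H \<le> \<epsilon>" for H
  proof -
    have "dist (I + H) I < d" using that \<epsilon> by (simp add: dist_norm)
    from d(2)[OF this] show det: "det (I + H) > 0" by (simp add: I_def dist_real_def)
    then show inv: "invertible (I + H)" using invertible_det_nz by force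
    let ?P = "matrix_inv (I + H)"
    have "?P ** (I + H) = I" using matrix_inv_left[OF inv] by (simp add: I_def)
    then have PH: "?P + ?P ** H = I" by (simp add: matrix_add_ldistrib I_def)
    then show eq: "?P - I = - (?P ** H)" by (simp add: algebra_simps eq_neg_iff_add_eq_0)
    have "?P = I - ?P ** H" using PH by (simp add: algebra_simps)
    then have "norm ?P \<le> norm I + norm (?P ** H)" by (metis norm_triangle_ineq4)
    also have "norm (?P ** H) \<le> norm ?P * norm H * K" using K(2) .
    also have "\<dots> = norm ?P * (K * norm H)" by simp
    also have "\<dots> \<le> norm ?P * (1/2)"
    proof (rule mult_left_mono)
      have "K * norm H \<le> K * \<epsilon>" using that K by simp
      then show "K * norm H \<le> 1/2" using \<epsilon> by simp
    qed simp
    finally show Pb: "norm ?P \<le> N" by (simp add: N_def)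
    have "norm (?P - I) \<le> norm ?P * norm H * K" using eq K(2)[of ?P H] by simp
    also have "\<dots> \<le> N * norm H * K" using Pb K by (intro mult_right_mono) auto
    finally show "norm (?P - I) \<le> N * K * norm H" by (simp add: mult_ac)
  qed
  \<comment> \<open>The factor 2 because two cubic traces occur at the end, each bounded with
    \<open>C1 / 2\<close>.\<close>
  define C1 where "C1 = 2 * (Tr * (N * K * K * K))"
  have C1: "C1 \<ge> 0" using Tr N0 K by (simp add: C1_def)
  have cubic: "\<bar>trace ((matrix_inv (I + X) - I) ** H ** H)\<bar> \<le> (C1 / 2) * norm H ^ 3" if X: "norm X \<le> \<epsilon>" "norm X \<le> norm H" for X H :: "real^'n^'n"
  proof -
    have "norm (matrix_inv (I + X) - I) \<le> N * K * norm H"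
      using I(5)[OF X(1)] mult_left_mono[OF X(2), of "N * K"] N0 K by simp
    then have "norm (matrix_inv (I + X) - I) * norm H * K * norm H * K * Tr \<le> (N * K * norm H) * norm H * K * norm H * K * Tr"
      using K Tr by (intro mult_right_mono) auto
    moreover have "norm ((matrix_inv (I + X) - I) ** H ** H) \<le> norm (matrix_inv (I + X) - I) * norm H * K * norm H * K"
      by (rule order_trans[OF K(2)]) (use K in \<open>intro mult_right_mono\<close>, auto)
    then have "norm ((matrix_inv (I + X) - I) ** H ** H) * Tr \<le> norm (matrix_inv (I + X) - I) * norm H * K * norm H * K * Tr"
      using Tr by (intro mult_right_mono) auto
    ultimately show ?thesis using Tr(2)[of "(matrix_inv (I + X) - I) ** H ** H"] by (simp add: C1_def power3_eq_cube mult_ac)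
  qed
  have tneg: "trace (- X) = - trace X" for X :: "real^'n^'n" by (simp add: trace_def sum_negf)
  have tsc: "trace (r *\<^sub>R X) = r * trace X" for r and X :: "real^'n^'n" by (simp add: trace_def sum_distrib_left)
  have msc: "X ** (r *\<^sub>R Y) = r *\<^sub>R (X ** Y)" "(r *\<^sub>R X) ** Y = r *\<^sub>R (X ** Y)" "(- X) ** Y = - (X ** Y)" "(X - Z) ** Y = X ** Y - Z ** Y"
    for r and X Y Z :: "real^'n^'n"
    using bounded_bilinear.scaleR_right[OF bounded_bilinear_matrix_mult] bounded_bilinear.scaleR_left[OF bounded_bilinear_matrix_mult]
      bounded_bilinear.minus_left[OF bounded_bilinear_matrix_mult] bounded_bilinear.diff_left[OF bounded_bilinear_matrix_mult] by blast+
  have main: "\<bar>trace (matrix_inv (I + H)) + ln (det (I + H)) - real CARD('n) - trace (H ** H) / 2\<bar> \<le> C1 * norm H ^ 3"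
    if H: "norm H \<le> \<epsilon>" for H
  proof -
    define P where "P t = matrix_inv (I + t *\<^sub>R H)" for t :: real
    \<comment> \<open>The second order Taylor remainder of \<open>ln det\<close> along the segment
      from \<open>I\<close> to \<open>I + H\<close>. Its derivative is already cubic in
      \<open>H\<close>, so the mean value theorem gives a cubic bound without third derivatives of
      the determinant.\<close>
    define f where "f t = ln (det (I + t *\<^sub>R H)) - t * trace H + t\<^sup>2 / 2 * trace (H ** H)" for t :: real
    have tH: "norm (t *\<^sub>R H) \<le> \<epsilon>" "norm (t *\<^sub>R H) \<le> norm H" if "0 \<le> t" "t \<le> 1" for t
      using that H mult_left_le_one_le[of "norm H" t] by auto
    have PH: "trace (P t ** H) = trace H - t * trace (H ** H) - t * trace ((P t - I) ** H ** H)" if t: "0 \<le> t" "t \<le> 1" for t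
    proof -
      have "P t ** H - H = - (t *\<^sub>R (P t ** H ** H))"
      proof -
        have "(P t - I) ** H = (- (t *\<^sub>R (P t ** H))) ** H" using I(4)[OF tH(1)[OF t]] by (simp add: P_def msc)
        then show ?thesis by (simp add: msc I_def)
      qed
      then have 1: "trace (P t ** H) - trace H = - (t * trace (P t ** H ** H))" by (metis tneg tsc trace_sub)
      have "trace ((P t - I) ** H ** H) = trace (P t ** H ** H) - trace (H ** H)" by (simp add: msc I_def trace_sub)
      then have 2: "trace (P t ** H ** H) = trace (H ** H) + trace ((P t - I) ** H ** H)" by simp
      show ?thesis using 1 unfolding 2 by (simp add: algebra_simps)
    qed
    have der: "(f has_real_derivative (- t * trace ((P t - I) ** H ** H))) (at t)" if t: "0 \<le> t" "t \<le> 1" for t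
    proof -
      have lin: "((\<lambda>t. I + t *\<^sub>R H) has_derivative (\<lambda>h. h *\<^sub>R H)) (at t)"
        by (auto intro!: derivative_eq_intros)
      note Pt = I[OF tH(1)[OF t]]
      have "((\<lambda>t. det (I + t *\<^sub>R H)) has_derivative (\<lambda>h. h * (det (I + t *\<^sub>R H) * trace (P t ** H)))) (at t)"
        using has_derivative_compose[OF lin has_derivative_det[OF Pt(2)]] by (simp add: P_def msc tsc mult_ac)
      then have d2: "((\<lambda>t. det (I + t *\<^sub>R H)) has_real_derivative det (I + t *\<^sub>R H) * trace (P t ** H)) (at t)"
        by (simp add: has_field_derivative_def mult_commute_abs)
      have d3: "((\<lambda>t. ln (det (I + t *\<^sub>R H))) has_real_derivative trace (P t ** H)) (at t)"
        using DERIV_chain2[OF DERIV_ln_divide[OF Pt(1)] d2] Pt(1) by simp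
      have d4: "((\<lambda>t. t * c) has_real_derivative c) (at t)" "((\<lambda>t. t\<^sup>2 / 2 * c) has_real_derivative t * c) (at t)" for c
        by (auto intro!: derivative_eq_intros)
      have "(f has_real_derivative trace (P t ** H) - trace H + t * trace (H ** H)) (at t)"
        unfolding f_def by (intro DERIV_add DERIV_diff d3 d4)
      then show ?thesis by (simp add: PH[OF t])
    qed
    obtain z where z: "0 < z" "z < 1" "f 1 - f 0 = (1 - 0) * (- z * trace ((P z - I) ** H ** H))"
      using MVT2[OF _ der, of 0 1] by auto
    have "f 1 = - z * trace ((P z - I) ** H ** H)" using z(3) by (simp add: f_def I_def)
    then have "\<bar>f 1\<bar> \<le> \<bar>trace ((P z - I) ** H ** H)\<bar>" using z by (simp add: abs_mult mult_left_le_one_le)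
    also have "\<dots> \<le> (C1 / 2) * norm H ^ 3" unfolding P_def using z by (intro cubic tH) auto
    finally have f1: "\<bar>f 1\<bar> \<le> (C1 / 2) * norm H ^ 3" .
    have "trace (P 1) - real CARD('n) = - trace (P 1 ** H)"
      using I(4)[OF H] by (simp add: P_def) (metis I_def tneg trace_I trace_sub)
    then have "trace (P 1) + ln (det (I + H)) - real CARD('n) - trace (H ** H) / 2 = f 1 + trace ((P 1 - I) ** H ** H)"
      using PH[of 1] by (simp add: f_def)
    moreover have "\<bar>trace ((P 1 - I) ** H ** H)\<bar> \<le> (C1 / 2) * norm H ^ 3" unfolding P_def by (intro cubic tH) auto
    ultimately have "\<bar>trace (P 1) + ln (det (I + H)) - real CARD('n) - trace (H ** H) / 2\<bar> \<le> C1 * norm H ^ 3"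
      using f1 by linarith
    then show ?thesis by (simp add: P_def)
  qed
  define C where "C = N + N * K + C1"
  have "norm H ^ 3 \<ge> 0" "norm H \<ge> 0" for H :: "real^'n^'n" by auto
  then have "N \<le> C" "N * K * norm H \<le> C * norm H" "C1 * norm H ^ 3 \<le> C * norm H ^ 3" for H :: "real^'n^'n"
    using N0 K C1 by (auto simp: C_def intro!: mult_right_mono)
  then have "det (I + H) > 0 \<and> norm (matrix_inv (I + H)) \<le> C \<and> norm (matrix_inv (I + H) - I) \<le> C * norm H \<and>
     \<bar>trace (matrix_inv (I + H)) + ln (det (I + H)) - real CARD('n) - trace (H ** H) / 2\<bar> \<le> C * norm H ^ 3"
    if "norm H \<le> \<epsilon>" for H using I[OF that] main[OF that] by (meson order_trans)
  moreover have "C \<ge> 0" using N0 K C1 by (simp add: C_def)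
  ultimately show ?thesis unfolding I_def using \<epsilon>(1) by blast
qed

section \<open>Connection and curvature in coordinates\<close>

text \<open>The Christoffel symbols \<open>\<Gamma>^l_ik\<close> as a matrix for each direction
  \<open>i\<close>, with row \<open>l\<close> and column \<open>k\<close>, that is, the connection
  form in the coordinate frame. Contractions over endomorphism indices become matrix products and
  traces.\<close>

definition conn :: "'n::finite mfield \<Rightarrow> 'n \<Rightarrow> 'n mfield"
  where "conn h i y = (\<chi> l k. (1/2) * (SUM m. matrix_inv (h y) $ l $ m *
      (pd i (\<lambda>z. h z $ k $ m) y + pd k (\<lambda>z. h z $ i $ m) y
       - pd m (\<lambda>z. h z $ i $ k) y)))"

text \<open>The entry in row \<open>l\<close> and column \<open>k\<close> is \<open>R^l_kij\<close>;
  \<open>riemann_component_eq_curv\<close> makes the link.\<close>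

definition curv :: "'n::finite mfield \<Rightarrow> 'n \<Rightarrow> 'n \<Rightarrow> 'n mfield"
  where "curv h i j y = pd i (conn h j) y - pd j (conn h i) y
    + conn h i y ** conn h j y - conn h j y ** conn h i y"

definition scal :: "'n::finite mfield \<Rightarrow> real^'n \<Rightarrow> real"
  where "scal h y = (SUM j k. matrix_inv (h y) $ j $ k * (SUM i. curv h i j y $ i $ k))"

definition metric_on :: "(real^'n::finite) set \<Rightarrow> 'n mfield \<Rightarrow> bool"
  where "metric_on S h \<longleftrightarrow> smooth_on S h \<and>
    (\<forall>y\<in>S. transpose (h y) = h y \<and> (\<forall>v. v \<noteq> 0 \<longrightarrow> v \<bullet> (h y *v v) > 0))"

definition jac :: "(real^'n::finite \<Rightarrow> real^'n) \<Rightarrow> 'n mfield"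
  where "jac \<psi> x = (\<chi> a b. pd b \<psi> x $ a)"

definition pullback :: "(real^'n::finite \<Rightarrow> real^'n) \<Rightarrow> 'n mfield \<Rightarrow> 'n mfield"
  where "pullback \<psi> h x = transpose (jac \<psi> x) ** h (\<psi> x) ** jac \<psi> x"

lemma christoffel_eq_conn: "christoffel g c l i k y = conn (metric_in_chart g c) i y $ l $ k"
  by (simp add: christoffel_def conn_def)

lemma metric_on_smooth: "metric_on S h \<Longrightarrow> smooth_on S h"
  and metric_on_sym: "metric_on S h \<Longrightarrow> y \<in> S \<Longrightarrow> transpose (h y) = h y"
  and metric_on_pos: "metric_on S h \<Longrightarrow> y \<in> S \<Longrightarrow> v \<noteq> 0 \<Longrightarrow> v \<bullet> (h y *v v) > 0"
  by (auto simp: metric_on_def)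

lemma metric_on_invertible: "metric_on S h \<Longrightarrow> y \<in> S \<Longrightarrow> invertible (h y)"
  by (rule posdef_invertible) (rule metric_on_pos)

lemma metric_on_det_pos: "metric_on S h \<Longrightarrow> y \<in> S \<Longrightarrow> det (h y) > 0"
  by (rule posdef_det_pos) (rule metric_on_pos)

lemma metric_on_subset: "metric_on S h \<Longrightarrow> T \<subseteq> S \<Longrightarrow> metric_on T h"
  unfolding metric_on_def using smooth_on_subset by blast

lemma transpose_component: "transpose A $ i $ j = A $ j $ i"
  by (simp add: transpose_def)

lemma transpose_eq_component: "transpose (A::'a^'n^'n) = A \<Longrightarrow> A $ i $ j = A $ j $ i"
  using transpose_component[of A j i] by simp

lemma metric_on_inv_sym:
  assumes "metric_on S h" "y \<in> S"
  shows "matrix_inv (h y) $ i $ j = matrix_inv (h y) $ j $ i"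
  by (rule transpose_eq_component)
    (use matrix_inv_transpose[OF metric_on_invertible[OF assms]] metric_on_sym[OF assms] in simp)

lemma smooth_on_matrix_component [smooth_intros]:
  "open S \<Longrightarrow> smooth_on S h \<Longrightarrow> smooth_on S (\<lambda>x. h x $ i $ j)"
  by (intro smooth_intros)

lemma pd_matrix_component:
  assumes "h differentiable (at y)"
  shows "pd i (\<lambda>z. h z $ j $ k) y = pd i h y $ j $ k"
  using pd_component[OF differentiable_bounded_linear[OF bounded_linear_vec_nth assms]]
    pd_component[OF assms] by simp

lemma pd_metric_sym:
  assumes "open S" "metric_on S h" "y \<in> S"
  shows "pd i h y $ j $ k = pd i h y $ k $ j"
proof -
  have d: "h differentiable (at y)" using smooth_onD assms metric_on_smooth by blast
  have "pd i (\<lambda>z. h z $ j $ k) y = pd i (\<lambda>z. h z $ k $ j) y"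
    by (rule pd_cong_open[OF assms(1,3)])
     (use transpose_eq_component metric_on_sym[OF assms(2)] in blast,
      rule differentiable_bounded_linear[OF bounded_linear_vec_nth differentiable_bounded_linear[OF bounded_linear_vec_nth d]])
  then show ?thesis by (simp add: pd_matrix_component[OF d])
qed

lemma smooth_on_conn [smooth_intros]:
  assumes "open S" "metric_on S h"
  shows "smooth_on S (conn h i)"
  unfolding conn_def[abs_def]
  by (intro smooth_intros assms(1) metric_on_smooth[OF assms(2)] metric_on_invertible[OF assms(2)])

lemma conn_sym:
  assumes "open S" "metric_on S h" "y \<in> S"
  shows "conn h i y $ l $ k = conn h k y $ l $ i"
proof -
  have d: "h differentiable (at y)" using smooth_onD assms metric_on_smooth by blast
  show ?thesis
    using pd_metric_sym[OF assms]
    by (simp add: conn_def pd_matrix_component[OF d] algebra_simps)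
qed

lemma conn_lower:
  assumes "open S" "metric_on S h" "y \<in> S"
  shows "(h y ** conn h i y) $ m $ k = (1/2) * (pd i h y $ k $ m + pd k h y $ i $ m - pd m h y $ i $ k)"
proof -
  have d: "h differentiable (at y)" using smooth_onD assms metric_on_smooth by blast
  define B where "B = (\<chi> m k. (1/2) * (pd i h y $ k $ m + pd k h y $ i $ m - pd m h y $ i $ k))"
  have "conn h i y = matrix_inv (h y) ** B"
    by (simp add: conn_def B_def vec_eq_iff matrix_matrix_mult_def pd_matrix_component[OF d] sum_distrib_left mult_ac)
  then have "h y ** conn h i y = B"
    using matrix_inv_right[OF metric_on_invertible[OF assms(2,3)]] by (simp add: matrix_mul_assoc)
  then show ?thesis by (simp add: B_def)
qed

lemma conn_compat:
  assumes "open S" "metric_on S h" "y \<in> S"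
  shows "pd i h y = transpose (conn h i y) ** h y + h y ** conn h i y"
proof -
  have tr: "transpose (h y ** conn h i y) = transpose (conn h i y) ** h y"
    using metric_on_sym[OF assms(2,3)] by (simp add: matrix_transpose_mul)
  then have t: "(transpose (conn h i y) ** h y) $ a $ b = (h y ** conn h i y) $ b $ a" for a b
    by (simp only: tr[symmetric] transpose_component)
  have "pd i h y $ a $ b = (h y ** conn h i y) $ b $ a + (h y ** conn h i y) $ a $ b" for a b
    unfolding conn_lower[OF assms] using pd_metric_sym[OF assms] by (simp add: algebra_simps)
  then show ?thesis by (simp add: vec_eq_iff t)
qed

text \<open>The uniqueness half of the fundamental theorem of Riemannian geometry: lowering an index
  and permuting compatibility cyclically recovers the Christoffel formula. It allows the connection
  of a pullback to be verified instead of computed.\<close>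

lemma conn_unique:
  assumes "open S" "metric_on S h" "y \<in> S"
    and sym: "\<And>i l k. C i $ l $ k = C k $ l $ i"
    and compat: "\<And>i. pd i h y = transpose (C i) ** h y + h y ** C i"
  shows "conn h i y = C i"
proof -
  define c where "c i = h y ** C i" for i
  have tr: "transpose (c i) = transpose (C i) ** h y" for i
    using metric_on_sym[OF assms(2,3)] by (simp add: matrix_transpose_mul c_def)
  then have t: "(transpose (C i) ** h y) $ a $ b = c i $ b $ a" for a b i
    by (simp only: tr[symmetric] transpose_component)
  have cs: "c i $ m $ k = c k $ m $ i" for i m k
    using sym by (simp add: c_def matrix_matrix_mult_def)
  have "pd i h y $ a $ b = c i $ b $ a + c i $ a $ b" for i a b
    unfolding compat vector_add_component t by (simp add: c_def)
  then have "(h y ** conn h i y) $ m $ k = c i $ m $ k" for m k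
    unfolding conn_lower[OF assms(1-3)] using cs[of i m k] cs[of i k m] cs[of k i m] cs[of m i k] cs[of m k i] by simp
  then have "h y ** conn h i y = h y ** C i" by (simp add: vec_eq_iff c_def)
  then have "matrix_inv (h y) ** (h y ** conn h i y) = matrix_inv (h y) ** (h y ** C i)" by simp
  then show ?thesis using matrix_inv_left[OF metric_on_invertible[OF assms(2,3)]] by (simp add: matrix_mul_assoc)
qed

section \<open>Behaviour of metric, connection and curvature under a change of coordinates\<close>

lemma smooth_on_jac [smooth_intros]: "open S \<Longrightarrow> smooth_on S \<psi> \<Longrightarrow> smooth_on S (jac \<psi>)"
  unfolding jac_def[abs_def] by (intro smooth_intros)

lemma pd_jac:
  assumes "open S" "smooth_on S \<psi>" "x \<in> S"
  shows "pd i (jac \<psi>) x $ a $ b = pd i (pd b \<psi>) x $ a"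
proof -
  have "pd i (jac \<psi>) x $ a $ b = pd i (\<lambda>x. jac \<psi> x $ a $ b) x"
    using pd_matrix_component[OF smooth_onD[OF smooth_on_jac[OF assms(1,2)] assms(3)]] by simp
  also have "\<dots> = pd i (pd b \<psi>) x $ a"
    using pd_component[OF smooth_onD[OF smooth_on_partial[OF assms(2)] assms(3)]]
    by (simp add: jac_def)
  finally show ?thesis .
qed

lemma metric_on_pullback:
  assumes "open S" "open T" "smooth_on S \<psi>" "\<psi> ` S \<subseteq> T" "\<And>x. x \<in> S \<Longrightarrow> invertible (jac \<psi> x)" "metric_on T h"
  shows "metric_on S (pullback \<psi> h)"
  unfolding metric_on_def
proof (intro conjI ballI allI impI)
  show "smooth_on S (pullback \<psi> h)" unfolding pullback_def[abs_def]
    by (intro smooth_intros smooth_on_compose[OF assms(1,2,4,3)] metric_on_smooth assms)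
  fix x assume x: "x \<in> S"
  then have Tx: "\<psi> x \<in> T" using assms by blast
  show "transpose (pullback \<psi> h x) = pullback \<psi> h x"
    by (simp add: pullback_def matrix_transpose_mul metric_on_sym[OF assms(6) Tx] matrix_mul_assoc)
  fix v :: "real^'a" assume v: "v \<noteq> 0"
  then have "jac \<psi> x *v v \<noteq> 0"
    using assms(5)[OF x] by (metis matrix_inv_left matrix_vector_mul_assoc matrix_vector_mul_lid matrix_vector_mult_0_right)
  then have "(jac \<psi> x *v v) \<bullet> (h (\<psi> x) *v (jac \<psi> x *v v)) > 0" by (rule metric_on_pos[OF assms(6) Tx])
  also have "(jac \<psi> x *v v) \<bullet> (h (\<psi> x) *v (jac \<psi> x *v v)) = v \<bullet> (pullback \<psi> h x *v v)"
  proof -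
    have "v \<bullet> (transpose (jac \<psi> x) *v w) = (jac \<psi> x *v v) \<bullet> w" for w
      by (metis dot_lmul_matrix inner_commute transpose_matrix_vector)
    then show ?thesis by (simp add: pullback_def flip: matrix_vector_mul_assoc)
  qed
  finally show "v \<bullet> (pullback \<psi> h x *v v) > 0" .
qed

lemma pd_comp_jac:
  assumes "\<psi> differentiable (at x)" "f differentiable (at (\<psi> x))"
  shows "pd i (\<lambda>x. f (\<psi> x)) x = (SUM j. (jac \<psi> x $ j $ i) *\<^sub>R pd j f (\<psi> x))"
  using pd_compose[OF assms] by (simp add: jac_def)

lemma matrix_mult_sum_left: "(\<Sum>p\<in>I. A p) ** (B::real^'n::finite^'n) = (\<Sum>p\<in>I. A p ** B)"
  using bounded_bilinear.sum_left[OF bounded_bilinear_matrix_mult] .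

lemma matrix_mult_sum_right: "(B::real^'n::finite^'n) ** (\<Sum>p\<in>I. A p) = (\<Sum>p\<in>I. B ** A p)"
  using bounded_bilinear.sum_right[OF bounded_bilinear_matrix_mult] .

lemma matrix_mult_scaleR_left: "(r *\<^sub>R A) ** (B::real^'n::finite^'n) = r *\<^sub>R (A ** B)"
  using bounded_bilinear.scaleR_left[OF bounded_bilinear_matrix_mult] .

lemma matrix_mult_scaleR_right: "(B::real^'n::finite^'n) ** (r *\<^sub>R A) = r *\<^sub>R (B ** A)"
  using bounded_bilinear.scaleR_right[OF bounded_bilinear_matrix_mult] .

lemma matrix_mult_diff_left: "(A - C) ** (B::real^'n::finite^'n) = A ** B - C ** B"
  using bounded_bilinear.diff_left[OF bounded_bilinear_matrix_mult] .

lemma matrix_mult_diff_right: "(B::real^'n::finite^'n) ** (A - C) = B ** A - B ** C"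
  using bounded_bilinear.diff_right[OF bounded_bilinear_matrix_mult] .

lemma matrix_mult_add_left: "(A + C) ** (B::real^'n::finite^'n) = A ** B + C ** B"
  using bounded_bilinear.add_left[OF bounded_bilinear_matrix_mult] .

text \<open>The connection form pulled back along \<open>\<psi>\<close>: only the direction index is
  transformed by the Jacobian, the endomorphism indices still refer to the target frame.\<close>

definition conn_along :: "(real^'n::finite \<Rightarrow> real^'n) \<Rightarrow> 'n mfield \<Rightarrow> 'n \<Rightarrow> 'n mfield"
  where "conn_along \<psi> h i x = (SUM q. jac \<psi> x $ q $ i *\<^sub>R conn h q (\<psi> x))"

context
  fixes S T :: "(real^'n::finite) set" and \<psi> h
  assumes S: "open S" and T: "open T" and \<psi>: "smooth_on S \<psi>" and \<psi>T: "\<psi> ` S \<subseteq> T"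
    and inv: "\<And>x. x \<in> S \<Longrightarrow> invertible (jac \<psi> x)" and h: "metric_on T h"
begin

text \<open>The transformation law of a connection form under a change of frame, multiplied by the
  Jacobian so that no inverse appears. The matrix \<open>C i\<close> prescribed by the law is
  torsion free because second derivatives of \<open>\<psi>\<close> commute, and it is compatible
  with the pulled back metric by the product rule; \<open>conn_unique\<close> does the rest.\<close>

lemma conn_pullback:
  assumes x: "x \<in> S"
  shows "jac \<psi> x ** conn (pullback \<psi> h) i x = pd i (jac \<psi>) x + conn_along \<psi> h i x ** jac \<psi> x"
proof -
  let ?J = "jac \<psi> x" and ?A = "\<lambda>i. conn_along \<psi> h i x" and ?D = "\<lambda>i. pd i (jac \<psi>) x"
  have Tx: "\<psi> x \<in> T" using \<psi>T x by blast
  have dJ: "jac \<psi> differentiable (at x)" using smooth_onD[OF smooth_on_jac[OF S \<psi>] x] .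
  have dh: "(\<lambda>x. h (\<psi> x)) differentiable (at x)"
    using smooth_onD[OF smooth_on_compose[OF S T \<psi>T \<psi> metric_on_smooth[OF h]] x] .
  define C where "C i = matrix_inv ?J ** (?D i + ?A i ** ?J)" for i
  have JC: "?J ** C i = ?D i + ?A i ** ?J" for i
    using matrix_inv_right[OF inv[OF x]] by (simp add: C_def matrix_mul_assoc)
  have "conn (pullback \<psi> h) i x = C i"
  proof (rule conn_unique[OF S metric_on_pullback[OF S T \<psi> \<psi>T inv h] x])
    have DA: "(?D i + ?A i ** ?J) $ l $ k = (?D k + ?A k ** ?J) $ l $ i" for i l k
    proof -
      have "?D i $ l $ k = ?D k $ l $ i"
        using pd_jac[OF S \<psi> x] pd_commute_vec[OF S \<psi> x] by metis
      moreover have "(?A i ** ?J) $ l $ k = (SUM q m. ?J $ q $ i * conn h q (\<psi> x) $ l $ m * ?J $ m $ k)" for i k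
        unfolding conn_along_def matrix_mult_sum_left by (simp add: matrix_matrix_mult_def sum_distrib_left mult_ac)
      moreover have "(SUM q m. ?J $ q $ i * conn h q (\<psi> x) $ l $ m * ?J $ m $ k)
        = (SUM q m. ?J $ q $ k * conn h q (\<psi> x) $ l $ m * ?J $ m $ i)"
        by (subst sum.swap) (simp add: conn_sym[OF T h Tx, of _ l] mult_ac)
      ultimately show ?thesis by simp
    qed
    show "C i $ l $ k = C k $ l $ i" for i l k
      unfolding C_def matrix_matrix_mult_def[of "matrix_inv ?J"] using DA by simp
    show "pd i (pullback \<psi> h) x = transpose (C i) ** pullback \<psi> h x + pullback \<psi> h x ** C i" for i
    proof -
      have 1: "pd i (\<lambda>x. transpose (jac \<psi> x)) x = transpose (?D i)"
        using pd_linear[OF bounded_linear_transpose dJ] .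
      have 2: "pd i (\<lambda>x. h (\<psi> x)) x = transpose (?A i) ** h (\<psi> x) + h (\<psi> x) ** ?A i"
      proof -
        have "pd i (\<lambda>x. h (\<psi> x)) x = (SUM q. (?J $ q $ i) *\<^sub>R pd q h (\<psi> x))"
          by (rule pd_comp_jac)
            (use smooth_onD[OF \<psi> x] smooth_onD[OF metric_on_smooth[OF h] Tx] in auto)
        also have "\<dots> = (SUM q. (?J $ q $ i) *\<^sub>R (transpose (conn h q (\<psi> x)) ** h (\<psi> x))) + (SUM q. (?J $ q $ i) *\<^sub>R (h (\<psi> x) ** conn h q (\<psi> x)))"
          unfolding conn_compat[OF T h Tx] by (simp add: scaleR_add_right sum.distrib)
        also have "(SUM q. (?J $ q $ i) *\<^sub>R (h (\<psi> x) ** conn h q (\<psi> x))) = h (\<psi> x) ** ?A i"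
          by (simp add: conn_along_def matrix_mult_sum_right matrix_mult_scaleR_right)
        also have "(SUM q. (?J $ q $ i) *\<^sub>R (transpose (conn h q (\<psi> x)) ** h (\<psi> x))) = transpose (?A i) ** h (\<psi> x)"
          by (simp add: conn_along_def linear_sum[OF bounded_linear.linear[OF bounded_linear_transpose]] linear_cmul[OF bounded_linear.linear[OF bounded_linear_transpose]] matrix_mult_sum_left matrix_mult_scaleR_left)
        finally show ?thesis .
      qed
      have dT: "(\<lambda>x. transpose (jac \<psi> x)) differentiable (at x)" using differentiable_bounded_linear[OF bounded_linear_transpose dJ] .
      have "pd i (pullback \<psi> h) x = transpose ?J ** h (\<psi> x) ** ?D i
         + (transpose ?J ** (transpose (?A i) ** h (\<psi> x) + h (\<psi> x) ** ?A i) + transpose (?D i) ** h (\<psi> x)) ** ?J"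
        unfolding pullback_def[abs_def]
        by (simp add: pd_matrix_mult dJ dh dT differentiable_matrix_mult 1 2)
      also have "\<dots> = transpose (?D i + ?A i ** ?J) ** h (\<psi> x) ** ?J + transpose ?J ** h (\<psi> x) ** (?D i + ?A i ** ?J)"
      proof -
        have tadd: "transpose (X + Y) = transpose X + transpose Y" for X Y :: "real^'n^'n" by (simp add: transpose_def vec_eq_iff)
        show ?thesis unfolding tadd matrix_transpose_mul
          by (simp add: matrix_mult_add_left matrix_add_ldistrib matrix_mul_assoc)
      qed
      also have "\<dots> = transpose (C i) ** pullback \<psi> h x + pullback \<psi> h x ** C i"
        unfolding JC[symmetric] matrix_transpose_mul pullback_def by (simp add: matrix_mul_assoc)
      finally show ?thesis .
    qed
  qed
  then show ?thesis using JC by simp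
qed

text \<open>The law for the connection is differentiated once more and antisymmetrized; all
  derivatives of the Jacobian then disappear, which is the tensoriality of the curvature.\<close>

lemma curv_pullback:
  assumes x: "x \<in> S"
  shows "jac \<psi> x ** curv (pullback \<psi> h) i j x
    = (SUM p q. (jac \<psi> x $ p $ i * jac \<psi> x $ q $ j) *\<^sub>R curv h p q (\<psi> x)) ** jac \<psi> x"
proof -
  let ?J = "jac \<psi> x" and ?A = "\<lambda>i. conn_along \<psi> h i x" and ?D = "\<lambda>i. pd i (jac \<psi>) x"
    and ?G = "\<lambda>i. conn (pullback \<psi> h) i x"
  let ?dG = "\<lambda>i j. pd i (conn (pullback \<psi> h) j) x" and ?dA = "\<lambda>i j. pd i (conn_along \<psi> h j) x"
    and ?dD = "\<lambda>i j. pd i (pd j (jac \<psi>)) x"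
  have Tx: "\<psi> x \<in> T" using \<psi>T x by blast
  have mG: "metric_on S (pullback \<psi> h)" by (rule metric_on_pullback[OF S T \<psi> \<psi>T inv h])
  have sJ: "smooth_on S (jac \<psi>)" using smooth_on_jac[OF S \<psi>] .
  have sC: "smooth_on S (\<lambda>x. conn h q (\<psi> x))" for q
    by (rule smooth_on_compose[OF S T \<psi>T \<psi> smooth_on_conn[OF T h]])
  have sA: "smooth_on S (conn_along \<psi> h j)" for j
    unfolding conn_along_def[abs_def] by (intro smooth_intros S sJ sC)
  note dd = smooth_onD[OF _ x]
  have dif: "jac \<psi> differentiable (at x)" "conn (pullback \<psi> h) j differentiable (at x)"
    "conn_along \<psi> h j differentiable (at x)" "pd j (jac \<psi>) differentiable (at x)" for j
    using dd[OF sJ] dd[OF sA] dd[OF smooth_on_conn[OF S mG]] dd[OF smooth_on_partial[OF sJ]] by blast+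
  have E: "?D i ** ?G j + ?J ** ?dG i j = ?dD i j + ?dA i j ** ?J + ?A j ** ?D i" for i j
  proof -
    have "pd i (\<lambda>x. jac \<psi> x ** conn (pullback \<psi> h) j x) x
        = pd i (\<lambda>x. pd j (jac \<psi>) x + conn_along \<psi> h j x ** jac \<psi> x) x"
      by (rule pd_cong_open[OF S x])
        (simp add: conn_pullback, intro dif differentiable_add differentiable_matrix_mult)
    then show ?thesis
      by (simp add: pd_matrix_mult pd_add dif differentiable_matrix_mult algebra_simps)
  qed
  have dDsym: "?dD i j = ?dD j i"
  proof -
    have "?dD a b $ l $ k = pd a (pd b (\<lambda>x. jac \<psi> x $ l $ k)) x" for a b l k
      using pd_partial_component[OF S sJ x] pd_partial_component[OF S smooth_on_component[OF S sJ] x] by simp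
    then show ?thesis
      using pd_commute_real[OF S smooth_on_matrix_component[OF S sJ] x] by (simp add: vec_eq_iff)
  qed
  have JG: "?J ** ?G i ** X = ?D i ** X + ?A i ** (?J ** X)" for i and X :: "real^'n^'n"
    unfolding conn_pullback[OF x] by (simp add: matrix_mult_add_left matrix_mul_assoc)
  have dA: "?dA i j = (SUM q. ?D i $ q $ j *\<^sub>R conn h q (\<psi> x))
      + (SUM q p. (?J $ p $ i * ?J $ q $ j) *\<^sub>R pd p (conn h q) (\<psi> x))" for i j
  proof -
    have "?dA i j = (SUM q. pd i (\<lambda>x. jac \<psi> x $ q $ j *\<^sub>R conn h q (\<psi> x)) x)"
      unfolding conn_along_def[abs_def]
      by (rule pd_sum) (auto intro!: dd smooth_intros S sJ sC)
    also have "\<dots> = (SUM q. ?J $ q $ j *\<^sub>R (SUM p. ?J $ p $ i *\<^sub>R pd p (conn h q) (\<psi> x)) + ?D i $ q $ j *\<^sub>R conn h q (\<psi> x))"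
    proof (rule sum.cong[OF refl])
      fix q
      have "pd i (\<lambda>x. conn h q (\<psi> x)) x = (SUM p. ?J $ p $ i *\<^sub>R pd p (conn h q) (\<psi> x))"
        by (rule pd_comp_jac[OF dd[OF \<psi>] smooth_onD[OF smooth_on_conn[OF T h] Tx]])
      then show "pd i (\<lambda>x. jac \<psi> x $ q $ j *\<^sub>R conn h q (\<psi> x)) x
        = ?J $ q $ j *\<^sub>R (SUM p. ?J $ p $ i *\<^sub>R pd p (conn h q) (\<psi> x)) + ?D i $ q $ j *\<^sub>R conn h q (\<psi> x)"
        using pd_scaleR[OF dd[OF smooth_on_matrix_component[OF S sJ]] dd[OF sC]]
          pd_matrix_component[OF dif(1)] by simp
    qed
    finally show ?thesis by (simp add: sum.distrib scaleR_sum_right mult.commute)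
  qed
  have Dsym: "?D i $ q $ j = ?D j $ q $ i" for q
    using pd_jac[OF S \<psi> x] pd_commute_vec[OF S \<psi> x] by metis
  have AA: "?A i ** ?A j = (SUM p q. (?J $ p $ i * ?J $ q $ j) *\<^sub>R (conn h p (\<psi> x) ** conn h q (\<psi> x)))" for i j
    unfolding conn_along_def
    by (simp add: matrix_mult_sum_left matrix_mult_sum_right matrix_mult_scaleR_left matrix_mult_scaleR_right scaleR_sum_right)
      (rule trans[OF sum.swap], intro sum.cong refl, simp add: mult.commute)
  \<comment> \<open>The curvature of the pulled back connection form. The terms with
    \<open>?D i $ q $ j\<close> are symmetric in \<open>i\<close> and \<open>j\<close> and drop out
    of the difference.\<close>
  have F: "?dA i j - ?dA j i + ?A i ** ?A j - ?A j ** ?A i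
     = (SUM p q. (?J $ p $ i * ?J $ q $ j) *\<^sub>R curv h p q (\<psi> x))"
  proof -
    have s1: "(SUM q p. (?J $ p $ i * ?J $ q $ j) *\<^sub>R pd p (conn h q) (\<psi> x))
       = (SUM p q. (?J $ p $ i * ?J $ q $ j) *\<^sub>R pd p (conn h q) (\<psi> x))"
      by (rule sum.swap)
    have s2: "(SUM q p. (?J $ p $ j * ?J $ q $ i) *\<^sub>R pd p (conn h q) (\<psi> x))
       = (SUM p q. (?J $ p $ i * ?J $ q $ j) *\<^sub>R pd q (conn h p) (\<psi> x))"
      by (simp add: mult.commute)
    have s3: "?A j ** ?A i = (SUM p q. (?J $ p $ i * ?J $ q $ j) *\<^sub>R (conn h q (\<psi> x) ** conn h p (\<psi> x)))"
      by (rule trans[OF AA trans[OF sum.swap]], intro sum.cong refl) (simp add: mult.commute)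
    show ?thesis unfolding dA s1 s2 AA[of i j] s3 curv_def
      by (simp add: scaleR_diff_right scaleR_add_right sum.distrib sum_subtractf Dsym)
  qed
  have "?J ** curv (pullback \<psi> h) i j x = ?J ** ?dG i j - ?J ** ?dG j i + ?J ** ?G i ** ?G j - ?J ** ?G j ** ?G i"
    by (simp add: curv_def matrix_add_ldistrib matrix_mult_diff_right matrix_mul_assoc)
  also have "\<dots> = (?dD i j + ?dA i j ** ?J + ?A j ** ?D i - ?D i ** ?G j) - (?dD j i + ?dA j i ** ?J + ?A i ** ?D j - ?D j ** ?G i)
      + (?D i ** ?G j + ?A i ** (?J ** ?G j)) - (?D j ** ?G i + ?A j ** (?J ** ?G i))"
    using E[of i j] E[of j i] unfolding JG by (simp add: algebra_simps)
  \<comment> \<open>The second derivatives of the Jacobian cancel by symmetry and the products of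
    \<open>?D\<close> with \<open>?G\<close> directly; those of \<open>?A\<close> with
    \<open>?D\<close> cancel once \<open>?J ** ?G\<close> is replaced by the transformation
    law.\<close>
  also have "\<dots> = (?dA i j - ?dA j i + ?A i ** ?A j - ?A j ** ?A i) ** ?J"
    unfolding conn_pullback[OF x] dDsym
    by (simp add: matrix_add_ldistrib matrix_mult_add_left matrix_mult_diff_left matrix_mul_assoc algebra_simps)
  finally show ?thesis unfolding F .
qed

text \<open>The trace defining the Ricci form absorbs one Jacobian and one inverse, so Ricci
  transforms like the metric; the trace against the inverse metric then cancels the remaining
  Jacobians.\<close>

lemma scal_pullback:
  assumes x: "x \<in> S"
  shows "scal (pullback \<psi> h) x = scal h (\<psi> x)"
proof -
  let ?J = "jac \<psi> x" and ?K = "matrix_inv (jac \<psi> x)"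
  have Tx: "\<psi> x \<in> T" using \<psi>T x by blast
  define Ric where "Ric = (\<chi> q b. SUM p. curv h p q (\<psi> x) $ p $ b)"
  define Ric' where "Ric' = (\<chi> q b. SUM p. curv (pullback \<psi> h) p q x $ p $ b)"
  define F where "F i j = (SUM p q. (?J $ p $ i * ?J $ q $ j) *\<^sub>R curv h p q (\<psi> x))" for i j
  have JK: "(SUM i. ?J $ p $ i * ?K $ i $ a) = (if p = a then 1 else 0)" for p a
  proof -
    have "(?J ** ?K) $ p $ a = mat 1 $ p $ a" using matrix_inv_right[OF inv[OF x]] by simp
    then show ?thesis by (simp add: matrix_matrix_mult_def mat_def)
  qed
  have c: "curv (pullback \<psi> h) i j x = ?K ** (F i j ** ?J)" for i j
    using curv_pullback[OF x, of i j, folded F_def] matrix_inv_left[OF inv[OF x]]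
    by (metis matrix_mul_assoc matrix_mul_lid)
  have "Ric' $ j $ k = (transpose ?J ** Ric ** ?J) $ j $ k" for j k
  proof -
    have "Ric' $ j $ k = (SUM i a. ?K $ i $ a * (F i j ** ?J) $ a $ k)"
      by (simp add: Ric'_def c matrix_matrix_mult_def)
    also have "\<dots> = (SUM i a. ?K $ i $ a * (SUM p q. (?J $ p $ i * ?J $ q $ j) * (curv h p q (\<psi> x) ** ?J) $ a $ k))"
      by (simp add: F_def matrix_mult_sum_left matrix_mult_scaleR_left)
    also have "\<dots> = (SUM i a p. (?J $ p $ i * ?K $ i $ a) * (SUM q. ?J $ q $ j * (curv h p q (\<psi> x) ** ?J) $ a $ k))"
      by (simp add: sum_distrib_left mult_ac)
    also have "\<dots> = (SUM a p i. (?J $ p $ i * ?K $ i $ a) * (SUM q. ?J $ q $ j * (curv h p q (\<psi> x) ** ?J) $ a $ k))"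
      by (subst sum.swap, rule sum.cong[OF refl], rule sum.swap)
    also have "\<dots> = (SUM a p. (SUM i. ?J $ p $ i * ?K $ i $ a) * (SUM q. ?J $ q $ j * (curv h p q (\<psi> x) ** ?J) $ a $ k))"
      by (simp only: sum_distrib_right)
    also have "\<dots> = (SUM a q. ?J $ q $ j * (curv h a q (\<psi> x) ** ?J) $ a $ k)"
      unfolding JK by (simp add: if_distrib[of "\<lambda>z. z * _"] cong: if_cong)
    also have "\<dots> = (SUM q. ?J $ q $ j * (SUM a. (curv h a q (\<psi> x) ** ?J) $ a $ k))"
      by (subst sum.swap) (simp add: sum_distrib_left)
    also have "(\<lambda>q. (SUM a. (curv h a q (\<psi> x) ** ?J) $ a $ k)) = (\<lambda>q. (Ric ** ?J) $ q $ k)"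
    proof
      fix q
      have "(SUM a. (curv h a q (\<psi> x) ** ?J) $ a $ k) = (SUM a b. curv h a q (\<psi> x) $ a $ b * ?J $ b $ k)"
        by (simp add: matrix_matrix_mult_def)
      also have "\<dots> = (SUM b a. curv h a q (\<psi> x) $ a $ b * ?J $ b $ k)" by (rule sum.swap)
      finally show "(SUM a. (curv h a q (\<psi> x) ** ?J) $ a $ k) = (Ric ** ?J) $ q $ k"
        by (simp add: matrix_matrix_mult_def Ric_def sum_distrib_right)
    qed
    finally have 1: "Ric' $ j $ k = (SUM q. ?J $ q $ j * (Ric ** ?J) $ q $ k)" .
    have "transpose ?J ** Ric ** ?J = transpose ?J ** (Ric ** ?J)" by (simp add: matrix_mul_assoc)
    moreover have "(transpose ?J ** (Ric ** ?J)) $ j $ k = (SUM q. ?J $ q $ j * (Ric ** ?J) $ q $ k)"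
      by (simp only: matrix_matrix_mult_def[of "transpose ?J" "Ric ** ?J"] vec_lambda_beta transpose_component)
    ultimately show ?thesis using 1 by simp
  qed
  then have R: "Ric' = transpose ?J ** Ric ** ?J" by (simp add: vec_eq_iff)
  have tr: "(SUM j k. M $ j $ k * X $ j $ k) = trace (M ** transpose X)" for M X :: "real^'n^'n"
    by (simp add: trace_def matrix_matrix_mult_def transpose_def)
  have iG: "matrix_inv (pullback \<psi> h x) = ?K ** matrix_inv (h (\<psi> x)) ** transpose ?K"
  proof -
    have i: "invertible (h (\<psi> x))" "invertible (transpose ?J)"
      using metric_on_invertible[OF h Tx] inv[OF x] transpose_invertible by blast+
    show ?thesis unfolding pullback_def
      by (simp add: matrix_inv_mult i inv[OF x] invertible_mult matrix_inv_transpose matrix_mul_assoc)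
  qed
  have "scal (pullback \<psi> h) x = trace (matrix_inv (pullback \<psi> h x) ** transpose Ric')"
    by (simp add: scal_def tr[symmetric] Ric'_def)
  also have "\<dots> = trace (?K ** (matrix_inv (h (\<psi> x)) ** (transpose ?K ** transpose ?J) ** transpose Ric ** ?J))"
    unfolding R iG by (simp add: matrix_transpose_mul matrix_mul_assoc)
  also have "transpose ?K ** transpose ?J = mat 1"
    using matrix_inv_right[OF inv[OF x]] by (metis matrix_transpose_mul transpose_mat)
  also have "trace (?K ** (matrix_inv (h (\<psi> x)) ** mat 1 ** transpose Ric ** ?J)) = trace (matrix_inv (h (\<psi> x)) ** transpose Ric ** (?J ** ?K))"
    by (subst trace_mul_sym) (simp add: matrix_mul_assoc)
  also have "\<dots> = scal h (\<psi> x)"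
    by (simp add: matrix_inv_right[OF inv[OF x]] scal_def tr[symmetric] Ric_def)
  finally show ?thesis .
qed

end

section \<open>Divergence form of the scalar curvature and of the energy\<close>

lemma sum_rot3: "(\<Sum>a\<in>A. \<Sum>b\<in>B. \<Sum>c\<in>C. f a b c) = (\<Sum>b\<in>B. \<Sum>c\<in>C. \<Sum>a\<in>A. f a b c)"
  by (subst sum.swap) (intro sum.cong refl sum.swap)

lemma sum_rot4: "(\<Sum>a\<in>A. \<Sum>b\<in>B. \<Sum>c\<in>C. \<Sum>d\<in>D. f a b c d) = (\<Sum>c\<in>C. \<Sum>d\<in>D. \<Sum>a\<in>A. \<Sum>b\<in>B. f a b c d)"
  unfolding sum_rot3[of _ D C B] by (rule sum_rot3)

text \<open>The vector field \<open>g^ij \<Gamma>^k_ij - g^ik \<Gamma>^j_ij\<close>. Up to terms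
  quadratic in the connection its Euclidean divergence is the scalar curvature, so it carries all
  second derivatives of the metric.\<close>

definition vfield :: "'n::finite mfield \<Rightarrow> 'n \<Rightarrow> real^'n \<Rightarrow> real"
  where "vfield h k y = (SUM i j. matrix_inv (h y) $ i $ j * conn h i y $ k $ j)
    - (SUM i. matrix_inv (h y) $ i $ k * trace (conn h i y))"

definition quadG :: "'n::finite mfield \<Rightarrow> real^'n \<Rightarrow> real"
  where "quadG h y = (SUM i j. matrix_inv (h y) $ i $ j * trace (conn h i y ** conn h j y))"

context
  fixes S :: "(real^'n::finite) set" and h
  assumes S: "open S" and h: "metric_on S h"
begin

lemma smooth_on_inv_metric: "smooth_on S (\<lambda>y. matrix_inv (h y))"
  by (intro smooth_intros S metric_on_smooth[OF h] metric_on_invertible[OF h])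

lemma pd_inv_metric:
  assumes y: "y \<in> S"
  shows "pd k (\<lambda>y. matrix_inv (h y)) y $ i $ j
    = - (SUM m. matrix_inv (h y) $ i $ m * conn h k y $ j $ m) - (SUM m. conn h k y $ i $ m * matrix_inv (h y) $ m $ j)"
proof -
  let ?P = "matrix_inv (h y)" and ?C = "conn h k y"
  note inv = metric_on_invertible[OF h y]
  have "?P ** pd k h y ** ?P = ?P ** transpose ?C ** (h y ** ?P) + (?P ** h y) ** ?C ** ?P"
    unfolding conn_compat[OF S h y]
    by (simp add: matrix_add_ldistrib matrix_mult_add_left matrix_mul_assoc)
  then have "pd k (\<lambda>y. matrix_inv (h y)) y = - (?P ** transpose ?C + ?C ** ?P)"
    using pd_matrix_inv[OF S y metric_on_smooth[OF h] metric_on_invertible[OF h]]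
    by (simp add: matrix_inv_left[OF inv] matrix_inv_right[OF inv])
  then show ?thesis by (simp add: matrix_matrix_mult_def transpose_def)
qed

lemma smooth_on_vfield: "smooth_on S (vfield h k)"
  unfolding vfield_def[abs_def]
  by (intro smooth_intros S smooth_on_inv_metric smooth_on_conn[OF S h])

text \<open>In this form the derivative of the inverse metric cancels against the one that the
  product rule produces from the second summand of \<open>energy_field\<close>.\<close>

lemma vfield_alt:
  assumes y: "y \<in> S"
  shows "vfield h k y = - (SUM i. pd i (\<lambda>y. matrix_inv (h y)) y $ i $ k)
    - 2 * (SUM i. matrix_inv (h y) $ i $ k * trace (conn h i y))"
proof -
  let ?p = "\<lambda>i j. matrix_inv (h y) $ i $ j" and ?c = "\<lambda>i a b. conn h i y $ a $ b"
  have "(SUM i m. ?c i i m * ?p m k) = (SUM m i. ?c m i i * ?p m k)"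
    by (subst sum.swap) (simp add: conn_sym[OF S h y, of _ _ _])
  then have "(SUM i m. ?c i i m * ?p m k) = (SUM m. ?p m k * trace (conn h m y))"
    by (simp add: trace_def sum_distrib_left mult.commute)
  then show ?thesis unfolding vfield_def pd_inv_metric[OF y]
    by (simp add: sum_subtractf sum_negf)
qed

text \<open>The derivatives of the connection in \<open>scal\<close> and in the divergence are the
  same, so only quadratic terms have to be compared. The quadratic part of the divergence contains
  \<open>- 2 * quadG\<close>, that of \<open>scal\<close> only \<open>- quadG\<close>; this explains
  the sign of \<open>quadG\<close> on the right.\<close>

lemma scal_divergence:
  assumes y: "y \<in> S"
  shows "scal h y = (SUM k. pd k (vfield h k) y) + quadG h y
    - (SUM i j. matrix_inv (h y) $ i $ j * (trace (conn h i y) * trace (conn h j y)))"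
proof -
  define p where "p i j = matrix_inv (h y) $ i $ j" for i j
  define c where "c i a b = conn h i y $ a $ b" for i a b
  define D where "D k i a b = pd k (conn h i) y $ a $ b" for k i a b
  define dP where "dP k i j = pd k (\<lambda>y. matrix_inv (h y)) y $ i $ j" for k i j
  define G where "G i = trace (conn h i y)" for i
  define V where "V m = (SUM j k. p j k * c j m k)" for m
  define Q where "Q = quadG h y"
  note dd = smooth_onD[OF _ y]
  note sC = smooth_on_conn[OF S h]
  have ps: "p i j = p j i" for i j using metric_on_inv_sym[OF h y] by (simp add: p_def)
  have cs: "c i a b = c b a i" for i a b unfolding c_def by (rule conn_sym[OF S h y])
  have Ds: "D k i a b = D k b a i" for k i a b
  proof -
    have "pd k (\<lambda>y. conn h i y $ a $ b) y = pd k (\<lambda>y. conn h b y $ a $ i) y"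
      by (rule pd_cong_open[OF S y conn_sym[OF S h]])
        (auto intro!: dd smooth_intros S h)
    then show ?thesis by (simp add: D_def pd_matrix_component[OF dd[OF sC]])
  qed
  have dPe: "dP k i j = - (SUM m. p i m * c k j m) - (SUM m. c k i m * p m j)" for k i j
    using pd_inv_metric[OF y] by (simp add: dP_def p_def c_def)
  have Ge: "G i = (SUM m. c i m m)" for i by (simp add: G_def trace_def c_def)
  have Qe: "Q = (SUM i j. SUM a b. p i j * (c i a b * c j b a))"
    by (simp add: Q_def quadG_def trace_def matrix_matrix_mult_def p_def c_def sum_distrib_left)
  have dv: "pd k (vfield h k) y = (SUM i j. p i j * D k i k j + dP k i j * c i k j)
      - (SUM i. p i k * (SUM m. D k i m m) + dP k i k * G i)" for k
  proof -
    have d1: "(\<lambda>y. matrix_inv (h y) $ i $ j) differentiable at y" "(\<lambda>y. conn h i y $ a $ b) differentiable at y"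
      "(\<lambda>y. trace (conn h i y)) differentiable at y" "(\<lambda>y. matrix_inv (h y) $ i $ j * conn h l y $ a $ b) differentiable at y"
      "(\<lambda>y. matrix_inv (h y) $ i $ j * trace (conn h l y)) differentiable at y"
      "(\<lambda>y. SUM j. matrix_inv (h y) $ i $ j * conn h l y $ a $ j) differentiable at y"
      "(\<lambda>y. SUM i j. matrix_inv (h y) $ i $ j * conn h i y $ k $ j) differentiable at y"
      "(\<lambda>y. SUM i. matrix_inv (h y) $ i $ j * trace (conn h i y)) differentiable at y" for i j a b l k
      by (auto intro!: dd smooth_intros S h smooth_on_inv_metric)
    have "pd k (\<lambda>y. trace (conn h i y)) y = (SUM m. D k i m m)" for i
      using pd_linear[OF bounded_linear_trace dd[OF sC]] by (simp add: D_def trace_def)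
    moreover have "pd k (\<lambda>y. conn h i y $ a $ b) y = D k i a b" for i a b
      by (simp add: D_def pd_matrix_component[OF dd[OF sC]])
    moreover have "pd k (\<lambda>y. matrix_inv (h y) $ i $ j) y = dP k i j" for i j
      by (simp add: dP_def pd_matrix_component[OF dd[OF smooth_on_inv_metric]])
    ultimately show ?thesis unfolding vfield_def[abs_def]
      by (simp add: pd_diff pd_sum pd_mult d1 p_def c_def G_def)
  qed
  \<comment> \<open>\<open>T1\<close> and \<open>T3\<close> collect the derivatives of the
    connection. \<open>T2\<close> and \<open>T4\<close> come from differentiating the inverse
    metric, and \<open>dPe\<close> makes them quadratic in the connection.\<close>
  define T1 where "T1 = (SUM k i j. p i j * D k i k j)"
  define T2 where "T2 = (SUM k i j. dP k i j * c i k j)"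
  define T3 where "T3 = (SUM k i. p i k * (SUM m. D k i m m))"
  define T4 where "T4 = (SUM k i. dP k i k * G i)"
  have div: "(SUM k. pd k (vfield h k) y) = T1 + T2 - T3 - T4"
    by (simp add: dv T1_def T2_def T3_def T4_def sum.distrib sum_subtractf)
  have "scal h y = (SUM j k. p j k * (SUM i. D i j i k - D j i i k
      + (SUM m. c i i m * c j m k) - (SUM m. c j i m * c i m k)))"
    by (simp add: scal_def curv_def p_def D_def c_def matrix_matrix_mult_def)
  also have "\<dots> = (SUM j k i. p j k * D i j i k) - (SUM j k i. p j k * D j i i k)
     + (SUM j k. SUM i m. p j k * (c i i m * c j m k)) - (SUM j k. SUM i m. p j k * (c j i m * c i m k))"
    by (simp add: sum_distrib_left sum.distrib sum_subtractf right_diff_distrib distrib_left)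
  also have "(SUM j k i. p j k * D i j i k) = T1"
    unfolding T1_def by (rule sum_rot3[symmetric])
  also have "(SUM j k i. p j k * D j i i k) = T3"
    unfolding T3_def sum_distrib_left by (intro sum.cong refl) (use ps Ds in metis)
  also have "(SUM j k. SUM i m. p j k * (c i i m * c j m k)) = (SUM m. V m * G m)"
  proof -
    have "(SUM j k. SUM i m. p j k * (c i i m * c j m k))
       = (SUM i m. SUM j k. (p j k * c j m k) * c m i i)"
      by (subst sum_rot4, intro sum.cong refl, subst cs) (simp add: mult_ac)
    also have "\<dots> = (SUM m i. V m * c m i i)"
      by (subst sum.swap) (simp only: V_def sum_distrib_right)
    also have "\<dots> = (SUM m. V m * G m)" by (simp only: Ge sum_distrib_left)
    finally show ?thesis .
  qed
  also have "(SUM j k. SUM i m. p j k * (c j i m * c i m k)) = Q"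
    unfolding Qe by (intro sum.cong refl) (use cs in metis)
  finally have sc: "scal h y = T1 - T3 + (SUM m. V m * G m) - Q" .
  have T2: "T2 = - 2 * Q"
  proof -
    have "T2 = - (SUM k i. SUM j m. p i m * c k j m * c i k j)
      - (SUM k i. SUM j m. c k i m * p m j * c i k j)"
      unfolding T2_def dPe
      by (simp add: left_diff_distrib sum_distrib_right sum_subtractf sum_negf)
    also have "(SUM k i. SUM j m. p i m * c k j m * c i k j) = Q"
    proof -
      have "(SUM k i. SUM j m. p i m * c k j m * c i k j)
        = (SUM i m. SUM k j. p i m * c k j m * c i k j)"
        by (subst sum.swap, rule sum.cong[OF refl], subst sum_rot3[symmetric], rule sum.cong[OF refl], rule refl)
      also have "\<dots> = Q" unfolding Qe by (intro sum.cong refl, subst cs) (simp add: mult_ac)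
      finally show ?thesis .
    qed
    also have "(SUM k i. SUM j m. c k i m * p m j * c i k j) = Q"
    proof -
      have "(SUM k i. SUM j m. c k i m * p m j * c i k j)
        = (SUM m j. SUM i k. c k i m * p m j * c i k j)"
      proof -
        have "(SUM k i. SUM j m. c k i m * p m j * c i k j)
          = (SUM j m. SUM k i. c k i m * p m j * c i k j)" by (rule sum_rot4)
        also have "\<dots> = (SUM m j. SUM k i. c k i m * p m j * c i k j)" by (rule sum.swap)
        also have "\<dots> = (SUM m j. SUM i k. c k i m * p m j * c i k j)"
          by (rule sum.cong[OF refl], rule sum.cong[OF refl], rule sum.swap)
        finally show ?thesis .
      qed
      also have "\<dots> = Q" unfolding Qe
      proof (intro sum.cong refl)
        fix m j i k
        show "c k i m * p m j * c i k j = p m j * (c m i k * c j k i)"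
          using cs[of k i m] cs[of i k j] by simp
      qed
      finally show ?thesis .
    qed
    finally show ?thesis by simp
  qed
  have T4: "T4 = - (SUM i m. p i m * (G i * G m)) - (SUM m. V m * G m)"
  proof -
    have "T4 = (SUM i. (SUM k. dP k i k) * G i)"
      unfolding T4_def by (subst sum.swap) (simp only: sum_distrib_right)
    moreover have "(SUM k. dP k i k) = - (SUM m. p i m * G m) - V i" for i
    proof -
      have "(SUM k. dP k i k) = - (SUM k m. p i m * c k k m) - (SUM k m. c k i m * p m k)"
        unfolding dPe by (simp add: sum_subtractf sum_negf)
      also have "(SUM k m. p i m * c k k m) = (SUM m. p i m * G m)"
        unfolding Ge sum_distrib_left by (subst sum.swap, intro sum.cong refl, subst cs) (rule refl)
      also have "(SUM k m. c k i m * p m k) = V i"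
        unfolding V_def by (subst sum.swap, intro sum.cong refl, subst cs) simp
      finally show ?thesis .
    qed
    ultimately show ?thesis
      by (simp add: algebra_simps sum_subtractf sum_negf sum.distrib sum_distrib_left)
  qed
  show ?thesis unfolding div sc T2 T4 Q_def[symmetric] by (simp add: p_def G_def)
qed

text \<open>
  With \<open>\<phi> = q (det h)\<^sup>-\<^sup>1\<^sup>/\<^sup>4\<close> the second derivatives of the metric in the scalar curvature are
  absorbed by a divergence, and no term linear in \<open>h - 1\<close> is left apart from the inverse metric.
\<close>

definition energy_field :: "(real^'n \<Rightarrow> real) \<Rightarrow> 'n \<Rightarrow> real^'n \<Rightarrow> real"
  where "energy_field q k y = (q y)\<^sup>2 * vfield h k y + (SUM i. matrix_inv (h y) $ k $ i * (2 * q y * pd i q y))"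

lemma smooth_on_energy_field: "smooth_on S q \<Longrightarrow> smooth_on S (energy_field q k)"
  unfolding energy_field_def[abs_def]
  by (intro smooth_intros S smooth_on_inv_metric smooth_on_vfield)

text \<open>The logarithmic derivative of \<open>det h\<close> is
  \<open>2 * trace (conn h k)\<close>; with the exponent -1/4 this gives the coefficient
  1/2.\<close>

lemma pd_density:
  assumes y: "y \<in> S" and q: "smooth_on S q"
  shows "pd k (\<lambda>y. q y * det (h y) powr (-1/4)) y
    = det (h y) powr (-1/4) * (pd k q y - (1/2) * trace (conn h k y) * q y)"
proof -
  note pos = metric_on_det_pos[OF h y] and inv = metric_on_invertible[OF h y]
  have dh: "h differentiable (at y)" using smooth_onD[OF metric_on_smooth[OF h] y] .
  have ddet: "(\<lambda>y. det (h y)) differentiable at y"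
    using smooth_onD[OF smooth_on_det[OF S metric_on_smooth[OF h]] y] .
  have "matrix_inv (h y) ** pd k h y = matrix_inv (h y) ** (transpose (conn h k y) ** h y) + conn h k y"
    unfolding conn_compat[OF S h y] by (simp add: matrix_add_ldistrib matrix_mul_assoc matrix_inv_left[OF inv])
  moreover have "trace (matrix_inv (h y) ** (transpose (conn h k y) ** h y)) = trace (conn h k y)"
    by (subst trace_mul_sym) (simp add: matrix_mul_assoc[symmetric] matrix_inv_right[OF inv] trace_def transpose_component)
  ultimately have tr: "trace (matrix_inv (h y) ** pd k h y) = 2 * trace (conn h k y)"
    by (simp add: trace_add)
  have pw: "((\<lambda>t. t powr (-1/4)) has_real_derivative (-1/4) * det (h y) powr (-1/4 - 1)) (at (det (h y)))"
    using pos by (auto intro!: derivative_eq_intros)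
  have "pd k (\<lambda>y. det (h y) powr (-1/4)) y = (-1/4) * det (h y) powr (-1/4 - 1) * (det (h y) * (2 * trace (conn h k y)))"
    using pd_compose_real(1)[OF ddet pw] pd_det[OF dh inv] tr by simp
  also have "\<dots> = (-1/2) * trace (conn h k y) * det (h y) powr (-1/4)"
    using pos powr_mult_base[of "det (h y)" "-5/4"] by simp
  finally have 1: "pd k (\<lambda>y. det (h y) powr (-1/4)) y = (-1/2) * trace (conn h k y) * det (h y) powr (-1/4)" .
  show ?thesis
    using pd_mult[OF smooth_onD[OF q y] pd_compose_real(2)[OF ddet pw], of k] 1
    by (simp add: algebra_simps)
qed

text \<open>By the choice of the exponent, \<open>(\<phi> y)\<^sup>2 * sqrt (det (h y))\<close> is
  \<open>(q y)\<^sup>2\<close>. Three cancellations follow: the divergence of \<open>vfield\<close>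
  against the derivatives of the connection in \<open>scal\<close>, the product of traces in
  \<open>scal_divergence\<close> against the square of the trace term in the derivative of
  \<open>\<phi>\<close>, and the cross terms \<open>PGq\<close> against \<open>vfield\<close> paired
  with the gradient of \<open>q\<close>.\<close>

lemma energy_identity:
  assumes y: "y \<in> S" and q: "smooth_on S q"
  defines "\<phi> \<equiv> \<lambda>y. q y * det (h y) powr (-1/4)"
  shows "(scal h y * (\<phi> y)\<^sup>2 + 4 * (SUM i j. matrix_inv (h y) $ i $ j * (pd i \<phi> y * pd j \<phi> y))) * sqrt (det (h y))
    = (SUM k. pd k (energy_field q k) y)
     + (SUM i j. matrix_inv (h y) $ i $ j * (2 * pd i q y * pd j q y - 2 * q y * pd i (pd j q) y))
     + (q y)\<^sup>2 * quadG h y"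
proof -
  define p where "p i j = matrix_inv (h y) $ i $ j" for i j
  define dP where "dP k i j = pd k (\<lambda>y. matrix_inv (h y)) y $ i $ j" for k i j
  define G where "G i = trace (conn h i y)" for i
  define q1 where "q1 i = pd i q y" for i
  define q2 where "q2 i j = pd i (pd j q) y" for i j
  define v where "v = (SUM k. pd k (vfield h k) y)"
  note dd = smooth_onD[OF _ y]
  note pos = metric_on_det_pos[OF h y]
  have ps: "p i j = p j i" for i j using metric_on_inv_sym[OF h y] by (simp add: p_def)
  have dPs: "dP k i j = dP k j i" for k i j
  proof -
    have "pd k (\<lambda>y. matrix_inv (h y) $ i $ j) y = pd k (\<lambda>y. matrix_inv (h y) $ j $ i) y"
      by (rule pd_cong_open[OF S y metric_on_inv_sym[OF h]])
        (auto intro!: dd smooth_intros S smooth_on_inv_metric)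
    then show ?thesis by (simp add: dP_def pd_matrix_component[OF dd[OF smooth_on_inv_metric]])
  qed
  define w where "w = det (h y) powr (-1/4)"
  have ww: "w * w * sqrt (det (h y)) = 1"
    using pos by (simp add: w_def powr_half_sqrt[symmetric] flip: powr_add)
  have "(\<phi> y)\<^sup>2 * sqrt (det (h y)) = (q y)\<^sup>2 * (w * w * sqrt (det (h y)))"
    by (simp add: \<phi>_def w_def power2_eq_square mult_ac)
  then have f1: "(\<phi> y)\<^sup>2 * sqrt (det (h y)) = (q y)\<^sup>2" using ww by simp
  have dphi: "pd i \<phi> y = w * (q1 i - (1/2) * G i * q y)" for i
    using pd_density[OF y q] by (simp add: \<phi>_def w_def q1_def G_def)
  have f2: "pd i \<phi> y * pd j \<phi> y * sqrt (det (h y)) = (q1 i - (1/2) * G i * q y) * (q1 j - (1/2) * G j * q y)" for i j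
  proof -
    have "pd i \<phi> y * pd j \<phi> y * sqrt (det (h y))
      = (w * w * sqrt (det (h y))) * ((q1 i - (1/2) * G i * q y) * (q1 j - (1/2) * G j * q y))"
      unfolding dphi by (simp only: mult_ac)
    then show ?thesis using ww by simp
  qed
  define PGG where "PGG = (SUM i j. p i j * (G i * G j))"
  define Pqq where "Pqq = (SUM i j. p i j * (q1 i * q1 j))"
  define PGq where "PGq = (SUM i j. p i j * (G i * q1 j))"
  define Pq2 where "Pq2 = (SUM i j. p i j * q2 i j)"
  define dPq where "dPq = (SUM k i. dP i i k * q1 k)"
  have PqG: "(SUM i j. p i j * (q1 i * G j)) = PGq"
    unfolding PGq_def by (subst sum.swap) (simp add: ps mult.commute)
  have "(scal h y * (\<phi> y)\<^sup>2 + 4 * (SUM i j. p i j * (pd i \<phi> y * pd j \<phi> y))) * sqrt (det (h y))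
     = scal h y * ((\<phi> y)\<^sup>2 * sqrt (det (h y))) + 4 * (SUM i j. p i j * (pd i \<phi> y * pd j \<phi> y * sqrt (det (h y))))"
    by (simp add: distrib_right sum_distrib_right mult.assoc)
  also have "\<dots> = scal h y * (q y)\<^sup>2 + 4 * (SUM i j. p i j * ((q1 i - (1/2) * G i * q y) * (q1 j - (1/2) * G j * q y)))"
    unfolding f1 f2 ..
  also have "(SUM i j. p i j * ((q1 i - (1/2) * G i * q y) * (q1 j - (1/2) * G j * q y)))
     = (SUM i j. p i j * (q1 i * q1 j) - (1/2) * q y * (p i j * (G i * q1 j)) - (1/2) * q y * (p i j * (q1 i * G j)) + (1/4) * (q y)\<^sup>2 * (p i j * (G i * G j)))"
    by (intro sum.cong refl) (simp add: field_simps power2_eq_square)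
  also have "\<dots> = Pqq - (1/2) * q y * PGq - (1/2) * q y * (SUM i j. p i j * (q1 i * G j)) + (1/4) * (q y)\<^sup>2 * PGG"
    unfolding Pqq_def PGq_def PGG_def by (simp add: sum.distrib sum_subtractf sum_distrib_left)
  also have "\<dots> = Pqq - (1/2) * q y * PGq - (1/2) * q y * PGq + (1/4) * (q y)\<^sup>2 * PGG" unfolding PqG ..
  finally have L: "(scal h y * (\<phi> y)\<^sup>2 + 4 * (SUM i j. p i j * (pd i \<phi> y * pd j \<phi> y))) * sqrt (det (h y))
     = scal h y * (q y)\<^sup>2 + 4 * (Pqq - q y * PGq + (1/4) * (q y)\<^sup>2 * PGG)" by simp
  have dq: "q differentiable at y" "pd i q differentiable at y" "vfield h k differentiable at y"
    "(\<lambda>y. matrix_inv (h y) $ i $ j) differentiable at y" "(\<lambda>y. (q y)\<^sup>2) differentiable at y" "(\<lambda>y. 2 * q y) differentiable at y"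
    "(\<lambda>y. (q y)\<^sup>2 * vfield h k y) differentiable at y" "(\<lambda>y. 2 * q y * pd i q y) differentiable at y"
    "(\<lambda>y. matrix_inv (h y) $ k $ i * (2 * q y * pd i q y)) differentiable at y"
    "(\<lambda>y. SUM i. matrix_inv (h y) $ k $ i * (2 * q y * pd i q y)) differentiable at y" for i j k
    by (auto intro!: dd smooth_intros S smooth_on_inv_metric smooth_on_vfield q)
  have pq2: "pd k (\<lambda>y. (q y)\<^sup>2) y = 2 * q y * q1 k" for k
    using pd_mult[OF dq(1) dq(1)] by (simp add: power2_eq_square q1_def)
  have p2q: "pd k (\<lambda>y. 2 * q y) y = 2 * q1 k" for k
    using pd_mult[of "\<lambda>_. 2" y q] dq(1) by (simp add: q1_def)
  have X: "pd k (energy_field q k) y = (q y)\<^sup>2 * pd k (vfield h k) y + 2 * q y * q1 k * vfield h k y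
      + (SUM i. p k i * (2 * q y * q2 k i + 2 * q1 k * q1 i) + dP k k i * (2 * q y * q1 i))" for k
  proof -
    have "pd k (\<lambda>y. matrix_inv (h y) $ i $ j) y = dP k i j" for i j
      by (simp add: dP_def pd_matrix_component[OF dd[OF smooth_on_inv_metric]])
    then show ?thesis unfolding energy_field_def[abs_def]
      by (simp add: pd_add pd_sum pd_mult dq pq2 p2q flip: p_def q1_def q2_def)
  qed
  have vf: "vfield h k y = - (SUM i. dP i i k) - 2 * (SUM i. p i k * G i)" for k
    using vfield_alt[OF y] by (simp add: dP_def p_def G_def)
  have "(SUM k. pd k (energy_field q k) y) = (q y)\<^sup>2 * v + 2 * q y * (SUM k. q1 k * vfield h k y)
      + (2 * q y * Pq2 + 2 * Pqq + 2 * q y * (SUM k i. dP k k i * q1 i))"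
    unfolding X v_def Pq2_def Pqq_def by (simp add: sum.distrib sum_distrib_left algebra_simps)
  also have "(SUM k i. dP k k i * q1 i) = dPq" unfolding dPq_def by (rule sum.swap)
  also have "(SUM k. q1 k * vfield h k y) = - dPq - 2 * PGq"
  proof -
    have "(SUM k. q1 k * vfield h k y) = - (SUM k i. dP i i k * q1 k) - 2 * (SUM k i. p i k * (G i * q1 k))"
      unfolding vf by (simp add: right_diff_distrib sum_subtractf sum_negf sum_distrib_left mult_ac)
    also have "(SUM k i. p i k * (G i * q1 k)) = PGq" unfolding PGq_def by (rule sum.swap)
    finally show ?thesis by (simp add: dPq_def)
  qed
  finally have divX: "(SUM k. pd k (energy_field q k) y) = (q y)\<^sup>2 * v + 2 * q y * (- dPq - 2 * PGq) + (2 * q y * Pq2 + 2 * Pqq + 2 * q y * dPq)" .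
  have R: "(SUM i j. p i j * (2 * q1 i * q1 j - 2 * q y * q2 i j)) = 2 * Pqq - 2 * q y * Pq2"
    unfolding Pqq_def Pq2_def by (simp add: sum_subtractf sum_distrib_left algebra_simps)
  have sc: "scal h y = v + quadG h y - PGG"
    using scal_divergence[OF y] by (simp add: v_def PGG_def p_def G_def)
  show ?thesis unfolding p_def[symmetric] q1_def[symmetric] q2_def[symmetric] L divX R
    unfolding sc by (simp add: algebra_simps)
qed

end

lemma Basis_vec_eq: "(Basis :: (real^'n::finite) set) = range (\<lambda>i. axis i 1)"
  by (auto simp: Basis_vec_def)

lemma prod_Basis_vec: "(\<Prod>b\<in>(Basis :: (real^'n::finite) set). f b) = (\<Prod>i\<in>UNIV. f (axis i 1))"
  unfolding Basis_vec_eq by (subst prod.reindex) (auto simp: inj_on_def axis_eq_axis)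

section \<open>Change of variables\<close>

text \<open>
  The change of variables theorem of the library needs a well-ordered index type; every finite
  type has a well-ordered copy.
\<close>

typedef 'n wo = "UNIV :: 'n set" by auto

lemma bij_Rep_wo: "bij (Rep_wo :: 'n wo \<Rightarrow> 'n)"
  by (metis Abs_wo_inverse Rep_wo_inverse UNIV_I bijI' )

instance wo :: (finite) finite
proof
  have "finite (range (Abs_wo :: 'a \<Rightarrow> 'a wo))" by simp
  moreover have "range (Abs_wo :: 'a \<Rightarrow> 'a wo) = UNIV" by (metis Rep_wo_inverse surjI)
  ultimately show "finite (UNIV :: 'a wo set)" by simp
qed

definition wo_rank :: "'n::finite wo \<Rightarrow> nat"
  where "wo_rank = (SOME f. inj f)"

lemma inj_wo_rank: "inj wo_rank"
proof -
  have "\<exists>f :: 'a wo \<Rightarrow> nat. inj f"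
    using finite_imp_inj_to_nat_seg[of "UNIV :: 'a wo set"] by auto
  then show ?thesis unfolding wo_rank_def by (rule someI_ex)
qed

instantiation wo :: (finite) wellorder
begin

definition less_eq_wo :: "'a wo \<Rightarrow> 'a wo \<Rightarrow> bool" where "less_eq_wo x y \<longleftrightarrow> wo_rank x \<le> wo_rank y"
definition less_wo :: "'a wo \<Rightarrow> 'a wo \<Rightarrow> bool" where "less_wo x y \<longleftrightarrow> wo_rank x < wo_rank y"

instance
proof
  show "P a" if "\<And>x. (\<And>y. y < x \<Longrightarrow> P y) \<Longrightarrow> P x" for P and a :: "'a wo"
  proof (induction "wo_rank a" arbitrary: a rule: less_induct)
    case less
    show ?case by (rule that) (use less in \<open>auto simp: less_wo_def\<close>)
  qed
qed (auto simp: less_eq_wo_def less_wo_def inj_eq[OF inj_wo_rank])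

end

definition to_wo :: "real^'n::finite \<Rightarrow> real^('n wo)" where "to_wo x = (\<chi> w. x $ Rep_wo w)"
definition of_wo :: "real^('n::finite wo) \<Rightarrow> real^'n" where "of_wo x = (\<chi> i. x $ Abs_wo i)"

lemma to_of_wo [simp]: "to_wo (of_wo x) = x" "of_wo (to_wo y) = y"
  by (simp_all add: to_wo_def of_wo_def vec_eq_iff Rep_wo_inverse Abs_wo_inverse)

lemma bounded_linear_to_wo: "bounded_linear to_wo" and bounded_linear_of_wo: "bounded_linear of_wo"
  unfolding linear_conv_bounded_linear[symmetric]
  by (auto intro!: linearI simp: to_wo_def of_wo_def vec_eq_iff)

lemma measurable_to_wo [measurable]: "to_wo \<in> borel_measurable borel"
  and measurable_of_wo [measurable]: "of_wo \<in> borel_measurable borel"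
  using bounded_linear_to_wo bounded_linear_of_wo
  by (auto intro!: borel_measurable_continuous_onI linear_continuous_on)

text \<open>Relabelling coordinates maps a box to a box with the same side lengths, and boxes
  determine Lebesgue measure.\<close>

lemma lborel_distr_to_wo: "distr lborel borel (to_wo :: real^'n::finite \<Rightarrow> _) = lborel"
proof (rule lborel_eqI[symmetric])
  fix l u :: "real^('n wo)" assume le: "\<And>b. b \<in> Basis \<Longrightarrow> l \<bullet> b \<le> u \<bullet> b"
  have le': "l $ i \<le> u $ i" for i using le[of "axis i 1"] by (auto simp: Basis_vec_eq inner_axis)
  have "x \<in> to_wo -` box l u \<longleftrightarrow> x \<in> box (of_wo l) (of_wo u)" for x :: "real^'n"
  proof -
    have "x \<in> to_wo -` box l u \<longleftrightarrow> (\<forall>w. l $ w < x $ Rep_wo w \<and> x $ Rep_wo w < u $ w)"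
      by (simp add: mem_box_cart to_wo_def)
    also have "\<dots> \<longleftrightarrow> (\<forall>i. l $ Abs_wo i < x $ i \<and> x $ i < u $ Abs_wo i)"
      by (metis Abs_wo_inverse Rep_wo_inverse UNIV_I)
    finally show ?thesis by (simp add: mem_box_cart of_wo_def)
  qed
  then have "to_wo -` box l u = box (of_wo l) (of_wo u)" by blast
  then have "emeasure (distr lborel borel to_wo) (box l u) = emeasure lborel (box (of_wo l) (of_wo u :: real^'n))"
    by (subst emeasure_distr) (auto simp: open_box)
  also have "\<dots> = (\<Prod>b\<in>Basis. (of_wo u - of_wo l :: real^'n) \<bullet> b)"
    by (rule emeasure_lborel_box) (use le' in \<open>auto simp: Basis_vec_eq inner_axis of_wo_def\<close>)
  also have "(\<Prod>b\<in>Basis. (of_wo u - of_wo l :: real^'n) \<bullet> b) = (\<Prod>i\<in>UNIV. (u - l) $ Abs_wo i)"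
    unfolding prod_Basis_vec by (simp add: inner_axis of_wo_def)
  also have "\<dots> = (\<Prod>w\<in>UNIV. (u - l) $ w)"
    by (rule prod.reindex_bij_betw)
      (metis Rep_wo_inverse Abs_wo_inverse UNIV_I bijI')
  also have "\<dots> = (\<Prod>b\<in>Basis. (u - l) \<bullet> b)"
    unfolding prod_Basis_vec by (simp add: inner_axis)
  finally show "emeasure (distr lborel borel to_wo) (box l u) = (\<Prod>b\<in>Basis. (u - l) \<bullet> b)" .
qed simp

text \<open>In the Leibniz sum, permutations of the two index types correspond by conjugation with
  the bijection, which preserves the sign.\<close>

lemma det_reindex_wo:
  fixes A :: "real^'n^'n::finite"
  shows "det (\<chi> a b. A $ Rep_wo a $ Rep_wo b) = det A"
proof -
  let ?f = "Abs_wo :: 'n \<Rightarrow> 'n wo"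
  have bf: "bij_betw ?f UNIV UNIV" by (metis Rep_wo_inverse Abs_wo_inverse UNIV_I bijI')
  have inj: "inj_on ?f UNIV" using bf bij_betw_imp_inj_on by blast
  have invf: "inv_into UNIV ?f = Rep_wo" by (metis Rep_wo_inverse Abs_wo_inverse UNIV_I inv_equality)
  have mp: "map_permutation UNIV ?f p = ?f \<circ> p \<circ> Rep_wo" for p
    unfolding map_permutation_def invf by (auto simp: restrict_id_def fun_eq_iff) (metis Rep_wo_inverse rangeI)
  let ?g = "\<lambda>p. ?f \<circ> p \<circ> Rep_wo"
  have bij: "bij_betw ?g {p. p permutes UNIV} {p. p permutes UNIV}"
  proof (rule bij_betw_byWitness[where f' = "\<lambda>q. Rep_wo \<circ> q \<circ> ?f"])
    show "?g ` {p. p permutes UNIV} \<subseteq> {p. p permutes UNIV}"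
      using map_permutation_permutes[OF bf] mp by auto
    show "(\<lambda>q. Rep_wo \<circ> q \<circ> ?f) ` {p. p permutes UNIV} \<subseteq> {p. p permutes UNIV}"
      using bf bij_Rep_wo by (auto intro!: bij_imp_permutes bij_comp dest: permutes_bij)
  qed (auto simp: fun_eq_iff Rep_wo_inverse Abs_wo_inverse)
  have "det (\<chi> a b. A $ Rep_wo a $ Rep_wo b) = (\<Sum>p | p permutes UNIV. of_int (sign (?g p)) * (\<Prod>w\<in>UNIV. A $ Rep_wo w $ Rep_wo (?g p w)))"
    unfolding det_def by (subst sum.reindex_bij_betw[OF bij, symmetric]) simp
  also have "\<dots> = det A" unfolding det_def
  proof (rule sum.cong[OF refl])
    fix p :: "'n \<Rightarrow> 'n" assume p: "p \<in> {p. p permutes UNIV}"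
    have "sign (?g p) = sign p"
      using sign_map_permutation[OF inj, of p] p mp by auto
    moreover have "(\<Prod>w\<in>UNIV. A $ Rep_wo w $ p (Rep_wo w)) = (\<Prod>i\<in>UNIV. A $ i $ p i)"
      by (rule prod.reindex_bij_betw[OF bij_Rep_wo])
    ultimately show "of_int (sign (?g p)) * (\<Prod>w\<in>UNIV. A $ Rep_wo w $ Rep_wo (?g p w)) = of_int (sign p) * (\<Prod>i\<in>UNIV. A $ i $ p i)"
      by (simp add: Abs_wo_inverse)
  qed
  finally show ?thesis .
qed

text \<open>\<open>has_measure_differentiable_image\<close> makes finiteness of the integral
  equivalent to finiteness of the measure of the image. In the infinite case a finite integral is
  therefore contradictory, and equality holds in the extended reals.\<close>

lemma emeasure_differentiable_image_wo:
  fixes \<psi> :: "real^'k::{finite,wellorder} \<Rightarrow> real^'k::_"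
  assumes T: "T \<in> sets borel" and der: "\<And>x. x \<in> T \<Longrightarrow> (\<psi> has_derivative \<psi>' x) (at x)" and inj: "inj_on \<psi> T"
    and im: "\<psi> ` T \<in> sets borel" and meas: "(\<lambda>x. indicator T x * \<bar>det (matrix (\<psi>' x))\<bar>) \<in> borel_measurable borel"
  shows "emeasure lborel (\<psi> ` T) = (\<integral>\<^sup>+x\<in>T. ennreal \<bar>det (matrix (\<psi>' x))\<bar> \<partial>lborel)"
proof -
  let ?d = "\<lambda>x. \<bar>det (matrix (\<psi>' x))\<bar>"
  have TL: "T \<in> sets lebesgue" "\<psi> ` T \<in> sets lebesgue" using T im by auto
  note key = has_measure_differentiable_image[OF TL(1) has_derivative_at_withinI[OF der] inj]
  have r: "(\<integral>\<^sup>+x\<in>T. ennreal (?d x) \<partial>lborel) = (\<integral>\<^sup>+x. ennreal (indicator T x * ?d x) \<partial>lborel)"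
    by (intro nn_integral_cong) (auto simp: indicator_def)
  have e: "emeasure lborel (\<psi> ` T) = emeasure lebesgue (\<psi> ` T)" using im by simp
  show ?thesis
  proof (cases "\<psi> ` T \<in> lmeasurable")
    case True
    then have "(?d has_integral measure lebesgue (\<psi> ` T)) T" using key by blast
    from nn_integral_has_integral_lebesgue[OF _ this]
    have "(\<integral>\<^sup>+x. ennreal (indicator T x * ?d x) \<partial>lborel) = measure lebesgue (\<psi> ` T)" by simp
    moreover have "emeasure lebesgue (\<psi> ` T) = ennreal (measure lebesgue (\<psi> ` T))"
      using emeasure_eq_measure2[OF True] by simp
    ultimately show ?thesis using r e by simp
  next
    case False
    then have inf: "emeasure lborel (\<psi> ` T) = \<infinity>"
      using TL e by (metis fmeasurableI infinity_ennreal_def top.not_eq_extremum)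
    have "(\<integral>\<^sup>+x. ennreal (indicator T x * ?d x) \<partial>lborel) = \<infinity>"
    proof (rule ccontr)
      assume "(\<integral>\<^sup>+x. ennreal (indicator T x * ?d x) \<partial>lborel) \<noteq> \<infinity>"
      then obtain m where m: "0 \<le> m" "(\<integral>\<^sup>+x. ennreal (indicator T x * ?d x) \<partial>lborel) = ennreal m"
        by (cases "\<integral>\<^sup>+x. ennreal (indicator T x * ?d x) \<partial>lborel" rule: ennreal_cases) auto
      have "((\<lambda>x. indicator T x * ?d x) has_integral m) UNIV"
        by (rule nn_integral_has_integral) (use meas m in auto)
      moreover have "(\<lambda>x. indicator T x * ?d x) = (\<lambda>x. if x \<in> T then ?d x else 0)" by (auto simp: indicator_def)
      ultimately have "(?d has_integral m) T" by (simp add: has_integral_restrict_UNIV)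
      then show False using key False by blast
    qed
    then show ?thesis using r inf by simp
  qed
qed

text \<open>Conjugation with \<open>to_wo\<close> and \<open>of_wo\<close> changes neither Lebesgue
  measure nor the Jacobian determinant.\<close>

lemma emeasure_differentiable_image:
  fixes \<psi> :: "real^'n::finite \<Rightarrow> real^'n"
  assumes T: "T \<in> sets borel" and der: "\<And>x. x \<in> T \<Longrightarrow> (\<psi> has_derivative \<psi>' x) (at x)" and inj: "inj_on \<psi> T"
    and im: "\<psi> ` T \<in> sets borel" and meas: "(\<lambda>x. indicator T x * \<bar>det (matrix (\<psi>' x))\<bar>) \<in> borel_measurable borel"
  shows "emeasure lborel (\<psi> ` T) = (\<integral>\<^sup>+x\<in>T. ennreal \<bar>det (matrix (\<psi>' x))\<bar> \<partial>lborel)"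
proof -
  define T' where "T' = of_wo -` T"
  define \<xi> where "\<xi> = to_wo \<circ> \<psi> \<circ> of_wo"
  define \<xi>' where "\<xi>' = (\<lambda>x. to_wo \<circ> \<psi>' (of_wo x) \<circ> of_wo)"
  have T': "T' \<in> sets borel" unfolding T'_def using measurable_sets_borel[OF measurable_of_wo T] by simp
  have im': "\<xi> ` T' = of_wo -` (\<psi> ` T)"
  proof (intro set_eqI iffI)
    fix z assume "z \<in> of_wo -` (\<psi> ` T)"
    then obtain x where "x \<in> T" "of_wo z = \<psi> x" by auto
    then have "\<xi> (to_wo x) = z" "to_wo x \<in> T'" by (auto simp: \<xi>_def T'_def) (metis to_of_wo(1))
    then show "z \<in> \<xi> ` T'" by blast
  qed (auto simp: \<xi>_def T'_def)
  have em: "emeasure lborel (of_wo -` B) = emeasure lborel B" if "B \<in> sets borel" for B :: "(real^'n) set"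
  proof -
    have "emeasure lborel (of_wo -` B) = emeasure (distr lborel borel to_wo) (of_wo -` B)"
      by (simp add: lborel_distr_to_wo)
    also have "\<dots> = emeasure lborel (to_wo -` (of_wo -` B))"
      using measurable_sets_borel[OF measurable_of_wo that] by (subst emeasure_distr) auto
    also have "to_wo -` (of_wo -` B) = B" by auto
    finally show ?thesis .
  qed
  have detm: "det (matrix (\<xi>' x)) = det (matrix (\<psi>' (of_wo x)))" if "x \<in> T'" for x
  proof -
    have "matrix (\<xi>' x) $ a $ b = matrix (\<psi>' (of_wo x)) $ Rep_wo a $ Rep_wo b" for a b
    proof -
      have "of_wo (axis b 1) = (axis (Rep_wo b) 1 :: real^'n)"
        by (auto simp: of_wo_def axis_def vec_eq_iff Rep_wo_inverse) (metis Abs_wo_inverse UNIV_I)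
      then show ?thesis by (simp add: matrix_def \<xi>'_def to_wo_def)
    qed
    then have "matrix (\<xi>' x) = (\<chi> a b. matrix (\<psi>' (of_wo x)) $ Rep_wo a $ Rep_wo b)" by (simp add: vec_eq_iff)
    then show ?thesis by (simp add: det_reindex_wo)
  qed
  have "emeasure lborel (\<xi> ` T') = (\<integral>\<^sup>+x\<in>T'. ennreal \<bar>det (matrix (\<xi>' x))\<bar> \<partial>lborel)"
  proof (rule emeasure_differentiable_image_wo[OF T'])
    show "(\<xi> has_derivative \<xi>' x) (at x)" if "x \<in> T'" for x
      unfolding \<xi>_def \<xi>'_def
    proof (intro diff_chain_at)
      show "(\<psi> has_derivative \<psi>' (of_wo x)) (at (of_wo x))" using der that by (simp add: T'_def)
    qed (auto intro: bounded_linear_imp_has_derivative bounded_linear_to_wo bounded_linear_of_wo)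
    show "inj_on \<xi> T'" using inj unfolding \<xi>_def T'_def
      by (auto simp: inj_on_def) (metis to_of_wo)
    show "\<xi> ` T' \<in> sets borel" unfolding im' using measurable_sets_borel[OF measurable_of_wo im] by simp
    have "(\<lambda>x. (\<lambda>x. indicator T x * \<bar>det (matrix (\<psi>' x))\<bar>) (of_wo x)) \<in> borel_measurable borel"
      using measurable_compose[OF measurable_of_wo meas] by simp
    moreover have "(\<lambda>x. (\<lambda>x. indicator T x * \<bar>det (matrix (\<psi>' x))\<bar>) (of_wo x)) = (\<lambda>x. indicator T' x * \<bar>det (matrix (\<xi>' x))\<bar>)"
      using detm by (auto simp: fun_eq_iff indicator_def T'_def)
    ultimately show "(\<lambda>x. indicator T' x * \<bar>det (matrix (\<xi>' x))\<bar>) \<in> borel_measurable borel" by simp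
  qed
  also have "\<dots> = (\<integral>\<^sup>+x. ennreal (indicator T (of_wo x) * \<bar>det (matrix (\<psi>' (of_wo x)))\<bar>) \<partial>lborel)"
    by (intro nn_integral_cong) (auto simp: indicator_def T'_def detm)
  also have "\<dots> = (\<integral>\<^sup>+x. ennreal (indicator T (of_wo x) * \<bar>det (matrix (\<psi>' (of_wo x)))\<bar>) \<partial>distr lborel borel to_wo)"
    by (simp add: lborel_distr_to_wo)
  also have "\<dots> = (\<integral>\<^sup>+x. ennreal (indicator T x * \<bar>det (matrix (\<psi>' x))\<bar>) \<partial>lborel)"
    using measurable_compose[OF measurable_of_wo meas] by (subst nn_integral_distr) auto
  also have "\<dots> = (\<integral>\<^sup>+x\<in>T. ennreal \<bar>det (matrix (\<psi>' x))\<bar> \<partial>lborel)"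
    by (intro nn_integral_cong) (auto simp: indicator_def)
  finally show ?thesis unfolding im' em[OF im] .
qed

lemma matrix_frechet_jac: "matrix (frechet_derivative \<psi> (at x)) = jac \<psi> x"
  by (simp add: jac_def matrix_def partial_deriv_def)

lemma measurable_indicator_continuous:
  fixes f :: "real^'n::finite \<Rightarrow> real"
  assumes "open S" "continuous_on S f"
  shows "(\<lambda>x. indicator S x * f x) \<in> borel_measurable borel"
  using borel_measurable_continuous_on_indicator[OF _ assms(2)] assms(1) by simp

text \<open>The map is extended by \<open>0\<close> outside its domain to obtain a Borel map.\<close>

lemma lborel_change_of_variables:
  fixes \<psi> :: "real^'n::finite \<Rightarrow> real^'n"
  assumes S: "open S" and \<psi>: "smooth_on S \<psi>" and inj: "inj_on \<psi> S" and im: "open (\<psi> ` S)"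
  shows "(\<lambda>x. if x \<in> S then \<psi> x else 0) \<in> borel_measurable borel"
    and "distr (density lborel (\<lambda>x. ennreal (indicator S x * \<bar>det (jac \<psi> x)\<bar>))) borel (\<lambda>x. if x \<in> S then \<psi> x else 0)
      = density lborel (indicator (\<psi> ` S))"
proof -
  let ?p = "\<lambda>x. if x \<in> S then \<psi> x else 0"
  show m [measurable]: "?p \<in> borel_measurable borel"
    using borel_measurable_continuous_on_if[OF _ smooth_on_continuous[OF \<psi>] continuous_on_const] S by simp
  have d [measurable]: "(\<lambda>x. indicator S x * \<bar>det (jac \<psi> x)\<bar>) \<in> borel_measurable borel"
    by (rule measurable_indicator_continuous[OF S])
      (intro continuous_on_rabs smooth_on_continuous[OF smooth_on_det[OF S smooth_on_jac[OF S \<psi>]]])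
  show "distr (density lborel (\<lambda>x. ennreal (indicator S x * \<bar>det (jac \<psi> x)\<bar>))) borel ?p = density lborel (indicator (\<psi> ` S))"
  proof (rule measure_eqI)
    fix B assume "B \<in> sets (distr (density lborel (\<lambda>x. ennreal (indicator S x * \<bar>det (jac \<psi> x)\<bar>))) borel ?p)"
    then have B [measurable]: "B \<in> sets borel" by simp
    define T where "T = S \<inter> ?p -` B"
    have T [measurable]: "T \<in> sets borel" unfolding T_def using S measurable_sets_borel[OF m B] by auto
    have TS: "T \<subseteq> S" by (auto simp: T_def)
    have imT: "\<psi> ` T = B \<inter> \<psi> ` S" by (auto simp: T_def)
    have "emeasure lborel (\<psi> ` T) = (\<integral>\<^sup>+x\<in>T. ennreal \<bar>det (matrix (frechet_derivative \<psi> (at x)))\<bar> \<partial>lborel)"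
    proof (rule emeasure_differentiable_image[OF T])
      show "(\<psi> has_derivative frechet_derivative \<psi> (at x)) (at x)" if "x \<in> T" for x
        using differentiable_has_derivative smooth_onD[OF \<psi>] that TS by blast
      show "inj_on \<psi> T" using inj TS inj_on_subset by blast
      show "\<psi> ` T \<in> sets borel" unfolding imT using im by auto
      have "(\<lambda>x. indicator T x * (indicator S x * \<bar>det (jac \<psi> x)\<bar>)) \<in> borel_measurable borel" by measurable
      moreover have "(\<lambda>x. indicator T x * (indicator S x * \<bar>det (jac \<psi> x)\<bar>)) = (\<lambda>x. indicator T x * \<bar>det (matrix (frechet_derivative \<psi> (at x)))\<bar>)"
        using TS by (auto simp: fun_eq_iff indicator_def matrix_frechet_jac)
      ultimately show "(\<lambda>x. indicator T x * \<bar>det (matrix (frechet_derivative \<psi> (at x)))\<bar>) \<in> borel_measurable borel" by simp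
    qed
    moreover have "emeasure (distr (density lborel (\<lambda>x. ennreal (indicator S x * \<bar>det (jac \<psi> x)\<bar>))) borel ?p) B
       = (\<integral>\<^sup>+x\<in>?p -` B. ennreal (indicator S x * \<bar>det (jac \<psi> x)\<bar>) \<partial>lborel)"
      using measurable_sets_borel[OF m B] by (subst emeasure_distr; simp) (subst emeasure_density; simp)
    moreover have "\<dots> = (\<integral>\<^sup>+x\<in>T. ennreal \<bar>det (matrix (frechet_derivative \<psi> (at x)))\<bar> \<partial>lborel)"
      by (intro nn_integral_cong) (auto simp: indicator_def T_def matrix_frechet_jac)
    moreover have "emeasure (density lborel (indicator (\<psi> ` S))) B = emeasure lborel (\<psi> ` T)"
      unfolding imT using im by (subst emeasure_density) (auto simp: Int_commute simp flip: indicator_inter_arith)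
    ultimately show "emeasure (distr (density lborel (\<lambda>x. ennreal (indicator S x * \<bar>det (jac \<psi> x)\<bar>))) borel ?p) B
      = emeasure (density lborel (indicator (\<psi> ` S))) B" by simp
  qed simp
qed

lemma nn_integral_change_of_variables:
  fixes \<psi> :: "real^'n::finite \<Rightarrow> real^'n"
  assumes S: "open S" and \<psi>: "smooth_on S \<psi>" and inj: "inj_on \<psi> S" and im: "open (\<psi> ` S)"
    and f: "f \<in> borel_measurable borel"
  shows "(\<integral>\<^sup>+y\<in>\<psi> ` S. f y \<partial>lborel) = (\<integral>\<^sup>+x\<in>S. f (\<psi> x) * ennreal \<bar>det (jac \<psi> x)\<bar> \<partial>lborel)"
proof -
  let ?p = "\<lambda>x. if x \<in> S then \<psi> x else 0"
  note cv = lborel_change_of_variables[OF S \<psi> inj im]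
  note [measurable] = cv(1) f
  have d [measurable]: "(\<lambda>x. indicator S x * \<bar>det (jac \<psi> x)\<bar>) \<in> borel_measurable borel"
    by (rule measurable_indicator_continuous[OF S])
      (intro continuous_on_rabs smooth_on_continuous[OF smooth_on_det[OF S smooth_on_jac[OF S \<psi>]]])
  have "(\<integral>\<^sup>+y\<in>\<psi> ` S. f y \<partial>lborel) = (\<integral>\<^sup>+y. f y \<partial>density lborel (indicator (\<psi> ` S)))"
    using im by (subst nn_integral_density) (auto simp: mult.commute)
  also have "\<dots> = (\<integral>\<^sup>+x. f (?p x) \<partial>density lborel (\<lambda>x. ennreal (indicator S x * \<bar>det (jac \<psi> x)\<bar>)))"
    unfolding cv(2)[symmetric] by (subst nn_integral_distr) auto
  also have "\<dots> = (\<integral>\<^sup>+x. ennreal (indicator S x * \<bar>det (jac \<psi> x)\<bar>) * f (?p x) \<partial>lborel)"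
    by (subst nn_integral_density) auto
  also have "\<dots> = (\<integral>\<^sup>+x\<in>S. f (\<psi> x) * ennreal \<bar>det (jac \<psi> x)\<bar> \<partial>lborel)"
    by (intro nn_integral_cong) (auto simp: indicator_def mult.commute)
  finally show ?thesis .
qed

lemma integral_change_of_variables_smooth:
  fixes \<psi> :: "real^'n::finite \<Rightarrow> real^'n" and f :: "real^'n \<Rightarrow> real"
  assumes S: "open S" and \<psi>: "smooth_on S \<psi>" and inj: "inj_on \<psi> S" and im: "open (\<psi> ` S)"
    and f: "f \<in> borel_measurable borel"
  shows "(LBINT y:\<psi> ` S. f y) = (LBINT x:S. \<bar>det (jac \<psi> x)\<bar> * f (\<psi> x))"
proof -
  let ?p = "\<lambda>x. if x \<in> S then \<psi> x else 0"
  note cv = lborel_change_of_variables[OF S \<psi> inj im]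
  note [measurable] = cv(1) f
  have d [measurable]: "(\<lambda>x. indicator S x * \<bar>det (jac \<psi> x)\<bar>) \<in> borel_measurable borel"
    by (rule measurable_indicator_continuous[OF S])
      (intro continuous_on_rabs smooth_on_continuous[OF smooth_on_det[OF S smooth_on_jac[OF S \<psi>]]])
  have i: "density lborel (indicator (\<psi> ` S)) = density lborel (\<lambda>y. ennreal (indicator (\<psi> ` S) y))"
    by (simp add: ennreal_indicator)
  have "(LBINT y:\<psi> ` S. f y) = (LINT y|density lborel (indicator (\<psi> ` S)). f y)"
    unfolding i using im by (subst integral_density) (auto simp: set_lebesgue_integral_def)
  also have "\<dots> = (LINT x|density lborel (\<lambda>x. ennreal (indicator S x * \<bar>det (jac \<psi> x)\<bar>)). f (?p x))"
    unfolding cv(2)[symmetric] by (subst integral_distr) auto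
  also have "\<dots> = (LINT x|lborel. (indicator S x * \<bar>det (jac \<psi> x)\<bar>) *\<^sub>R f (?p x))"
    by (subst integral_density) auto
  also have "\<dots> = (LBINT x:S. \<bar>det (jac \<psi> x)\<bar> * f (\<psi> x))"
    unfolding set_lebesgue_integral_def by (intro Bochner_Integration.integral_cong) (auto simp: indicator_def)
  finally show ?thesis .
qed

section \<open>Integration by parts\<close>

lemma integral_translate:
  fixes f :: "real^'n::finite \<Rightarrow> real"
  assumes [measurable]: "f \<in> borel_measurable borel"
  shows "(LBINT x. f (x + c)) = (LBINT x. f x)"
    and "integrable lborel f \<Longrightarrow> integrable lborel (\<lambda>x. f (x + c))"
proof -
  have "(LBINT x. f x) = (\<integral>x. f x \<partial>distr lborel borel ((+) c))" by (simp add: lborel_distr_plus)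
  also have "\<dots> = (LBINT x. f (c + x))" by (subst integral_distr) auto
  finally show "(LBINT x. f (x + c)) = (LBINT x. f x)" by (simp add: add.commute)
  assume "integrable lborel f"
  then have "integrable (distr lborel borel ((+) c)) f" by (simp add: lborel_distr_plus)
  then have "integrable lborel (\<lambda>x. f (c + x))" by (subst (asm) integrable_distr_eq) auto
  then show "integrable lborel (\<lambda>x. f (x + c))" by (simp add: add.commute)
qed

text \<open>Difference quotients of \<open>F\<close> have integral zero by translation invariance.
  By the mean value theorem they equal a partial derivative at a point shifted by at most 1 along
  the axis, so a bound \<open>H\<close> that is uniform over such shifts permits dominated
  convergence.\<close>

lemma integral_pd_zero:
  fixes F :: "real^'n::finite \<Rightarrow> real"
  assumes F: "smooth_on UNIV F" "integrable lborel F" and H: "integrable lborel H"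
    and bound: "\<And>x t. \<bar>t\<bar> \<le> 1 \<Longrightarrow> \<bar>pd i F (x + t *\<^sub>R axis i 1)\<bar> \<le> H x"
  shows "integrable lborel (pd i F)" "(LBINT x. pd i F x) = 0"
proof -
  define h where "h k = 1 / (real k + 1)" for k
  define D where "D k x = (F (x + h k *\<^sub>R axis i 1) - F x) / h k" for k x
  have h: "h k > 0" "h k \<le> 1" for k by (auto simp: h_def)
  have h0: "h \<longlonglongrightarrow> 0" unfolding h_def using LIMSEQ_inverse_real_of_nat by (simp add: field_simps)
  have mF [measurable]: "F \<in> borel_measurable borel" using F(2) by auto
  have mD [measurable]: "D k \<in> borel_measurable lborel" for k unfolding D_def by measurable
  have mdF [measurable]: "pd i F \<in> borel_measurable lborel"
    using smooth_on_continuous[OF smooth_on_partial[OF F(1)]] by (simp add: borel_measurable_continuous_onI)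
  have der: "((\<lambda>t. F (x + t *\<^sub>R axis i 1)) has_real_derivative pd i F (x + t *\<^sub>R axis i 1)) (at t)" for x t
    by (rule has_real_derivative_line) (use smooth_onD[OF F(1)] in auto)
  have lim: "(\<lambda>k. D k x) \<longlonglongrightarrow> pd i F x" for x
  proof -
    have "((\<lambda>t. (F (x + (0 + t) *\<^sub>R axis i 1) - F (x + 0 *\<^sub>R axis i 1)) / t) \<longlongrightarrow> pd i F x) (at 0)"
      using der[of x 0] unfolding DERIV_def by simp
    moreover have "filterlim h (at 0) sequentially"
      using h0 h(1) by (auto simp: filterlim_at intro!: always_eventually) (metis less_irrefl)
    ultimately show ?thesis unfolding D_def using filterlim_compose by fastforce
  qed
  have Db: "\<bar>D k x\<bar> \<le> H x" for k x
  proof -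
    obtain z where z: "0 < z" "z < h k" "F (x + h k *\<^sub>R axis i 1) - F (x + 0 *\<^sub>R axis i 1) = (h k - 0) * pd i F (x + z *\<^sub>R axis i 1)"
      using MVT2[OF h(1) der] by blast
    then have "D k x = pd i F (x + z *\<^sub>R axis i 1)" using h(1)[of k] by (simp add: D_def)
    then show ?thesis using bound[of z x] z h(2)[of k] by simp
  qed
  have D0: "(LBINT x. D k x) = 0" for k
    unfolding D_def using integral_translate[OF mF] F(2) by simp
  have A: "AE x in lborel. (\<lambda>k. D k x) \<longlonglongrightarrow> pd i F x" "AE x in lborel. norm (D k x) \<le> H x" for k
    using lim Db by auto
  have "integrable lborel (pd i F)"
    by (rule integrable_dominated_convergence[OF mdF mD H A])
  moreover have "(\<lambda>k. \<integral>x. D k x \<partial>lborel) \<longlonglongrightarrow> (LBINT x. pd i F x)"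
    by (rule integral_dominated_convergence[OF mdF mD H A])
  ultimately show "integrable lborel (pd i F)" "(LBINT x. pd i F x) = 0"
    unfolding D0 by (auto simp: LIMSEQ_const_iff)
qed

lemma integrable_compact_support:
  fixes f :: "real^'n::finite \<Rightarrow> real"
  assumes "continuous_on UNIV f" "compact K" "\<And>x. x \<notin> K \<Longrightarrow> f x = 0"
  shows "integrable lborel f" "\<exists>B. \<forall>x. \<bar>f x\<bar> \<le> B"
proof -
  have cK: "continuous_on K f" using assms(1) continuous_on_subset by blast
  have "integrable lborel (\<lambda>x. indicator K x *\<^sub>R f x)"
    by (rule borel_integrable_compact[OF assms(2) cK])
  moreover have "(\<lambda>x. indicator K x *\<^sub>R f x) = f" using assms(3) by (auto simp: indicator_def fun_eq_iff)
  ultimately show "integrable lborel f" by simp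
  have "bounded (f ` K)" using compact_imp_bounded[OF compact_continuous_image[OF cK assms(2)]] .
  then obtain B where "\<forall>x\<in>K. \<bar>f x\<bar> \<le> B" unfolding bounded_iff by auto
  then have "\<bar>f x\<bar> \<le> max B 0" for x using assms(3)[of x] by (cases "x \<in> K") auto
  then show "\<exists>B. \<forall>x. \<bar>f x\<bar> \<le> B" by blast
qed

lemma pd_zero_outside:
  assumes "closed K" "\<And>x. x \<notin> K \<Longrightarrow> f x = 0" "x \<notin> K"
  shows "pd i f x = 0"
proof -
  have "pd i f x = pd i (\<lambda>x. 0) x"
    by (rule pd_cong_open[of "- K"]) (use assms in auto)
  then show ?thesis by simp
qed

lemma integral_pd_compact:
  fixes F :: "real^'n::finite \<Rightarrow> real"
  assumes F: "smooth_on UNIV F" and K: "compact K" "\<And>x. x \<notin> K \<Longrightarrow> F x = 0"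
  shows "integrable lborel (pd i F)" "(LBINT x. pd i F x) = 0"
proof -
  note cont = smooth_on_continuous[OF smooth_on_partial[OF F]]
  have out: "x \<notin> K \<Longrightarrow> pd i F x = 0" for x
    using pd_zero_outside[OF compact_imp_closed[OF K(1)] K(2)] .
  obtain B where B: "\<And>x. \<bar>pd i F x\<bar> \<le> B"
    using integrable_compact_support(2)[OF cont K(1) out] by blast
  obtain R where R: "\<And>x. x \<in> K \<Longrightarrow> norm x \<le> R" using compact_imp_bounded[OF K(1)] bounded_iff by metis
  \<comment> \<open>The radius exceeds that of the support by 1, the largest shift that
    \<open>integral_pd_zero\<close> allows.\<close>
  define H where "H x = B * indicator (cball 0 (R + 1)) x" for x :: "real^'n"
  have H: "integrable lborel H" unfolding H_def
    using emeasure_lborel_cball_finite[of 0 "R + 1"] by (intro integrable_mult_right integrable_real_indicator) auto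
  have bound: "\<bar>pd i F (x + t *\<^sub>R axis i 1)\<bar> \<le> H x" if "\<bar>t\<bar> \<le> 1" for x t
  proof (cases "x + t *\<^sub>R axis i 1 \<in> K")
    case True
    have "norm x \<le> norm (x + t *\<^sub>R axis i 1) + norm (t *\<^sub>R axis i (1::real) :: real^'n)"
      by (metis add_diff_cancel_right' norm_triangle_ineq4)
    also have "\<dots> \<le> R + 1" using R[OF True] that by simp
    finally show ?thesis using B by (simp add: H_def)
  next
    case False
    have "0 \<le> B" using B[of 0] by linarith
    then show ?thesis using out[OF False] by (simp add: H_def)
  qed
  have "integrable lborel F"
    by (rule integrable_compact_support(1)[OF smooth_on_continuous[OF F] K])
  from integral_pd_zero[OF F this H bound]
  show "integrable lborel (pd i F)" "(LBINT x. pd i F x) = 0" by auto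
qed

lemma Ck_on_Un:
  assumes "open S" "open T"
  shows "Ck_on k S f \<Longrightarrow> Ck_on k T f \<Longrightarrow> Ck_on k (S \<union> T) f"
proof (induction k arbitrary: f)
  case 0
  then show ?case using continuous_on_open_Un[OF assms] by auto
qed auto

lemma smooth_on_Un: "open S \<Longrightarrow> open T \<Longrightarrow> smooth_on S f \<Longrightarrow> smooth_on T f \<Longrightarrow> smooth_on (S \<union> T) f"
  unfolding smooth_on_def using Ck_on_Un by blast

text \<open>Extension by zero: the function is smooth on \<open>S\<close> and vanishes on the open
  complement of \<open>K\<close>, and these two open sets cover the space.\<close>

lemma smooth_on_extend:
  fixes f :: "real^'n::finite \<Rightarrow> 'b::real_normed_vector"
  assumes "open S" "smooth_on S f" "closed K" "K \<subseteq> S" "\<And>x. x \<in> S - K \<Longrightarrow> f x = 0"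
  shows "smooth_on UNIV (\<lambda>x. if x \<in> S then f x else 0)"
proof -
  have "smooth_on S (\<lambda>x. if x \<in> S then f x else 0)"
    by (rule smooth_on_cong[OF assms(1) _ assms(2)]) simp
  moreover have "smooth_on (- K) (\<lambda>x. if x \<in> S then f x else 0)"
    by (rule smooth_on_cong[OF _ _ smooth_on_const[of _ 0]]) (use assms in auto)
  ultimately have "smooth_on (S \<union> - K) (\<lambda>x. if x \<in> S then f x else 0)"
    using assms by (intro smooth_on_Un) auto
  moreover have "S \<union> - K = UNIV" using assms(4) by auto
  ultimately show ?thesis by simp
qed

section \<open>Smooth bump functions\<close>

text \<open>With \<open>u = 1/t\<close>, differentiating \<open>p(u) exp(-u)\<close> in
  \<open>t\<close> gives \<open>u^2 (p(u) - p'(u)) exp(-u)\<close>; the polynomial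
  \<open>[:0, 0, 1:]\<close> is the factor \<open>u^2\<close>.\<close>

fun flat_poly :: "nat \<Rightarrow> real poly"
  where "flat_poly 0 = 1" | "flat_poly (Suc j) = [:0, 0, 1:] * (flat_poly j - pderiv (flat_poly j))"

text \<open>\<open>flat_exp j\<close> is the \<open>j\<close>-th derivative of \<open>exp (- 1/t)\<close>, extended by \<open>0\<close> to \<open>t \<le> 0\<close>.\<close>

definition flat_exp :: "nat \<Rightarrow> real \<Rightarrow> real"
  where "flat_exp j t = (if t \<le> 0 then 0 else poly (flat_poly j) (1/t) * exp (- (1/t)))"

lemma poly_exp_tendsto_0: "((\<lambda>u. poly p u * exp (- u)) \<longlongrightarrow> (0::real)) at_top"
proof -
  have "((\<lambda>u. \<Sum>i\<le>degree p. coeff p i * (u ^ i / exp u)) \<longlongrightarrow> (\<Sum>i\<le>degree p. coeff p i * 0)) at_top"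
    by (intro tendsto_sum tendsto_mult tendsto_const tendsto_power_div_exp_0)
  moreover have "(\<Sum>i\<le>degree p. coeff p i * (u ^ i / exp u)) = poly p u * exp (- u)" for u :: real
    by (simp add: poly_altdef sum_distrib_right exp_minus divide_inverse mult.assoc)
  ultimately show ?thesis by simp
qed

lemma flat_exp_deriv: "(flat_exp j has_real_derivative flat_exp (Suc j) t) (at t)"
proof -
  consider "t < 0" | "t > 0" | "t = 0" by linarith
  then show ?thesis
  proof cases
    case 1
    have "((\<lambda>_. 0) has_real_derivative 0) (at t)" by simp
    then have "(flat_exp j has_real_derivative 0) (at t)"
      by (rule has_field_derivative_transform_within_open[of _ _ _ "{..<0}"]) (use 1 in \<open>auto simp: flat_exp_def\<close>)
    then show ?thesis using 1 by (simp add: flat_exp_def)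
  next
    case 2
    let ?p = "flat_poly j"
    have "((\<lambda>t. poly ?p (1/t) * exp (- (1/t))) has_real_derivative
        (poly (pderiv ?p) (1/t) * (- 1 / t^2)) * exp (- (1/t)) + (exp (- (1/t)) * (1/t^2)) * poly ?p (1/t)) (at t)"
      using 2 by (auto intro!: derivative_eq_intros DERIV_chain2[OF poly_DERIV] simp: power2_eq_square field_simps)
    moreover have "(poly (pderiv ?p) (1/t) * (- 1 / t^2)) * exp (- (1/t)) + (exp (- (1/t)) * (1/t^2)) * poly ?p (1/t)
       = flat_exp (Suc j) t"
      using 2 by (simp add: flat_exp_def power2_eq_square field_simps)
    ultimately have "((\<lambda>t. poly ?p (1/t) * exp (- (1/t))) has_real_derivative flat_exp (Suc j) t) (at t)" by simp
    then show ?thesis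
      by (rule has_field_derivative_transform_within_open[of _ _ _ "{0<..}"]) (use 2 in \<open>auto simp: flat_exp_def\<close>)
  next
    case 3
    have R: "((\<lambda>h. flat_exp j h / h) \<longlongrightarrow> 0) (at_right 0)"
    proof -
      \<comment> \<open>The additional factor \<open>[:0, 1:]\<close> is the \<open>1/h\<close> of
        the difference quotient at the origin, in the variable \<open>u = 1/h\<close>.\<close>
      have "((\<lambda>u. poly ([:0, 1:] * flat_poly j) u * exp (- u)) \<longlongrightarrow> 0) at_top" by (rule poly_exp_tendsto_0)
      then have "((\<lambda>h. poly ([:0, 1:] * flat_poly j) (inverse h) * exp (- inverse h)) \<longlongrightarrow> 0) (at_right 0)"
        by (rule filterlim_compose[OF _ filterlim_inverse_at_top_right])
      then show ?thesis
        by (rule Lim_transform_eventually)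
          (auto simp: eventually_at_right_field flat_exp_def field_simps intro!: exI[of _ 1])
    qed
    have L: "((\<lambda>h. flat_exp j h / h) \<longlongrightarrow> 0) (at_left 0)"
      by (rule Lim_transform_eventually[OF tendsto_const])
        (auto simp: eventually_at_left_field flat_exp_def intro!: exI[of _ "-1"])
    have "((\<lambda>h. (flat_exp j (0 + h) - flat_exp j 0) / h) \<longlongrightarrow> 0) (at 0)"
      using filterlim_split_at[OF L R] by (simp add: flat_exp_def)
    then show ?thesis using 3 by (simp add: DERIV_def flat_exp_def)
  qed
qed

definition bump :: "real \<Rightarrow> real"
  where "bump = flat_exp 0"

lemma bump_nonneg: "bump t \<ge> 0" and bump_le_1: "bump t \<le> 1" and bump_pos: "t > 0 \<Longrightarrow> bump t > 0"
  and bump_zero: "t \<le> 0 \<Longrightarrow> bump t = 0"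
  by (auto simp: bump_def flat_exp_def)

lemma smooth_on_bump [smooth_intros]:
  "open S \<Longrightarrow> smooth_on S f \<Longrightarrow> smooth_on S (\<lambda>x. bump (f x))"
  unfolding bump_def using smooth_on_compose_real[of S UNIV flat_exp f 0] flat_exp_deriv by blast

text \<open>With \<open>bump_zero\<close> this makes products of scaled bumps converge pointwise to
  the indicator of an open box.\<close>

lemma bump_scaled_tendsto: "t > 0 \<Longrightarrow> (\<lambda>k. bump (real k * t)) \<longlonglongrightarrow> 1"
proof -
  assume t: "t > 0"
  have "(\<lambda>k. exp (- (1 / (real k * t)))) \<longlonglongrightarrow> exp (- 0)"
  proof (intro tendsto_intros)
    have "(\<lambda>k. (1/t) * (1 / real k)) \<longlonglongrightarrow> (1/t) * 0"
      by (intro tendsto_mult tendsto_const lim_1_over_n)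
    then show "(\<lambda>k. 1 / (real k * t)) \<longlonglongrightarrow> 0" by (simp add: mult.commute)
  qed
  then have "(\<lambda>k. exp (- (1 / (real k * t)))) \<longlonglongrightarrow> 1" by simp
  moreover have "\<forall>\<^sub>F k in sequentially. exp (- (1 / (real k * t))) = bump (real k * t)"
    using eventually_gt_at_top[of 0] by eventually_elim (use t in \<open>auto simp: bump_def flat_exp_def mult_le_0_iff\<close>)
  ultimately show ?thesis by (rule Lim_transform_eventually)
qed

definition cutoff :: "real \<Rightarrow> (real^'n::finite \<Rightarrow> real) \<Rightarrow> bool"
  where "cutoff \<rho> \<xi> \<longleftrightarrow> smooth_on UNIV \<xi> \<and> (\<forall>x. 0 \<le> \<xi> x \<and> \<xi> x \<le> 1) \<and>
    (\<forall>x. norm x \<le> \<rho>/2 \<longrightarrow> \<xi> x = 1) \<and> (\<forall>x. norm x \<ge> \<rho> \<longrightarrow> \<xi> x = 0)"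

lemma cutoffD:
  assumes "cutoff \<rho> \<xi>"
  shows "smooth_on UNIV \<xi>" "0 \<le> \<xi> x" "\<xi> x \<le> 1" "norm x \<le> \<rho>/2 \<Longrightarrow> \<xi> x = 1" "norm x \<ge> \<rho> \<Longrightarrow> \<xi> x = 0"
  using assms unfolding cutoff_def by auto

lemma cutoff_exists:
  assumes "\<rho> > 0"
  shows "\<exists>\<xi> :: real^'n::finite \<Rightarrow> real. cutoff \<rho> \<xi>"
  unfolding cutoff_def
proof (intro exI conjI allI impI)
  \<comment> \<open>\<open>?a\<close> is positive exactly inside the radius \<open>\<rho>\<close>,
    \<open>?b\<close> exactly outside \<open>\<rho>/2\<close>. The two regions overlap and cover
    everything, so the denominator never vanishes. Squared norms keep the functions smooth at the
    origin.\<close>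
  let ?a = "\<lambda>x::real^'n. bump (\<rho>\<^sup>2 - (x \<bullet> x))" and ?b = "\<lambda>x::real^'n. bump ((x \<bullet> x) - (\<rho>/2)\<^sup>2)"
  have n: "x \<bullet> x = (norm x)\<^sup>2" for x :: "real^'n" by (simp add: power2_norm_eq_inner)
  have pos: "?a x + ?b x > 0" for x
  proof (cases "norm x < \<rho>")
    case True
    then have "(norm x)\<^sup>2 < \<rho>\<^sup>2" by (intro power_strict_mono) auto
    then show ?thesis using bump_pos[of "\<rho>\<^sup>2 - x \<bullet> x"] bump_nonneg n by (smt (verit))
  next
    case False
    then have "\<rho>/2 < norm x" using assms by simp
    then have "(\<rho>/2)\<^sup>2 < (norm x)\<^sup>2" using assms by (intro power_strict_mono) auto
    then show ?thesis using bump_pos[of "x \<bullet> x - (\<rho>/2)\<^sup>2"] bump_nonneg n by (smt (verit))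
  qed
  have sq: "smooth_on UNIV (\<lambda>x::real^'n. x \<bullet> x)"
    unfolding inner_vec_def inner_real_def by (intro smooth_intros) auto
  show "smooth_on UNIV (\<lambda>x. ?a x / (?a x + ?b x))"
    by (intro smooth_on_divide smooth_intros sq) (use pos in \<open>auto simp: less_imp_neq[symmetric] dest: less_imp_neq[of 0]\<close>)
  show "0 \<le> ?a x / (?a x + ?b x)"  for x using bump_nonneg pos[of x] by simp
  show "?a x / (?a x + ?b x) \<le> 1"  for x using bump_nonneg pos[of x] by simp
  show "?a x / (?a x + ?b x) = 1" if "norm x \<le> \<rho>/2" for x
  proof -
    have "(norm x)\<^sup>2 \<le> (\<rho>/2)\<^sup>2" using that by (intro power_mono) auto
    then have "?b x = 0" by (intro bump_zero) (simp add: n)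
    then show ?thesis using pos[of x] by simp
  qed
  show "?a x / (?a x + ?b x) = 0" if "norm x \<ge> \<rho>" for x
  proof -
    have "\<rho>\<^sup>2 \<le> (norm x)\<^sup>2" using that assms by (intro power_mono) auto
    then have "?a x = 0" by (intro bump_zero) (simp add: n)
    then show ?thesis by simp
  qed
qed

section \<open>The fundamental lemma of the calculus of variations\<close>

text \<open>Open boxes generate the Borel sets and are stable under intersection, so the vanishing
  of the integral extends from boxes to all Borel sets. The induction passes to complements by means
  of the total integral, which vanishes by exhaustion with growing boxes.\<close>

lemma AE_zero_if_box_integrals_zero:
  fixes u :: "real^'n::finite \<Rightarrow> real"
  assumes u: "integrable lborel u" and box: "\<And>a b. (LBINT x:box a b. u x) = 0"
  shows "AE x in lborel. u x = 0"
proof -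
  have [measurable]: "u \<in> borel_measurable borel" using u by auto
  have si: "set_integrable lborel A u" if "A \<in> sets borel" for A
    unfolding set_integrable_def using u that by (intro integrable_mult_indicator) auto
  have total: "(LBINT x:UNIV. u x) = 0"
  proof -
    have U: "(\<Union>n::nat. box (- (\<chi> i. real n)) (\<chi> i. real n)) = (UNIV :: (real^'n) set)"
    proof -
      have "x \<in> (\<Union>n::nat. box (- (\<chi> i. real n)) (\<chi> i. real n))" for x :: "real^'n"
      proof -
        obtain n where "norm x < real n" using reals_Archimedean2 by blast
        then have "\<bar>x $ i\<bar> < real n" for i using component_le_norm_cart[of x i] by linarith
        then have "- real n < x $ i \<and> x $ i < real n" for i by (metis abs_less_iff minus_less_iff)
        then show ?thesis by (auto simp: mem_box_cart)
      qed
      then show ?thesis by blast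
    qed
    have "(\<lambda>n. LBINT x:box (- (\<chi> i. real n)) (\<chi> i. real n). u x) \<longlonglongrightarrow> (LBINT x:(\<Union>n::nat. box (- (\<chi> i. real n)) (\<chi> i. real n)). u x)"
    proof (rule set_integral_cont_up)
      show "incseq (\<lambda>n::nat. box (- (\<chi> i. real n)) (\<chi> i. real n) :: (real^'n) set)"
        by (rule incseq_SucI) (auto simp: mem_box_cart intro: order_less_trans; (smt (verit) of_nat_Suc))
    qed (auto simp: si)
    then show ?thesis unfolding U box by (simp add: LIMSEQ_const_iff)
  qed
  have all: "(LBINT x:A. u x) = 0" if "A \<in> sets borel" for A
  proof -
    have "Int_stable (range (\<lambda>(a, b). box a b :: (real^'n) set))"
      by (auto simp: Int_stable_def box_Int_box)
    moreover have "range (\<lambda>(a, b). box a b :: (real^'n) set) \<subseteq> Pow UNIV" by simp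
    moreover have "A \<in> sigma_sets UNIV (range (\<lambda>(a, b). box a b :: (real^'n) set))"
      using that by (simp add: borel_eq_box)
    ultimately show ?thesis
    proof (induction rule: sigma_sets_induct_disjoint)
      case (basic A)
      then show ?case using box by auto
    next
      case empty
      show ?case by (simp add: set_lebesgue_integral_def)
    next
      case (compl A)
      then have A: "A \<in> sets borel" by (simp add: borel_eq_box)
      have "(LBINT x:UNIV. u x) = (LBINT x:A. u x) + (LBINT x:UNIV - A. u x)"
        using set_integral_Un[of A "UNIV - A" lborel u] si A by (simp add: Un_absorb1)
      then show ?case using total compl by simp
    next
      case (union A)
      then have A: "A i \<in> sets borel" for i by (auto simp: borel_eq_box)
      have "(LBINT x:(\<Union>i. A i). u x) = (\<Sum>i. LBINT x:A i. u x)"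
        using union A by (intro lebesgue_integral_countable_add si) (auto simp: disjoint_family_on_def)
      then show ?case using union by simp
    qed
  qed
  have "AE x in lborel. u x = (\<lambda>_. 0) x"
    by (rule density_unique_real[OF u]) (use all in \<open>auto simp: set_lebesgue_integral_def\<close>)
  then show ?thesis by simp
qed

text \<open>Products of scaled bumps in the coordinates are admissible test functions that converge
  to the indicator of an open box, so \<open>w\<close> has integral zero over every small box. The
  conclusion on \<open>S\<close> follows from a countable cover by compact boxes.\<close>

lemma fundamental_lemma:
  fixes w :: "real^'n::finite \<Rightarrow> real"
  assumes S: "open S" and loc: "\<And>K. compact K \<Longrightarrow> K \<subseteq> S \<Longrightarrow> set_integrable lborel K w"
    and test: "\<And>\<eta> K. smooth_on UNIV \<eta> \<Longrightarrow> compact K \<Longrightarrow> K \<subseteq> S \<Longrightarrow> (\<And>y. y \<notin> K \<Longrightarrow> \<eta> y = 0) \<Longrightarrow>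
       (LBINT y:S. w y * \<eta> y) = 0"
  shows "AE y in lborel. y \<in> S \<longrightarrow> w y = 0"
proof -
  have boxes: "AE y in lborel. y \<in> box c d \<longrightarrow> w y = 0" if cd: "cbox c d \<subseteq> S" for c d
  proof -
    define v where "v x = indicator (cbox c d) x * w x" for x
    have v: "integrable lborel v" using loc[of "cbox c d"] cd by (simp add: set_integrable_def v_def[abs_def])
    have sub: "(LBINT x:box a b. v x) = 0" if ab: "box a b \<subseteq> box c d" for a b
    proof -
      define \<eta> where "\<eta> k x = (\<Prod>i\<in>UNIV. bump (real k * (x $ i - a $ i)) * bump (real k * (b $ i - x $ i)))" for k :: nat and x :: "real^'n"
      have s: "smooth_on UNIV (\<eta> k)" for k unfolding \<eta>_def by (intro smooth_intros) auto
      have out: "\<eta> k x = 0" if "x \<notin> box a b" for k x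
      proof -
        have "\<not> (\<forall>i. a $ i < x $ i \<and> x $ i < b $ i)" using that by (simp add: mem_box_cart)
        then obtain i where "x $ i \<le> a $ i \<or> b $ i \<le> x $ i" by (meson not_less)
        then have z0: "bump (real k * (x $ i - a $ i)) * bump (real k * (b $ i - x $ i)) = 0"
          by (auto intro!: bump_zero mult_nonneg_nonpos)
        show ?thesis unfolding \<eta>_def by (rule prod_zero[OF finite bexI[of _ i]]) (simp_all only: z0 UNIV_I)
      qed
      have le: "\<bar>\<eta> k x\<bar> \<le> 1" "0 \<le> \<eta> k x" for k x
      proof -
        show "0 \<le> \<eta> k x" unfolding \<eta>_def by (intro prod_nonneg mult_nonneg_nonneg bump_nonneg)
        moreover have "\<eta> k x \<le> 1" unfolding \<eta>_def
          by (intro prod_le_1 conjI mult_nonneg_nonneg bump_nonneg mult_le_one bump_le_1)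
        ultimately show "\<bar>\<eta> k x\<bar> \<le> 1" by simp
      qed
      have lim: "(\<lambda>k. \<eta> k x) \<longlonglongrightarrow> indicator (box a b) x" for x
      proof (cases "x \<in> box a b")
        case True
        have "(\<lambda>k. \<eta> k x) \<longlonglongrightarrow> (\<Prod>i\<in>(UNIV::'n set). 1 * 1)" unfolding \<eta>_def
          by (intro tendsto_prod tendsto_mult bump_scaled_tendsto) (use True in \<open>auto simp: mem_box_cart\<close>)
        then show ?thesis using True by simp
      qed (simp add: out)
      have z: "(LBINT x. v x * \<eta> k x) = 0" for k
      proof -
        have "(LBINT y:S. w y * \<eta> k y) = 0"
          by (rule test[OF s compact_cbox cd]) (use out ab box_subset_cbox in blast)
        moreover have "(LBINT y:S. w y * \<eta> k y) = (LBINT x. v x * \<eta> k x)"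
          unfolding set_lebesgue_integral_def v_def
        proof (rule Bochner_Integration.integral_cong[OF refl])
          fix x
          show "indicator S x *\<^sub>R (w x * \<eta> k x) = indicator (cbox c d) x * w x * \<eta> k x"
          proof (cases "x \<in> box a b")
            case True
            then have "x \<in> cbox c d" "x \<in> S" using ab cd box_subset_cbox by blast+
            then show ?thesis by simp
          qed (simp add: out)
        qed
        ultimately show ?thesis by simp
      qed
      have [measurable]: "v \<in> borel_measurable borel" "\<eta> k \<in> borel_measurable borel" for k
        using v smooth_on_continuous[OF s] by (auto intro: borel_measurable_continuous_onI)
      have "(\<lambda>k. \<integral>x. v x * \<eta> k x \<partial>lborel) \<longlonglongrightarrow> (LBINT x. v x * indicator (box a b) x)"
      proof (rule integral_dominated_convergence[where w = "\<lambda>x. \<bar>v x\<bar>"])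
        show "AE x in lborel. (\<lambda>k. v x * \<eta> k x) \<longlonglongrightarrow> v x * indicator (box a b) x"
          by (intro AE_I2 tendsto_mult tendsto_const lim)
        show "AE x in lborel. norm (v x * \<eta> k x) \<le> \<bar>v x\<bar>" for k
          using le(1) by (auto simp: abs_mult mult_left_le)
      qed (use v in auto)
      then have "(LBINT x. v x * indicator (box a b) x) = 0" unfolding z by (simp add: LIMSEQ_const_iff)
      then show ?thesis by (simp add: set_lebesgue_integral_def mult.commute)
    qed
    define u where "u x = indicator (box c d) x * v x" for x
    have "integrable lborel u" using integrable_mult_indicator[OF _ v, of "box c d"] by (simp add: u_def[abs_def])
    moreover have "(LBINT x:box a b. u x) = 0" for a b
    proof -
      obtain a' b' where I: "box a b \<inter> box c d = box a' b'" using box_Int_box by blast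
      have "(LBINT x:box a b. u x) = (LBINT x:box a' b'. v x)"
        unfolding set_lebesgue_integral_def u_def I[symmetric] by (simp add: indicator_inter_arith mult.assoc)
      also have "\<dots> = 0" by (rule sub) (use I in blast)
      finally show ?thesis .
    qed
    ultimately have "AE x in lborel. u x = 0" by (rule AE_zero_if_box_integrals_zero)
    then show ?thesis
      by eventually_elim (use box_subset_cbox in \<open>auto simp: u_def v_def indicator_def split: if_splits\<close>)
  qed
  obtain \<D> where D: "countable \<D>" "\<D> \<subseteq> Pow S" "\<And>X. X \<in> \<D> \<Longrightarrow> \<exists>a b. X = cbox a b" "\<Union>\<D> = S"
    using open_countable_Union_open_cbox[OF S] by metis
  have "AE y in lborel. \<forall>X\<in>\<D>. y \<in> X \<longrightarrow> w y = 0"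
  proof (subst AE_ball_countable[OF D(1)], intro ballI)
    fix X assume X: "X \<in> \<D>"
    then obtain a b where ab: "X = cbox a b" using D by blast
    \<comment> \<open>The cover consists of closed boxes whereas \<open>boxes\<close> speaks of open
      ones; the faces in between form a null set.\<close>
    have "AE y in lborel. y \<notin> cbox a b - box a b"
      by (rule AE_not_in) (use negligible_frontier_interval[of a b] in \<open>auto simp: negligible_iff_null_sets null_sets_completion_iff\<close>)
    moreover have "AE y in lborel. y \<in> box a b \<longrightarrow> w y = 0" by (rule boxes) (use X D ab in auto)
    ultimately show "AE y in lborel. y \<in> X \<longrightarrow> w y = 0" by eventually_elim (auto simp: ab)
  qed
  then show ?thesis by eventually_elim (use D(4) in blast)
qed

section \<open>Charts\<close>

lemma jac_compose:
  assumes "\<psi> differentiable (at x)" "f differentiable (at (\<psi> x))"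
  shows "jac (\<lambda>x. f (\<psi> x)) x = jac f (\<psi> x) ** jac \<psi> x"
  by (simp add: jac_def vec_eq_iff matrix_matrix_mult_def pd_compose[OF assms] mult.commute)

lemma jac_cong_open:
  assumes "open S" "x \<in> S" "\<And>x. x \<in> S \<Longrightarrow> f x = g x" "f differentiable (at x)"
  shows "jac g x = jac f x"
  by (simp add: jac_def vec_eq_iff pd_cong_open[OF assms])

lemma jac_ident: "jac (\<lambda>x. x) x = mat 1"
  by (simp add: jac_def vec_eq_iff pd_eq[OF has_derivative_ident] axis_def mat_def)

lemma det_pullback: "det (pullback \<psi> h x) = (det (jac \<psi> x))\<^sup>2 * det (h (\<psi> x))"
  by (simp add: pullback_def det_mul power2_eq_square)

text \<open>The squared length of a covector does not depend on coordinates: \<open>J\<close>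
  relates the components of both the metric and the covector, and all its factors cancel.\<close>

lemma inner_pullback_inv:
  fixes g J :: "real^'n^'n::finite"
  assumes "invertible g" "invertible J"
  shows "(transpose J *v w) \<bullet> (matrix_inv (transpose J ** g ** J) *v (transpose J *v w)) = w \<bullet> (matrix_inv g *v w)"
proof -
  have i: "invertible (transpose J)" using assms transpose_invertible by blast
  have "matrix_inv (transpose J ** g ** J) = matrix_inv J ** matrix_inv g ** transpose (matrix_inv J)"
    by (simp add: matrix_inv_mult i assms invertible_mult matrix_inv_transpose matrix_mul_assoc)
  moreover have "transpose (matrix_inv J) ** transpose J = mat 1"
    using matrix_inv_right[OF assms(2)] by (metis matrix_transpose_mul transpose_mat)
  ultimately have "matrix_inv (transpose J ** g ** J) *v (transpose J *v w) = matrix_inv J *v (matrix_inv g *v w)"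
    by (simp only: matrix_vector_mul_assoc matrix_mul_assoc[symmetric]) (simp add: matrix_mul_assoc)
  moreover have "(transpose J *v w) \<bullet> z = w \<bullet> (J *v z)" for z
    by (metis dot_lmul_matrix transpose_matrix_vector)
  ultimately show ?thesis by (simp add: matrix_vector_mul_assoc matrix_mul_assoc matrix_inv_right[OF assms(2)])
qed

section \<open>Locality of connection and curvature; weak derivatives\<close>

lemma conn_cong_open:
  assumes S: "open S" and h: "metric_on S h" and eq: "\<And>x. x \<in> S \<Longrightarrow> h x = h' x" and y: "y \<in> S"
  shows "conn h' i y = conn h i y"
proof -
  have "pd a (\<lambda>z. h' z $ b $ c) y = pd a (\<lambda>z. h z $ b $ c) y" for a b c
    by (rule pd_cong_open[OF S y])
      (auto simp: eq intro!: smooth_onD[OF _ y] smooth_intros S metric_on_smooth[OF h])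
  then show ?thesis by (simp add: conn_def eq[OF y])
qed

lemma curv_cong_open:
  assumes S: "open S" and h: "metric_on S h" and eq: "\<And>x. x \<in> S \<Longrightarrow> h x = h' x" and y: "y \<in> S"
  shows "curv h' i j y = curv h i j y"
proof -
  have "pd a (conn h' b) y = pd a (conn h b) y" for a b
    by (rule pd_cong_open[OF S y])
      (auto simp: conn_cong_open[OF S h eq] intro!: smooth_onD[OF _ y] smooth_intros S h)
  then show ?thesis by (simp add: curv_def conn_cong_open[OF S h eq y])
qed

lemma scal_cong_open:
  assumes S: "open S" and h: "metric_on S h" and eq: "\<And>x. x \<in> S \<Longrightarrow> h x = h' x" and y: "y \<in> S"
  shows "scal h' y = scal h y"
  by (simp add: scal_def curv_cong_open[OF S h eq y] eq[OF y])

lemma riemann_component_eq_curv: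
  assumes S: "open S" and h: "metric_on S (metric_in_chart g c)" and y: "y \<in> S"
  shows "riemann_component g c l k i j y = curv (metric_in_chart g c) i j y $ l $ k"
proof -
  have "pd a (christoffel g c l b k) y = pd a (conn (metric_in_chart g c) b) y $ l $ k" for a b
    using pd_matrix_component[OF smooth_onD[OF smooth_on_conn[OF S h] y]]
    by (simp add: christoffel_eq_conn[abs_def])
  then show ?thesis
    by (simp add: riemann_component_def curv_def christoffel_eq_conn matrix_matrix_mult_def sum_subtractf)
qed

text \<open>The product of \<open>u\<close> with a test function extends by zero to a smooth
  function with compact support, and the integral of its partial derivative vanishes.\<close>

lemma weak_partial_deriv_smooth:
  assumes S: "open S" and u: "smooth_on S u" and w: "\<And>y. y \<in> S \<Longrightarrow> w y = pd i u y"
  shows "weak_partial_deriv S u i w"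
  unfolding weak_partial_deriv_def
proof (intro conjI allI impI; elim conjE exE)
  have cw: "continuous_on S w"
    using smooth_on_continuous[OF smooth_on_partial[OF u]] w by (metis continuous_on_cong)
  fix K :: "(real^'a) set" assume K: "compact K" "K \<subseteq> S"
  show "set_integrable lborel K u" "set_integrable lborel K w"
    unfolding set_integrable_def
    using borel_integrable_compact[OF K(1)] continuous_on_subset[OF _ K(2)] cw smooth_on_continuous[OF u] by blast+
next
  fix \<eta> :: "real^'a \<Rightarrow> real" and K
  assume \<eta>: "smooth_on UNIV \<eta>" and K: "compact K" "K \<subseteq> S" and out: "\<forall>y. y \<notin> K \<longrightarrow> \<eta> y = 0"
  define F where "F y = (if y \<in> S then u y * \<eta> y else 0)" for y
  have \<eta>S: "smooth_on S \<eta>" using \<eta> smooth_on_subset by blast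
  have F: "smooth_on UNIV F" unfolding F_def[abs_def]
    by (rule smooth_on_extend[OF S _ compact_imp_closed[OF K(1)] K(2)])
      (use out in \<open>auto intro!: smooth_intros S u \<eta>S\<close>)
  have dout: "y \<notin> K \<Longrightarrow> pd i \<eta> y = 0" for y
    using pd_zero_outside[OF compact_imp_closed[OF K(1)]] out by blast
  have dF: "pd i F y = indicator S y *\<^sub>R (u y * pd i \<eta> y) + indicator S y *\<^sub>R (w y * \<eta> y)" for y
  proof (cases "y \<in> S")
    case True
    have "pd i F y = pd i (\<lambda>y. u y * \<eta> y) y"
      by (rule pd_cong_open[OF S True])
        (auto simp: F_def intro!: smooth_onD[OF _ True] smooth_intros S u \<eta>S)
    also have "\<dots> = u y * pd i \<eta> y + w y * \<eta> y"
      using pd_mult[OF smooth_onD[OF u True] smooth_onD[OF \<eta>S True]] w[OF True] by simp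
    finally show ?thesis using True by simp
  next
    case False
    then have "y \<notin> K" using K by blast
    then have "pd i F y = 0"
      by (intro pd_zero_outside[OF compact_imp_closed[OF K(1)]]) (auto simp: F_def out)
    then show ?thesis using False by simp
  qed
  have ext: "integrable lborel (\<lambda>y. indicator S y *\<^sub>R (f y * e y))" if "continuous_on S f" "continuous_on UNIV e" "\<And>y. y \<notin> K \<Longrightarrow> e y = 0" for f e :: "real^'a \<Rightarrow> real"
  proof -
    have "continuous_on K (\<lambda>y. f y * e y)"
      using that K(2) by (intro continuous_on_mult) (auto intro: continuous_on_subset)
    then have "integrable lborel (\<lambda>y. indicator K y *\<^sub>R (f y * e y))" by (rule borel_integrable_compact[OF K(1)])
    moreover have "(\<lambda>y. indicator K y *\<^sub>R (f y * e y)) = (\<lambda>y. indicator S y *\<^sub>R (f y * e y))"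
      using K(2) that(3) by (auto simp: fun_eq_iff indicator_def)
    ultimately show ?thesis by simp
  qed
  have cw: "continuous_on S w"
    using smooth_on_continuous[OF smooth_on_partial[OF u]] w by (metis continuous_on_cong)
  have "(LBINT y. pd i F y) = 0"
    by (rule integral_pd_compact(2)[OF F K(1)]) (use out in \<open>auto simp: F_def\<close>)
  then have "(LBINT y. indicator S y *\<^sub>R (u y * pd i \<eta> y)) + (LBINT y. indicator S y *\<^sub>R (w y * \<eta> y)) = 0"
    unfolding dF using ext[of u "pd i \<eta>"] ext[of w \<eta>] dout out cw
      smooth_on_continuous[OF u] smooth_on_continuous[OF \<eta>] smooth_on_continuous[OF smooth_on_partial[OF \<eta>]]
    by (subst (asm) Bochner_Integration.integral_add) blast+
  then show "(LBINT y:S. u y * pd i \<eta> y) = - (LBINT y:S. w y * \<eta> y)"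
    by (simp add: set_lebesgue_integral_def)
qed

text \<open>Two weak derivatives have the same integrals against test functions, so
  \<open>fundamental_lemma\<close> applies to their difference. This controls
  \<open>weak_differential\<close>, which is an arbitrary choice.\<close>

lemma weak_partial_deriv_unique:
  assumes S: "open S" and w: "weak_partial_deriv S u i w" "weak_partial_deriv S u i w'"
  shows "AE y in lborel. y \<in> S \<longrightarrow> w y = w' y"
proof -
  have "AE y in lborel. y \<in> S \<longrightarrow> w y - w' y = 0"
  proof (rule fundamental_lemma[OF S])
    show "set_integrable lborel K (\<lambda>y. w y - w' y)" if "compact K" "K \<subseteq> S" for K
      using w that unfolding weak_partial_deriv_def by (auto intro: set_integral_diff)
    fix \<eta> :: "real^'a \<Rightarrow> real" and K
    assume \<eta>: "smooth_on UNIV \<eta>" and K: "compact K" "K \<subseteq> S" and out: "\<And>y. y \<notin> K \<Longrightarrow> \<eta> y = 0"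
    have c: "continuous_on UNIV \<eta>" using smooth_on_continuous[OF \<eta>] .
    obtain B where B: "\<And>x. \<bar>\<eta> x\<bar> \<le> B" using integrable_compact_support(2)[OF c K(1) out] by blast
    have i: "set_integrable lborel S (\<lambda>y. v y * \<eta> y)" if "set_integrable lborel K v" for v
    proof -
      have v: "integrable lborel (\<lambda>y. indicator K y *\<^sub>R v y)" using that by (simp add: set_integrable_def)
      have "integrable lborel (\<lambda>y. (indicator K y *\<^sub>R v y) * \<eta> y)"
      proof (rule Bochner_Integration.integrable_bound[of _ "\<lambda>y. B * (indicator K y *\<^sub>R v y)"])
        show "integrable lborel (\<lambda>y. B * (indicator K y *\<^sub>R v y))" using v by (intro integrable_mult_right)
        show "(\<lambda>y. (indicator K y *\<^sub>R v y) * \<eta> y) \<in> borel_measurable lborel"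
          using borel_measurable_integrable[OF v] c by (intro borel_measurable_times) (auto intro: borel_measurable_continuous_onI)
        show "AE y in lborel. norm ((indicator K y *\<^sub>R v y) * \<eta> y) \<le> norm (B * (indicator K y *\<^sub>R v y))"
        proof (rule AE_I2)
          fix y
          have le: "\<bar>\<eta> y\<bar> \<le> \<bar>B\<bar>" using B[of y] by linarith
          then show "norm ((indicator K y *\<^sub>R v y) * \<eta> y) \<le> norm (B * (indicator K y *\<^sub>R v y))"
            using mult_right_mono[OF le, of "\<bar>indicator K y * v y\<bar>"] by (simp add: abs_mult mult_ac)
        qed
      qed
      moreover have "(\<lambda>y. (indicator K y *\<^sub>R v y) * \<eta> y) = (\<lambda>y. indicator S y *\<^sub>R (v y * \<eta> y))"
        using K(2) out by (auto simp: fun_eq_iff indicator_def)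
      ultimately show ?thesis by (simp add: set_integrable_def)
    qed
    have "set_integrable lborel K w" "set_integrable lborel K w'" using w K unfolding weak_partial_deriv_def by auto
    then have "(LBINT y:S. w y * \<eta> y - w' y * \<eta> y) = (LBINT y:S. w y * \<eta> y) - (LBINT y:S. w' y * \<eta> y)"
      by (intro set_integral_diff(2) i)
    also have "\<dots> = 0"
    proof -
      have "(LBINT y:S. u y * pd i \<eta> y) = - (LBINT y:S. v y * \<eta> y)" if "weak_partial_deriv S u i v" for v
        using that \<eta> K out unfolding weak_partial_deriv_def by blast
      from this[OF w(1)] this[OF w(2)] show ?thesis by simp
    qed
    finally show "(LBINT y:S. (w y - w' y) * \<eta> y) = 0" by (simp add: left_diff_distrib)
  qed
  then show ?thesis by simp
qed

lemma extended_integral_eq: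
  assumes "integrable \<nu> F" "(\<integral>\<^sup>+p\<in>V. ennreal (f p) \<partial>\<mu>) = (\<integral>\<^sup>+y. ennreal (F y) \<partial>\<nu>)"
    "(\<integral>\<^sup>+p\<in>V. ennreal (- f p) \<partial>\<mu>) = (\<integral>\<^sup>+y. ennreal (- F y) \<partial>\<nu>)"
  shows "extended_integral \<mu> V f = ereal (\<integral>y. F y \<partial>\<nu>)"
proof -
  obtain a where a: "a \<ge> 0" "(\<integral>\<^sup>+y. ennreal (F y) \<partial>\<nu>) = ennreal a"
    using assms(1) by (cases "\<integral>\<^sup>+y. ennreal (F y) \<partial>\<nu>" rule: ennreal_cases) (auto simp: real_integrable_def)
  obtain b where b: "b \<ge> 0" "(\<integral>\<^sup>+y. ennreal (- F y) \<partial>\<nu>) = ennreal b"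
    using assms(1) by (cases "\<integral>\<^sup>+y. ennreal (- F y) \<partial>\<nu>" rule: ennreal_cases) (auto simp: real_integrable_def)
  show ?thesis unfolding extended_integral_def assms(2,3) real_lebesgue_integral_def[OF assms(1)] a(2) b(2)
    using a(1) b(1) by simp
qed

lemma smooth_on_curv [smooth_intros]:
  assumes "open S" "metric_on S h"
  shows "smooth_on S (curv h i j)"
  unfolding curv_def[abs_def] by (intro smooth_intros assms)

lemma smooth_on_scal [smooth_intros]:
  assumes "open S" "metric_on S h"
  shows "smooth_on S (scal h)"
  unfolding scal_def[abs_def]
  by (intro smooth_intros assms(1) smooth_on_inv_metric[OF assms] smooth_on_curv[OF assms])

definition grad_sq :: "'n::finite mfield \<Rightarrow> (real^'n \<Rightarrow> real) \<Rightarrow> real^'n \<Rightarrow> real"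
  where "grad_sq h f y = (SUM i j. matrix_inv (h y) $ i $ j * (pd i f y * pd j f y))"

lemma smooth_on_grad_sq [smooth_intros]:
  assumes "open S" "metric_on S h" "smooth_on S f"
  shows "smooth_on S (grad_sq h f)"
  unfolding grad_sq_def[abs_def]
  by (intro smooth_intros assms(1) smooth_on_inv_metric[OF assms(1,2)] assms(3))

lemma grad_sq_eq: "w \<bullet> (P *v w) = (SUM i j. P $ i $ j * (w $ i * w $ j))"
  for P :: "real^'n::finite^'n"
  by (simp add: inner_vec_def matrix_vector_mult_def sum_distrib_left mult_ac)

text \<open>From \<open>ln t <= t\<close>, applied to \<open>t\<close> and to \<open>1/t\<close>. It
  dominates the logarithmic term of the entropy by a polynomial that vanishes wherever the test
  function does.\<close>

lemma abs_square_ln_le: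
  fixes t :: real
  assumes "t \<ge> 0"
  shows "\<bar>t\<^sup>2 * ln t\<bar> \<le> t + t ^ 3"
proof (cases "t = 0")
  case False
  then have t: "t > 0" using assms by simp
  have "ln t \<le> t" using ln_bound[OF t] by simp
  moreover have "- ln t \<le> 1 / t" using ln_bound[of "1/t"] t by (simp add: ln_div)
  ultimately have "\<bar>ln t\<bar> \<le> 1 / t + t" using t by (auto simp: abs_le_iff intro: add_increasing add_increasing2)
  then have "t\<^sup>2 * \<bar>ln t\<bar> \<le> t\<^sup>2 * (1 / t + t)" by (intro mult_left_mono) auto
  also have "\<dots> = t + t ^ 3" using t by (simp add: power2_eq_square power3_eq_cube field_simps)
  finally show ?thesis by (simp add: abs_mult)
qed simp

section \<open>A fixed manifold with a metric: charts, transition maps and local metrics\<close>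

context
  fixes M :: "'m::{t2_space, second_countable_topology} set" and A :: "('m, 'n::finite) chart set" and g :: "('m, 'n) metric"
  assumes M: "smooth_manifold M A" and g: "riemannian_metric A g"
begin

abbreviation "img c \<equiv> chart_map c ` chart_dom c"
abbreviation "overlap c c' \<equiv> chart_map c ` (chart_dom c \<inter> chart_dom c')"
abbreviation "loc c \<equiv> metric_in_chart g c"

lemma chart: "c \<in> A \<Longrightarrow> is_chart c"
  and cover: "(\<Union>c\<in>A. chart_dom c) = M"
  using M unfolding smooth_manifold_def by auto

definition "trn c c' x = chart_map c' (chart_inv c x)"

lemma transition_smooth: "c \<in> A \<Longrightarrow> c' \<in> A \<Longrightarrow> smooth_on (overlap c c') (trn c c')"
  using M unfolding smooth_manifold_def trn_def[abs_def] comp_def by auto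

lemma chart_open: "c \<in> A \<Longrightarrow> open (chart_dom c)" "c \<in> A \<Longrightarrow> open (img c)"
  and chart_inj: "c \<in> A \<Longrightarrow> inj_on (chart_map c) (chart_dom c)"
  and chart_cont: "c \<in> A \<Longrightarrow> continuous_on (chart_dom c) (chart_map c)"
  and chart_inv_cont: "c \<in> A \<Longrightarrow> continuous_on (img c) (chart_inv c)"
  using chart unfolding is_chart_def by auto

lemma chart_inv_map [simp]: "c \<in> A \<Longrightarrow> p \<in> chart_dom c \<Longrightarrow> chart_inv c (chart_map c p) = p"
  by (simp add: chart_inv_def chart_inj)

lemma chart_map_inv [simp]: "y \<in> img c \<Longrightarrow> chart_map c (chart_inv c y) = y"
  by (simp add: chart_inv_def f_inv_into_f)

lemma chart_inv_dom [simp]: "y \<in> img c \<Longrightarrow> chart_inv c y \<in> chart_dom c"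
  unfolding chart_inv_def by (rule inv_into_into)

lemma chart_image_eq: "c \<in> A \<Longrightarrow> B \<subseteq> chart_dom c \<Longrightarrow> chart_map c ` B = img c \<inter> chart_inv c -` B"
  by (auto simp: subset_iff)

lemma open_chart_image:
  assumes "c \<in> A" "open B"
  shows "open (chart_map c ` (B \<inter> chart_dom c))"
proof -
  have "chart_map c ` (B \<inter> chart_dom c) = img c \<inter> chart_inv c -` B"
    using chart_image_eq[OF assms(1), of "B \<inter> chart_dom c"] by auto
  then show ?thesis
    using continuous_open_preimage[OF chart_inv_cont[OF assms(1)] chart_open(2)[OF assms(1)] assms(2)] by simp
qed

lemma open_overlap: "c \<in> A \<Longrightarrow> c' \<in> A \<Longrightarrow> open (overlap c c')"
  using open_chart_image[of c "chart_dom c'"] chart_open by (simp add: Int_commute)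

lemma chart_image_sets: "c \<in> A \<Longrightarrow> B \<in> sets borel \<Longrightarrow> B \<subseteq> chart_dom c \<Longrightarrow> chart_map c ` B \<in> sets borel"
proof -
  assume c: "c \<in> A" "B \<in> sets borel" "B \<subseteq> chart_dom c"
  have "chart_inv c -` B \<inter> space (restrict_space borel (img c)) \<in> sets (restrict_space borel (img c))"
    by (rule measurable_sets[OF borel_measurable_continuous_on_restrict[OF chart_inv_cont[OF c(1)]] c(2)])
  then show ?thesis
    using chart_open(2)[OF c(1)] by (simp add: chart_image_eq[OF c(1,3)] sets_restrict_space_iff space_restrict_space Int_commute)
qed

lemma transition:
  assumes c: "c \<in> A" "c' \<in> A"
  defines "\<tau> \<equiv> trn c c'"
  shows "\<tau> ` overlap c c' = overlap c' c" "inj_on \<tau> (overlap c c')"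
    "x \<in> overlap c c' \<Longrightarrow> invertible (jac \<tau> x)"
    "x \<in> overlap c c' \<Longrightarrow> loc c x = pullback \<tau> (loc c') x"
proof -
  have e: "\<tau> (chart_map c p) = chart_map c' p" if "p \<in> chart_dom c" for p using that c by (simp add: \<tau>_def trn_def)
  show im: "\<tau> ` overlap c c' = overlap c' c" using e by (force simp: image_iff)
  show "inj_on \<tau> (overlap c c')"
    using e chart_inj[OF c(2)] by (auto simp: inj_on_def)
  assume x: "x \<in> overlap c c'"
  then obtain p where p: "p \<in> chart_dom c" "p \<in> chart_dom c'" "x = chart_map c p" by auto
  let ?\<sigma> = "trn c' c"
  have d: "\<tau> differentiable at x" using smooth_onD[OF transition_smooth[OF c]] x by (simp add: \<tau>_def)
  have d': "?\<sigma> differentiable at (\<tau> x)"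
    using smooth_onD[OF transition_smooth[OF c(2,1)]] x im by blast
  \<comment> \<open>The transition back undoes \<open>\<tau>\<close> on the whole overlap, not just
    at \<open>x\<close>, so the chain rule provides a left inverse of the Jacobian.\<close>
  have "jac (\<lambda>x. ?\<sigma> (\<tau> x)) x = jac (\<lambda>x. x) x"
  proof (rule jac_cong_open[OF open_overlap[OF c] x, symmetric])
    show "?\<sigma> (\<tau> z) = z" if z: "z \<in> overlap c c'" for z
    proof -
      obtain q where q: "q \<in> chart_dom c" "q \<in> chart_dom c'" "z = chart_map c q" using z by auto
      then show ?thesis using e[OF q(1)] c by (simp add: trn_def)
    qed
    show "(\<lambda>x. ?\<sigma> (\<tau> x)) differentiable at x" using differentiable_chain_at[OF d d'] by (simp add: o_def)
  qed
  then have "jac ?\<sigma> (\<tau> x) ** jac \<tau> x = mat 1" using jac_compose[OF d d'] by (simp add: jac_ident)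
  then show "invertible (jac \<tau> x)" using matrix_left_right_inverse invertible_def by blast
  have "g c p = transpose (transition_jacobian c c' p) ** g c' p ** transition_jacobian c c' p"
    using g c p unfolding riemannian_metric_def by blast
  moreover have "transition_jacobian c c' p = jac \<tau> x"
    by (simp add: transition_jacobian_def jacobian_def matrix_frechet_jac \<tau>_def p(3) trn_def[abs_def] comp_def)
  ultimately show "loc c x = pullback \<tau> (loc c') x"
    using p c e[OF p(1)] by (simp add: metric_in_chart_def pullback_def)
qed

lemma metric_on_chart: "c \<in> A \<Longrightarrow> metric_on (img c) (loc c)"
  unfolding metric_on_def
proof (intro conjI ballI)
  assume c: "c \<in> A"
  show "smooth_on (img c) (loc c)" using g c unfolding riemannian_metric_def by blast
  fix y assume y: "y \<in> img c"
  have "transpose (g c (chart_inv c y)) = g c (chart_inv c y) \<and> (\<forall>v. v \<noteq> 0 \<longrightarrow> v \<bullet> (g c (chart_inv c y) *v v) > 0)"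
    using g c chart_inv_dom[OF y] unfolding riemannian_metric_def by blast
  then show "transpose (loc c y) = loc c y" "\<forall>v. v \<noteq> 0 \<longrightarrow> v \<bullet> (loc c y *v v) > 0"
    by (simp_all add: metric_in_chart_def)
qed

lemma metric_on_overlap: "c \<in> A \<Longrightarrow> metric_on (overlap c c') (loc c)"
  by (rule metric_on_subset[OF metric_on_chart]) auto

lemma chart_at: "p \<in> M \<Longrightarrow> chart_at A p \<in> A \<and> p \<in> chart_dom (chart_at A p)"
  unfolding chart_at_def by (rule someI_ex) (use cover in auto)

text \<open>The chart picked by \<open>chart_at\<close> is related to \<open>c\<close> by a
  transition map, and \<open>scal\<close> is invariant under pullback.\<close>

lemma scalar_curvature_chart:
  assumes c: "c \<in> A" "p \<in> chart_dom c"
  shows "scalar_curvature A g p = scal (loc c) (chart_map c p)"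
proof -
  define c1 where "c1 = chart_at A p"
  have "p \<in> M" using c cover by blast
  then have c1: "c1 \<in> A" "p \<in> chart_dom c1" using chart_at by (auto simp: c1_def)
  let ?x = "chart_map c1 p" and ?\<tau> = "trn c1 c"
  have x: "?x \<in> img c1" "?x \<in> overlap c1 c" using c1 c by auto
  have "scalar_curvature A g p = scal (loc c1) ?x"
    by (simp add: scalar_curvature_def Let_def c1_def[symmetric] scal_def ricci_component_def
        riemann_component_eq_curv[OF chart_open(2)[OF c1(1)] metric_on_chart[OF c1(1)] x(1)])
  also have "\<dots> = scal (pullback ?\<tau> (loc c)) ?x"
    by (rule scal_cong_open[OF open_overlap[OF c1(1) c(1)] metric_on_overlap[OF c1(1)] transition(4)[OF c1(1) c(1)] x(2), symmetric])
  also have "\<dots> = scal (loc c) (?\<tau> ?x)"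
    by (rule scal_pullback[OF open_overlap[OF c1(1) c(1)] open_overlap[OF c(1) c1(1)] transition_smooth[OF c1(1) c(1)] _ transition(3)[OF c1(1) c(1)] metric_on_overlap[OF c(1)] x(2)])
     (simp add: transition(1)[OF c1(1) c(1)])
  finally show ?thesis using c1 by (simp add: trn_def)
qed

subsection \<open>The Riemannian volume\<close>

definition "vdens c y = sqrt (det (loc c y))"
definition "cvol c = density lborel (\<lambda>y. ennreal (indicator (img c) y * vdens c y))"

lemma continuous_vdens: "c \<in> A \<Longrightarrow> continuous_on (img c) (vdens c)"
  unfolding vdens_def[abs_def]
  by (intro continuous_intros smooth_on_continuous smooth_on_det chart_open metric_on_smooth metric_on_chart)

lemma measurable_vdens [measurable]: "c \<in> A \<Longrightarrow> (\<lambda>y. indicator (img c) y * vdens c y) \<in> borel_measurable borel"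
  by (rule measurable_indicator_continuous[OF chart_open(2) continuous_vdens])

lemma vdens_pos: "c \<in> A \<Longrightarrow> y \<in> img c \<Longrightarrow> vdens c y > 0"
  using metric_on_det_pos[OF metric_on_chart] by (simp add: vdens_def)

lemma sets_cvol [simp]: "sets (cvol c) = sets borel" by (simp add: cvol_def)

lemma emeasure_cvol:
  assumes "c \<in> A" "B \<in> sets borel" "B \<subseteq> chart_dom c"
  shows "emeasure (cvol c) (chart_map c ` B) = (\<integral>\<^sup>+y\<in>chart_map c ` B. ennreal (sqrt (det (loc c y))) \<partial>lborel)"
proof -
  have "emeasure (cvol c) (chart_map c ` B) = (\<integral>\<^sup>+y\<in>chart_map c ` B. ennreal (indicator (img c) y * vdens c y) \<partial>lborel)"
    unfolding cvol_def using chart_image_sets[OF assms] measurable_vdens[OF assms(1)] by (subst emeasure_density) auto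
  also have "\<dots> = (\<integral>\<^sup>+y\<in>chart_map c ` B. ennreal (sqrt (det (loc c y))) \<partial>lborel)"
    by (intro nn_integral_cong) (use assms(3) in \<open>auto simp: indicator_def vdens_def\<close>)
  finally show ?thesis .
qed

text \<open>The factor by which the two densities differ is the absolute Jacobian determinant of the
  transition map, exactly as in the change of variables formula.\<close>

lemma cvol_agree:
  assumes c: "c \<in> A" "c' \<in> A" and B: "B \<in> sets borel" "B \<subseteq> chart_dom c" "B \<subseteq> chart_dom c'"
  shows "emeasure (cvol c) (chart_map c ` B) = emeasure (cvol c') (chart_map c' ` B)"
proof -
  let ?\<tau> = "trn c c'" and ?S = "overlap c c'"
  define f where "f y = indicator (chart_map c' ` B) y * ennreal (indicator (img c') y * vdens c' y)" for y
  have f: "f \<in> borel_measurable borel" unfolding f_def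
    using chart_image_sets[OF c(2) B(1,3)] measurable_vdens[OF c(2)] by measurable
  have im: "open (?\<tau> ` ?S)" unfolding transition(1)[OF c] by (rule open_overlap[OF c(2,1)])
  have "emeasure (cvol c') (chart_map c' ` B) = (\<integral>\<^sup>+y\<in>?\<tau> ` ?S. f y \<partial>lborel)"
    unfolding emeasure_cvol[OF c(2) B(1,3)]
  proof (rule nn_integral_cong)
    fix y
    show "ennreal (sqrt (det (loc c' y))) * indicator (chart_map c' ` B) y = f y * indicator (?\<tau> ` ?S) y"
    proof (cases "y \<in> chart_map c' ` B")
      case True
      then have "y \<in> overlap c' c" "y \<in> img c'" using B by auto
      then show ?thesis using True by (simp add: f_def vdens_def transition(1)[OF c])
    qed (simp add: f_def)
  qed
  also have "\<dots> = (\<integral>\<^sup>+x\<in>?S. f (?\<tau> x) * ennreal \<bar>det (jac ?\<tau> x)\<bar> \<partial>lborel)"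
    by (rule nn_integral_change_of_variables[OF open_overlap[OF c] transition_smooth[OF c] transition(2)[OF c] im f])
  also have "\<dots> = emeasure (cvol c) (chart_map c ` B)"
    unfolding emeasure_cvol[OF c(1) B(1,2)]
  proof (rule nn_integral_cong)
    fix x
    show "f (?\<tau> x) * ennreal \<bar>det (jac ?\<tau> x)\<bar> * indicator ?S x = ennreal (sqrt (det (loc c x))) * indicator (chart_map c ` B) x"
    proof (cases "x \<in> ?S")
      case True
      then obtain p where p: "p \<in> chart_dom c" "p \<in> chart_dom c'" "x = chart_map c p" by auto
      have t: "?\<tau> x = chart_map c' p" using p c by (simp add: trn_def)
      have i1: "chart_map c' p \<in> chart_map c' ` B \<longleftrightarrow> p \<in> B"
        using B(3) p(2) inj_on_image_mem_iff[OF chart_inj[OF c(2)]] by blast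
      have i2: "x \<in> chart_map c ` B \<longleftrightarrow> p \<in> B"
        using B(2) p inj_on_image_mem_iff[OF chart_inj[OF c(1)]] by blast
      have "sqrt (det (loc c x)) = \<bar>det (jac ?\<tau> x)\<bar> * sqrt (det (loc c' (?\<tau> x)))"
        by (simp only: transition(4)[OF c True] det_pullback real_sqrt_mult real_sqrt_abs)
      then have "ennreal (sqrt (det (loc c x))) = ennreal (vdens c' (?\<tau> x)) * ennreal \<bar>det (jac ?\<tau> x)\<bar>"
        using vdens_pos[OF c(2), of "?\<tau> x"] p t by (simp add: ennreal_mult[symmetric] vdens_def mult.commute)
      then show ?thesis using True i1 i2 p t by (simp add: f_def indicator_def)
    next
      case False
      then have "x \<notin> chart_map c ` B" using B by auto
      then show ?thesis using False by simp
    qed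
  qed
  finally show ?thesis by simp
qed

lemma countable_cover:
  assumes "A \<noteq> {}"
  obtains e :: "nat \<Rightarrow> ('m, 'n) chart" where "range e \<subseteq> A" "(\<Union>n. chart_dom (e n)) = M"
proof -
  obtain F' where F': "F' \<subseteq> chart_dom ` A" "countable F'" "\<Union>F' = \<Union>(chart_dom ` A)"
    using Lindelof[of "chart_dom ` A"] chart_open(1) by (metis (no_types, lifting) imageE)
  obtain C where C: "C \<subseteq> A" "countable C" "F' = chart_dom ` C"
    using F'(1,2) by (metis countable_subset_image)
  obtain a where a: "a \<in> A" using assms by blast
  \<comment> \<open>The extra chart makes the family nonempty in any case, as enumerating it by
    natural numbers requires.\<close>
  let ?C = "insert a C"
  have "range (from_nat_into ?C) = ?C" using C by (intro range_from_nat_into) auto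
  moreover have "(\<Union>c\<in>?C. chart_dom c) = M" using F'(3) C a cover by auto
  ultimately have "range (from_nat_into ?C) \<subseteq> A" "(\<Union>n. chart_dom (from_nat_into ?C n)) = M"
    using C a by (simp, metis image_image)
  then show thesis using that by blast
qed

abbreviation "vol \<equiv> riemannian_volume A g"

text \<open>The volume is a definite description, so existence and uniqueness have to be shown
  first. Existence: cut \<open>M\<close> into countably many Borel pieces, each inside one chart,
  and add up the chart measures; \<open>cvol_agree\<close> shows independence of the pieces.
  Uniqueness: the same pieces determine every candidate.\<close>

lemma volume:
  assumes ne: "A \<noteq> {}"
  shows "sets vol = sets borel"
    and "c \<in> A \<Longrightarrow> B \<in> sets borel \<Longrightarrow> B \<subseteq> chart_dom c \<Longrightarrow> emeasure vol B = emeasure (cvol c) (chart_map c ` B)"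
proof -
  obtain e :: "nat \<Rightarrow> ('m, 'n) chart" where e: "range e \<subseteq> A" "(\<Union>n. chart_dom (e n)) = M" using countable_cover[OF ne] by blast
  then have eA: "e n \<in> A" for n by auto
  \<comment> \<open>A disjoint Borel partition of \<open>M\<close> subordinate to a countable family
    of charts.\<close>
  define D where "D n = disjointed (\<lambda>n. chart_dom (e n)) n" for n
  have oD: "D n \<in> sets borel" for n
    unfolding D_def disjointed_def using chart_open(1)[OF eA] by (intro sets.Diff sets.finite_UN) auto
  have Dd: "D n \<subseteq> chart_dom (e n)" for n unfolding D_def by (rule disjointed_subset)
  have Dun: "(\<Union>n. D n) = M" unfolding D_def using UN_disjointed_eq e(2) by metis
  have Ddis: "disjoint_family D" unfolding D_def by (rule disjoint_family_disjointed)
  have oM: "M \<in> sets borel" unfolding Dun[symmetric] using oD by auto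
  define P where "P \<mu> \<longleftrightarrow> sets \<mu> = sets borel \<and>
    (\<forall>c\<in>A. \<forall>B\<in>sets borel. B \<subseteq> chart_dom c \<longrightarrow>
       emeasure \<mu> B = (\<integral>\<^sup>+ y\<in>chart_map c ` B. ennreal (sqrt (det (metric_in_chart g c y))) \<partial>lborel)) \<and>
    emeasure \<mu> (- (\<Union>c\<in>A. chart_dom c)) = 0" for \<mu> :: "'m measure"
  have cv_suminf: "(\<Sum>n. emeasure (cvol c) (chart_map c ` (B n))) = emeasure (cvol c) (chart_map c ` (\<Union>n. B n))"
    if "c \<in> A" "\<And>n. B n \<in> sets borel" "\<And>n. B n \<subseteq> chart_dom c" "disjoint_family B" for c and B :: "nat \<Rightarrow> 'm set"
  proof -
    have "disjoint_family (\<lambda>n. chart_map c ` B n)" unfolding disjoint_family_on_def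
    proof (intro ballI impI)
      fix m n :: nat assume "m \<noteq> n"
      then have "B m \<inter> B n = {}" using that(4) by (auto simp: disjoint_family_on_def)
      then show "chart_map c ` B m \<inter> chart_map c ` B n = {}"
        using inj_on_image_Int[OF chart_inj[OF that(1)] that(3,3)] by (metis image_empty)
    qed
    then have "(\<Sum>n. emeasure (cvol c) (chart_map c ` (B n))) = emeasure (cvol c) (\<Union>n. chart_map c ` B n)"
      by (intro suminf_emeasure) (use chart_image_sets[OF that(1)] that in auto)
    then show ?thesis by (simp add: image_UN)
  qed
  define \<mu>0 where "\<mu>0 B = (\<Sum>n. emeasure (cvol (e n)) (chart_map (e n) ` (B \<inter> D n)))" for B
  define \<mu> where "\<mu> = measure_of UNIV (sets borel) \<mu>0"
  have sets\<mu>: "sets \<mu> = sets borel" unfolding \<mu>_def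
    by (metis sets.sigma_sets_eq sets_measure_of space_borel subset_Pow_Union Sup_UNIV sets.space_closed)
  have ca: "countably_additive (sets \<mu>) \<mu>0"
  proof (rule countably_additiveI)
    fix B :: "nat \<Rightarrow> 'm set" assume B: "range B \<subseteq> sets \<mu>" "disjoint_family B" "(\<Union>i. B i) \<in> sets \<mu>"
    have "(\<Sum>i. \<mu>0 (B i)) = (\<Sum>i. \<integral>\<^sup>+n. emeasure (cvol (e n)) (chart_map (e n) ` (B i \<inter> D n)) \<partial>count_space UNIV)"
      by (simp add: \<mu>0_def nn_integral_count_space_nat)
    also have "\<dots> = (\<integral>\<^sup>+n. (\<Sum>i. emeasure (cvol (e n)) (chart_map (e n) ` (B i \<inter> D n))) \<partial>count_space UNIV)"
      by (rule nn_integral_suminf[symmetric]) simp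
    also have "\<dots> = (\<Sum>n. (\<Sum>i. emeasure (cvol (e n)) (chart_map (e n) ` (B i \<inter> D n))))"
      by (rule nn_integral_count_space_nat)
    also have "\<dots> = (\<Sum>n. emeasure (cvol (e n)) (chart_map (e n) ` (\<Union>i. B i \<inter> D n)))"
    proof (intro suminf_cong cv_suminf eA)
      fix n
      show "B i \<inter> D n \<in> sets borel" for i using B(1) oD sets\<mu> by auto
      show "B i \<inter> D n \<subseteq> chart_dom (e n)" for i using Dd by blast
      show "disjoint_family (\<lambda>i. B i \<inter> D n)" using B(2) unfolding disjoint_family_on_def by blast
    qed
    also have "\<dots> = \<mu>0 (\<Union>i. B i)" by (simp add: \<mu>0_def)
    finally show "(\<Sum>i. \<mu>0 (B i)) = \<mu>0 (\<Union>i. B i)" .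
  qed
  have em: "emeasure \<mu> B = \<mu>0 B" if "B \<in> sets borel" for B
    by (rule emeasure_measure_of[OF \<mu>_def _ _ ca]) (use that sets\<mu> in \<open>auto simp: positive_def \<mu>0_def\<close>)
  have ex: "P \<mu>" unfolding P_def
  proof (intro conjI ballI impI sets\<mu>)
    fix c B assume c: "c \<in> A" and B: "B \<in> sets borel" "B \<subseteq> chart_dom c"
    have "emeasure \<mu> B = (\<Sum>n. emeasure (cvol c) (chart_map c ` (B \<inter> D n)))"
      unfolding em[OF B(1)] \<mu>0_def
      by (intro suminf_cong cvol_agree) (use eA c B oD Dd in blast)+
    also have "\<dots> = emeasure (cvol c) (chart_map c ` (\<Union>n. B \<inter> D n))"
    proof (rule cv_suminf[OF c])
      show "disjoint_family (\<lambda>n. B \<inter> D n)" using Ddis unfolding disjoint_family_on_def by blast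
    qed (use B oD in auto)
    also have "(\<Union>n. B \<inter> D n) = B" using B c cover Dun by blast
    finally show "emeasure \<mu> B = (\<integral>\<^sup>+ y\<in>chart_map c ` B. ennreal (sqrt (det (metric_in_chart g c y))) \<partial>lborel)"
      using emeasure_cvol[OF c B] by simp
  next
    have "- M \<in> sets borel" using oM by auto
    moreover have "- M \<inter> D n = {}" for n using Dun by blast
    ultimately show "emeasure \<mu> (- (\<Union>c\<in>A. chart_dom c)) = 0" unfolding cover by (simp add: em \<mu>0_def)
  qed
  have un: "\<mu>' = \<mu>" if P': "P \<mu>'" for \<mu>'
  proof (rule measure_eqI)
    show "sets \<mu>' = sets \<mu>" using P' ex by (simp add: P_def)
    fix B assume "B \<in> sets \<mu>'"
    then have B: "B \<in> sets borel" using P' by (simp add: P_def)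
    have val: "emeasure \<nu> B = (\<Sum>n. emeasure (cvol (e n)) (chart_map (e n) ` (B \<inter> D n)))" if "P \<nu>" for \<nu>
    proof -
      have s: "sets \<nu> = sets borel" using that by (simp add: P_def)
      have "emeasure \<nu> (- M) = 0" using that cover by (simp add: P_def)
      \<comment> \<open>The part of \<open>B\<close> outside the manifold is null by the last clause
        of the description.\<close>
      then have z: "emeasure \<nu> (B - M) = 0"
        using emeasure_mono[of "B - M" "- M" \<nu>] s oM by auto
      have "emeasure \<nu> B = emeasure \<nu> (B \<inter> M) + emeasure \<nu> (B - M)"
        using plus_emeasure[of "B \<inter> M" \<nu> "B - M"] s B oM by (simp add: Int_Diff_Un Int_Diff_disjoint)
      also have "\<dots> = emeasure \<nu> (\<Union>n. B \<inter> D n)" using z Dun by (simp flip: Int_UN_distrib)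
      also have "\<dots> = (\<Sum>n. emeasure \<nu> (B \<inter> D n))"
      proof (rule suminf_emeasure[symmetric])
        show "disjoint_family (\<lambda>n. B \<inter> D n)" using Ddis unfolding disjoint_family_on_def by blast
      qed (use s B oD in auto)
      also have "\<dots> = (\<Sum>n. emeasure (cvol (e n)) (chart_map (e n) ` (B \<inter> D n)))"
      proof (rule suminf_cong)
        fix n
        have b: "B \<inter> D n \<in> sets borel" "B \<inter> D n \<subseteq> chart_dom (e n)" using B oD Dd by auto
        show "emeasure \<nu> (B \<inter> D n) = emeasure (cvol (e n)) (chart_map (e n) ` (B \<inter> D n))"
          using that eA b emeasure_cvol[OF eA b] by (simp add: P_def)
      qed
      finally show ?thesis .
    qed
    show "emeasure \<mu>' B = emeasure \<mu> B" using val[OF P'] val[OF ex] by simp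
  qed
  have "P (THE \<mu>. P \<mu>)" using theI[of P, OF ex un] .
  then have PV: "P vol" unfolding riemannian_volume_def P_def .
  then show "sets vol = sets borel" by (simp add: P_def)
  show "emeasure vol B = emeasure (cvol c) (chart_map c ` B)" if "c \<in> A" "B \<in> sets borel" "B \<subseteq> chart_dom c"
    using PV that emeasure_cvol[OF that] by (simp add: P_def)
qed

lemma AE_volume_chart:
  assumes c: "c \<in> A" and ae: "AE y in lborel. y \<in> img c \<longrightarrow> Q y"
  shows "AE p in vol. p \<in> chart_dom c \<longrightarrow> Q (chart_map c p)"
proof -
  have ne: "A \<noteq> {}" using c by auto
  obtain N where N: "N \<in> null_sets lborel" "{y. \<not> (y \<in> img c \<longrightarrow> Q y)} \<subseteq> N"
    using ae unfolding eventually_ae_filter by auto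
  define Z where "Z = {p \<in> chart_dom c. chart_map c p \<in> N}"
  have Nb: "N \<in> sets borel" using N by auto
  have "chart_map c -` N \<inter> space (restrict_space borel (chart_dom c)) \<in> sets (restrict_space borel (chart_dom c))"
    by (rule measurable_sets[OF borel_measurable_continuous_on_restrict[OF chart_cont[OF c]] Nb])
  moreover have "chart_map c -` N \<inter> space (restrict_space borel (chart_dom c)) = Z"
    by (auto simp: Z_def space_restrict_space)
  ultimately have Z: "Z \<in> sets borel" "Z \<subseteq> chart_dom c"
    using chart_open(1)[OF c] by (auto simp: sets_restrict_space_iff Z_def)
  have "emeasure vol Z = emeasure (cvol c) (chart_map c ` Z)" by (rule volume(2)[OF ne c Z])
  also have "\<dots> \<le> emeasure (cvol c) N" by (rule emeasure_mono) (use Nb in \<open>auto simp: Z_def\<close>)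
  also have "\<dots> = 0"
  proof -
    have "absolutely_continuous lborel (cvol c)"
      unfolding cvol_def by (rule absolutely_continuousI_density) (use measurable_vdens[OF c] in simp)
    then show ?thesis using N(1) unfolding absolutely_continuous_def by auto
  qed
  finally have "Z \<in> null_sets vol" using Z volume(1)[OF ne] by auto
  then show ?thesis
    by (rule AE_I') (use N(2) in \<open>auto simp: Z_def\<close>)
qed

lemma nn_integral_volume_chart:
  assumes c: "c \<in> A" and f: "f \<in> borel_measurable borel"
  shows "(\<integral>\<^sup>+p\<in>chart_dom c. f p \<partial>vol) = (\<integral>\<^sup>+y\<in>img c. f (chart_inv c y) * ennreal (vdens c y) \<partial>lborel)"
proof -
  have ne: "A \<noteq> {}" using c by auto
  \<comment> \<open>The inverse chart made total by a constant value, which turns it into a Borel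
    map; the density of \<open>cvol c\<close> vanishes where the value is artificial.\<close>
  define J where "J y = (if y \<in> img c then chart_inv c y else undefined)" for y
  have J [measurable]: "J \<in> borel_measurable borel" unfolding J_def
    using borel_measurable_continuous_on_if[OF _ chart_inv_cont[OF c] continuous_on_const] chart_open(2)[OF c] by simp
  have [measurable]: "(\<lambda>y. indicator (img c) y * vdens c y) \<in> borel_measurable borel" using measurable_vdens[OF c] .
  have sv: "sets vol = sets borel" using volume(1)[OF ne] .
  have od: "chart_dom c \<in> sets borel" using chart_open[OF c] by auto
  have eq: "density vol (indicator (chart_dom c)) = distr (cvol c) borel J"
  proof (rule measure_eqI)
    show "sets (density vol (indicator (chart_dom c))) = sets (distr (cvol c) borel J)" by (simp add: sv)
    fix B assume "B \<in> sets (density vol (indicator (chart_dom c)))"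
    then have B: "B \<in> sets borel" by (simp add: sv)
    have "emeasure (density vol (indicator (chart_dom c))) B = emeasure vol (B \<inter> chart_dom c)"
      using B od sv by (subst emeasure_density) (auto simp: Int_commute simp flip: indicator_inter_arith)
    also have "\<dots> = emeasure (cvol c) (chart_map c ` (B \<inter> chart_dom c))"
      by (rule volume(2)[OF ne c]) (use B od in auto)
    also have "\<dots> = (\<integral>\<^sup>+y\<in>chart_map c ` (B \<inter> chart_dom c). ennreal (indicator (img c) y * vdens c y) \<partial>lborel)"
      unfolding cvol_def using chart_image_sets[OF c, of "B \<inter> chart_dom c"] B od by (subst emeasure_density) auto
    also have "\<dots> = (\<integral>\<^sup>+y\<in>J -` B. ennreal (indicator (img c) y * vdens c y) \<partial>lborel)"
    proof (rule nn_integral_cong)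
      fix y
      have "y \<in> img c \<Longrightarrow> y \<in> chart_map c ` (B \<inter> chart_dom c) \<longleftrightarrow> J y \<in> B"
        unfolding J_def using c by auto
      then show "ennreal (indicator (img c) y * vdens c y) * indicator (chart_map c ` (B \<inter> chart_dom c)) y
          = ennreal (indicator (img c) y * vdens c y) * indicator (J -` B) y"
        by (cases "y \<in> img c") (auto simp: indicator_def)
    qed
    also have "\<dots> = emeasure (distr (cvol c) borel J) B"
      using measurable_sets_borel[OF J B] B by (simp add: emeasure_distr cvol_def emeasure_density)
    finally show "emeasure (density vol (indicator (chart_dom c))) B = emeasure (distr (cvol c) borel J) B" .
  qed
  have "(\<integral>\<^sup>+p\<in>chart_dom c. f p \<partial>vol) = (\<integral>\<^sup>+p. f p \<partial>density vol (indicator (chart_dom c)))"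
    using f od sv by (subst nn_integral_density) (auto simp: mult.commute cong: measurable_cong_sets)
  also have "\<dots> = (\<integral>\<^sup>+y. f (J y) \<partial>cvol c)"
    unfolding eq using f by (subst nn_integral_distr) (auto cong: measurable_cong_sets)
  also have "\<dots> = (\<integral>\<^sup>+y. ennreal (indicator (img c) y * vdens c y) * f (J y) \<partial>lborel)"
    unfolding cvol_def using f by (subst nn_integral_density) auto
  also have "\<dots> = (\<integral>\<^sup>+y\<in>img c. f (chart_inv c y) * ennreal (vdens c y) \<partial>lborel)"
    by (intro nn_integral_cong) (auto simp: indicator_def J_def mult.commute)
  finally show ?thesis .
qed

subsection \<open>Test functions supported in a chart\<close>

definition cdiff :: "('m \<Rightarrow> real) \<Rightarrow> ('m, 'n) covector_field"
  where "cdiff f c p = (\<chi> i. pd i (\<lambda>y. f (chart_inv c y)) (chart_map c p))"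

context
  fixes V :: "'m set" and c0 :: "('m, 'n) chart"
  assumes V: "open V" "V \<subseteq> M" and c0: "c0 \<in> A"
begin

definition "lift f p = (if p \<in> chart_dom c0 then f (chart_map c0 p) else (0::real))"

lemma measurable_lift:
  assumes "(\<lambda>y. indicator (img c0) y * F y) \<in> borel_measurable borel"
  shows "lift F \<in> borel_measurable borel"
proof -
  let ?c = "\<lambda>p. if p \<in> chart_dom c0 then chart_map c0 p else 0"
  have od: "chart_dom c0 \<in> sets borel" using chart_open(1)[OF c0] by auto
  have "?c \<in> borel_measurable borel"
    by (rule borel_measurable_continuous_on_if[OF od chart_cont[OF c0] continuous_on_const])
  from measurable_compose[OF this assms]
  have [measurable]: "(\<lambda>p. indicator (img c0) (?c p) * F (?c p)) \<in> borel_measurable borel" .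
  have [measurable]: "chart_dom c0 \<in> sets borel" by (rule od)
  have "(\<lambda>p. indicator (chart_dom c0) p * (indicator (img c0) (?c p) * F (?c p))) \<in> borel_measurable borel"
    by measurable
  moreover have "(\<lambda>p. indicator (chart_dom c0) p * (indicator (img c0) (?c p) * F (?c p))) = lift F"
    by (auto simp: fun_eq_iff lift_def indicator_def)
  ultimately show ?thesis by simp
qed

text \<open>Only agreement almost everywhere is required of \<open>f\<close>, because the gradient
  in the entropy comes from a chosen weak differential and is determined just up to null
  sets.\<close>

lemma nn_integral_lift:
  assumes F: "(\<lambda>y. indicator (img c0) y * F y) \<in> borel_measurable borel"
    and K: "K \<subseteq> chart_map c0 ` (V \<inter> chart_dom c0)" "\<forall>y\<in>img c0 - K. F y = 0"
    and f: "AE p in vol. p \<in> V \<longrightarrow> f p = lift F p"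
  shows "(\<integral>\<^sup>+p\<in>V. ennreal (f p) \<partial>vol) = (\<integral>\<^sup>+y. ennreal (indicator (img c0) y * (F y * vdens c0 y)) \<partial>lborel)"
proof -
  have z: "lift F p = 0" if "p \<notin> V" for p
  proof (cases "p \<in> chart_dom c0")
    case True
    have "chart_map c0 p \<notin> K"
    proof
      assume "chart_map c0 p \<in> K"
      then obtain q where "q \<in> V" "q \<in> chart_dom c0" "chart_map c0 p = chart_map c0 q" using K by blast
      then have "p = q" using chart_inj[OF c0] True by (auto dest: inj_onD)
      then show False using that \<open>q \<in> V\<close> by simp
    qed
    then show ?thesis using K(2) True by (simp add: lift_def)
  qed (simp add: lift_def)
  have "(\<integral>\<^sup>+p\<in>V. ennreal (f p) \<partial>vol) = (\<integral>\<^sup>+p\<in>chart_dom c0. ennreal (lift F p) \<partial>vol)"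
    by (rule nn_integral_cong_AE, use f in eventually_elim)
      (auto simp: indicator_def z; auto simp: lift_def)
  also have "\<dots> = (\<integral>\<^sup>+y\<in>img c0. ennreal (lift F (chart_inv c0 y)) * ennreal (vdens c0 y) \<partial>lborel)"
    by (rule nn_integral_volume_chart[OF c0]) (use measurable_lift[OF F] in measurable)
  also have "\<dots> = (\<integral>\<^sup>+y. ennreal (indicator (img c0) y * (F y * vdens c0 y)) \<partial>lborel)"
  proof (rule nn_integral_cong)
    fix y
    show "ennreal (lift F (chart_inv c0 y)) * ennreal (vdens c0 y) * indicator (img c0) y = ennreal (indicator (img c0) y * (F y * vdens c0 y))"
    proof (cases "y \<in> img c0")
      case True
      have "lift F (chart_inv c0 y) = F y"
        unfolding lift_def using chart_inv_dom[OF True] chart_map_inv[OF True] by simp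
      then show ?thesis using vdens_pos[OF c0 True] True by (simp add: ennreal_mult'')
    qed simp
  qed
  finally show ?thesis .
qed

context
  fixes f :: "real^'n \<Rightarrow> real" and K :: "(real^'n) set"
  assumes f: "smooth_on UNIV f" and K: "compact K" "K \<subseteq> chart_map c0 ` (V \<inter> chart_dom c0)"
    and outside: "\<forall>y. y \<notin> K \<longrightarrow> f y = 0"
begin

lemma out: "y \<notin> K \<Longrightarrow> f y = 0"
  using outside by blast

lemma support: "compact (chart_inv c0 ` K)" "chart_inv c0 ` K \<subseteq> V" "chart_inv c0 ` K \<subseteq> chart_dom c0"
  "p \<notin> chart_inv c0 ` K \<Longrightarrow> lift f p = 0"
proof -
  have "K \<subseteq> img c0" using K(2) by blast
  then show "compact (chart_inv c0 ` K)"
    using compact_continuous_image[OF continuous_on_subset[OF chart_inv_cont[OF c0]] K(1)] by blast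
  show "chart_inv c0 ` K \<subseteq> V" "chart_inv c0 ` K \<subseteq> chart_dom c0" using K(2) c0 by auto
  assume p: "p \<notin> chart_inv c0 ` K"
  have "chart_map c0 p \<notin> K" if "p \<in> chart_dom c0" using p c0 that by (metis chart_inv_map imageI)
  then show "lift f p = 0" by (simp add: lift_def out)
qed

text \<open>In a Hausdorff space the compact support is closed. So every chart domain is covered by
  the overlap with \<open>c0\<close>, where the function is a composition with a transition map, and
  an open set where it is zero.\<close>

lemma lift_smooth:
  assumes c: "c \<in> A"
  shows "smooth_on (img c) (\<lambda>y. lift f (chart_inv c y))"
proof -
  let ?S = "overlap c c0" and ?T = "img c \<inter> chart_inv c -` (- (chart_inv c0 ` K))"
  have oT: "open ?T"
    by (rule continuous_open_preimage[OF chart_inv_cont[OF c] chart_open(2)[OF c]])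
      (use compact_imp_closed[OF support(1)] in auto)
  have "smooth_on ?S (\<lambda>y. f (trn c c0 y))"
    by (rule smooth_on_compose[OF open_overlap[OF c c0] open_UNIV _ transition_smooth[OF c c0] f]) simp
  then have 1: "smooth_on ?S (\<lambda>y. lift f (chart_inv c y))"
    by (rule smooth_on_cong[OF open_overlap[OF c c0], rotated]) (use c in \<open>auto simp: lift_def trn_def\<close>)
  have 2: "smooth_on ?T (\<lambda>y. lift f (chart_inv c y))"
    by (rule smooth_on_cong[OF oT _ smooth_on_const[of _ 0]]) (use support(4) in auto)
  have "?S \<union> ?T = img c"
  proof (intro equalityI subsetI)
    fix y assume y: "y \<in> img c"
    show "y \<in> ?S \<union> ?T"
    proof (cases "chart_inv c y \<in> chart_inv c0 ` K")
      case True
      then have "chart_inv c y \<in> chart_dom c0" using support(3) by blast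
      then have "y \<in> ?S" using y chart_inv_dom[OF y] chart_map_inv[OF y] by (metis IntI imageI)
      then show ?thesis by blast
    qed (use y in auto)
  qed auto
  then show ?thesis using smooth_on_Un[OF open_overlap[OF c c0] oT 1 2] by simp
qed

lemma lift_test_function: "lift f \<in> test_functions A V"
  unfolding test_functions_def using lift_smooth support by (auto simp: comp_def)

lemma cdiff_transform:
  assumes c: "c \<in> A" "c' \<in> A" and p: "p \<in> chart_dom c" "p \<in> chart_dom c'"
  shows "cdiff (lift f) c p = transpose (transition_jacobian c c' p) *v cdiff (lift f) c' p"
proof -
  let ?x = "chart_map c p"
  have x: "?x \<in> overlap c c'" using p by auto
  have tx: "trn c c' ?x = chart_map c' p" using c p by (simp add: trn_def)
  have J: "transition_jacobian c c' p = jac (trn c c') ?x"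
    by (simp add: transition_jacobian_def jacobian_def matrix_frechet_jac trn_def[abs_def] comp_def)
  have d1: "trn c c' differentiable (at ?x)" using smooth_onD[OF transition_smooth[OF c] x] .
  have d2: "(\<lambda>y. lift f (chart_inv c' y)) differentiable (at (trn c c' ?x))"
    unfolding tx by (rule smooth_onD[OF lift_smooth[OF c(2)]]) (use p in auto)
  have "pd i (\<lambda>y. lift f (chart_inv c y)) ?x = (SUM j. jac (trn c c') ?x $ j $ i *\<^sub>R pd j (\<lambda>y. lift f (chart_inv c' y)) (chart_map c' p))" for i
  proof -
    have "pd i (\<lambda>y. lift f (chart_inv c y)) ?x = pd i (\<lambda>y. lift f (chart_inv c' (trn c c' y))) ?x"
      by (rule pd_cong_open[OF open_overlap[OF c] x])
        (use c differentiable_chain_at[OF d1 d2] in \<open>auto simp: trn_def comp_def\<close>)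
    then show ?thesis using pd_comp_jac[OF d1 d2] by (simp add: tx)
  qed
  then show ?thesis unfolding J
    by (simp add: cdiff_def vec_eq_iff matrix_vector_mult_def transpose_component)
qed

lemma weak_differential_lift: "is_weak_differential A V (lift f) (cdiff (lift f))"
  unfolding is_weak_differential_def
proof (intro conjI ballI allI)
  fix c c' p assume "c \<in> A" "c' \<in> A" "p \<in> V \<inter> chart_dom c \<inter> chart_dom c'"
  then show "cdiff (lift f) c p = transpose (transition_jacobian c c' p) *v cdiff (lift f) c' p"
    using cdiff_transform by blast
next
  fix c i assume c: "c \<in> A"
  have "chart_map c ` (V \<inter> chart_dom c) \<subseteq> img c" by blast
  then show "weak_partial_deriv (chart_map c ` (V \<inter> chart_dom c)) (\<lambda>y. lift f (chart_inv c y)) i (\<lambda>y. cdiff (lift f) c (chart_inv c y) $ i)"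
    by (intro weak_partial_deriv_smooth open_chart_image[OF c V(1)] smooth_on_subset[OF lift_smooth[OF c]])
      (auto simp: cdiff_def c)
qed

text \<open>In each single chart the chosen weak differential agrees with the classical one outside
  a null set, by uniqueness of weak derivatives. A countable cover gives one null set for all its
  charts, and the transformation laws carry the length of the covector over to the chart used by
  \<open>chart_at\<close> and to \<open>c0\<close>.\<close>

lemma AE_grad_lift: "AE p in vol. p \<in> V \<longrightarrow> grad_norm_sq A g V (lift f) p = lift (grad_sq (loc c0) f) p"
proof -
  define \<omega> where "\<omega> = weak_differential A V (lift f)"
  define q where "q c \<theta> p = \<theta> c p \<bullet> (matrix_inv (g c p) *v \<theta> c p)" for c and \<theta> :: "('m, 'n) covector_field" and p
  have \<omega>: "is_weak_differential A V (lift f) \<omega>"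
    unfolding \<omega>_def weak_differential_def by (rule someI[of _ "cdiff (lift f)"]) (rule weak_differential_lift)
  have qinv: "q c \<theta> p = q c' \<theta> p"
    if "c \<in> A" "c' \<in> A" "p \<in> chart_dom c" "p \<in> chart_dom c'" "\<theta> c p = transpose (transition_jacobian c c' p) *v \<theta> c' p" for c c' \<theta> p
  proof -
    let ?x = "chart_map c p"
    have x: "?x \<in> overlap c c'" using that by auto
    have J: "transition_jacobian c c' p = jac (trn c c') ?x"
      by (simp add: transition_jacobian_def jacobian_def matrix_frechet_jac trn_def[abs_def] comp_def)
    have gg: "g c p = transpose (transition_jacobian c c' p) ** g c' p ** transition_jacobian c c' p"
      using g that unfolding riemannian_metric_def by blast
    have "invertible (loc c' (chart_map c' p))"
      using metric_on_invertible[OF metric_on_chart[OF that(2)]] that by blast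
    then have "invertible (g c' p)" using that by (simp add: metric_in_chart_def)
    then show ?thesis unfolding q_def that(5) gg J
      using inner_pullback_inv transition(3)[OF that(1,2) x] by blast
  qed
  have chartwise: "AE p in vol. p \<in> V \<inter> chart_dom c \<longrightarrow> \<omega> c p = cdiff (lift f) c p" if c: "c \<in> A" for c
  proof -
    let ?S = "chart_map c ` (V \<inter> chart_dom c)"
    have "AE y in lborel. y \<in> ?S \<longrightarrow> \<omega> c (chart_inv c y) $ i = cdiff (lift f) c (chart_inv c y) $ i" for i
      by (rule weak_partial_deriv_unique[OF open_chart_image[OF c V(1)]])
       (use \<omega> weak_differential_lift c in \<open>unfold is_weak_differential_def, blast+\<close>)
    then have "AE y in lborel. \<forall>i. y \<in> ?S \<longrightarrow> \<omega> c (chart_inv c y) $ i = cdiff (lift f) c (chart_inv c y) $ i"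
      unfolding AE_all_countable ..
    then have "AE y in lborel. y \<in> img c \<longrightarrow> (y \<in> ?S \<longrightarrow> \<omega> c (chart_inv c y) = cdiff (lift f) c (chart_inv c y))"
      by eventually_elim (auto simp: vec_eq_iff)
    from AE_volume_chart[OF c this] show ?thesis
      by eventually_elim (use c in auto)
  qed
  have ne: "A \<noteq> {}" using c0 by auto
  obtain e :: "nat \<Rightarrow> ('m, 'n) chart" where e: "range e \<subseteq> A" "(\<Union>n. chart_dom (e n)) = M"
    using countable_cover[OF ne] by blast
  \<comment> \<open>This passage needs countably many charts; the atlas itself may be
    uncountable.\<close>
  have "AE p in vol. \<forall>n. p \<in> V \<inter> chart_dom (e n) \<longrightarrow> \<omega> (e n) p = cdiff (lift f) (e n) p"
    unfolding AE_all_countable using chartwise e(1) by blast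
  then show ?thesis
  proof eventually_elim
    fix p assume ae: "\<forall>n. p \<in> V \<inter> chart_dom (e n) \<longrightarrow> \<omega> (e n) p = cdiff (lift f) (e n) p"
    show "p \<in> V \<longrightarrow> grad_norm_sq A g V (lift f) p = lift (grad_sq (loc c0) f) p"
    proof
      assume pV: "p \<in> V"
      then have pM: "p \<in> M" using V by blast
      then obtain n where n: "p \<in> chart_dom (e n)" using e by blast
      define c where "c = e n"
      have c: "c \<in> A" "p \<in> chart_dom c" using e n by (auto simp: c_def)
      define c1 where "c1 = chart_at A p"
      have c1: "c1 \<in> A" "p \<in> chart_dom c1" using chart_at[OF pM] by (auto simp: c1_def)
      have "grad_norm_sq A g V (lift f) p = q c1 \<omega> p"
        by (simp add: grad_norm_sq_def Let_def q_def c1_def \<omega>_def)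
      \<comment> \<open>The chart \<open>c1\<close> chosen at \<open>p\<close> may lie outside the
        countable family, so no almost everywhere statement is available for it. The transformation
        law in \<open>is_weak_differential\<close> holds at every point of \<open>V\<close> and
        bridges the gap.\<close>
      also have "\<dots> = q c \<omega> p"
        by (rule qinv[OF c1(1) c(1) c1(2) c(2)])
         (use \<omega> c c1 pV in \<open>unfold is_weak_differential_def, blast\<close>)
      also have "\<dots> = q c (cdiff (lift f)) p" using ae pV n by (simp add: q_def c_def)
      also have "\<dots> = lift (grad_sq (loc c0) f) p"
      proof (cases "p \<in> chart_dom c0")
        case True
        have "q c (cdiff (lift f)) p = q c0 (cdiff (lift f)) p"
          by (intro qinv cdiff_transform c c0 True)
        moreover have "cdiff (lift f) c0 p = (\<chi> i. pd i f (chart_map c0 p))"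
        proof -
          have "pd i (\<lambda>y. lift f (chart_inv c0 y)) (chart_map c0 p) = pd i f (chart_map c0 p)" for i
            by (rule pd_cong_open[OF chart_open(2)[OF c0]])
              (use True c0 smooth_onD[OF f] in \<open>auto simp: lift_def\<close>)
          then show ?thesis by (simp add: cdiff_def)
        qed
        ultimately show ?thesis using True c0
          by (simp add: q_def lift_def grad_sq_eq grad_sq_def metric_in_chart_def)
      next
        case False
        let ?T = "img c \<inter> chart_inv c -` (- (chart_inv c0 ` K))"
        have oT: "open ?T"
          by (rule continuous_open_preimage[OF chart_inv_cont[OF c(1)] chart_open(2)[OF c(1)]])
            (use compact_imp_closed[OF support(1)] in auto)
        have "chart_map c p \<in> ?T" using False support(3) c by auto
        have "pd i (\<lambda>y. lift f (chart_inv c y)) (chart_map c p) = pd i (\<lambda>y. 0) (chart_map c p)" for i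
          by (rule pd_cong_open[OF oT \<open>chart_map c p \<in> ?T\<close>]) (use support(4) in auto)
        then have "cdiff (lift f) c p = 0" by (simp add: cdiff_def vec_eq_iff)
        then show ?thesis using False by (simp add: q_def lift_def)
      qed
      finally show "grad_norm_sq A g V (lift f) p = lift (grad_sq (loc c0) f) p" .
    qed
  qed
qed

lemma measurable_integrable_lift:
  assumes F: "continuous_on (img c0) F" "\<forall>y\<in>img c0 - K. F y = 0"
  shows "(\<lambda>y. indicator (img c0) y * F y) \<in> borel_measurable borel"
    and "integrable lborel (\<lambda>y. indicator (img c0) y * (F y * vdens c0 y))"
proof -
  show "(\<lambda>y. indicator (img c0) y * F y) \<in> borel_measurable borel"
    by (rule measurable_indicator_continuous[OF chart_open(2)[OF c0] F(1)])
  have KU: "K \<subseteq> img c0" using K by blast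
  have "continuous_on K (\<lambda>y. F y * vdens c0 y)"
    by (intro continuous_on_mult continuous_on_subset[OF F(1) KU] continuous_on_subset[OF continuous_vdens[OF c0] KU])
  then have "integrable lborel (\<lambda>y. indicator K y *\<^sub>R (F y * vdens c0 y))"
    by (rule borel_integrable_compact[OF K(1)])
  moreover have "(\<lambda>y. indicator K y *\<^sub>R (F y * vdens c0 y)) = (\<lambda>y. indicator (img c0) y * (F y * vdens c0 y))"
  proof
    fix y
    show "indicator K y *\<^sub>R (F y * vdens c0 y) = indicator (img c0) y * (F y * vdens c0 y)"
      using KU F(2) by (cases "y \<in> img c0"; cases "y \<in> K") auto
  qed
  ultimately show "integrable lborel (\<lambda>y. indicator (img c0) y * (F y * vdens c0 y))" by simp
qed

lemma lift_energy: "sobolev_norm_sq A g V (lift f) = (\<integral>\<^sup>+y. ennreal (indicator (img c0) y * (((f y)\<^sup>2 + grad_sq (loc c0) f y) * vdens c0 y)) \<partial>lborel)"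
  "sobolev_norm_sq A g V (lift f) < \<infinity>"
proof -
  let ?F = "\<lambda>y. (f y)\<^sup>2 + grad_sq (loc c0) f y"
  have fU: "smooth_on (img c0) f" using f smooth_on_subset by blast
  have cF: "continuous_on (img c0) ?F"
    by (intro smooth_on_continuous smooth_intros chart_open[OF c0] metric_on_chart[OF c0] fU)
  have F0: "\<forall>y\<in>img c0 - K. ?F y = 0"
    using out pd_zero_outside[OF compact_imp_closed[OF K(1)] out] by (simp add: grad_sq_def)
  note mi = measurable_integrable_lift[OF cF F0]
  show "sobolev_norm_sq A g V (lift f) = (\<integral>\<^sup>+y. ennreal (indicator (img c0) y * (?F y * vdens c0 y)) \<partial>lborel)"
    unfolding sobolev_norm_sq_def
    by (rule nn_integral_lift[OF mi(1) K(2) F0], use AE_grad_lift in eventually_elim) (auto simp: lift_def)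
  then show "sobolev_norm_sq A g V (lift f) < \<infinity>"
    using mi(2) by (simp add: real_integrable_def top.not_eq_extremum)
qed

end

text \<open>The lift of \<open>f\<close> is itself an admissible smooth test function, hence
  trivially a limit of such functions in the Sobolev norm. It competes in the infimum, and both
  parts of the entropy integral are computed in the chart.\<close>

lemma entropy_inequality_chart:
  fixes f :: "real^'n \<Rightarrow> real"
  assumes nu: "nu_entropy A V g \<tau> \<ge> 0" and s: "0 < s" "s \<le> \<tau>"
    and f: "smooth_on UNIV f" and K: "compact K" "K \<subseteq> chart_map c0 ` (V \<inter> chart_dom c0)"
    and out: "\<forall>y. y \<notin> K \<longrightarrow> f y = 0" and nn: "\<And>y. f y \<ge> 0"
    and one: "(LBINT y. indicator (img c0) y * ((f y)\<^sup>2 * sqrt (det (loc c0 y)))) = 1"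
  defines "E \<equiv> \<lambda>y. indicator (img c0) y * ((s * (scal (loc c0) y * (f y)\<^sup>2 + 4 * grad_sq (loc c0) f y) - 2 * (f y)\<^sup>2 * ln (f y)) * sqrt (det (loc c0 y)))"
  shows "integrable lborel E" "0 \<le> - real CARD('n) - real CARD('n) / 2 * ln (4 * pi * s) + (LBINT y. E y)"
proof -
  note L = lift_test_function[OF f K out] weak_differential_lift[OF f K out] lift_energy[OF f K out] AE_grad_lift[OF f K out]
  note mi = measurable_integrable_lift[OF f K out]
  have fU: "smooth_on (img c0) f" using f smooth_on_subset by blast
  have cf: "continuous_on (img c0) f" using smooth_on_continuous[OF fU] .
  have m0: "lift f \<in> borel_measurable borel"
    by (rule measurable_lift[OF mi(1)[OF cf]]) (use out in auto)
  have sv: "sets vol = sets borel" using volume(1) c0 by blast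
  have W12: "lift f \<in> W12 A g V"
    unfolding W12_def set_borel_measurable_def using m0 V(1) L(2,4) by auto
  \<comment> \<open>Not immediate: for the zero function too, the gradient comes from a chosen weak
    differential, which vanishes only almost everywhere. The zero function is treated as a
    lift.\<close>
  have zero: "sobolev_norm_sq A g V (\<lambda>p. lift f p - lift f p) = 0"
  proof -
    have "sobolev_norm_sq A g V (lift (\<lambda>_. 0)) = 0"
      using lift_energy(1)[OF smooth_on_const[of UNIV 0] K] by (simp add: grad_sq_def)
    moreover have "lift (\<lambda>_. 0) = (\<lambda>p. lift f p - lift f p)" by (auto simp: lift_def)
    ultimately show ?thesis by simp
  qed
  have W120: "lift f \<in> W12_0 A g V"
    unfolding W12_0_def
  proof (intro CollectI conjI allI impI W12)
    fix \<epsilon> :: ennreal assume "\<epsilon> > 0"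
    then show "\<exists>t\<in>test_functions A V. sobolev_norm_sq A g V (\<lambda>p. lift f p - t p) < \<epsilon>"
      using L(1) zero by (intro bexI[of _ "lift f"]) simp_all
  qed
  have sq: "(\<integral>\<^sup>+p\<in>V. ennreal ((lift f p)\<^sup>2) \<partial>vol) = 1"
  proof -
    have c: "continuous_on (img c0) (\<lambda>y. (f y)\<^sup>2)" by (intro continuous_intros cf)
    have z: "\<forall>y\<in>img c0 - K. (f y)\<^sup>2 = 0" using out by simp
    have "(\<integral>\<^sup>+p\<in>V. ennreal ((lift f p)\<^sup>2) \<partial>vol) = (\<integral>\<^sup>+y. ennreal (indicator (img c0) y * ((f y)\<^sup>2 * vdens c0 y)) \<partial>lborel)"
      by (rule nn_integral_lift[OF mi(1)[OF c z] K(2) z]) (auto simp: lift_def)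
    also have "\<dots> = ennreal (LBINT y. indicator (img c0) y * ((f y)\<^sup>2 * vdens c0 y))"
    proof (rule nn_integral_eq_integral[OF mi(2)[OF c z]])
      show "AE y in lborel. 0 \<le> indicator (img c0) y * ((f y)\<^sup>2 * vdens c0 y)"
        using vdens_pos[OF c0] by (intro AE_I2) (auto simp: indicator_def less_imp_le)
    qed
    also have "\<dots> = 1" using one by (simp add: vdens_def)
    finally show ?thesis .
  qed
  have test: "lift f \<in> entropy_test_functions A g V"
    unfolding entropy_test_functions_def using W120 sq nn by (auto simp: lift_def)
  define F1 where "F1 y = s * (scal (loc c0) y * (f y)\<^sup>2 + 4 * grad_sq (loc c0) f y)" for y
  define F2 where "F2 y = 2 * (f y)\<^sup>2 * ln (f y)" for y
  define F where "F y = F1 y - F2 y" for y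
  have pd0: "y \<notin> K \<Longrightarrow> pd i f y = 0" for y i
    using pd_zero_outside[OF compact_imp_closed[OF K(1)]] out by blast
  have c1: "continuous_on (img c0) F1" unfolding F1_def
    by (intro smooth_on_continuous smooth_intros chart_open[OF c0] metric_on_chart[OF c0] fU)
  have z1: "\<forall>y\<in>img c0 - K. F1 y = 0" using out pd0 by (simp add: F1_def grad_sq_def)
  have z2: "\<forall>y\<in>img c0 - K. F2 y = 0" using out by (simp add: F2_def)
  have m2: "(\<lambda>y. indicator (img c0) y * F2 y) \<in> borel_measurable borel"
  proof -
    have [measurable]: "f \<in> borel_measurable borel" using smooth_on_continuous[OF f] borel_measurable_continuous_onI by blast
    have "img c0 \<in> sets borel" using chart_open(2)[OF c0] by auto
    then show ?thesis unfolding F2_def by measurable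
  qed
  \<comment> \<open>The logarithmic term is dominated by a continuous function with compact
    support.\<close>
  have i2: "integrable lborel (\<lambda>y. indicator (img c0) y * (F2 y * vdens c0 y))"
  proof (rule Bochner_Integration.integrable_bound)
    show "integrable lborel (\<lambda>y. indicator (img c0) y * ((2 * (f y + f y ^ 3)) * vdens c0 y))"
      by (rule mi(2)) (use out in \<open>auto intro!: continuous_intros cf\<close>)
    have "(\<lambda>y. (indicator (img c0) y * F2 y) * (indicator (img c0) y * vdens c0 y)) \<in> borel_measurable borel"
      using m2 measurable_vdens[OF c0] by measurable
    moreover have "(\<lambda>y. (indicator (img c0) y * F2 y) * (indicator (img c0) y * vdens c0 y)) = (\<lambda>y. indicator (img c0) y * (F2 y * vdens c0 y))"
      by (auto simp: fun_eq_iff indicator_def)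
    ultimately show "(\<lambda>y. indicator (img c0) y * (F2 y * vdens c0 y)) \<in> borel_measurable lborel" by simp
    show "AE y in lborel. norm (indicator (img c0) y * (F2 y * vdens c0 y)) \<le> norm (indicator (img c0) y * ((2 * (f y + f y ^ 3)) * vdens c0 y))"
    proof (rule AE_I2)
      fix y
      have "\<bar>F2 y\<bar> = 2 * \<bar>(f y)\<^sup>2 * ln (f y)\<bar>" by (simp add: F2_def abs_mult)
      also have "\<dots> \<le> 2 * (f y + f y ^ 3)" using abs_square_ln_le[OF nn[of y]] by simp
      also have "\<dots> = \<bar>2 * (f y + f y ^ 3)\<bar>" using nn[of y] by simp
      finally show "norm (indicator (img c0) y * (F2 y * vdens c0 y)) \<le> norm (indicator (img c0) y * ((2 * (f y + f y ^ 3)) * vdens c0 y))"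
        unfolding real_norm_def abs_mult[of "indicator _ _"] abs_mult[of _ "vdens c0 y"] by (intro mult_mono order_refl) auto
    qed
  qed
  have Es: "E = (\<lambda>y. indicator (img c0) y * (F y * vdens c0 y))" by (simp add: E_def F_def F1_def F2_def vdens_def)
  have Ed: "E = (\<lambda>y. indicator (img c0) y * (F1 y * vdens c0 y) - indicator (img c0) y * (F2 y * vdens c0 y))"
    unfolding Es F_def by (auto simp: fun_eq_iff algebra_simps)
  show iE: "integrable lborel E"
    unfolding Ed by (intro Bochner_Integration.integrable_diff i2 mi(2)[OF c1 z1])
  have mF: "(\<lambda>y. indicator (img c0) y * F y) \<in> borel_measurable borel"
  proof -
    have "(\<lambda>y. indicator (img c0) y * F1 y - indicator (img c0) y * F2 y) \<in> borel_measurable borel"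
      using m2 mi(1)[OF c1 z1] by measurable
    then show ?thesis by (simp add: F_def right_diff_distrib)
  qed
  have zF: "\<forall>y\<in>img c0 - K. F y = 0" using z1 z2 by (simp add: F_def)
  let ?I = "\<lambda>p. s * (scalar_curvature A g p * (lift f p)\<^sup>2 + 4 * grad_norm_sq A g V (lift f) p) - 2 * (lift f p)\<^sup>2 * ln (lift f p)"
  have ae: "AE p in vol. p \<in> V \<longrightarrow> ?I p = lift F p"
    using L(5) by eventually_elim (auto simp: lift_def F_def F1_def F2_def scalar_curvature_chart[OF c0])
  have ae': "AE p in vol. p \<in> V \<longrightarrow> - ?I p = lift (\<lambda>y. - F y) p"
    using ae by eventually_elim (auto simp: lift_def)
  have "extended_integral vol V ?I = ereal (LBINT y. E y)"
  proof (rule extended_integral_eq[OF iE])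
    show "(\<integral>\<^sup>+p\<in>V. ennreal (?I p) \<partial>vol) = (\<integral>\<^sup>+y. ennreal (E y) \<partial>lborel)"
      unfolding Es by (rule nn_integral_lift[OF mF K(2) zF ae])
    have "(\<integral>\<^sup>+p\<in>V. ennreal (- ?I p) \<partial>vol) = (\<integral>\<^sup>+y. ennreal (indicator (img c0) y * ((- F y) * vdens c0 y)) \<partial>lborel)"
      by (rule nn_integral_lift[OF _ K(2) _ ae']) (use mF zF in auto)
    then show "(\<integral>\<^sup>+p\<in>V. ennreal (- ?I p) \<partial>vol) = (\<integral>\<^sup>+y. ennreal (- E y) \<partial>lborel)"
      unfolding Es by simp
  qed
  then have "W_entropy A V g (lift f) s = ereal (- real CARD('n) - real CARD('n) / 2 * ln (4 * pi * s) + (LBINT y. E y))"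
    by (simp add: W_entropy_def)
  moreover have "0 \<le> W_entropy A V g (lift f) s"
    using nu s test unfolding nu_entropy_def by (simp add: le_INF_iff)
  ultimately show "0 \<le> - real CARD('n) - real CARD('n) / 2 * ln (4 * pi * s) + (LBINT y. E y)"
    by (metis ereal_less_eq(3) zero_ereal_def)
qed

end

end

section \<open>The entropy inequality in arbitrary coordinates\<close>

text \<open>All that the rest of the proof uses of the manifold: an inequality for a metric on an
  open set of Euclidean space and smooth functions with compact support. Integrability is part of it
  because the integral of a function that is not integrable is 0 by convention, which would make the
  inequality meaningless.\<close>

definition entropy_ineq :: "(real^'n::finite) set \<Rightarrow> 'n mfield \<Rightarrow> real \<Rightarrow> bool"
  where "entropy_ineq U h \<tau> \<longleftrightarrow> (\<forall>s f K. 0 < s \<longrightarrow> s \<le> \<tau> \<longrightarrow> smooth_on UNIV f \<longrightarrow> compact K \<longrightarrow> K \<subseteq> U \<longrightarrow>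
    (\<forall>y. y \<notin> K \<longrightarrow> f y = 0) \<longrightarrow> (\<forall>y. f y \<ge> 0) \<longrightarrow>
    (LBINT y:U. (f y)\<^sup>2 * sqrt (det (h y))) = 1 \<longrightarrow>
    set_integrable lborel U (\<lambda>y. (s * (scal h y * (f y)\<^sup>2 + 4 * grad_sq h f y) - 2 * (f y)\<^sup>2 * ln (f y)) * sqrt (det (h y))) \<and>
    0 \<le> - real CARD('n) - real CARD('n) / 2 * ln (4 * pi * s)
      + (LBINT y:U. (s * (scal h y * (f y)\<^sup>2 + 4 * grad_sq h f y) - 2 * (f y)\<^sup>2 * ln (f y)) * sqrt (det (h y))))"

lemma entropy_ineq_chart:
  fixes A :: "('m::{t2_space, second_countable_topology}, 'n::finite) chart set"
  assumes "smooth_manifold M A" "riemannian_metric A g" "open V" "V \<subseteq> M" "c \<in> A"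
    and nu: "nu_entropy A V g \<tau> \<ge> 0"
  shows "entropy_ineq (chart_map c ` (V \<inter> chart_dom c)) (metric_in_chart g c) \<tau>"
  unfolding entropy_ineq_def
proof (intro allI impI)
  fix s f K
  assume s: "0 < s" "s \<le> \<tau>" and f: "smooth_on UNIV f" and K: "compact K" "K \<subseteq> chart_map c ` (V \<inter> chart_dom c)"
    and out: "\<forall>y. y \<notin> K \<longrightarrow> f y = 0" and nn: "\<forall>y. f y \<ge> 0"
    and one: "(LBINT y:chart_map c ` (V \<inter> chart_dom c). (f y)\<^sup>2 * sqrt (det (metric_in_chart g c y))) = 1"
  let ?U = "chart_map c ` (V \<inter> chart_dom c)" and ?W = "chart_map c ` chart_dom c"
  have pd: "y \<notin> K \<Longrightarrow> pd i f y = 0" for y i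
    using pd_zero_outside[OF compact_imp_closed[OF K(1)]] out by blast
  have sw: "(\<lambda>y. indicator ?U y *\<^sub>R F y) = (\<lambda>y. indicator ?W y * F y)" if "\<And>y. y \<notin> K \<Longrightarrow> F y = 0" for F :: "real^'n \<Rightarrow> real"
  proof
    fix y show "indicator ?U y *\<^sub>R F y = indicator ?W y * F y"
    proof (cases "y \<in> K")
      case True
      then have "y \<in> ?U" "y \<in> ?W" using K(2) by blast+
      then show ?thesis by simp
    qed (simp add: that)
  qed
  have one': "(LBINT y. indicator ?W y * ((f y)\<^sup>2 * sqrt (det (metric_in_chart g c y)))) = 1"
    using one unfolding set_lebesgue_integral_def by (subst (asm) sw) (use out in auto)
  note E = entropy_inequality_chart[OF assms(1-5) nu s f K out _ one']
  let ?F = "\<lambda>y. (s * (scal (metric_in_chart g c) y * (f y)\<^sup>2 + 4 * grad_sq (metric_in_chart g c) f y) - 2 * (f y)\<^sup>2 * ln (f y)) * sqrt (det (metric_in_chart g c y))"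
  have z: "y \<notin> K \<Longrightarrow> ?F y = 0" for y using out pd by (simp add: grad_sq_def)
  show "set_integrable lborel ?U ?F \<and> 0 \<le> - real CARD('n) - real CARD('n) / 2 * ln (4 * pi * s) + (LBINT y:?U. ?F y)"
  proof -
    have eq: "(\<lambda>y. indicator ?U y *\<^sub>R ?F y) = (\<lambda>y. indicator ?W y * ?F y)" by (rule sw) (rule z)
    show ?thesis unfolding set_integrable_def set_lebesgue_integral_def eq using E nn by simp
  qed
qed

definition diffeo :: "(real^'n::finite) set \<Rightarrow> (real^'n \<Rightarrow> real^'n) \<Rightarrow> (real^'n \<Rightarrow> real^'n) \<Rightarrow> (real^'n) set \<Rightarrow> bool"
  where "diffeo S \<psi> \<phi> U \<longleftrightarrow> open S \<and> open (\<psi> ` S) \<and> \<psi> ` S \<subseteq> U \<and> smooth_on S \<psi> \<and> smooth_on (\<psi> ` S) \<phi> \<and>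
    (\<forall>x\<in>S. \<phi> (\<psi> x) = x) \<and> (\<forall>x\<in>S. invertible (jac \<psi> x))"

lemma diffeoD:
  assumes "diffeo S \<psi> \<phi> U"
  shows "open S" "open (\<psi> ` S)" "\<psi> ` S \<subseteq> U" "smooth_on S \<psi>" "smooth_on (\<psi> ` S) \<phi>"
    "x \<in> S \<Longrightarrow> \<phi> (\<psi> x) = x" "x \<in> S \<Longrightarrow> invertible (jac \<psi> x)" "inj_on \<psi> S"
  using assms unfolding diffeo_def by (auto intro: inj_on_inverseI)

lemma grad_sq_pullback:
  assumes \<psi>: "\<psi> differentiable (at x)" and f: "f differentiable (at (\<psi> x))" and J: "invertible (jac \<psi> x)" and h: "invertible (h (\<psi> x))"
  shows "grad_sq (pullback \<psi> h) (\<lambda>x. f (\<psi> x)) x = grad_sq h f (\<psi> x)"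
proof -
  define w where "w = (\<chi> i. pd i f (\<psi> x))"
  have "(\<chi> i. pd i (\<lambda>x. f (\<psi> x)) x) = transpose (jac \<psi> x) *v w"
    by (simp add: w_def vec_eq_iff matrix_vector_mult_def transpose_component pd_comp_jac[OF \<psi> f])
  moreover have "grad_sq (pullback \<psi> h) (\<lambda>x. f (\<psi> x)) x = (\<chi> i. pd i (\<lambda>x. f (\<psi> x)) x) \<bullet> (matrix_inv (pullback \<psi> h x) *v (\<chi> i. pd i (\<lambda>x. f (\<psi> x)) x))"
    by (simp add: grad_sq_eq grad_sq_def)
  moreover have "grad_sq h f (\<psi> x) = w \<bullet> (matrix_inv (h (\<psi> x)) *v w)"
    by (simp add: grad_sq_eq grad_sq_def w_def)
  ultimately show ?thesis using inner_pullback_inv[OF h J] by (simp add: pullback_def)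
qed

text \<open>The entropy integrand in the variable \<open>q\<close>, without the divergence. The
  logarithm of \<open>q det^(-1/4)\<close> splits, and its determinant part is the last
  summand.\<close>

definition rhs_density :: "real \<Rightarrow> 'n::finite mfield \<Rightarrow> (real^'n \<Rightarrow> real) \<Rightarrow> real^'n \<Rightarrow> real"
  where "rhs_density s G q x =
    s * ((SUM i j. matrix_inv (G x) $ i $ j * (2 * pd i q x * pd j q x - 2 * q x * pd i (pd j q) x))
      + (q x)\<^sup>2 * quadG G x) - (q x)\<^sup>2 * ln ((q x)\<^sup>2) + (q x)\<^sup>2 * ln (det (G x)) / 2"

text \<open>The function \<open>q det^(-1/4)\<close> is transplanted from the coordinates
  \<open>S\<close> to \<open>U\<close>, where the entropy inequality applies, and the integral is
  pulled back to \<open>S\<close>. By \<open>energy_identity\<close> the result differs from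
  \<open>rhs_density\<close> by a divergence with compact support, whose integral is zero.\<close>

lemma entropy_density:
  fixes h :: "'n::finite mfield"
  assumes U: "open U" "metric_on U h" and e: "entropy_ineq U h \<tau>" and d: "diffeo S \<psi> \<phi> U" and s: "0 < s" "s \<le> \<tau>"
    and q: "smooth_on UNIV q" "\<forall>x. q x \<ge> 0" and K: "compact K" "K \<subseteq> S" "\<forall>x. x \<notin> K \<longrightarrow> q x = 0"
    and one: "(LBINT x. (q x)\<^sup>2) = 1"
  shows "set_integrable lborel S (rhs_density s (pullback \<psi> h) q)"
    "0 \<le> - real CARD('n) - real CARD('n) / 2 * ln (4 * pi * s) + (LBINT x:S. rhs_density s (pullback \<psi> h) q x)"
proof -
  note D = diffeoD[OF d]
  let ?G = "pullback \<psi> h" and ?T = "\<psi> ` S"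
  have mG: "metric_on S ?G" by (rule metric_on_pullback[OF D(1) U(1) D(4,3,7) U(2)])
  have mh: "metric_on ?T h" using metric_on_subset[OF U(2) D(3)] .
  have qS: "smooth_on S q" using q(1) smooth_on_subset by blast
  define p where "p x = q x * det (?G x) powr (-1/4)" for x
  have sp: "smooth_on S p" unfolding p_def[abs_def]
    by (intro smooth_intros smooth_on_powr D(1) qS metric_on_smooth[OF mG] metric_on_det_pos[OF mG])
  \<comment> \<open>Extension by zero outside the image of \<open>S\<close>, where
    \<open>\<phi>\<close> carries no information.\<close>
  define f where "f y = (if y \<in> ?T then p (\<phi> y) else 0)" for y
  have \<phi>T: "\<phi> ` ?T \<subseteq> S" using D(6) by auto
  have KT: "compact (\<psi> ` K)" "\<psi> ` K \<subseteq> ?T"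
    using compact_continuous_image[OF continuous_on_subset[OF smooth_on_continuous[OF D(4)] K(2)] K(1)] K(2) by auto
  have f: "smooth_on UNIV f" unfolding f_def[abs_def]
  proof (rule smooth_on_extend[OF D(2) _ compact_imp_closed[OF KT(1)] KT(2)])
    show "smooth_on ?T (\<lambda>y. p (\<phi> y))" by (rule smooth_on_compose[OF D(2,1) \<phi>T D(5) sp])
    show "p (\<phi> y) = 0" if "y \<in> ?T - \<psi> ` K" for y
      using that D(6) K(3) by (auto simp: p_def)
  qed
  have fp: "f (\<psi> x) = p x" if "x \<in> S" for x using that D(6) by (simp add: f_def)
  have fout: "\<forall>y. y \<notin> \<psi> ` K \<longrightarrow> f y = 0" using D(6) K(3) by (auto simp: f_def p_def)
  have fnn: "\<forall>y. f y \<ge> 0" using q(2) by (simp add: f_def p_def)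
  have sd: "\<bar>det (jac \<psi> x)\<bar> * sqrt (det (h (\<psi> x))) = sqrt (det (?G x))" for x
    by (simp add: det_pullback real_sqrt_mult)
  have cv: "(LBINT y:U. F y) = (LBINT x:S. \<bar>det (jac \<psi> x)\<bar> * F (\<psi> x))"
    if m: "(\<lambda>y. indicator ?T y * F y) \<in> borel_measurable borel" and z: "\<And>y. y \<notin> \<psi> ` K \<Longrightarrow> F y = 0" for F :: "real^'n \<Rightarrow> real"
  proof -
    have "(LBINT y:U. F y) = (LBINT y:?T. indicator ?T y * F y)"
      unfolding set_lebesgue_integral_def
    proof (intro Bochner_Integration.integral_cong refl)
      fix y show "indicator U y *\<^sub>R F y = indicator ?T y *\<^sub>R (indicator ?T y * F y)"
        using z[of y] KT(2) D(3) by (cases "y \<in> \<psi> ` K") (auto simp: indicator_def)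
    qed
    also have "\<dots> = (LBINT x:S. \<bar>det (jac \<psi> x)\<bar> * (indicator ?T (\<psi> x) * F (\<psi> x)))"
      by (rule integral_change_of_variables_smooth[OF D(1,4,8,2) m])
    also have "\<dots> = (LBINT x:S. \<bar>det (jac \<psi> x)\<bar> * F (\<psi> x))"
      unfolding set_lebesgue_integral_def by (intro Bochner_Integration.integral_cong) (auto simp: indicator_def)
    finally show ?thesis .
  qed
  have fT: "smooth_on ?T f" using f smooth_on_subset by blast
  have cd: "continuous_on ?T (\<lambda>y. sqrt (det (h y)))"
    by (intro continuous_intros smooth_on_continuous smooth_intros D(2) metric_on_smooth[OF mh])
  have pp: "(p x)\<^sup>2 * sqrt (det (?G x)) = (q x)\<^sup>2" if "x \<in> S" for x
  proof -
    have pos: "det (?G x) > 0" using metric_on_det_pos[OF mG that] .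
    have "(det (?G x) powr (-1/4))\<^sup>2 * sqrt (det (?G x)) = 1"
      using pos by (simp add: power2_eq_square powr_half_sqrt[symmetric] flip: powr_add)
    then have "(q x)\<^sup>2 * ((det (?G x) powr (-1/4))\<^sup>2 * sqrt (det (?G x))) = (q x)\<^sup>2" by simp
    then show ?thesis by (simp only: p_def power_mult_distrib mult.assoc)
  qed
  have one': "(LBINT y:U. (f y)\<^sup>2 * sqrt (det (h y))) = 1"
  proof -
    have c: "continuous_on ?T (\<lambda>y. (f y)\<^sup>2 * sqrt (det (h y)))"
      by (intro continuous_on_mult cd continuous_on_power smooth_on_continuous[OF fT])
    have "(LBINT y:U. (f y)\<^sup>2 * sqrt (det (h y))) = (LBINT x:S. \<bar>det (jac \<psi> x)\<bar> * ((f (\<psi> x))\<^sup>2 * sqrt (det (h (\<psi> x)))))"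
      by (rule cv[OF measurable_indicator_continuous[OF D(2) c]]) (use fout in auto)
    also have "\<dots> = (LBINT x. (q x)\<^sup>2)"
      unfolding set_lebesgue_integral_def
    proof (intro Bochner_Integration.integral_cong refl)
      fix x
      show "indicator S x *\<^sub>R (\<bar>det (jac \<psi> x)\<bar> * ((f (\<psi> x))\<^sup>2 * sqrt (det (h (\<psi> x))))) = (q x)\<^sup>2"
      proof (cases "x \<in> S")
        case True
        have "\<bar>det (jac \<psi> x)\<bar> * ((f (\<psi> x))\<^sup>2 * sqrt (det (h (\<psi> x)))) = (p x)\<^sup>2 * (\<bar>det (jac \<psi> x)\<bar> * sqrt (det (h (\<psi> x))))"
          by (simp add: fp[OF True] mult_ac)
        then show ?thesis using True pp[OF True] by (simp only: sd indicator_simps scaleR_one)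
      qed (use K in auto)
    qed
    finally show ?thesis using one by simp
  qed
  let ?E = "\<lambda>y. (s * (scal h y * (f y)\<^sup>2 + 4 * grad_sq h f y) - 2 * (f y)\<^sup>2 * ln (f y)) * sqrt (det (h y))"
  have EI: "set_integrable lborel U ?E" "0 \<le> - real CARD('n) - real CARD('n) / 2 * ln (4 * pi * s) + (LBINT y:U. ?E y)"
    using e[unfolded entropy_ineq_def, rule_format, OF s f KT(1) _ _ _ one'] KT(2) D(3) fout fnn by blast+
  have pdf: "y \<notin> \<psi> ` K \<Longrightarrow> pd i f y = 0" for y i
    using pd_zero_outside[OF compact_imp_closed[OF KT(1)]] fout by blast
  have Ez: "?E y = 0" if "y \<notin> \<psi> ` K" for y using fout pdf that by (simp add: grad_sq_def)
  have Em: "(\<lambda>y. indicator ?T y * ?E y) \<in> borel_measurable borel"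
  proof -
    have [measurable]: "(\<lambda>y. indicator ?T y * (s * (scal h y * (f y)\<^sup>2 + 4 * grad_sq h f y) * sqrt (det (h y)))) \<in> borel_measurable borel"
      by (intro measurable_indicator_continuous[OF D(2)] continuous_on_mult cd smooth_on_continuous smooth_intros D(2) mh fT)
    have [measurable]: "(\<lambda>y. indicator ?T y * sqrt (det (h y))) \<in> borel_measurable borel"
      by (intro measurable_indicator_continuous[OF D(2)] cd)
    have [measurable]: "f \<in> borel_measurable borel" using smooth_on_continuous[OF f] borel_measurable_continuous_onI by blast
    have "(\<lambda>y. indicator ?T y * (s * (scal h y * (f y)\<^sup>2 + 4 * grad_sq h f y) * sqrt (det (h y))) - (2 * (f y)\<^sup>2 * ln (f y)) * (indicator ?T y * sqrt (det (h y)))) \<in> borel_measurable borel"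
      by measurable
    then show ?thesis by (simp add: algebra_simps)
  qed
  have Ecv: "(LBINT y:U. ?E y) = (LBINT x:S. \<bar>det (jac \<psi> x)\<bar> * ?E (\<psi> x))"
    by (rule cv[OF Em Ez])
  define X where "X x = (SUM k. pd k (energy_field ?G q k) x)" for x
  have point: "\<bar>det (jac \<psi> x)\<bar> * ?E (\<psi> x) = s * X x + rhs_density s ?G q x" if x: "x \<in> S" for x
  proof -
    have Tx: "\<psi> x \<in> ?T" using x by blast
    have df: "f differentiable at (\<psi> x)" using smooth_onD[OF f] by blast
    have "grad_sq h f (\<psi> x) = grad_sq ?G (\<lambda>x. f (\<psi> x)) x"
      using grad_sq_pullback[of \<psi> x f h] smooth_onD[OF D(4) x] df D(7)[OF x] metric_on_invertible[OF mh Tx] by simp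
    also have "\<dots> = grad_sq ?G p x"
    proof -
      have "pd i (\<lambda>x. f (\<psi> x)) x = pd i p x" for i
        by (rule pd_cong_open[OF D(1) x]) (use fp smooth_onD[OF sp x] in auto)
      then show ?thesis by (simp add: grad_sq_def)
    qed
    finally have gr: "grad_sq h f (\<psi> x) = grad_sq ?G p x" .
    have sc: "scal h (\<psi> x) = scal ?G x" by (rule scal_pullback[OF D(1) U(1) D(4,3,7) U(2) x, symmetric])
    have id: "(scal ?G x * (p x)\<^sup>2 + 4 * grad_sq ?G p x) * sqrt (det (?G x))
      = X x + (SUM i j. matrix_inv (?G x) $ i $ j * (2 * pd i q x * pd j q x - 2 * q x * pd i (pd j q) x)) + (q x)\<^sup>2 * quadG ?G x"
      using energy_identity[OF D(1) mG x qS] unfolding grad_sq_def X_def p_def[abs_def] by simp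
    have lnp: "2 * (p x)\<^sup>2 * ln (p x) * sqrt (det (?G x)) = (q x)\<^sup>2 * ln ((q x)\<^sup>2) - (q x)\<^sup>2 * ln (det (?G x)) / 2"
    proof (cases "q x = 0")
      case False
      then have qp: "q x > 0" using q(2) by (simp add: order_less_le)
      have pos: "det (?G x) > 0" using metric_on_det_pos[OF mG x] .
      have l1: "ln (p x) = ln (q x) - ln (det (?G x)) / 4" using qp pos by (simp add: p_def ln_mult ln_powr)
      have l2: "ln ((q x)\<^sup>2) = 2 * ln (q x)" using qp by (simp add: ln_realpow)
      have "2 * (p x)\<^sup>2 * ln (p x) * sqrt (det (?G x)) = 2 * ((p x)\<^sup>2 * sqrt (det (?G x))) * ln (p x)" by (simp only: mult_ac)
      then have l3: "2 * (p x)\<^sup>2 * ln (p x) * sqrt (det (?G x)) = 2 * (q x)\<^sup>2 * ln (p x)" by (simp only: pp[OF x])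
      show ?thesis unfolding l3 unfolding l1 l2 by (simp add: algebra_simps)
    qed (simp add: p_def)
    have "\<bar>det (jac \<psi> x)\<bar> * ?E (\<psi> x) = (s * (scal ?G x * (p x)\<^sup>2 + 4 * grad_sq ?G p x) - 2 * (p x)\<^sup>2 * ln (p x)) * (\<bar>det (jac \<psi> x)\<bar> * sqrt (det (h (\<psi> x))))"
      by (simp add: fp[OF x] sc gr mult_ac)
    also have "\<dots> = s * ((scal ?G x * (p x)\<^sup>2 + 4 * grad_sq ?G p x) * sqrt (det (?G x))) - 2 * (p x)\<^sup>2 * ln (p x) * sqrt (det (?G x))"
      unfolding sd by (simp add: algebra_simps)
    also have "\<dots> = s * X x + rhs_density s ?G q x"
      unfolding id lnp rhs_density_def by (simp add: algebra_simps)
    finally show ?thesis .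
  qed
  have Ef: "energy_field ?G q k x = 0" if "x \<notin> K" for k x using K(3) that by (simp add: energy_field_def[OF D(1) mG])
  \<comment> \<open>The components of the energy field extended by zero, so that they are smooth on
    the whole space and the integral of their divergence vanishes.\<close>
  define Y where "Y k x = (if x \<in> S then energy_field ?G q k x else 0)" for k x
  have sY: "smooth_on UNIV (Y k)" for k unfolding Y_def[abs_def]
    by (rule smooth_on_extend[OF D(1) smooth_on_energy_field[OF D(1) mG qS] compact_imp_closed[OF K(1)] K(2)]) (use Ef in auto)
  have Yout: "\<forall>x. x \<notin> K \<longrightarrow> Y k x = 0" for k using Ef by (simp add: Y_def)
  have XY: "indicator S x * X x = (SUM k. pd k (Y k) x)" for x
  proof (cases "x \<in> S")
    case True
    have "pd k (Y k) x = pd k (energy_field ?G q k) x" for k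
      by (rule pd_cong_open[OF D(1) True])
        (auto simp: Y_def intro: smooth_onD[OF smooth_on_energy_field[OF D(1) mG qS] True])
    then show ?thesis using True by (simp add: X_def)
  next
    case False
    then have "x \<notin> K" using K by blast
    then have "pd k (Y k) x = 0" for k
      using pd_zero_outside[OF compact_imp_closed[OF K(1)]] Yout by blast
    then show ?thesis using False by simp
  qed
  have Yi: "integrable lborel (pd k (Y k))" "(LBINT x. pd k (Y k) x) = 0" for k
    using integral_pd_compact[OF sY K(1)] Yout by blast+
  have Xi: "integrable lborel (\<lambda>x. indicator S x * X x)" "(LBINT x. indicator S x * X x) = 0"
    unfolding XY using Yi by (auto simp: Bochner_Integration.integral_sum)
  have Ti: "integrable lborel (\<lambda>x. indicator S x * (\<bar>det (jac \<psi> x)\<bar> * ?E (\<psi> x)))"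
  proof -
    let ?p = "\<lambda>x. if x \<in> S then \<psi> x else 0"
    note cvd = lborel_change_of_variables[OF D(1,4,8,2)]
    have dm [measurable]: "(\<lambda>x. indicator S x * \<bar>det (jac \<psi> x)\<bar>) \<in> borel_measurable borel"
      by (rule measurable_indicator_continuous[OF D(1)])
        (intro continuous_on_rabs smooth_on_continuous[OF smooth_on_det[OF D(1) smooth_on_jac[OF D(1,4)]]])
    note [measurable] = cvd(1) Em
    have Tb [measurable]: "?T \<in> sets borel" using D(2) by auto
    have "integrable lborel (\<lambda>y. indicator ?T y *\<^sub>R (indicator U y *\<^sub>R ?E y))"
      by (rule integrable_mult_indicator) (use EI(1) D(2) in \<open>auto simp: set_integrable_def\<close>)
    moreover have "(\<lambda>y. indicator ?T y *\<^sub>R (indicator U y *\<^sub>R ?E y)) = (\<lambda>y. indicator ?T y *\<^sub>R (indicator ?T y * ?E y))"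
      using D(3) by (auto simp: fun_eq_iff indicator_def)
    ultimately have "integrable (density lborel (\<lambda>y. ennreal (indicator ?T y))) (\<lambda>y. indicator ?T y * ?E y)"
      by (subst integrable_density) auto
    then have "integrable (distr (density lborel (\<lambda>x. ennreal (indicator S x * \<bar>det (jac \<psi> x)\<bar>))) borel ?p) (\<lambda>y. indicator ?T y * ?E y)"
      unfolding cvd(2) by (simp add: ennreal_indicator)
    then have "integrable (density lborel (\<lambda>x. ennreal (indicator S x * \<bar>det (jac \<psi> x)\<bar>))) (\<lambda>x. indicator ?T (?p x) * ?E (?p x))"
      by (subst (asm) integrable_distr_eq) auto
    then have "integrable lborel (\<lambda>x. (indicator S x * \<bar>det (jac \<psi> x)\<bar>) *\<^sub>R (indicator ?T (?p x) * ?E (?p x)))"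
    proof (subst (asm) integrable_density)
      show "(\<lambda>x. indicator ?T (?p x) * ?E (?p x)) \<in> borel_measurable lborel"
        using measurable_compose[OF cvd(1) Em] by simp
    qed auto
    moreover have "(\<lambda>x. (indicator S x * \<bar>det (jac \<psi> x)\<bar>) *\<^sub>R (indicator ?T (?p x) * ?E (?p x))) = (\<lambda>x. indicator S x * (\<bar>det (jac \<psi> x)\<bar> * ?E (\<psi> x)))"
      by (auto simp: fun_eq_iff indicator_def)
    ultimately show ?thesis by simp
  qed
  have rd: "indicator S x *\<^sub>R rhs_density s ?G q x = indicator S x * (\<bar>det (jac \<psi> x)\<bar> * ?E (\<psi> x)) - s * (indicator S x * X x)" for x
  proof (cases "x \<in> S")
    case True
    then show ?thesis using point[OF True] by (simp only: indicator_simps) simp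
  qed simp
  show "set_integrable lborel S (rhs_density s ?G q)"
    unfolding set_integrable_def rd by (intro Bochner_Integration.integrable_diff integrable_mult_right Ti Xi)
  have "(LBINT x:S. rhs_density s ?G q x) = (LBINT x. indicator S x * (\<bar>det (jac \<psi> x)\<bar> * ?E (\<psi> x))) - s * (LBINT x. indicator S x * X x)"
    unfolding set_lebesgue_integral_def rd
    by (subst Bochner_Integration.integral_diff) (auto intro: Ti Xi)
  also have "\<dots> = (LBINT y:U. ?E y)" unfolding Ecv Xi(2) by (simp add: set_lebesgue_integral_def)
  finally show "0 \<le> - real CARD('n) - real CARD('n) / 2 * ln (4 * pi * s) + (LBINT x:S. rhs_density s ?G q x)"
    using EI(2) by simp
qed

text \<open>Everything in \<open>rhs_density\<close> is quadratic in \<open>q\<close> except the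
  logarithm, so dividing \<open>q\<close> by \<open>sqrt m\<close> and multiplying the inequality by
  \<open>m\<close> costs exactly \<open>m * ln m\<close>.\<close>

lemma entropy_density_unnormalized:
  fixes h :: "'n::finite mfield"
  assumes U: "open U" "metric_on U h" and e: "entropy_ineq U h \<tau>" and d: "diffeo S \<psi> \<phi> U" and s: "0 < s" "s \<le> \<tau>"
    and q: "smooth_on UNIV q" "\<forall>x. q x \<ge> 0" and K: "compact K" "K \<subseteq> S" "\<forall>x. x \<notin> K \<longrightarrow> q x = 0"
  defines "m \<equiv> \<integral>x. (q x)\<^sup>2 \<partial>lborel"
  assumes m: "m > 0"
  shows "set_integrable lborel S (rhs_density s (pullback \<psi> h) q)"
    "0 \<le> m * (- real CARD('n) - real CARD('n) / 2 * ln (4 * pi * s)) + (LBINT x:S. rhs_density s (pullback \<psi> h) q x) + m * ln m"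
proof -
  define r where "r = 1 / sqrt m"
  have r: "r > 0" "r\<^sup>2 = 1 / m" using m by (auto simp: r_def power_divide)
  let ?q = "\<lambda>x. r * q x" and ?G = "pullback \<psi> h"
  have qi: "integrable lborel (\<lambda>x. (q x)\<^sup>2)"
    using integrable_compact_support(1)[OF continuous_on_power[OF smooth_on_continuous[OF q(1)]] K(1)] K(3) by auto
  have one: "(LBINT x. (?q x)\<^sup>2) = 1"
    unfolding power_mult_distrib using r m by (simp add: m_def)
  have sq: "smooth_on UNIV ?q" by (intro smooth_intros q) auto
  have "\<forall>x. ?q x \<ge> 0" "\<forall>x. x \<notin> K \<longrightarrow> ?q x = 0" using q(2) r K(3) by auto
  note E = entropy_density[OF U e d s sq this(1) K(1,2) this(2) one]
  have p1: "pd i ?q x = r * pd i q x" for i x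
    using pd_linear[OF bounded_linear_mult_right smooth_onD[OF q(1)]] by blast
  have p2: "pd i (pd j ?q) x = r * pd i (pd j q) x" for i j x
    unfolding p1[abs_def] using pd_linear[OF bounded_linear_mult_right smooth_onD[OF smooth_on_partial[OF q(1)]]] by blast
  have rd: "rhs_density s ?G ?q x = (1/m) * rhs_density s ?G q x + (ln m / m) * (q x)\<^sup>2" for x
  proof -
    define Sm where "Sm = (SUM i j. matrix_inv (?G x) $ i $ j * (2 * pd i q x * pd j q x - 2 * q x * pd i (pd j q) x))"
    have "(SUM i j. matrix_inv (?G x) $ i $ j * (2 * pd i ?q x * pd j ?q x - 2 * ?q x * pd i (pd j ?q) x)) = r\<^sup>2 * Sm"
      unfolding p1 p2 Sm_def sum_distrib_left by (intro sum.cong refl) (simp add: algebra_simps power2_eq_square)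
    moreover have "(?q x)\<^sup>2 * ln ((?q x)\<^sup>2) = r\<^sup>2 * ((q x)\<^sup>2 * ln ((q x)\<^sup>2)) - r\<^sup>2 * ln m * (q x)\<^sup>2"
    proof (cases "q x = 0")
      case False
      have "ln ((?q x)\<^sup>2) = ln (r\<^sup>2) + ln ((q x)\<^sup>2)"
        unfolding power_mult_distrib using False r(1) by (simp add: ln_mult)
      also have "ln (r\<^sup>2) = - ln m" unfolding r(2) using m by (simp add: ln_div)
      finally have L: "ln ((?q x)\<^sup>2) = - ln m + ln ((q x)\<^sup>2)" .
      show ?thesis unfolding L by (simp add: power_mult_distrib algebra_simps)
    qed simp
    ultimately have "rhs_density s ?G ?q x = r\<^sup>2 * rhs_density s ?G q x + r\<^sup>2 * ln m * (q x)\<^sup>2"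
      unfolding rhs_density_def Sm_def[symmetric] by (simp add: power_mult_distrib algebra_simps)
    then show ?thesis unfolding r(2) by simp
  qed
  have qS: "(\<lambda>x. indicator S x *\<^sub>R (q x)\<^sup>2) = (\<lambda>x. (q x)\<^sup>2)" using K by (auto simp: fun_eq_iff indicator_def)
  have rq: "indicator S x *\<^sub>R rhs_density s ?G q x = m * (indicator S x *\<^sub>R rhs_density s ?G ?q x) - ln m * (q x)\<^sup>2" for x
  proof -
    have "indicator S x *\<^sub>R (q x)\<^sup>2 = (q x)\<^sup>2" using qS by meson
    then show ?thesis unfolding rd using m by (auto simp: algebra_simps)
  qed
  show "set_integrable lborel S (rhs_density s ?G q)"
    using E(1) qi unfolding set_integrable_def rq by (intro Bochner_Integration.integrable_diff integrable_mult_right)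
  have "(LBINT x:S. rhs_density s ?G q x) = m * (LBINT x:S. rhs_density s ?G ?q x) - ln m * m"
    using E(1) qi unfolding set_integrable_def set_lebesgue_integral_def rq
    by (subst Bochner_Integration.integral_diff) (auto simp: m_def)
  moreover have "0 \<le> m * (- real CARD('n) - real CARD('n) / 2 * ln (4 * pi * s) + (LBINT x:S. rhs_density s ?G ?q x))"
    using E(2) m by (intro mult_nonneg_nonneg) auto
  ultimately show "0 \<le> m * (- real CARD('n) - real CARD('n) / 2 * ln (4 * pi * s)) + (LBINT x:S. rhs_density s ?G q x) + m * ln m"
    by (simp add: algebra_simps)
qed

section \<open>Normal coordinates to third order\<close>

lemma invertible_mat_1: "invertible (mat 1 :: real^'n^'n::finite)"
  by (rule matrix_inv_unique(2)[of _ "mat 1"]) simp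

lemma diffeo_compose:
  assumes d1: "diffeo S1 \<psi>1 \<phi>1 U" and d2: "diffeo S2 \<psi>2 \<phi>2 S1"
  shows "diffeo S2 (\<lambda>x. \<psi>1 (\<psi>2 x)) (\<lambda>y. \<phi>2 (\<phi>1 y)) U"
proof -
  note D1 = diffeoD[OF d1] and D2 = diffeoD[OF d2]
  have im: "(\<lambda>x. \<psi>1 (\<psi>2 x)) ` S2 = \<psi>1 ` S1 \<inter> \<phi>1 -` (\<psi>2 ` S2)" (is "?A = ?B")
  proof (intro equalityI subsetI)
    fix y assume "y \<in> ?A"
    then obtain x where x: "x \<in> S2" "y = \<psi>1 (\<psi>2 x)" by blast
    then have "\<psi>2 x \<in> S1" using D2(3) by blast
    then show "y \<in> ?B" using x D1(6) by auto
  next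
    fix y assume "y \<in> ?B"
    then obtain z where z: "z \<in> S1" "y = \<psi>1 z" "\<phi>1 y \<in> \<psi>2 ` S2" by blast
    then have "z \<in> \<psi>2 ` S2" using D1(6) by simp
    then show "y \<in> ?A" using z by blast
  qed
  have op: "open ?A" unfolding im
    by (rule continuous_open_preimage[OF smooth_on_continuous[OF D1(5)] D1(2) D2(2)])
  have sA: "?A \<subseteq> \<psi>1 ` S1" using D2(3) by blast
  have s1: "smooth_on S2 (\<lambda>x. \<psi>1 (\<psi>2 x))"
    by (rule smooth_on_compose[OF D2(1) D1(1) D2(3) D2(4) D1(4)])
  have "\<phi>1 ` ?A \<subseteq> \<psi>2 ` S2" using im by blast
  then have s2: "smooth_on ?A (\<lambda>y. \<phi>2 (\<phi>1 y))"
    by (rule smooth_on_compose[OF op D2(2) _ smooth_on_subset[OF D1(5) sA] D2(5)])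
  have inv: "invertible (jac (\<lambda>x. \<psi>1 (\<psi>2 x)) x)" if "x \<in> S2" for x
  proof -
    have "\<psi>2 x \<in> S1" using that D2(3) by blast
    then show ?thesis
      using jac_compose[OF smooth_onD[OF D2(4) that] smooth_onD[OF D1(4)]] D1(7) D2(7)[OF that]
      by (simp add: invertible_mult)
  qed
  show ?thesis unfolding diffeo_def
    using D2(1) op sA D1(3) s1 s2 inv D1(6) D2(6) D2(3) by (auto simp: image_subset_iff)
qed

lemma pullback_compose:
  assumes "\<psi>2 differentiable (at x)" "\<psi>1 differentiable (at (\<psi>2 x))"
  shows "pullback (\<lambda>x. \<psi>1 (\<psi>2 x)) h x = pullback \<psi>2 (pullback \<psi>1 h) x"
  by (simp add: pullback_def jac_compose[OF assms] matrix_transpose_mul matrix_mul_assoc)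

text \<open>The inverse function theorem, applied on the part of \<open>W\<close> that
  \<open>\<psi>\<close> maps into \<open>U\<close> and where its Jacobian is invertible;
  \<open>smooth_on_inverse_map\<close> improves the differentiable inverse to a smooth one.\<close>

lemma local_diffeo:
  fixes \<psi> :: "real^'n::finite \<Rightarrow> real^'n"
  assumes W: "open W" "x0 \<in> W" and \<psi>: "smooth_on W \<psi>" and U: "open U" "\<psi> x0 \<in> U" and inv0: "invertible (jac \<psi> x0)"
  obtains S \<phi> where "x0 \<in> S" "S \<subseteq> W" "diffeo S \<psi> \<phi> U"
proof -
  define W' where "W' = {x \<in> W. det (jac \<psi> x) \<noteq> 0} \<inter> (W \<inter> \<psi> -` U)"
  have cdet: "continuous_on W (\<lambda>x. det (jac \<psi> x))"
    by (intro smooth_on_continuous smooth_intros W \<psi>)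
  have "open (W \<inter> (\<lambda>x. det (jac \<psi> x)) -` (- {0}))"
    by (rule continuous_open_preimage[OF cdet W(1)]) auto
  moreover have "open (W \<inter> \<psi> -` U)" by (rule continuous_open_preimage[OF smooth_on_continuous[OF \<psi>] W(1) U(1)])
  moreover have "W' = (W \<inter> (\<lambda>x. det (jac \<psi> x)) -` (- {0})) \<inter> (W \<inter> \<psi> -` U)" by (auto simp: W'_def)
  ultimately have W': "open W'" "x0 \<in> W'" "W' \<subseteq> W"
    using inv0 W U by (auto simp: W'_def invertible_det_nz)
  have inv: "invertible (jac \<psi> x)" if "x \<in> W'" for x using that by (simp add: W'_def invertible_det_nz)
  define D where "D x = Blinfun (\<lambda>v. jac \<psi> x *v v)" for x
  have Da: "blinfun_apply (D x) = (\<lambda>v. jac \<psi> x *v v)" for x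
    unfolding D_def by (rule bounded_linear_Blinfun_apply) (rule matrix_vector_mul_bounded_linear)
  have der: "(\<psi> has_derivative blinfun_apply (D x)) (at x)" if "x \<in> W'" for x
  proof -
    have d: "(\<psi> has_derivative frechet_derivative \<psi> (at x)) (at x)"
      using differentiable_has_derivative[OF smooth_onD[OF \<psi>]] W'(3) that by blast
    have "frechet_derivative \<psi> (at x) = (\<lambda>v. jac \<psi> x *v v)"
      by (simp add: fun_eq_iff vec_eq_iff has_derivative_partial_sum[OF d] matrix_vector_mult_def jac_def mult.commute)
    then show ?thesis using d by (simp add: Da)
  qed
  have cont: "continuous_on W' D"
  proof (rule continuous_on_blinfun_componentwise)
    fix b :: "real^'n"
    have "continuous_on W' (\<lambda>x. jac \<psi> x *v b)"
      by (intro smooth_on_continuous smooth_intros W'(1) smooth_on_subset[OF smooth_on_jac[OF W(1) \<psi>] W'(3)])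
    then show "continuous_on W' (\<lambda>x. blinfun_apply (D x) b)" by (simp add: Da)
  qed
  define I where "I = Blinfun (\<lambda>v. matrix_inv (jac \<psi> x0) *v v)"
  have Ia: "blinfun_apply I = (\<lambda>v. matrix_inv (jac \<psi> x0) *v v)"
    unfolding I_def by (rule bounded_linear_Blinfun_apply) (rule matrix_vector_mul_bounded_linear)
  have "I o\<^sub>L D x0 = id_blinfun"
    by (rule blinfun_eqI) (simp add: Ia Da matrix_vector_mul_assoc matrix_inv_left[OF inv0])
  from inverse_function_theorem[OF W'(1) der cont W'(2) this]
  obtain S T \<phi> \<phi>' where S: "open S" "S \<subseteq> W'" "x0 \<in> S" and T: "open T" and hom: "homeomorphism S T \<psi> \<phi>"
    and d\<phi>: "\<And>y. y \<in> T \<Longrightarrow> (\<phi> has_derivative (\<phi>' y)) (at y)" by metis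
  have im: "\<psi> ` S = T" "\<phi> ` T = S" "\<And>x. x \<in> S \<Longrightarrow> \<phi> (\<psi> x) = x" "\<And>y. y \<in> T \<Longrightarrow> \<psi> (\<phi> y) = y"
    using hom unfolding homeomorphism_def by auto
  have sS: "smooth_on S \<psi>" using \<psi> S(2) W'(3) smooth_on_subset by blast
  have "smooth_on T \<phi>"
  proof (rule smooth_on_inverse_map[OF S(1) T sS])
    show "\<phi> differentiable at y" if "y \<in> T" for y using d\<phi>[OF that] differentiable_def by blast
    show "invertible (\<chi> a b. pd b \<psi> x $ a)" if "x \<in> S" for x
      using inv[of x] that S(2) unfolding jac_def by blast
  qed (use im in auto)
  then have "diffeo S \<psi> \<phi> U"
    unfolding diffeo_def im(1)
  proof (intro conjI ballI)
    show "T \<subseteq> U" using S(2) im(1) by (auto simp: W'_def)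
    show "\<phi> (\<psi> x) = x" "invertible (jac \<psi> x)" if "x \<in> S" for x using that S(2) im(3) inv by blast+
  qed (use S T sS in auto)
  then show thesis using that S W'(3) by blast
qed

text \<open>An orthonormal basis for the form \<open>P\<close> is built one vector at a time, by
  induction over the index set; its vectors are the columns of \<open>L\<close>.\<close>

lemma orthonormalizing_matrix:
  fixes P :: "real^'n^'n::finite"
  assumes sym: "transpose P = P" and pos: "\<And>v. v \<noteq> 0 \<Longrightarrow> v \<bullet> (P *v v) > 0"
  obtains L :: "real^'n^'n" where "transpose L ** P ** L = mat 1"
proof -
  have symi: "u \<bullet> (P *v w) = w \<bullet> (P *v u)" for u w
    by (metis dot_lmul_matrix inner_commute sym transpose_matrix_vector)
  have "\<exists>v::'n \<Rightarrow> real^'n. \<forall>i\<in>I. \<forall>j\<in>I. v i \<bullet> (P *v v j) = (if i = j then 1 else 0)" if "finite I" for I :: "'n set"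
    using that
  proof (induction I rule: finite_induct)
    case empty
    then show ?case by simp
  next
    case (insert a I)
    then obtain v where v: "\<And>i j. i \<in> I \<Longrightarrow> j \<in> I \<Longrightarrow> v i \<bullet> (P *v v j) = (if i = j then 1 else 0)" by metis
    have "card I < CARD('n)" using insert by (intro psubset_card_mono) auto
    have "dim ((\<lambda>i. P *v v i) ` I) \<le> card I"
      using dim_le_card'[of "(\<lambda>i. P *v v i) ` I"] card_image_le[OF insert(1)] insert(1) by (meson finite_imageI order_trans)
    then have "span ((\<lambda>i. P *v v i) ` I) \<subset> UNIV"
      using \<open>card I < CARD('n)\<close> by (metis dim_UNIV dim_span DIM_cart DIM_real mult.right_neutral not_less psubsetI top_greatest)
    then have "dim (span ((\<lambda>i. P *v v i) ` I)) < DIM(real^'n)"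
      using \<open>card I < CARD('n)\<close> \<open>dim ((\<lambda>i. P *v v i) ` I) \<le> card I\<close> by simp
    \<comment> \<open>Fewer than \<open>CARD('n)\<close> vectors leave a direction orthogonal to all
      of them; being orthogonal to \<open>P *v v i\<close> means being orthogonal to
      \<open>v i\<close> with respect to \<open>P\<close>.\<close>
    then obtain u where u: "u \<noteq> 0" "\<And>y. y \<in> span ((\<lambda>i. P *v v i) ` I) \<Longrightarrow> orthogonal u y"
      using orthogonal_to_subspace_exists[of "(\<lambda>i. P *v v i) ` I"] by (metis dim_span)
    define c where "c = u \<bullet> (P *v u)"
    have c: "c > 0" using pos[OF u(1)] by (simp add: c_def)
    have uo: "u \<bullet> (P *v v i) = 0" if "i \<in> I" for i
      using u(2)[of "P *v v i"] that by (auto simp: orthogonal_def intro: span_base)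
    define v' where "v' i = (if i = a then (1 / sqrt c) *\<^sub>R u else v i)" for i
    have "v' i \<bullet> (P *v v' j) = (if i = j then 1 else 0)" if "i \<in> insert a I" "j \<in> insert a I" for i j
    proof (cases "i = a"; cases "j = a")
      assume "i = a" "j = a"
      then show ?thesis using c by (simp add: v'_def matrix_vector_mult_scaleR c_def[symmetric])
    next
      assume "i = a" "j \<noteq> a"
      then show ?thesis using uo that by (simp add: v'_def)
    next
      assume "i \<noteq> a" "j = a"
      then show ?thesis using uo[of i] that symi[of "v i" u] by (simp add: v'_def matrix_vector_mult_scaleR)
    next
      assume "i \<noteq> a" "j \<noteq> a"
      then show ?thesis using v that by (simp add: v'_def)
    qed
    then show ?case by blast
  qed
  from this[of UNIV] obtain v :: "'n \<Rightarrow> real^'n" where v: "\<And>i j. v i \<bullet> (P *v v j) = (if i = j then 1 else 0)" by auto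
  define L :: "real^'n^'n" where "L = (\<chi> a i. v i $ a)"
  have Li: "L *v axis i 1 = v i" for i
    by (simp add: L_def matrix_vector_mult_basis column_def)
  have "(transpose L ** P ** L) $ i $ j = v i \<bullet> (P *v v j)" for i j
  proof -
    have "(transpose L ** P ** L) $ i $ j = axis i 1 \<bullet> ((transpose L ** P ** L) *v axis j 1)"
      by (simp add: matrix_vector_mult_basis column_def inner_axis' )
    also have "\<dots> = axis i 1 \<bullet> (transpose L *v (P *v v j))" by (simp add: Li flip: matrix_vector_mul_assoc)
    also have "\<dots> = (L *v axis i 1) \<bullet> (P *v v j)" by (metis dot_lmul_matrix inner_commute transpose_matrix_vector)
    finally show ?thesis by (simp add: Li)
  qed
  then have "transpose L ** P ** L = mat 1" by (simp add: vec_eq_iff v mat_def)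
  then show thesis by (rule that)
qed

lemma pd_coord: "pd k (\<lambda>x::real^'n::finite. x $ i) y = (if i = k then 1 else 0)"
proof -
  have "((\<lambda>x::real^'n. x $ i) has_derivative (\<lambda>v. v $ i)) (at y)"
    by (rule bounded_linear_imp_has_derivative) (rule bounded_linear_vec_nth)
  from pd_eq[OF this] show ?thesis by (simp add: axis_def)
qed

lemma smooth_on_coord [smooth_intros]: "open S \<Longrightarrow> smooth_on S (\<lambda>x::real^'n::finite. x $ i)"
  by (intro smooth_intros)

lemma pd_linear_form:
  "pd k (\<lambda>x::real^'n::finite. SUM i. b i * x $ i) y = (b k :: real)"
proof -
  have d: "(\<lambda>x::real^'n. x $ i) differentiable at y" "(\<lambda>x. b i * x $ i) differentiable at y" for i
    by (auto intro!: smooth_onD[of UNIV] smooth_intros)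
  have "pd k (\<lambda>x. SUM i. b i * x $ i) y = (SUM i. b i * (if i = k then 1 else 0))"
    by (simp add: pd_sum d pd_mult[of "\<lambda>_. b _"] pd_coord)
  also have "\<dots> = (SUM i. if i = k then b i else 0)" by (intro sum.cong) auto
  finally show ?thesis by simp
qed

lemma pd_quadratic_form:
  "pd k (\<lambda>x::real^'n::finite. SUM i j. B i j * (x $ i * x $ j)) y
    = (SUM j. (B k j + B j k :: real) * y $ j)"
proof -
  have d: "(\<lambda>x::real^'n. x $ i) differentiable at y" "(\<lambda>x. x $ i * x $ j) differentiable at y" "(\<lambda>x. B i j * (x $ i * x $ j)) differentiable at y"
    "(\<lambda>x. SUM j. B i j * (x $ i * x $ j)) differentiable at y" for i j
    by (auto intro!: smooth_onD[of UNIV] smooth_intros)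
  have "pd k (\<lambda>x::real^'n. SUM i j. B i j * (x $ i * x $ j)) y
     = (SUM i j. B i j * (y $ i * (if j = k then 1 else 0) + (if i = k then 1 else 0) * y $ j))"
    by (simp add: pd_sum d pd_mult[of "\<lambda>_. B _ _"] pd_mult[OF d(1) d(1)] pd_coord)
  also have "\<dots> = (SUM i j. (if j = k then B i j * y $ i else 0)) + (SUM i j. (if i = k then B i j * y $ j else 0))"
    unfolding sum.distrib[symmetric] by (intro sum.cong refl) auto
  also have "(SUM i j. (if i = k then B i j * y $ j else 0)) = (SUM j i. (if i = k then B i j * y $ j else 0))"
    by (rule sum.swap)
  finally show ?thesis by (simp add: sum.distrib[symmetric] algebra_simps)
qed

lemma pd_cubic_form:
  "pd k (\<lambda>x::real^'n::finite. SUM l i j. T l i j * (x $ l * x $ i * x $ j)) y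
    = (SUM i j. (T k i j + T i k j + T i j k :: real) * (y $ i * y $ j))"
proof -
  have d: "(\<lambda>x::real^'n. x $ i) differentiable at y" "(\<lambda>x. x $ i * x $ j) differentiable at y" "(\<lambda>x. x $ l * x $ i * x $ j) differentiable at y"
    "(\<lambda>x. T l i j * (x $ l * x $ i * x $ j)) differentiable at y" "(\<lambda>x. SUM j. T l i j * (x $ l * x $ i * x $ j)) differentiable at y"
    "(\<lambda>x. SUM i j. T l i j * (x $ l * x $ i * x $ j)) differentiable at y" for i j l
    by (auto intro!: smooth_onD[of UNIV] smooth_intros)
  have "pd k (\<lambda>x::real^'n. SUM l i j. T l i j * (x $ l * x $ i * x $ j)) y
     = (SUM l i j. T l i j * (y $ l * y $ i * (if j = k then 1 else 0) + (y $ l * (if i = k then 1 else 0) + (if l = k then 1 else 0) * y $ i) * y $ j))"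
    by (simp add: pd_sum d pd_mult[of "\<lambda>_. T _ _ _"] pd_mult[OF d(2) d(1)] pd_mult[OF d(1) d(1)] pd_coord)
  also have "\<dots> = (SUM l i j. (if j = k then T l i j * (y $ l * y $ i) else 0))
     + (SUM l i j. (if i = k then T l i j * (y $ l * y $ j) else 0))
     + (SUM l i j. (if l = k then T l i j * (y $ i * y $ j) else 0))"
    unfolding sum.distrib[symmetric] by (intro sum.cong refl) (auto simp: algebra_simps)
  also have "(SUM l i j. (if i = k then T l i j * (y $ l * y $ j) else 0)) = (SUM l j i. (if i = k then T l i j * (y $ l * y $ j) else 0))"
    by (rule sum.cong[OF refl], rule sum.swap)
  also have "(SUM l i j. (if l = k then T l i j * (y $ i * y $ j) else 0)) = (SUM i j l. (if l = k then T l i j * (y $ i * y $ j) else 0))"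
    by (rule sum_rot3)
  finally show ?thesis by (simp add: sum.distrib[symmetric] algebra_simps)
qed

section \<open>Three successive coordinate changes, adjusting the metric, the connection and the
  derivative of the connection at the origin\<close>

lemma normal_step_linear:
  fixes h :: "'n::finite mfield"
  assumes U: "open U" "y0 \<in> U" and h: "metric_on U h"
  obtains S \<psi> \<phi> where "0 \<in> S" "diffeo S \<psi> \<phi> U" "\<psi> 0 = y0" "pullback \<psi> h 0 = mat 1"
proof -
  obtain L :: "real^'n^'n" where L: "transpose L ** h y0 ** L = mat 1"
    by (rule orthonormalizing_matrix[OF metric_on_sym[OF h U(2)]], erule metric_on_pos[OF h U(2)])
  have iL: "invertible L"
    using L matrix_left_right_inverse[of "transpose L ** h y0" L] unfolding invertible_def by blast
  define \<psi> where "\<psi> = (\<lambda>x. y0 + L *v x)"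
  have s: "smooth_on UNIV \<psi>" unfolding \<psi>_def by (intro smooth_intros) auto
  have der: "(\<psi> has_derivative (\<lambda>v. L *v v)) (at x)" for x
    unfolding \<psi>_def by (auto intro!: derivative_eq_intros bounded_linear_imp_has_derivative matrix_vector_mul_bounded_linear)
  have J: "jac \<psi> x = L" for x
    by (simp add: jac_def pd_eq[OF der] vec_eq_iff matrix_vector_mult_basis column_def)
  have 0: "\<psi> 0 = y0" by (simp add: \<psi>_def)
  have "\<psi> 0 \<in> U" "invertible (jac \<psi> 0)" using U(2) 0 J iL by simp_all
  then obtain S \<phi> where "0 \<in> S" "diffeo S \<psi> \<phi> U"
    by (rule local_diffeo[OF open_UNIV UNIV_I s U(1)])
  then show thesis using that 0 L by (simp add: pullback_def J)
qed

text \<open>The second derivatives of \<open>\<psi>\<close> are chosen to be minus the Christoffel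
  symbols at the origin, which cancels the two terms on the right of \<open>conn_pullback\<close>;
  the first derivative is the identity there and preserves the metric.\<close>

lemma normal_step_quadratic:
  assumes U: "open U" "0 \<in> U" and h: "metric_on U h" and h0: "h 0 = mat 1"
  obtains S \<psi> \<phi> where "0 \<in> S" "diffeo S \<psi> \<phi> U" "\<psi> 0 = 0" "pullback \<psi> h 0 = mat 1" "\<And>i. conn (pullback \<psi> h) i 0 = 0"
proof -
  define c where "c i a j = conn h i 0 $ a $ j" for i a j
  have cs: "c i a j = c j a i" for i a j unfolding c_def by (rule conn_sym[OF U(1) h U(2)])
  define \<psi> :: "real^'a \<Rightarrow> real^'a" where "\<psi> = (\<lambda>x. \<chi> a. x $ a - (1/2) * (SUM i j. c i a j * (x $ i * x $ j)))"
  have s: "smooth_on UNIV \<psi>" unfolding \<psi>_def by (intro smooth_intros) auto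
  have p1: "pd b (\<lambda>x. \<psi> x $ a) x = (if a = b then 1 else 0) - (1/2) * (SUM j. (c b a j + c j a b) * x $ j)" for a b x
  proof -
    have d: "(\<lambda>x::real^'a. x $ a) differentiable at x" "(\<lambda>x. (1/2) * (SUM i j. c i a j * (x $ i * x $ j))) differentiable at x"
      "(\<lambda>x. (SUM i j. c i a j * (x $ i * x $ j))) differentiable at x"
      by (intro smooth_onD[OF _ UNIV_I] smooth_intros open_UNIV)+
    show ?thesis unfolding \<psi>_def vec_lambda_beta pd_diff[OF d(1,2)]
      pd_linear[OF bounded_linear_mult_right d(3)] pd_quadratic_form pd_coord ..
  qed
  have p2: "pd i (pd b (\<lambda>x. \<psi> x $ a)) x = - c i a b" for i b a x
  proof -
    have d: "(\<lambda>x. (1/2) * (SUM j. (c b a j + c j a b) * x $ j)) differentiable at x" "(\<lambda>x. (SUM j. (c b a j + c j a b) * x $ j)) differentiable at x"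
      by (intro smooth_onD[OF _ UNIV_I] smooth_intros open_UNIV)+
    show ?thesis unfolding p1[abs_def] pd_diff[OF differentiable_const d(1)]
      pd_linear[OF bounded_linear_mult_right d(2)] pd_linear_form using cs[of b a i] by simp
  qed
  have J0: "jac \<psi> 0 = mat 1"
  proof -
    have "pd b \<psi> 0 $ a = (if a = b then 1 else 0)" for a b
      using p1[of b a 0] pd_component[OF smooth_onD[OF s]] by simp
    then show ?thesis by (simp add: jac_def mat_def vec_eq_iff)
  qed
  have 0: "\<psi> 0 = 0" by (simp add: \<psi>_def vec_eq_iff)
  have "\<psi> 0 \<in> U" "invertible (jac \<psi> 0)" using U(2) 0 J0 invertible_mat_1 by simp_all
  then obtain S \<phi> where S: "0 \<in> S" and d: "diffeo S \<psi> \<phi> U"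
    by (rule local_diffeo[OF open_UNIV UNIV_I s U(1)])
  note D = diffeoD[OF d]
  have G0: "pullback \<psi> h 0 = mat 1" by (simp add: pullback_def J0 0 h0 transpose_mat)
  have "conn (pullback \<psi> h) i 0 = 0" for i
  proof -
    have "pd i (jac \<psi>) 0 $ a $ b = - c i a b" for a b
      using pd_jac[OF open_UNIV s UNIV_I] pd_partial_component[OF open_UNIV s UNIV_I] p2 by metis
    moreover have "conn_along \<psi> h i 0 = conn h i 0"
    proof -
      have "conn_along \<psi> h i 0 = (SUM q. (if q = i then conn h q 0 else 0))"
        unfolding conn_along_def J0 0 by (intro sum.cong) (auto simp: mat_def)
      then show ?thesis by simp
    qed
    ultimately have "pd i (jac \<psi>) 0 + conn_along \<psi> h i 0 = 0" by (simp add: vec_eq_iff c_def)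
    then show ?thesis using conn_pullback[OF D(1) U(1) D(4,3,7) h S, of i] by (simp add: J0)
  qed
  then show thesis using that S d 0 G0 by blast
qed

text \<open>The cyclic condition says that the totally symmetric part of the derivative of the
  connection vanishes, as it does when straight lines through the origin are geodesics. Only this
  part can be changed by third derivatives of the coordinates, and since the connection already
  vanishes at the origin no lower order terms interfere.\<close>

lemma normal_step_cubic:
  assumes U: "open U" "0 \<in> U" and h: "metric_on U h" and h0: "h 0 = mat 1" and c0: "\<And>i. conn h i 0 = 0"
  obtains S \<psi> \<phi> where "0 \<in> S" "diffeo S \<psi> \<phi> U" "\<psi> 0 = 0" "pullback \<psi> h 0 = mat 1" "\<And>i. conn (pullback \<psi> h) i 0 = 0"
    "\<And>l i a b. pd l (conn (pullback \<psi> h) i) 0 $ a $ b + pd i (conn (pullback \<psi> h) b) 0 $ a $ l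
      + pd b (conn (pullback \<psi> h) l) 0 $ a $ i = 0"
proof -
  define t where "t l i a j = pd l (conn h i) 0 $ a $ j" for l i a j
  have ts: "t l i a j = t l j a i" for l i a j
  proof -
    have "pd l (\<lambda>y. conn h i y $ a $ j) 0 = pd l (\<lambda>y. conn h j y $ a $ i) 0"
      by (rule pd_cong_open[OF U conn_sym[OF U(1) h]])
        (auto intro!: smooth_onD[OF _ U(2)] smooth_intros U h)
    then show ?thesis by (simp add: t_def pd_matrix_component[OF smooth_onD[OF smooth_on_conn[OF U(1) h] U(2)]])
  qed
  \<comment> \<open>The factor is 1/3!, so that the third derivatives of the subtracted cubic are
    the symmetrization of \<open>t\<close>, one third of a cyclic sum because \<open>t\<close> is
    symmetric in its two lower connection indices.\<close>
  define \<psi> :: "real^'a \<Rightarrow> real^'a" where "\<psi> = (\<lambda>x. \<chi> a. x $ a - (1/6) * (SUM l i j. t l i a j * (x $ l * x $ i * x $ j)))"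
  define N where "N a b i j = t b i a j + t i b a j + t i j a b" for a b i j
  have s: "smooth_on UNIV \<psi>" unfolding \<psi>_def by (intro smooth_intros) auto
  have p1: "pd b (\<lambda>x. \<psi> x $ a) x = (if a = b then 1 else 0) - (1/6) * (SUM i j. N a b i j * (x $ i * x $ j))" for a b x
  proof -
    have d: "(\<lambda>x::real^'a. x $ a) differentiable at x"
      "(\<lambda>x. (1/6) * (SUM l i j. t l i a j * (x $ l * x $ i * x $ j))) differentiable at x"
      "(\<lambda>x. (SUM l i j. t l i a j * (x $ l * x $ i * x $ j))) differentiable at x"
      by (intro smooth_onD[OF _ UNIV_I] smooth_intros open_UNIV)+
    show ?thesis unfolding \<psi>_def vec_lambda_beta pd_diff[OF d(1,2)] N_def
      pd_linear[OF bounded_linear_mult_right d(3)] pd_cubic_form pd_coord ..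
  qed
  have p2: "pd i (pd b (\<lambda>x. \<psi> x $ a)) x = - (1/6) * (SUM j. (N a b i j + N a b j i) * x $ j)" for i b a x
  proof -
    have d: "(\<lambda>x. (1/6) * (SUM i j. N a b i j * (x $ i * x $ j))) differentiable at x"
      "(\<lambda>x. (SUM i j. N a b i j * (x $ i * x $ j))) differentiable at x"
      by (intro smooth_onD[OF _ UNIV_I] smooth_intros open_UNIV)+
    show ?thesis unfolding p1[abs_def] pd_diff[OF differentiable_const d(1)]
      pd_linear[OF bounded_linear_mult_right d(2)] pd_quadratic_form by simp
  qed
  have p3: "pd l (pd i (pd b (\<lambda>x. \<psi> x $ a))) x = - (1/3) * (t b i a l + t i b a l + t l b a i)" for l i b a x
  proof -
    have d: "(\<lambda>x. (SUM j. (N a b i j + N a b j i) * x $ j)) differentiable at x"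
      by (intro smooth_onD[OF _ UNIV_I] smooth_intros open_UNIV)+
    have "pd l (pd i (pd b (\<lambda>x. \<psi> x $ a))) x = - (1/6) * (N a b i l + N a b l i)"
      unfolding p2[abs_def] pd_linear[OF bounded_linear_mult_right d] pd_linear_form ..
    also have "\<dots> = - (1/3) * (t b i a l + t i b a l + t l b a i)"
      using ts[of b i a l] ts[of i b a l] ts[of l b a i] by (simp add: N_def)
    finally show ?thesis .
  qed
  have pc: "pd b \<psi> x $ a = pd b (\<lambda>x. \<psi> x $ a) x" for b x a
    using pd_component[OF smooth_onD[OF s]] by simp
  have jc: "jac \<psi> x $ a $ b = pd b (\<lambda>x. \<psi> x $ a) x" for x a b
    by (simp add: jac_def pc)
  have sJ: "smooth_on UNIV (jac \<psi>)" by (rule smooth_on_jac[OF open_UNIV s])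
  have J0: "jac \<psi> 0 = mat 1" by (simp add: vec_eq_iff jc p1 mat_def)
  have dJ: "pd i (jac \<psi>) x $ a $ b = pd i (pd b (\<lambda>x. \<psi> x $ a)) x" for i a b x
    using pd_matrix_component[OF smooth_onD[OF sJ UNIV_I], of i a b] by (simp add: jc[abs_def])
  have dJ0: "pd i (jac \<psi>) 0 = 0" for i by (simp add: vec_eq_iff dJ p2)
  have ddJ: "pd l (pd i (jac \<psi>)) 0 $ a $ b = - (1/3) * (t b i a l + t i b a l + t l b a i)" for l i a b
    using pd_matrix_component[OF smooth_onD[OF smooth_on_partial[OF sJ] UNIV_I], of l i a b] p3
    by (simp add: dJ[abs_def])
  have 0: "\<psi> 0 = 0" by (simp add: \<psi>_def vec_eq_iff)
  have "\<psi> 0 \<in> U" "invertible (jac \<psi> 0)" using U(2) 0 J0 invertible_mat_1 by simp_all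
  then obtain S \<phi> where S: "0 \<in> S" and d: "diffeo S \<psi> \<phi> U"
    by (rule local_diffeo[OF open_UNIV UNIV_I s U(1)])
  note D = diffeoD[OF d]
  let ?G = "pullback \<psi> h"
  have mG: "metric_on S ?G" by (rule metric_on_pullback[OF D(1) U(1) D(4,3,7) h])
  have G0: "?G 0 = mat 1" by (simp add: pullback_def J0 0 h0 transpose_mat)
  have ca0: "conn_along \<psi> h i 0 = 0" for i by (simp add: conn_along_def 0 c0)
  have cG0: "conn ?G i 0 = 0" for i
    using conn_pullback[OF D(1) U(1) D(4,3,7) h S, of i] by (simp add: J0 ca0 dJ0)
  have sC: "smooth_on S (\<lambda>x. conn h q (\<psi> x))" for q
    by (rule smooth_on_compose[OF D(1) U(1) D(3,4) smooth_on_conn[OF U(1) h]])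
  have sJS: "smooth_on S (jac \<psi>)" using sJ smooth_on_subset by blast
  have sA: "smooth_on S (conn_along \<psi> h j)" for j
    unfolding conn_along_def[abs_def] by (intro smooth_intros D(1) sJS sC)
  note dd = smooth_onD[OF _ S]
  have dif: "jac \<psi> differentiable (at 0)" "conn ?G j differentiable (at 0)"
    "conn_along \<psi> h j differentiable (at 0)" "pd j (jac \<psi>) differentiable (at 0)" for j
    using dd[OF sJS] dd[OF sA] dd[OF smooth_on_conn[OF D(1) mG]] dd[OF smooth_on_partial[OF sJS]] by blast+
  have dA: "pd l (conn_along \<psi> h i) 0 = pd l (conn h i) 0" for l i
  proof -
    have e: "pd l (\<lambda>x. conn h q (\<psi> x)) 0 = pd l (conn h q) 0" for q
    proof -
      have "pd l (\<lambda>x. conn h q (\<psi> x)) 0 = (SUM p. jac \<psi> 0 $ p $ l *\<^sub>R pd p (conn h q) (\<psi> 0))"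
        by (rule pd_comp_jac[OF smooth_onD[OF s UNIV_I]])
          (use smooth_onD[OF smooth_on_conn[OF U(1) h] U(2)] 0 in simp)
      also have "\<dots> = (SUM p. if p = l then pd p (conn h q) 0 else 0)"
        unfolding J0 0 by (intro sum.cong) (auto simp: mat_def)
      finally show ?thesis by simp
    qed
    have "pd l (conn_along \<psi> h i) 0 = (SUM q. pd l (\<lambda>x. jac \<psi> x $ q $ i *\<^sub>R conn h q (\<psi> x)) 0)"
      unfolding conn_along_def[abs_def]
      by (rule pd_sum) (auto intro!: dd smooth_intros D(1) sJS sC)
    also have "\<dots> = (SUM q. if q = i then pd l (conn h q) 0 else 0)"
    proof (rule sum.cong[OF refl])
      fix q
      show "pd l (\<lambda>x. jac \<psi> x $ q $ i *\<^sub>R conn h q (\<psi> x)) 0 = (if q = i then pd l (conn h q) 0 else 0)"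
        using pd_scaleR[OF dd[OF smooth_on_matrix_component[OF D(1) sJS]] dd[OF sC]]
        by (simp add: e J0 0 c0 mat_def)
    qed
    finally show ?thesis by simp
  qed
  have dG: "pd l (conn ?G i) 0 $ a $ b = t l i a b - (1/3) * (t b i a l + t i b a l + t l b a i)" for l i a b
  proof -
    have "pd l (\<lambda>x. jac \<psi> x ** conn ?G i x) 0 = pd l (\<lambda>x. pd i (jac \<psi>) x + conn_along \<psi> h i x ** jac \<psi> x) 0"
      by (rule pd_cong_open[OF D(1) S])
        (simp add: conn_pullback[OF D(1) U(1) D(4,3,7) h], intro dif differentiable_add differentiable_matrix_mult)
    then have "pd l (conn ?G i) 0 = pd l (pd i (jac \<psi>)) 0 + pd l (conn_along \<psi> h i) 0"
      by (simp add: pd_matrix_mult pd_add dif differentiable_matrix_mult cG0 ca0 J0)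
    then show ?thesis by (simp add: ddJ dA t_def)
  qed
  have "pd l (conn ?G i) 0 $ a $ b + pd i (conn ?G b) 0 $ a $ l + pd b (conn ?G l) 0 $ a $ i = 0" for l i a b
    unfolding dG using ts[of l i a b] ts[of i b a l] ts[of b l a i] by (simp add: algebra_simps)
  then show thesis using that S d 0 G0 cG0 by blast
qed

lemma normal_coordinates:
  assumes U: "open U" "y0 \<in> U" and h: "metric_on U h"
  obtains S \<psi> \<phi> where "0 \<in> S" "diffeo S \<psi> \<phi> U" "\<psi> 0 = y0" "pullback \<psi> h 0 = mat 1" "\<And>i. conn (pullback \<psi> h) i 0 = 0"
    "\<And>l i a b. pd l (conn (pullback \<psi> h) i) 0 $ a $ b + pd i (conn (pullback \<psi> h) b) 0 $ a $ l
      + pd b (conn (pullback \<psi> h) l) 0 $ a $ i = 0"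
proof -
  obtain S1 \<psi>1 \<phi>1 where 1: "0 \<in> S1" "diffeo S1 \<psi>1 \<phi>1 U" "\<psi>1 0 = y0" "pullback \<psi>1 h 0 = mat 1"
    by (rule normal_step_linear[OF U h])
  note D1 = diffeoD[OF 1(2)]
  have m1: "metric_on S1 (pullback \<psi>1 h)" by (rule metric_on_pullback[OF D1(1) U(1) D1(4,3,7) h])
  obtain S2 \<psi>2 \<phi>2 where 2: "0 \<in> S2" "diffeo S2 \<psi>2 \<phi>2 S1" "\<psi>2 0 = 0" "pullback \<psi>2 (pullback \<psi>1 h) 0 = mat 1"
    "\<And>i. conn (pullback \<psi>2 (pullback \<psi>1 h)) i 0 = 0"
    using normal_step_quadratic[OF D1(1) 1(1) m1 1(4)] by blast
  note D2 = diffeoD[OF 2(2)]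
  have m2: "metric_on S2 (pullback \<psi>2 (pullback \<psi>1 h))" by (rule metric_on_pullback[OF D2(1) D1(1) D2(4,3,7) m1])
  obtain S3 \<psi>3 \<phi>3 where 3: "0 \<in> S3" "diffeo S3 \<psi>3 \<phi>3 S2" "\<psi>3 0 = 0"
    "pullback \<psi>3 (pullback \<psi>2 (pullback \<psi>1 h)) 0 = mat 1" "\<And>i. conn (pullback \<psi>3 (pullback \<psi>2 (pullback \<psi>1 h))) i 0 = 0"
    "\<And>l i a b. pd l (conn (pullback \<psi>3 (pullback \<psi>2 (pullback \<psi>1 h))) i) 0 $ a $ b
      + pd i (conn (pullback \<psi>3 (pullback \<psi>2 (pullback \<psi>1 h))) b) 0 $ a $ l
      + pd b (conn (pullback \<psi>3 (pullback \<psi>2 (pullback \<psi>1 h))) l) 0 $ a $ i = 0"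
    using normal_step_cubic[OF D2(1) 2(1) m2 2(4,5)] by blast
  note D3 = diffeoD[OF 3(2)]
  let ?G = "pullback \<psi>3 (pullback \<psi>2 (pullback \<psi>1 h))"
  have mG: "metric_on S3 ?G" by (rule metric_on_pullback[OF D3(1) D2(1) D3(4,3,7) m2])
  let ?\<psi> = "\<lambda>x. \<psi>1 (\<psi>2 (\<psi>3 x))"
  have d12: "diffeo S2 (\<lambda>x. \<psi>1 (\<psi>2 x)) (\<lambda>y. \<phi>2 (\<phi>1 y)) U" by (rule diffeo_compose[OF 1(2) 2(2)])
  have d: "diffeo S3 ?\<psi> (\<lambda>y. \<phi>3 (\<phi>2 (\<phi>1 y))) U" using diffeo_compose[OF d12 3(2)] .
  note D12 = diffeoD[OF d12]
  \<comment> \<open>Iterated and composite pullback agree only on \<open>S3\<close>, so connection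
    and derivative are transferred by locality.\<close>
  have eq: "?G x = pullback ?\<psi> h x" if x: "x \<in> S3" for x
  proof -
    have x2: "\<psi>3 x \<in> S2" using D3(3) x by blast
    then have x1: "\<psi>2 (\<psi>3 x) \<in> S1" using D2(3) by blast
    note di = smooth_onD[OF D3(4) x] smooth_onD[OF D2(4) x2] smooth_onD[OF D1(4) x1]
      smooth_onD[OF D12(4) x2]
    have "pullback ?\<psi> h x = pullback \<psi>3 (pullback (\<lambda>x. \<psi>1 (\<psi>2 x)) h) x"
      by (rule pullback_compose[OF di(1,4)])
    also have "\<dots> = ?G x" using pullback_compose[OF di(2,3)] by (simp add: pullback_def[of \<psi>3])
    finally show ?thesis by simp
  qed
  have c: "conn (pullback ?\<psi> h) i x = conn ?G i x" if "x \<in> S3" for i x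
    by (rule conn_cong_open[OF D3(1) mG eq that])
  have dc: "pd l (conn (pullback ?\<psi> h) i) 0 = pd l (conn ?G i) 0" for l i
    by (rule pd_cong_open[OF D3(1) 3(1)])
      (auto simp: c intro: smooth_onD[OF smooth_on_conn[OF D3(1) mG] 3(1)])
  show thesis
    by (rule that[of S3 ?\<psi>, OF 3(1) d]) (use 1 2 3 eq[OF 3(1)] c[OF 3(1)] dc in simp_all)
qed

section \<open>Gaussian moments\<close>

text \<open>The Euclidean heat kernel at time one: mean zero and covariance twice the identity.
  After rescaling by \<delta> it is the density for \<open>s = 1\<close>, at which Euclidean entropy
  is zero.\<close>

definition gauss :: "real^'n::finite \<Rightarrow> real"
  where "gauss y = exp (- (norm y)\<^sup>2 / 4) / sqrt (4 * pi) ^ CARD('n)"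

lemma gauss_pos: "gauss y > 0" by (simp add: gauss_def)

lemma has_bochner_integral_normal_vec:
  assumes "\<sigma> > 0"
  shows "has_bochner_integral lborel (\<lambda>y::real^'n::finite. exp (- (norm y)\<^sup>2 / (2 * \<sigma>\<^sup>2)) / sqrt (2 * pi * \<sigma>\<^sup>2) ^ CARD('n)) 1"
proof (rule has_bochner_integral_nn_integral)
  have eq: "exp (- (norm y)\<^sup>2 / (2 * \<sigma>\<^sup>2)) / sqrt (2 * pi * \<sigma>\<^sup>2) ^ CARD('n) = (\<Prod>b\<in>Basis. normal_density 0 \<sigma> (y \<bullet> b))" for y :: "real^'n"
  proof -
    have n: "(norm y)\<^sup>2 = (SUM i. (y $ i)\<^sup>2)"
      unfolding power2_norm_eq_inner by (simp add: inner_vec_def power2_eq_square)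
    have "(\<Prod>b\<in>Basis. normal_density 0 \<sigma> (y \<bullet> b)) = (\<Prod>i\<in>UNIV. normal_density 0 \<sigma> (y $ i))"
      by (simp add: prod_Basis_vec inner_axis)
    also have "\<dots> = (\<Prod>i\<in>UNIV. exp (- (y $ i)\<^sup>2 / (2 * \<sigma>\<^sup>2))) / sqrt (2 * pi * \<sigma>\<^sup>2) ^ CARD('n)"
      by (simp add: normal_density_def prod_dividef)
    also have "(\<Prod>i\<in>UNIV. exp (- (y $ i)\<^sup>2 / (2 * \<sigma>\<^sup>2))) = exp (- (norm y)\<^sup>2 / (2 * \<sigma>\<^sup>2))"
      by (simp add: exp_sum[symmetric] n sum_negf sum_divide_distrib)
    finally show ?thesis by simp
  qed
  have "(\<integral>\<^sup>+y. ennreal (\<Prod>b\<in>(Basis::(real^'n) set). normal_density 0 \<sigma> (y \<bullet> b)) \<partial>lborel)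
    = (\<integral>\<^sup>+y. (\<Prod>b\<in>(Basis::(real^'n) set). ennreal (normal_density 0 \<sigma> (y \<bullet> b))) \<partial>lborel)"
    by (simp add: prod_ennreal)
  also have "\<dots> = (\<Prod>b\<in>(Basis::(real^'n) set). (\<integral>\<^sup>+x. ennreal (normal_density 0 \<sigma> x) \<partial>lborel))"
    by (rule nn_integral_lborel_prod) auto
  also have "(\<integral>\<^sup>+x. ennreal (normal_density 0 \<sigma> x) \<partial>lborel) = 1"
    using nn_integral_eq_integral[OF integrable_normal_density[of \<sigma> 0]] assms by simp
  finally show "(\<integral>\<^sup>+y. ennreal (exp (- (norm y)\<^sup>2 / (2 * \<sigma>\<^sup>2)) / sqrt (2 * pi * \<sigma>\<^sup>2) ^ CARD('n)) \<partial>(lborel :: (real^'n) measure)) = ennreal 1"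
    unfolding eq by simp
qed (auto intro!: borel_measurable_continuous_onI continuous_intros)

lemma has_bochner_integral_gauss: "has_bochner_integral lborel (gauss :: real^'n::finite \<Rightarrow> real) 1"
  using has_bochner_integral_normal_vec[of "sqrt 2", where 'n='n] by (simp add: gauss_def[abs_def])

lemma integrable_exp_norm:
  assumes "c > 0"
  shows "integrable lborel (\<lambda>y::real^'n::finite. exp (- c * (norm y)\<^sup>2))"
proof -
  let ?\<sigma> = "sqrt (1 / (2 * c))"
  have s: "?\<sigma> > 0" "?\<sigma>\<^sup>2 = 1 / (2 * c)" using assms by simp_all
  have "integrable lborel (\<lambda>y::real^'n. exp (- (norm y)\<^sup>2 / (2 * ?\<sigma>\<^sup>2)) / sqrt (2 * pi * ?\<sigma>\<^sup>2) ^ CARD('n))"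
    using has_bochner_integral_normal_vec[OF s(1)] by (rule integrable.intros)
  then have "integrable lborel (\<lambda>y::real^'n. sqrt (2 * pi * ?\<sigma>\<^sup>2) ^ CARD('n) * (exp (- (norm y)\<^sup>2 / (2 * ?\<sigma>\<^sup>2)) / sqrt (2 * pi * ?\<sigma>\<^sup>2) ^ CARD('n)))"
    by (rule integrable_mult_right)
  then show ?thesis using assms s(1) by (simp add: s(2) mult.commute)
qed

text \<open>The inequality \<open>x <= exp x\<close> at \<open>x = c * t^2 / K\<close>, raised to
  the power \<open>K\<close>, bounds the square of \<open>t ^ K\<close>; then
  \<open>u <= 1 + u^2\<close>.\<close>

lemma power_le_exp_square:
  assumes c: "(c::real) > 0"
  shows "\<exists>C. \<forall>t\<ge>0. t ^ K \<le> C * exp (c * t\<^sup>2)"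
proof (cases "K = 0")
  case True
  then show ?thesis using c by (intro exI[of _ 1]) auto
next
  case False
  have "t ^ K \<le> (1 + (K / c) ^ K) * exp (c * t\<^sup>2)" if t: "t \<ge> 0" for t :: real
  proof -
    have "c * t\<^sup>2 / K \<le> exp (c * t\<^sup>2 / K)" using exp_ge_add_one_self[of "c * t\<^sup>2 / K"] by linarith
    then have "t\<^sup>2 \<le> (K / c) * exp (c * t\<^sup>2 / K)" using c False by (simp add: field_simps)
    then have "(t\<^sup>2) ^ K \<le> ((K / c) * exp (c * t\<^sup>2 / K)) ^ K" by (intro power_mono) auto
    also have "\<dots> = (K / c) ^ K * exp (c * t\<^sup>2)"
      unfolding power_mult_distrib using False by (simp flip: exp_of_nat_mult)
    finally have 1: "(t ^ K)\<^sup>2 \<le> (K / c) ^ K * exp (c * t\<^sup>2)" by (simp add: power_mult[symmetric] mult.commute)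
    have "0 \<le> (t ^ K - 1)\<^sup>2" by simp
    then have "2 * t ^ K \<le> 1 + (t ^ K)\<^sup>2" by (simp only: power2_diff) simp
    moreover have "0 \<le> t ^ K" using t by simp
    ultimately have "t ^ K \<le> 1 + (t ^ K)\<^sup>2" by linarith
    moreover have "1 \<le> exp (c * t\<^sup>2)" using c by simp
    ultimately show ?thesis unfolding distrib_right using 1 by linarith
  qed
  then show ?thesis by blast
qed

lemma integrable_power_exp_norm:
  assumes c: "c > 0" and a: "a \<ge> 0"
  shows "integrable lborel (\<lambda>y::real^'n::finite. (a + norm y) ^ K * exp (- c * (norm y)\<^sup>2))"
proof -
  obtain C where C: "\<And>t. t \<ge> 0 \<Longrightarrow> t ^ K \<le> C * exp (c / 4 * t\<^sup>2)"
    using power_le_exp_square[of "c/4" K] c by auto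
  have "C \<ge> 0" using C[of 0] zero_le_power[of "0::real" K] by (simp del: zero_le_power)
  have b: "(a + norm y) ^ K * exp (- c * (norm y)\<^sup>2) \<le> C * exp (c * a\<^sup>2 / 2) * exp (- (c / 2) * (norm y)\<^sup>2)" for y :: "real^'n"
  proof -
    have "0 \<le> (a - norm y)\<^sup>2" by simp
    then have "(a + norm y)\<^sup>2 \<le> 2 * a\<^sup>2 + 2 * (norm y)\<^sup>2" by (simp add: power2_eq_square algebra_simps)
    then have "c / 4 * (a + norm y)\<^sup>2 \<le> c / 4 * (2 * a\<^sup>2 + 2 * (norm y)\<^sup>2)" using c by (intro mult_left_mono) auto
    then have "exp (c / 4 * (a + norm y)\<^sup>2) \<le> exp (c * a\<^sup>2 / 2 + c / 2 * (norm y)\<^sup>2)" by (simp add: algebra_simps)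
    then have "C * exp (c / 4 * (a + norm y)\<^sup>2) \<le> C * exp (c * a\<^sup>2 / 2 + c / 2 * (norm y)\<^sup>2)"
      using \<open>C \<ge> 0\<close> by (rule mult_left_mono)
    then have "(a + norm y) ^ K \<le> C * exp (c * a\<^sup>2 / 2 + c / 2 * (norm y)\<^sup>2)"
      using C[of "a + norm y"] a by simp
    then have "(a + norm y) ^ K * exp (- c * (norm y)\<^sup>2) \<le> C * exp (c * a\<^sup>2 / 2 + c / 2 * (norm y)\<^sup>2) * exp (- c * (norm y)\<^sup>2)"
      by (rule mult_right_mono) simp
    also have "\<dots> = C * exp (c * a\<^sup>2 / 2) * exp (- (c / 2) * (norm y)\<^sup>2)"
      by (simp add: mult.assoc flip: exp_add)
    finally show ?thesis .
  qed
  show ?thesis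
  proof (rule Bochner_Integration.integrable_bound)
    show "integrable lborel (\<lambda>y::real^'n. C * exp (c * a\<^sup>2 / 2) * exp (- (c / 2) * (norm y)\<^sup>2))"
      using c by (intro integrable_mult_right integrable_exp_norm) simp
    show "AE y in lborel. norm ((a + norm y) ^ K * exp (- c * (norm y)\<^sup>2)) \<le> norm (C * exp (c * a\<^sup>2 / 2) * exp (- (c / 2) * (norm (y::real^'n))\<^sup>2))"
      using b a \<open>C \<ge> 0\<close> by (intro AE_I2) (simp add: abs_mult)
  qed (auto intro!: borel_measurable_continuous_onI continuous_intros)
qed

lemma integrable_gauss_power: "integrable lborel (\<lambda>y::real^'n::finite. gauss y * (C * (1 + norm y) ^ K))"
proof -
  have "integrable lborel (\<lambda>y::real^'n. (C / sqrt (4 * pi) ^ CARD('n)) * ((1 + norm y) ^ K * exp (- (1/4) * (norm y)\<^sup>2)))"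
    by (intro integrable_mult_right integrable_power_exp_norm) auto
  then show ?thesis by (simp add: gauss_def mult_ac)
qed

lemma integrable_gauss_bound:
  fixes f :: "real^'n::finite \<Rightarrow> real"
  assumes "f \<in> borel_measurable borel" "\<And>y. \<bar>f y\<bar> \<le> C * (1 + norm y) ^ K"
  shows "integrable lborel (\<lambda>y. gauss y * f y)"
proof (rule Bochner_Integration.integrable_bound[OF integrable_gauss_power[of C K]])
  have "gauss \<in> borel_measurable (borel :: (real^'n) measure)"
    unfolding gauss_def[abs_def] by (intro borel_measurable_continuous_onI continuous_intros) auto
  then show "(\<lambda>y. gauss y * f y) \<in> borel_measurable lborel" using assms(1) by simp
  show "AE y in lborel. norm (gauss y * f y) \<le> norm (gauss y * (C * (1 + norm y) ^ K))"
  proof (intro AE_I2)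
    fix y :: "real^'n"
    have "\<bar>f y\<bar> \<le> \<bar>C * (1 + norm y) ^ K\<bar>" using assms(2)[of y] by linarith
    then show "norm (gauss y * f y) \<le> norm (gauss y * (C * (1 + norm y) ^ K))"
      using gauss_pos[of y] by (simp add: abs_mult mult_left_mono)
  qed
qed

lemma smooth_on_norm_square: "smooth_on UNIV (\<lambda>y::real^'n::finite. (norm y)\<^sup>2)"
proof -
  have "smooth_on UNIV (\<lambda>y::real^'n. SUM i. y $ i * y $ i)" by (intro smooth_intros) auto
  then show ?thesis by (simp add: power2_norm_eq_inner inner_vec_def)
qed

lemma pd_norm_square: "pd i (\<lambda>y::real^'n::finite. (norm y)\<^sup>2) y = 2 * y $ i"
proof -
  have d: "(\<lambda>x::real^'n. x $ j) differentiable (at y)" "(\<lambda>x::real^'n. x $ j * x $ j) differentiable (at y)" for j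
    by (auto intro!: smooth_onD[of UNIV] smooth_intros)
  have "pd i (\<lambda>y::real^'n. SUM j. y $ j * y $ j) y = (SUM j. y $ j * (if j = i then 1 else 0) + (if j = i then 1 else 0) * y $ j)"
    by (subst pd_sum) (auto simp: d pd_mult pd_coord intro!: sum.cong)
  also have "\<dots> = (SUM j. if j = i then 2 * y $ j else 0)" by (intro sum.cong) auto
  finally show ?thesis by (simp add: power2_norm_eq_inner inner_vec_def)
qed

lemma smooth_on_gauss: "smooth_on UNIV (gauss :: real^'n::finite \<Rightarrow> real)"
proof -
  have "smooth_on UNIV (\<lambda>y::real^'n. (1 / sqrt (4 * pi) ^ CARD('n)) * exp ((- 1/4) * (norm y)\<^sup>2))"
    by (intro smooth_intros smooth_on_norm_square) auto
  then show ?thesis by (simp add: gauss_def[abs_def])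
qed

lemma pd_gauss: "pd i gauss y = - (y $ i / 2) * gauss y"
proof -
  let ?c = "1 / sqrt (4 * pi) ^ CARD('a)"
  have "((\<lambda>t. ?c * exp ((- 1/4) * t)) has_real_derivative ?c * ((- 1/4) * exp ((- 1/4) * (norm y)\<^sup>2))) (at ((norm y)\<^sup>2))"
    by (auto intro!: derivative_eq_intros)
  from pd_compose_real(1)[OF smooth_onD[OF smooth_on_norm_square UNIV_I] this, of i]
  show ?thesis by (simp add: gauss_def[abs_def] pd_norm_square)
qed

text \<open>Stein's identity: \<open>y $ i * gauss y\<close> is minus twice a partial derivative of
  \<open>gauss\<close>. The factor 2 is the variance.\<close>

lemma gauss_integral_by_parts:
  fixes p :: "real^'n::finite \<Rightarrow> real"
  assumes p: "smooth_on UNIV p" "\<And>y. \<bar>p y\<bar> \<le> C * (1 + norm y) ^ K" "\<And>y. \<bar>pd i p y\<bar> \<le> C * (1 + norm y) ^ K"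
  shows "(LBINT y. gauss y * (y $ i * p y)) = 2 * (LBINT y. gauss y * pd i p y)"
proof -
  let ?F = "\<lambda>y. gauss y * p y"
  have C: "C \<ge> 0" using p(2)[of 0] by (auto intro: order_trans[OF abs_ge_zero])
  have mp: "p \<in> borel_measurable borel" "pd i p \<in> borel_measurable borel"
    using smooth_on_continuous[OF p(1)] smooth_on_continuous[OF smooth_on_partial[OF p(1)]]
    by (auto intro: borel_measurable_continuous_onI)
  have pF: "pd i ?F y = gauss y * (pd i p y - (y $ i / 2) * p y)" for y
    using pd_mult[OF smooth_onD[OF smooth_on_gauss] smooth_onD[OF p(1)], of y]
    by (simp add: pd_gauss algebra_simps)
  have B1: "\<bar>y $ i * p y\<bar> \<le> C * (1 + norm y) ^ Suc K" for y
  proof -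
    have "\<bar>y $ i\<bar> * \<bar>p y\<bar> \<le> (1 + norm y) * (C * (1 + norm y) ^ K)"
      by (intro mult_mono p) (auto intro: order_trans[OF component_le_norm_cart] C)
    then show ?thesis by (simp add: abs_mult mult_ac)
  qed
  have B2: "\<bar>pd i p y - (y $ i / 2) * p y\<bar> \<le> 2 * C * (1 + norm y) ^ Suc K" for y
  proof -
    have "C * (1 + norm y) ^ K \<le> C * (1 + norm y) ^ Suc K"
      using C by (intro mult_left_mono power_increasing) auto
    then have "\<bar>pd i p y\<bar> \<le> C * (1 + norm y) ^ Suc K" using p(3)[of y] by linarith
    then show ?thesis using B1[of y] by (simp add: abs_le_iff)
  qed
  \<comment> \<open>For a shift of length at most 1 the squared norm of \<open>?z\<close> is at
    least \<open>(norm x)^2 / 2 - 1\<close>, which turns the Gaussian at \<open>?z\<close> into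
    \<open>exp (1/4)\<close> times the wider one \<open>exp (- (norm x)^2 / 8)\<close>; the
    polynomial factor changes from \<open>1 + norm\<close> to \<open>2 + norm\<close>.\<close>
  define H where "H y = exp (1/4) * 2 * C / sqrt (4 * pi) ^ CARD('n) * ((2 + norm y) ^ Suc K * exp (- (1/8) * (norm y)\<^sup>2))" for y :: "real^'n"
  have iH: "integrable lborel H" unfolding H_def by (intro integrable_mult_right integrable_power_exp_norm) auto
  have iF: "integrable lborel ?F" by (rule integrable_gauss_bound[OF mp(1) p(2)])
  have "\<bar>pd i ?F (x + t *\<^sub>R axis i 1)\<bar> \<le> H x" if t: "\<bar>t\<bar> \<le> 1" for x t
  proof -
    let ?z = "x + t *\<^sub>R axis i 1"
    have ax: "norm (t *\<^sub>R axis i (1::real)) \<le> 1" using t by simp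
    have z1: "norm ?z \<le> norm x + 1" using norm_triangle_ineq[of x "t *\<^sub>R axis i 1"] ax by linarith
    have "norm x \<le> norm ?z + norm (t *\<^sub>R axis i (1::real) :: real^'n)" using norm_triangle_ineq4[of ?z "t *\<^sub>R axis i 1"] by simp
    then have "norm x \<le> norm ?z + 1" using ax by linarith
    then have "(norm x)\<^sup>2 \<le> (norm ?z + 1)\<^sup>2" by (intro power_mono) auto
    also have "\<dots> \<le> 2 * (norm ?z)\<^sup>2 + 2"
    proof -
      have "0 \<le> (norm ?z - 1)\<^sup>2" by simp
      then show ?thesis by (simp only: power2_sum power2_diff) simp
    qed
    finally have "exp (- (norm ?z)\<^sup>2 / 4) \<le> exp (1/4) * exp (- (1/8) * (norm x)\<^sup>2)"
      by (simp flip: exp_add)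
    then have g: "gauss ?z \<le> exp (1/4) * exp (- (1/8) * (norm x)\<^sup>2) / sqrt (4 * pi) ^ CARD('n)"
      unfolding gauss_def by (rule divide_right_mono) simp
    have "(1 + norm ?z) ^ Suc K \<le> (2 + norm x) ^ Suc K" using z1 by (intro power_mono) auto
    then have "2 * C * (1 + norm ?z) ^ Suc K \<le> 2 * C * (2 + norm x) ^ Suc K" using C by (intro mult_left_mono) auto
    then have "\<bar>pd i p ?z - (?z $ i / 2) * p ?z\<bar> \<le> 2 * C * (2 + norm x) ^ Suc K" using B2[of ?z] by linarith
    then have "gauss ?z * \<bar>pd i p ?z - (?z $ i / 2) * p ?z\<bar> \<le> (exp (1/4) * exp (- (1/8) * (norm x)\<^sup>2) / sqrt (4 * pi) ^ CARD('n)) * (2 * C * (2 + norm x) ^ Suc K)"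
      by (intro mult_mono g) auto
    moreover have "\<bar>pd i ?F ?z\<bar> = gauss ?z * \<bar>pd i p ?z - (?z $ i / 2) * p ?z\<bar>"
      unfolding pF abs_mult using gauss_pos[of ?z] by simp
    ultimately show ?thesis by (simp add: H_def mult_ac)
  qed
  then have "(LBINT y. pd i ?F y) = 0"
    by (intro integral_pd_zero[OF _ iF iH] smooth_intros smooth_on_gauss p) auto
  moreover have i1: "integrable lborel (\<lambda>y. gauss y * pd i p y)" by (rule integrable_gauss_bound[OF mp(2) p(3)])
  moreover have i2: "integrable lborel (\<lambda>y. gauss y * (y $ i * p y))"
    by (rule integrable_gauss_bound[OF _ B1]) (use mp(1) in measurable)
  ultimately have "(LBINT y. gauss y * pd i p y) - (1/2) * (LBINT y. gauss y * (y $ i * p y)) = 0"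
    unfolding pF by (simp add: algebra_simps)
  then show ?thesis by simp
qed

abbreviation kron :: "'n \<Rightarrow> 'n \<Rightarrow> real" where "kron i j \<equiv> (if i = j then 1 else 0)"

lemma coord_le: "\<bar>y $ i\<bar> \<le> 1 + norm (y :: real^'n::finite)"
  by (rule order_trans[OF component_le_norm_cart]) simp

lemma gauss_second_moment: "has_bochner_integral lborel (\<lambda>y::real^'n::finite. gauss y * (y $ i * y $ j)) (2 * kron i j)"
proof -
  have s: "smooth_on UNIV (\<lambda>y::real^'n. y $ j)" by (intro smooth_intros) auto
  have "(LBINT y. gauss y * (y $ i * y $ j)) = 2 * (LBINT y. gauss y * pd i (\<lambda>y. y $ j) y)"
    by (rule gauss_integral_by_parts[OF s, of 1 1]) (use coord_le in \<open>auto simp: pd_coord\<close>)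
  also have "\<dots> = 2 * kron i j"
    using has_bochner_integral_integral_eq[OF has_bochner_integral_gauss[where 'n='n]] by (simp add: pd_coord)
  finally have "(LBINT y. gauss y * (y $ i * y $ j)) = 2 * kron i j" .
  moreover have "integrable lborel (\<lambda>y::real^'n. gauss y * (y $ i * y $ j))"
    by (rule integrable_gauss_bound[of _ 1 2]) (auto simp: abs_mult power2_eq_square intro!: mult_mono coord_le)
  ultimately show ?thesis by (simp add: has_bochner_integral_iff)
qed

text \<open>Isserlis' formula, one term for each pairing of the four indices, each with the product
  of two variances equal to 2. Integration by parts in \<open>y $ i\<close> reduces it to second
  moments.\<close>

lemma gauss_fourth_moment:
  "has_bochner_integral lborel (\<lambda>y::real^'n::finite. gauss y * (y $ i * y $ j * y $ k * y $ l))
     (4 * (kron i j * kron k l + kron i k * kron j l + kron i l * kron j k))"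
proof -
  let ?p = "\<lambda>y::real^'n. y $ j * y $ k * y $ l"
  have s: "smooth_on UNIV ?p" by (intro smooth_intros) auto
  have d: "(\<lambda>x::real^'n. x $ j) differentiable (at y)" "(\<lambda>x::real^'n. x $ j * x $ k) differentiable (at y)" for j k y
    by (auto intro!: smooth_onD[of UNIV] smooth_intros)
  have pd: "pd i ?p y = kron i j * (y $ k * y $ l) + kron i k * (y $ j * y $ l) + kron i l * (y $ j * y $ k)" for y
    by (simp add: pd_mult d pd_coord)
  have aux: "\<bar>kron i j * u + kron i k * v + kron i l * w\<bar> \<le> \<bar>u\<bar> + \<bar>v\<bar> + \<bar>w\<bar>" for u v w by auto
  have c2: "\<bar>y $ a * y $ b\<bar> \<le> (1 + norm y)\<^sup>2" for a b and y :: "real^'n"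
    unfolding abs_mult power2_eq_square by (intro mult_mono coord_le) auto
  have c3: "\<bar>?p y\<bar> \<le> (1 + norm y) ^ 3" for y
    unfolding abs_mult power3_eq_cube by (intro mult_mono coord_le) auto
  have "(LBINT y. gauss y * (y $ i * ?p y)) = 2 * (LBINT y. gauss y * pd i ?p y)"
  proof (rule gauss_integral_by_parts[OF s, of 3 3])
    show "\<bar>?p y\<bar> \<le> 3 * (1 + norm y) ^ 3" for y using c3[of y] by (smt (verit) zero_le_power norm_ge_zero)
    fix y
    have "\<bar>pd i ?p y\<bar> \<le> \<bar>y $ k * y $ l\<bar> + \<bar>y $ j * y $ l\<bar> + \<bar>y $ j * y $ k\<bar>" unfolding pd by (rule aux)
    also have "\<dots> \<le> 3 * (1 + norm y)\<^sup>2" using c2[of y k l] c2[of y j l] c2[of y j k] by linarith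
    also have "\<dots> \<le> 3 * (1 + norm y) ^ 3" by (intro mult_left_mono power_increasing) auto
    finally show "\<bar>pd i ?p y\<bar> \<le> 3 * (1 + norm y) ^ 3" .
  qed
  also have "\<dots> = 2 * (kron i j * (2 * kron k l) + kron i k * (2 * kron j l) + kron i l * (2 * kron j k))"
  proof -
    have "has_bochner_integral lborel (\<lambda>y::real^'n. kron i j * (gauss y * (y $ k * y $ l)) + kron i k * (gauss y * (y $ j * y $ l)) + kron i l * (gauss y * (y $ j * y $ k)))
      (kron i j * (2 * kron k l) + kron i k * (2 * kron j l) + kron i l * (2 * kron j k))"
      by (intro has_bochner_integral_add has_bochner_integral_mult_right gauss_second_moment)
    from has_bochner_integral_integral_eq[OF this] show ?thesis
      unfolding pd by (simp only: distrib_left mult.left_commute)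
  qed
  finally have "(LBINT y. gauss y * (y $ i * y $ j * y $ k * y $ l)) = 4 * (kron i j * kron k l + kron i k * kron j l + kron i l * kron j k)"
    by (simp add: mult_ac)
  moreover have "integrable lborel (\<lambda>y::real^'n. gauss y * (y $ i * y $ j * y $ k * y $ l))"
  proof (rule integrable_gauss_bound[of _ 1 4])
    fix y :: "real^'n"
    have "\<bar>y $ i * y $ j\<bar> * \<bar>y $ k * y $ l\<bar> \<le> (1 + norm y)\<^sup>2 * (1 + norm y)\<^sup>2" by (intro mult_mono c2) auto
    then show "\<bar>y $ i * y $ j * y $ k * y $ l\<bar> \<le> 1 * (1 + norm y) ^ 4" by (simp add: abs_mult mult_ac power_add[symmetric])
  qed measurable
  ultimately show ?thesis by (simp add: has_bochner_integral_iff)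
qed

section \<open>Taylor bounds at the origin\<close>

text \<open>The mean value inequality on the ball of radius \<open>norm x\<close> raises the order
  of vanishing by one; iterated, it replaces Taylor's formula.\<close>

lemma taylor_step:
  fixes F :: "real^'n::finite \<Rightarrow> 'b::real_normed_vector"
  assumes S: "cball 0 r \<subseteq> S" and F: "smooth_on S F" "F 0 = 0"
    and d: "\<And>i x. norm x \<le> r \<Longrightarrow> norm (pd i F x) \<le> C * norm x ^ k"
    and x: "norm x \<le> r"
  shows "norm (F x) \<le> real CARD('n) * C * norm x ^ Suc k"
proof -
  let ?B = "real CARD('n) * C * norm x ^ k"
  have C: "0 \<le> C * norm x ^ k" using d[OF x, of undefined] norm_ge_zero order_trans by blast
  have der: "(F has_derivative frechet_derivative F (at z)) (at z)" if "norm z \<le> norm x" for z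
    using differentiable_has_derivative[OF smooth_onD[OF F(1)]] S x that by (auto simp: subset_iff)
  have "norm (F x - F 0) \<le> ?B * norm (x - 0)"
  proof (rule differentiable_bound[of "cball 0 (norm x)"])
    show "(F has_derivative frechet_derivative F (at z)) (at z within cball 0 (norm x))" if "z \<in> cball 0 (norm x)" for z
      using der[of z] that by (auto intro: has_derivative_at_withinI)
    show "onorm (frechet_derivative F (at z)) \<le> ?B" if z: "z \<in> cball 0 (norm x)" for z
    proof (rule onorm_le)
      fix v
      have zx: "norm z \<le> norm x" using z by simp
      have nz: "norm (pd i F z) \<le> C * norm x ^ k" for i
      proof (cases "C \<ge> 0")
        case True
        then have "C * norm z ^ k \<le> C * norm x ^ k" using zx by (intro mult_left_mono power_mono) auto
        then show ?thesis using d[of z i] zx x by linarith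
      next
        case False
        \<comment> \<open>No sign of \<open>C\<close> is assumed. A negative value is consistent
          with the bound only at \<open>x = 0\<close> and for positive \<open>k\<close>.\<close>
        then have "norm x ^ k = 0" using C by (smt (verit) mult_neg_pos zero_le_power norm_ge_zero)
        then have "x = 0" "k > 0" by (auto simp: power_eq_0_iff)
        then show ?thesis using d[of z i] zx x by simp
      qed
      have "norm (frechet_derivative F (at z) v) = norm (SUM i. v $ i *\<^sub>R pd i F z)"
        using has_derivative_partial_sum[OF der[OF zx]] by simp
      also have "\<dots> \<le> (\<Sum>i\<in>(UNIV::'n set). norm v * (C * norm x ^ k))"
        by (rule order_trans[OF norm_sum sum_mono]) (auto intro!: mult_mono component_le_norm_cart nz)
      finally show "norm (frechet_derivative F (at z) v) \<le> ?B * norm v" by (simp add: mult_ac)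
    qed
  qed auto
  then show ?thesis using F(2) by (simp add: mult_ac)
qed

lemma smooth_bounded_cball:
  assumes "cball 0 r \<subseteq> S" "smooth_on S F"
  shows "\<exists>C\<ge>0. \<forall>x. norm x \<le> r \<longrightarrow> norm (F x) \<le> C"
proof -
  have "compact (F ` cball 0 r)"
    by (rule compact_continuous_image[OF continuous_on_subset[OF smooth_on_continuous[OF assms(2)] assms(1)] compact_cball])
  then obtain C where C: "\<forall>y\<in>F ` cball 0 r. norm y \<le> C" using compact_imp_bounded bounded_iff by metis
  have "norm (F x) \<le> max 0 C" if "norm x \<le> r" for x using C that by (auto simp: max.coboundedI2)
  then show ?thesis by (intro exI[of _ "max 0 C"]) auto
qed

lemma uniform_partial_bound:
  assumes "\<And>i::'n::finite. \<exists>C\<ge>0. \<forall>x. P x \<longrightarrow> norm (F i x) \<le> C * g x" "\<And>x. g x \<ge> (0::real)"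
  shows "\<exists>C\<ge>0. \<forall>i x. P x \<longrightarrow> norm (F i x) \<le> C * g x"
proof -
  obtain C where C: "\<And>i. C i \<ge> 0" "\<And>i x. P x \<Longrightarrow> norm (F i x) \<le> C i * g x" using assms(1) by metis
  have "C i \<le> (SUM i. C i)" for i by (rule member_le_sum) (use C in auto)
  then have "P x \<Longrightarrow> norm (F i x) \<le> (SUM i. C i) * g x" for i x
    using C(2) assms(2) mult_right_mono order_trans by meson
  moreover have "(SUM i. C i) \<ge> 0" using C(1) by (rule sum_nonneg)
  ultimately show ?thesis by blast
qed

lemma taylor_first:
  fixes F :: "real^'n::finite \<Rightarrow> 'b::real_normed_vector"
  assumes S: "cball 0 r \<subseteq> S" and F: "smooth_on S F" "F 0 = 0"
  shows "\<exists>C\<ge>0. \<forall>x. norm x \<le> r \<longrightarrow> norm (F x) \<le> C * norm x"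
proof -
  have "\<exists>C\<ge>0. \<forall>i x. norm x \<le> r \<longrightarrow> norm (pd i F x) \<le> C * norm x ^ 0"
    by (rule uniform_partial_bound) (use smooth_bounded_cball[OF S smooth_on_partial[OF F(1)]] in auto)
  then obtain C where C: "C \<ge> 0" "\<And>i x. norm x \<le> r \<Longrightarrow> norm (pd i F x) \<le> C * norm x ^ 0" by blast
  show ?thesis using taylor_step[OF S F C(2)] C(1) by (intro exI[of _ "real CARD('n) * C"]) auto
qed

lemma taylor_second:
  fixes F :: "real^'n::finite \<Rightarrow> 'b::real_normed_vector"
  assumes S: "cball 0 r \<subseteq> S" and F: "smooth_on S F" "F 0 = 0" "\<And>i. pd i F 0 = 0"
  shows "\<exists>C\<ge>0. \<forall>x. norm x \<le> r \<longrightarrow> norm (F x) \<le> C * norm x ^ 2"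
proof -
  have "\<exists>C\<ge>0. \<forall>i x. norm x \<le> r \<longrightarrow> norm (pd i F x) \<le> C * norm x ^ 1"
    by (rule uniform_partial_bound) (use taylor_first[OF S smooth_on_partial[OF F(1)] F(3)] in auto)
  then obtain C where C: "C \<ge> 0" "\<And>i x. norm x \<le> r \<Longrightarrow> norm (pd i F x) \<le> C * norm x ^ 1" by blast
  show ?thesis using taylor_step[OF S F(1,2) C(2)] C(1) by (intro exI[of _ "real CARD('n) * C"]) (auto simp: numeral_2_eq_2)
qed

lemma taylor_third:
  fixes F :: "real^'n::finite \<Rightarrow> 'b::real_normed_vector"
  assumes S: "cball 0 r \<subseteq> S" and F: "smooth_on S F" "F 0 = 0" "\<And>i. pd i F 0 = 0"
    "\<And>i j. pd i (pd j F) 0 = 0"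
  shows "\<exists>C\<ge>0. \<forall>x. norm x \<le> r \<longrightarrow> norm (F x) \<le> C * norm x ^ 3"
proof -
  have "\<exists>C\<ge>0. \<forall>i x. norm x \<le> r \<longrightarrow> norm (pd i F x) \<le> C * norm x ^ 2"
    by (rule uniform_partial_bound) (use taylor_second[OF S smooth_on_partial[OF F(1)] F(3,4)] in auto)
  then obtain C where C: "C \<ge> 0" "\<And>i x. norm x \<le> r \<Longrightarrow> norm (pd i F x) \<le> C * norm x ^ 2" by blast
  show ?thesis using taylor_step[OF S F(1,2) C(2)] C(1) by (intro exI[of _ "real CARD('n) * C"]) (auto simp: numeral_3_eq_3 numeral_2_eq_2)
qed

text \<open>The direction is a convergent sequence \<open>v\<close> instead of a fixed vector
  because in the application it is the image of \<open>y\<close> under a shear depending on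
  \<delta>.\<close>

lemma taylor_remainder_limit:
  fixes R :: "real^'n::finite \<Rightarrow> real"
  assumes r: "r > 0" and R: "\<And>x. norm x \<le> r \<Longrightarrow> norm (R x) \<le> C * norm x ^ Suc k"
    and \<delta>: "\<delta> \<longlonglongrightarrow> 0" "\<And>n. \<delta> n > 0" and v: "v \<longlonglongrightarrow> y"
  shows "(\<lambda>n. R (\<delta> n *\<^sub>R v n) / \<delta> n ^ k) \<longlonglongrightarrow> 0"
proof (rule Lim_null_comparison)
  have "(\<lambda>n. \<delta> n *\<^sub>R v n) \<longlonglongrightarrow> 0" using tendsto_scaleR[OF \<delta>(1) v] by simp
  then have "\<forall>\<^sub>F n in sequentially. dist (\<delta> n *\<^sub>R v n) 0 < r" using r by (rule tendstoD)
  then show "\<forall>\<^sub>F n in sequentially. norm (R (\<delta> n *\<^sub>R v n) / \<delta> n ^ k) \<le> C * (\<delta> n * norm (v n) ^ Suc k)"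
  proof (rule eventually_mono)
    fix n assume "dist (\<delta> n *\<^sub>R v n) 0 < r"
    then have "norm (R (\<delta> n *\<^sub>R v n)) \<le> \<delta> n ^ k * (C * (\<delta> n * norm (v n) ^ Suc k))"
      using R[of "\<delta> n *\<^sub>R v n"] \<delta>(2)[of n] by (simp add: power_mult_distrib mult_ac)
    then show "norm (R (\<delta> n *\<^sub>R v n) / \<delta> n ^ k) \<le> C * (\<delta> n * norm (v n) ^ Suc k)"
      using \<delta>(2)[of n] by (simp add: divide_le_eq mult.commute)
  qed
  have "(\<lambda>n. C * (\<delta> n * norm (v n) ^ Suc k)) \<longlonglongrightarrow> C * (0 * norm y ^ Suc k)" by (intro tendsto_intros \<delta> v)
  then show "(\<lambda>n. C * (\<delta> n * norm (v n) ^ Suc k)) \<longlonglongrightarrow> 0" by simp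
qed

lemma taylor_first_limit:
  fixes F :: "real^'n::finite \<Rightarrow> real"
  assumes S: "open S" "0 \<in> S" and F: "smooth_on S F" "F 0 = 0"
    and \<delta>: "\<delta> \<longlonglongrightarrow> 0" "\<And>n. \<delta> n > 0" and v: "v \<longlonglongrightarrow> y"
  shows "(\<lambda>n. F (\<delta> n *\<^sub>R v n) / \<delta> n) \<longlonglongrightarrow> (SUM l. pd l F 0 * y $ l)"
proof -
  obtain r where r: "r > 0" "cball 0 r \<subseteq> S" using S open_contains_cball by blast
  let ?R = "\<lambda>x. F x - (SUM l. pd l F 0 * x $ l)"
  have sL: "smooth_on S (\<lambda>x. SUM l. pd l F 0 * x $ l)" by (intro smooth_intros S)
  have "smooth_on S ?R" by (intro smooth_on_diff S F sL)
  moreover have "pd i ?R 0 = 0" for i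
    using pd_diff[OF smooth_onD[OF F(1) S(2)] smooth_onD[OF sL S(2)]]
    by (simp add: pd_linear_form)
  ultimately obtain C where C: "C \<ge> 0" "\<And>x. norm x \<le> r \<Longrightarrow> norm (?R x) \<le> C * norm x ^ 2"
    using taylor_second[OF r(2), of ?R] F(2) by auto
  have "(\<lambda>n. ?R (\<delta> n *\<^sub>R v n) / \<delta> n) \<longlonglongrightarrow> 0"
    using taylor_remainder_limit[OF r(1), of ?R C 1, OF _ \<delta> v] C(2) by (simp add: eval_nat_numeral)
  moreover have "(\<lambda>n. SUM l. pd l F 0 * v n $ l) \<longlonglongrightarrow> (SUM l. pd l F 0 * y $ l)"
    by (intro tendsto_intros v)
  ultimately have "(\<lambda>n. ?R (\<delta> n *\<^sub>R v n) / \<delta> n + (SUM l. pd l F 0 * v n $ l)) \<longlonglongrightarrow> 0 + (SUM l. pd l F 0 * y $ l)"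
    by (rule tendsto_add)
  moreover have "?R (\<delta> n *\<^sub>R v n) / \<delta> n + (SUM l. pd l F 0 * v n $ l) = F (\<delta> n *\<^sub>R v n) / \<delta> n" for n
    using \<delta>(2)[of n] by (simp add: diff_divide_distrib sum_divide_distrib)
  ultimately show ?thesis by simp
qed

lemma taylor_second_limit:
  fixes F :: "real^'n::finite \<Rightarrow> real"
  assumes S: "open S" "0 \<in> S" and F: "smooth_on S F" "F 0 = 0" "\<And>i. pd i F 0 = 0"
    and \<delta>: "\<delta> \<longlonglongrightarrow> 0" "\<And>n. \<delta> n > 0" and v: "v \<longlonglongrightarrow> y"
  shows "(\<lambda>n. F (\<delta> n *\<^sub>R v n) / (\<delta> n)\<^sup>2) \<longlonglongrightarrow> (1/2) * (SUM k l. pd k (pd l F) 0 * (y $ k * y $ l))"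
proof -
  obtain r where r: "r > 0" "cball 0 r \<subseteq> S" using S open_contains_cball by blast
  define b where "b k l = (1/2) * pd k (pd l F) 0" for k l
  have bs: "b k l = b l k" for k l unfolding b_def using pd_commute_real[OF S(1) F(1) S(2)] by simp
  let ?Q = "\<lambda>x. SUM k l. b k l * (x $ k * x $ l)"
  let ?R = "\<lambda>x. F x - ?Q x"
  have sQ: "smooth_on S ?Q" by (intro smooth_intros S)
  have sL: "smooth_on S (\<lambda>y. SUM j. (b i j + b j i) * y $ j)" for i by (intro smooth_intros S)
  have "smooth_on S ?R" by (intro smooth_on_diff S F sQ)
  moreover have pR: "pd i ?R x = pd i F x - (SUM j. (b i j + b j i) * x $ j)" if "x \<in> S" for i x
    using pd_diff[OF smooth_onD[OF F(1) that] smooth_onD[OF sQ that]]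
    by (simp add: pd_quadratic_form)
  moreover have "pd i (pd j ?R) 0 = 0" for i j
  proof -
    have dd: "(\<lambda>x. pd j F x - (SUM l. (b j l + b l j) * x $ l)) differentiable (at 0)"
      by (intro differentiable_diff smooth_onD[OF smooth_on_partial[OF F(1)] S(2)] smooth_onD[OF sL S(2)])
    have "pd i (pd j ?R) 0 = pd i (\<lambda>x. pd j F x - (SUM l. (b j l + b l j) * x $ l)) 0"
      by (rule pd_cong_open[OF S _ dd]) (simp add: pR)
    also have "\<dots> = pd i (pd j F) 0 - (b j i + b i j)"
      using pd_diff[OF smooth_onD[OF smooth_on_partial[OF F(1)] S(2)] smooth_onD[OF sL S(2)]]
      by (simp add: pd_linear_form)
    finally show ?thesis using bs[of j i] by (simp add: b_def)
  qed
  ultimately obtain C where C: "C \<ge> 0" "\<And>x. norm x \<le> r \<Longrightarrow> norm (?R x) \<le> C * norm x ^ 3"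
    using taylor_third[OF r(2), of ?R] F(2,3) S(2) by auto
  have "(\<lambda>n. ?R (\<delta> n *\<^sub>R v n) / (\<delta> n)\<^sup>2) \<longlonglongrightarrow> 0"
    using taylor_remainder_limit[OF r(1), of ?R C 2, OF _ \<delta> v] C(2) by (simp add: eval_nat_numeral)
  moreover have "(\<lambda>n. ?Q (v n)) \<longlonglongrightarrow> ?Q y" by (intro tendsto_intros v)
  ultimately have "(\<lambda>n. ?R (\<delta> n *\<^sub>R v n) / (\<delta> n)\<^sup>2 + ?Q (v n)) \<longlonglongrightarrow> 0 + ?Q y"
    by (rule tendsto_add)
  moreover have "?R (\<delta> n *\<^sub>R v n) / (\<delta> n)\<^sup>2 + ?Q (v n) = F (\<delta> n *\<^sub>R v n) / (\<delta> n)\<^sup>2" for n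
  proof -
    have "?Q (\<delta> n *\<^sub>R v n) = (\<delta> n)\<^sup>2 * ?Q (v n)"
      unfolding sum_distrib_left by (intro sum.cong refl) (simp add: power2_eq_square mult_ac)
    then show ?thesis using \<delta>(2)[of n] by (simp add: diff_divide_distrib)
  qed
  ultimately show ?thesis by (simp add: b_def sum_distrib_left mult_ac)
qed

section \<open>The second order jet of the metric in normal coordinates\<close>

text \<open>Here \<open>t l i a c\<close> stands for the derivative in direction \<open>l\<close> of
  \<open>\<Gamma>^a_ic\<close> at the origin, and \<open>t k l a c + t k l c a\<close> for the
  second derivative of \<open>g_ac\<close> in the directions \<open>k\<close> and \<open>l\<close>.
  The hypotheses are torsion freeness, the third order normalization and symmetry of second
  derivatives. This linear system determines \<open>t\<close> from the second derivatives of the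
  metric, and shows that those of \<open>g_im\<close> in the directions \<open>k\<close> and
  \<open>l\<close> have cyclic sum zero over \<open>m\<close>, \<open>k\<close>, \<open>l\<close>;
  the listed instances are the equations to be combined.\<close>

lemma jet_algebra:
  fixes t :: "'n \<Rightarrow> 'n \<Rightarrow> 'n \<Rightarrow> 'n \<Rightarrow> real"
  assumes ts: "\<And>l i a j. t l i a j = t l j a i" and cyc: "\<And>l i a j. t l i a j + t i j a l + t j l a i = 0"
    and bs: "\<And>a c l i. t l i a c + t l i c a = t i l a c + t i l c a"
  shows "t l i m k = - (t m l i k + t m l k i)"
    and "(t k l i m + t k l m i) + (t l m i k + t l m k i) + (t m k i l + t m k l i) = 0"
proof -
  show "t l i m k = - (t m l i k + t m l k i)"
    using ts[of m l i k] bs[of l i m k] ts[of i l m k] ts[of m i k l] ts[of l m i k] cyc[of l m i k] cyc[of l i m k] bs[of l m i k]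
      cyc[of l m k i] ts[of l k m i] ts[of l m k i] bs[of l k i m] by linarith
  show "(t k l i m + t k l m i) + (t l m i k + t l m k i) + (t m k i l + t m k l i) = 0"
    using bs[of l k m i] bs[of i k m l] bs[of m l i k] cyc[of i k m l] ts[of m l k i] cyc[of i k l m] bs[of i l m k] ts[of k m l i]
      ts[of i m k l] cyc[of m i k l] ts[of i k m l] cyc[of l k i m] cyc[of m k l i] cyc[of l m i k] ts[of i k l m] cyc[of l i k m]
      bs[of m i l k] ts[of l i m k] cyc[of i l m k] bs[of k m l i] by linarith
qed

text \<open>Multiply the cyclic relation by \<open>f a b l\<close> and sum: by the symmetry in the
  last two arguments both cross sums are equal, so twice one of them is minus the sum of squares.
  This fixes the sign of the connection term.\<close>

lemma cyclic_sum_square: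
  fixes f :: "'n::finite \<Rightarrow> 'n \<Rightarrow> 'n \<Rightarrow> real"
  assumes s: "\<And>b a l. f b a l = f b l a" and c: "\<And>b a l. f b a l + f a l b + f l b a = 0"
  shows "2 * (SUM a b l. f b a l * f a b l) = - (SUM a b l. (f a b l)\<^sup>2)"
proof -
  let ?X = "SUM a b l. f b a l * f a b l"
  have 1: "(SUM a b l. f a b l * f b a l) = ?X" by (simp add: mult.commute)
  have 2: "(SUM a b l. f a b l * f l a b) = ?X"
  proof -
    have "(SUM a b l. f a b l * f l a b) = (SUM a l b. f a l b * f l a b)"
      using s by (subst sum.swap[of _ "UNIV :: 'n set" "UNIV :: 'n set"]) simp
    then show ?thesis using 1 by simp
  qed
  have "(f a b l)\<^sup>2 = - (f a b l * f b a l + f a b l * f l a b)" for a b l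
  proof -
    have "f a b l = - (f b a l + f l a b)" using c[of a b l] s[of b l a] by linarith
    then have "f a b l * f a b l = f a b l * - (f b a l + f l a b)" by simp
    then show ?thesis by (simp add: power2_eq_square algebra_simps)
  qed
  then have "(SUM a b l. (f a b l)\<^sup>2) = - (?X + ?X)"
    by (simp add: sum_negf sum.distrib sum_subtractf 1 2)
  then show ?thesis by simp
qed

lemma gauss_linear_product:
  "has_bochner_integral lborel (\<lambda>y::real^'n::finite. gauss y * ((SUM l. u l * y $ l) * (SUM l. v l * y $ l))) (2 * (SUM l. u l * v l))"
proof -
  have "has_bochner_integral lborel (\<lambda>y::real^'n. SUM l k. (u l * v k) * (gauss y * (y $ l * y $ k)))
    (SUM l k. (u l * v k) * (2 * kron l k))"
    by (intro has_bochner_integral_sum has_bochner_integral_mult_right gauss_second_moment)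
  moreover have "(\<lambda>y::real^'n. SUM l k. (u l * v k) * (gauss y * (y $ l * y $ k))) = (\<lambda>y. gauss y * ((SUM l. u l * y $ l) * (SUM l. v l * y $ l)))"
    unfolding sum_product unfolding sum_distrib_left by (simp add: mult_ac)
  moreover have "(SUM l k. (u l * v k) * (2 * kron l k)) = 2 * (SUM l. u l * v l)"
    by (simp add: if_distrib[of "\<lambda>x. _ * x"] sum_distrib_left mult_ac cong: if_cong)
  ultimately show ?thesis by simp
qed

text \<open>The subtracted trace is the mean of the quadratic form, as half of it meets a covariance
  of twice the identity. In the fourth moment one pairing yields the square of the mean and the
  other two the sum of squares.\<close>

lemma gauss_quadratic_variance:
  fixes b :: "'n::finite \<Rightarrow> 'n \<Rightarrow> real"
  assumes s: "\<And>k l. b k l = b l k"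
  shows "has_bochner_integral lborel (\<lambda>y::real^'n. gauss y * ((1/2) * (SUM k l. b k l * (y $ k * y $ l)) - (SUM k. b k k))\<^sup>2)
    (2 * (SUM k l. (b k l)\<^sup>2))"
proof -
  define c where "c = (SUM k. b k k)"
  let ?q = "\<lambda>y::real^'n. SUM k l. b k l * (y $ k * y $ l)"
  let ?N = "SUM k l. (b k l)\<^sup>2"
  have 2: "has_bochner_integral lborel (\<lambda>y. gauss y * ?q y) (2 * c)"
  proof -
    have "has_bochner_integral lborel (\<lambda>y::real^'n. SUM k l. b k l * (gauss y * (y $ k * y $ l))) (SUM k l. b k l * (2 * kron k l))"
      by (intro has_bochner_integral_sum has_bochner_integral_mult_right gauss_second_moment)
    moreover have "(SUM k l. b k l * (2 * kron k l)) = 2 * c"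
      by (simp add: if_distrib[of "\<lambda>x. _ * x"] sum_distrib_left c_def mult_ac cong: if_cong)
    moreover have "(\<lambda>y::real^'n. SUM k l. b k l * (gauss y * (y $ k * y $ l))) = (\<lambda>y. gauss y * ?q y)"
      unfolding sum_distrib_left by (simp add: mult_ac)
    ultimately show ?thesis by simp
  qed
  have 4: "has_bochner_integral lborel (\<lambda>y. gauss y * (?q y)\<^sup>2) (4 * c\<^sup>2 + 8 * ?N)"
  proof -
    have "has_bochner_integral lborel (\<lambda>y::real^'n. SUM k l. SUM p q. (b k l * b p q) * (gauss y * (y $ k * y $ l * y $ p * y $ q)))
      (SUM k l. SUM p q. (b k l * b p q) * (4 * (kron k l * kron p q + kron k p * kron l q + kron k q * kron l p)))"
      by (intro has_bochner_integral_sum has_bochner_integral_mult_right gauss_fourth_moment)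
    moreover have "(SUM k l. SUM p q. (b k l * b p q) * (4 * (kron k l * kron p q + kron k p * kron l q + kron k q * kron l p))) = 4 * c\<^sup>2 + 8 * ?N"
    proof -
      have e: "(b k l * b p q) * (4 * (kron k l * kron p q + kron k p * kron l q + kron k q * kron l p))
        = 4 * (if k = l then (if p = q then b k l * b p q else 0) else 0) + 4 * (if k = p then (if l = q then b k l * b p q else 0) else 0)
        + 4 * (if k = q then (if l = p then b k l * b p q else 0) else 0)" for k l p q by simp
      have A: "(SUM k l. SUM p q. (if k = l then (if p = q then b k l * b p q else 0) else 0)) = c\<^sup>2"
      proof -
        have "(SUM k l. SUM p q. (if k = l then (if p = q then b k l * b p q else 0) else 0))
          = (SUM k l. if k = l then (SUM p q. if p = q then b k l * b p q else 0) else 0)"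
          by (intro sum.cong refl) auto
        also have "\<dots> = (SUM k p. b k k * b p p)" by simp
        finally show ?thesis unfolding c_def power2_eq_square sum_product .
      qed
      have B: "(SUM k l. SUM p q. (if k = p then (if l = q then b k l * b p q else 0) else 0)) = ?N"
      proof -
        have "(SUM p q. (if k = p then (if l = q then b k l * b p q else 0) else 0)) = (b k l)\<^sup>2" for k l
        proof -
          have "(SUM p q. (if k = p then (if l = q then b k l * b p q else 0) else 0)) = (SUM p. if k = p then (SUM q. if l = q then b k l * b p q else 0) else 0)"
            by (intro sum.cong refl) auto
          then show ?thesis by (simp add: power2_eq_square)
        qed
        then show ?thesis by simp
      qed
      have C: "(SUM k l. SUM p q. (if k = q then (if l = p then b k l * b p q else 0) else 0)) = ?N"
      proof -
        have "(SUM p q. (if k = q then (if l = p then b k l * b p q else 0) else 0)) = (b k l)\<^sup>2" for k l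
          using s[of l k] by (simp add: power2_eq_square)
        then show ?thesis by simp
      qed
      show ?thesis unfolding e by (simp only: sum.distrib sum_distrib_left[symmetric] A B C)
    qed
    moreover have "(\<lambda>y::real^'n. SUM k l. SUM p q. (b k l * b p q) * (gauss y * (y $ k * y $ l * y $ p * y $ q))) = (\<lambda>y. gauss y * (?q y)\<^sup>2)"
      unfolding power2_eq_square unfolding sum_distrib_right unfolding sum_distrib_left by (simp add: mult_ac)
    ultimately show ?thesis by simp
  qed
  have "has_bochner_integral lborel (\<lambda>y. (1/4) * (gauss y * (?q y)\<^sup>2) + (- c) * (gauss y * ?q y) + c\<^sup>2 * gauss y)
    ((1/4) * (4 * c\<^sup>2 + 8 * ?N) + (- c) * (2 * c) + c\<^sup>2 * 1)"
    by (intro has_bochner_integral_add has_bochner_integral_mult_right 2 4 has_bochner_integral_gauss)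
  moreover have "(1/4) * (4 * c\<^sup>2 + 8 * X) + (- c) * (2 * c) + c\<^sup>2 * 1 = 2 * X" for X
    by (simp add: power2_eq_square algebra_simps)
  moreover have "(1/4) * (gauss y * (?q y)\<^sup>2) + (- c) * (gauss y * ?q y) + c\<^sup>2 * gauss y = gauss y * ((1/2) * ?q y - c)\<^sup>2" for y
    by (simp add: power2_eq_square algebra_simps)
  ultimately show ?thesis unfolding c_def by simp
qed

section \<open>The entropy inequality for rescaled Gaussians\<close>

lemma jac_matrix: "jac (\<lambda>y. L *v y) y = (L :: real^'n^'n::finite)"
proof -
  have "((\<lambda>y. L *v y) has_derivative (\<lambda>v. L *v v)) (at y)"
    by (rule bounded_linear_imp_has_derivative) (rule matrix_vector_mul_bounded_linear)
  from pd_eq[OF this] show ?thesis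
    by (simp add: jac_def vec_eq_iff matrix_vector_mult_basis column_def)
qed

lemma smooth_on_matrix_vector: "open S \<Longrightarrow> smooth_on S (\<lambda>y::real^'n::finite. (L :: real^'n^'n) *v y)"
  by (rule smooth_on_linear[OF matrix_vector_mul_bounded_linear _ smooth_on_id])

lemma diffeo_matrix:
  fixes L :: "real^'n^'n::finite"
  assumes "open S" "invertible L"
  shows "diffeo {y. L *v y \<in> S} (\<lambda>y. L *v y) (\<lambda>x. matrix_inv L *v x) S"
proof -
  have "open {y. L *v y \<in> S}"
    using continuous_open_preimage[OF smooth_on_continuous[OF smooth_on_matrix_vector] open_UNIV assms(1)]
    by (simp add: vimage_def)
  moreover have "(\<lambda>y. L *v y) ` {y. L *v y \<in> S} = S"
  proof -
    have "x = L *v (matrix_inv L *v x)" for x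
      by (simp add: matrix_vector_mul_assoc matrix_inv_right[OF assms(2)])
    then show ?thesis by (auto simp: image_iff) metis
  qed
  moreover have "matrix_inv L *v (L *v x) = x" for x
    by (simp add: matrix_vector_mul_assoc matrix_inv_left[OF assms(2)])
  ultimately show ?thesis unfolding diffeo_def
    using assms by (auto simp: jac_matrix intro!: smooth_on_matrix_vector)
qed

lemma quadG_cong_open:
  assumes "open S" "metric_on S h" "\<And>x. x \<in> S \<Longrightarrow> h x = h' x" "y \<in> S"
  shows "quadG h' y = quadG h y"
  using conn_cong_open[OF assms] assms(3,4) by (simp add: quadG_def)

text \<open>\<open>quadG\<close> is not invariant under general coordinate changes. For a linear
  map, however, the derivative of the Jacobian in the transformation law of the connection is zero,
  and the connection behaves like a tensor.\<close>

lemma quadG_linear: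
  fixes L :: "real^'n^'n::finite"
  assumes S: "open S" "metric_on S G" and L: "invertible L" and y: "L *v y \<in> S"
  shows "quadG (pullback (\<lambda>y. L *v y) G) y = quadG G (L *v y)"
proof -
  let ?P = "pullback (\<lambda>y. L *v y) G" and ?x = "L *v y"
  note D = diffeoD[OF diffeo_matrix[OF S(1) L]]
  have yS: "y \<in> {y. L *v y \<in> S}" using y by simp
  let ?C = "\<lambda>i. conn ?P i y" and ?A = "\<lambda>i. conn_along (\<lambda>y. L *v y) G i y"
  have C: "?C i = matrix_inv L ** (?A i ** L)" for i
  proof -
    have "L ** ?C i = ?A i ** L"
      using conn_pullback[OF D(1) S(1) D(4,3,7) S(2) yS, of i] by (simp add: jac_matrix[abs_def])
    then have "matrix_inv L ** (L ** ?C i) = matrix_inv L ** (?A i ** L)" by simp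
    then show ?thesis by (simp add: matrix_mul_assoc matrix_inv_left[OF L])
  qed
  have tr: "trace (?C i ** ?C j) = (SUM p q. L $ p $ i * L $ q $ j * trace (conn G p ?x ** conn G q ?x))" for i j
  proof -
    have "?C i ** ?C j = matrix_inv L ** (?A i ** (L ** matrix_inv L) ** ?A j ** L)" unfolding C by (simp only: matrix_mul_assoc)
    then have "trace (?C i ** ?C j) = trace (?A i ** ?A j)"
      by (simp add: matrix_inv_right[OF L] trace_mul_sym[of "matrix_inv L"] flip: matrix_mul_assoc)
    also have "\<dots> = (SUM p q. L $ p $ i * L $ q $ j * trace (conn G p ?x ** conn G q ?x))"
      unfolding conn_along_def jac_matrix matrix_mult_sum_left unfolding matrix_mult_sum_right matrix_mult_scaleR_left
      unfolding matrix_mult_scaleR_right linear_sum[OF bounded_linear.linear[OF bounded_linear_trace]]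
      by (simp add: linear_scale[OF bounded_linear.linear[OF bounded_linear_trace]] mult_ac)
    finally show ?thesis .
  qed
  define X where "X = matrix_inv (?P y)"
  have inv: "invertible (G ?x)" by (rule metric_on_invertible[OF S(2) y])
  have X: "L ** X ** transpose L = matrix_inv (G ?x)"
  proof -
    have tL: "invertible (transpose L)" using L by (simp add: invertible_det_nz)
    have "X = matrix_inv L ** (matrix_inv (G ?x) ** matrix_inv (transpose L))"
      unfolding X_def pullback_def jac_matrix
      by (simp add: matrix_inv_mult[OF invertible_mult[OF tL inv] L] matrix_inv_mult[OF tL inv])
    then have "L ** X ** transpose L = (L ** matrix_inv L) ** matrix_inv (G ?x) ** (matrix_inv (transpose L) ** transpose L)"
      by (simp only: matrix_mul_assoc)
    then show ?thesis by (simp add: matrix_inv_right[OF L] matrix_inv_left[OF tL])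
  qed
  have Xpq: "matrix_inv (G ?x) $ p $ q = (SUM i j. L $ p $ i * X $ i $ j * L $ q $ j)" for p q
    unfolding X[symmetric] by (subst sum.swap) (simp add: matrix_matrix_mult_def transpose_component sum_distrib_right)
  have "quadG ?P y = (SUM i j. SUM p q. X $ i $ j * (L $ p $ i * L $ q $ j * trace (conn G p ?x ** conn G q ?x)))"
    unfolding quadG_def tr X_def by (simp add: sum_distrib_left)
  also have "\<dots> = (SUM p q. SUM i j. X $ i $ j * (L $ p $ i * L $ q $ j * trace (conn G p ?x ** conn G q ?x)))"
    by (rule sum_rot4)
  also have "\<dots> = quadG G ?x"
    unfolding quadG_def Xpq sum_distrib_right
    by (simp add: mult_ac)
  finally show ?thesis .
qed

text \<open>The pullback of \<open>G\<close> under \<open>y\<close> to \<open>\<delta> T y\<close>,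
  divided by \<delta>^2; for small \<delta> it is close to the identity matrix if \<open>G 0\<close>
  and \<open>T\<close> are.\<close>

definition rescaled :: "'n::finite mfield \<Rightarrow> real^'n^'n \<Rightarrow> real \<Rightarrow> 'n mfield"
  where "rescaled G T \<delta> y = transpose T ** G (\<delta> *\<^sub>R (T *v y)) ** T"

lemma matrix_inv_scaleR:
  fixes A :: "real^'n^'n::finite"
  assumes "invertible A" "c \<noteq> 0"
  shows "matrix_inv (c *\<^sub>R A) = (1 / c) *\<^sub>R matrix_inv A"
  by (rule matrix_inv_unique) (simp add: matrix_mult_scaleR_left matrix_mult_scaleR_right matrix_inv_right assms)

lemma det_scaleR: "det (c *\<^sub>R (A :: real^'n^'n::finite)) = c ^ CARD('n) * det A"
proof -
  have "c *\<^sub>R A = (c *\<^sub>R mat 1) ** A" by (simp add: matrix_mult_scaleR_left)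
  moreover have "det (c *\<^sub>R mat 1 :: real^'n^'n) = c ^ CARD('n)"
    by (subst det_diagonal) (auto simp: mat_def)
  ultimately show ?thesis by (simp add: det_mul)
qed

text \<open>With \<open>s = \<delta>\<^sup>2\<close> the entropy is invariant under scaling:
  \<open>s\<close> cancels the factor in the inverse of the dilated metric, and the power of
  \<delta> in its determinant cancels the one in \<open>ln (4 * pi * s)\<close>. Only
  \<open>quadG\<close> keeps the factor \<delta>^2.\<close>

lemma scaled_entropy:
  fixes h :: "'n::finite mfield"
  assumes U: "open U" "metric_on U h" and e: "entropy_ineq U h \<tau>" and d: "diffeo S \<psi> \<phi> U"
    and \<delta>: "0 < \<delta>" "\<delta>\<^sup>2 \<le> \<tau>" and T: "invertible T"
    and q: "smooth_on UNIV q" "\<forall>x. q x \<ge> 0"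
    and K: "compact K" "K \<subseteq> {y. \<delta> *\<^sub>R (T *v y) \<in> S}" "\<forall>x. x \<notin> K \<longrightarrow> q x = 0"
  defines "G \<equiv> pullback \<psi> h" and "m \<equiv> \<integral>x. (q x)\<^sup>2 \<partial>lborel" and "S' \<equiv> {y. \<delta> *\<^sub>R (T *v y) \<in> S}"
  defines "D \<equiv> \<lambda>y. (SUM i j. matrix_inv (rescaled G T \<delta> y) $ i $ j * (2 * pd i q y * pd j q y - 2 * q y * pd i (pd j q) y))
      + \<delta>\<^sup>2 * (q y)\<^sup>2 * quadG G (\<delta> *\<^sub>R (T *v y)) - (q y)\<^sup>2 * ln ((q y)\<^sup>2) + (q y)\<^sup>2 * ln (det (rescaled G T \<delta> y)) / 2"
  assumes m: "m > 0"
  shows "set_integrable lborel S' D"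
    "0 \<le> m * (- real CARD('n) - real CARD('n) / 2 * ln (4 * pi)) + (LBINT y:S'. D y) + m * ln m"
proof -
  note Dd = diffeoD[OF d]
  define L where "L = \<delta> *\<^sub>R T"
  have Lv: "L *v y = \<delta> *\<^sub>R (T *v y)" for y by (simp add: L_def scaleR_matrix_vector_assoc)
  have L: "invertible L"
    by (rule matrix_inv_unique(2)[of _ "(1/\<delta>) *\<^sub>R matrix_inv T"])
      (use \<delta>(1) in \<open>simp add: L_def matrix_mult_scaleR_left matrix_mult_scaleR_right matrix_inv_right[OF T]\<close>)
  have S': "S' = {y. L *v y \<in> S}" by (simp add: S'_def Lv)
  have dL: "diffeo S' (\<lambda>y. L *v y) (\<lambda>x. matrix_inv L *v x) S" unfolding S' by (rule diffeo_matrix[OF Dd(1) L])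
  note DL = diffeoD[OF dL]
  have mG: "metric_on S G" unfolding G_def by (rule metric_on_pullback[OF Dd(1) U(1) Dd(4,3,7) U(2)])
  let ?P = "pullback (\<lambda>y. L *v y) G" and ?H = "pullback (\<lambda>y. \<psi> (L *v y)) h"
  have mP: "metric_on S' ?P" by (rule metric_on_pullback[OF DL(1) Dd(1) DL(4,3,7) mG])
  have HP: "?P y = ?H y" if "y \<in> S'" for y
  proof -
    have "?H y = pullback (\<lambda>y. L *v y) (pullback \<psi> h) y"
      by (rule pullback_compose)
        (use that DL(3) in \<open>auto intro: smooth_onD[OF DL(4)] smooth_onD[OF Dd(4)]\<close>)
    then show ?thesis by (simp add: G_def)
  qed
  have PR: "?P y = \<delta>\<^sup>2 *\<^sub>R rescaled G T \<delta> y" for y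
    unfolding pullback_def jac_matrix unfolding rescaled_def Lv
    by (simp add: L_def transpose_scalar matrix_mult_scaleR_left matrix_mult_scaleR_right power2_eq_square)
  have iR: "invertible (rescaled G T \<delta> y)" "det (rescaled G T \<delta> y) > 0" if "y \<in> S'" for y
  proof -
    have "G (\<delta> *\<^sub>R (T *v y)) = G (L *v y)" by (simp add: Lv)
    moreover have "L *v y \<in> S" using that by (simp add: S')
    ultimately show "invertible (rescaled G T \<delta> y)" unfolding rescaled_def
      using T metric_on_invertible[OF mG] by (simp add: invertible_det_nz det_mul)
    have "0 < (\<delta>\<^sup>2) ^ CARD('n) * det (rescaled G T \<delta> y)"
      using metric_on_det_pos[OF mP that] unfolding PR det_scaleR .
    then show "det (rescaled G T \<delta> y) > 0" using \<delta>(1) by (simp add: zero_less_mult_iff)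
  qed
  have rd: "rhs_density (\<delta>\<^sup>2) ?H q y = D y + (real CARD('n) / 2 * ln (\<delta>\<^sup>2)) * (q y)\<^sup>2" if y: "y \<in> S'" for y
  proof -
    have q1: "quadG ?H y = quadG G (\<delta> *\<^sub>R (T *v y))"
      using quadG_cong_open[OF DL(1) mP HP y] quadG_linear[OF Dd(1) mG L] y by (simp add: S' Lv)
    have H: "?H y = \<delta>\<^sup>2 *\<^sub>R rescaled G T \<delta> y" using HP[OF y] PR by simp
    have i1: "matrix_inv (?H y) $ i $ j = (1 / \<delta>\<^sup>2) * matrix_inv (rescaled G T \<delta> y) $ i $ j" for i j
      unfolding H using matrix_inv_scaleR[OF iR(1)[OF y], of "\<delta>\<^sup>2"] \<delta>(1) by simp
    have l1: "ln (det (?H y)) = real CARD('n) * ln (\<delta>\<^sup>2) + ln (det (rescaled G T \<delta> y))"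
    proof -
      have "ln ((\<delta>\<^sup>2) ^ CARD('n) * det (rescaled G T \<delta> y)) = ln ((\<delta>\<^sup>2) ^ CARD('n)) + ln (det (rescaled G T \<delta> y))"
        using \<delta>(1) iR(2)[OF y] by (simp add: ln_mult)
      also have "ln ((\<delta>\<^sup>2) ^ CARD('n)) = real CARD('n) * ln (\<delta>\<^sup>2)" using \<delta>(1) by (simp add: ln_realpow)
      finally show ?thesis unfolding H det_scaleR .
    qed
    have sm: "\<delta>\<^sup>2 * (SUM i j. (1 / \<delta>\<^sup>2) * matrix_inv (rescaled G T \<delta> y) $ i $ j * F i j) = (SUM i j. matrix_inv (rescaled G T \<delta> y) $ i $ j * F i j)" for F :: "'n \<Rightarrow> 'n \<Rightarrow> real"
      unfolding sum_distrib_left using \<delta>(1) by (intro sum.cong refl) simp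
    show ?thesis unfolding rhs_density_def q1 i1 l1 D_def distrib_left sm by (simp add: algebra_simps add_divide_distrib)
  qed
  have dc: "diffeo S' (\<lambda>y. \<psi> (L *v y)) (\<lambda>x. matrix_inv L *v \<phi> x) U" by (rule diffeo_compose[OF d dL])
  have m': "(LBINT x. (q x)\<^sup>2) > 0" using m by (simp add: m_def)
  have KS: "K \<subseteq> S'" using K(2) by (simp add: S'_def)
  have s: "0 < \<delta>\<^sup>2" using \<delta>(1) by simp
  note E = entropy_density_unnormalized[OF U e dc s \<delta>(2) q K(1) KS K(3) m']
  have qi: "integrable lborel (\<lambda>x. (q x)\<^sup>2)"
    using integrable_compact_support(1)[OF continuous_on_power[OF smooth_on_continuous[OF q(1)]] K(1)] K(3) by auto
  have qS: "indicator S' y *\<^sub>R (q y)\<^sup>2 = (q y)\<^sup>2" for y using KS K(3) by (auto simp: indicator_def)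
  have eq: "indicator S' y *\<^sub>R D y = indicator S' y *\<^sub>R rhs_density (\<delta>\<^sup>2) ?H q y - (real CARD('n) / 2 * ln (\<delta>\<^sup>2)) * (q y)\<^sup>2" for y
  proof (cases "y \<in> S'")
    case True then show ?thesis using rd by simp
  next
    case False then show ?thesis using qS[of y] by simp
  qed
  show "set_integrable lborel S' D"
    using E(1) qi unfolding set_integrable_def eq by (intro Bochner_Integration.integrable_diff integrable_mult_right)
  have "(LBINT y:S'. D y) = (LBINT y:S'. rhs_density (\<delta>\<^sup>2) ?H q y) - (real CARD('n) / 2 * ln (\<delta>\<^sup>2)) * m"
    using E(1) qi unfolding set_integrable_def set_lebesgue_integral_def eq
    by (subst Bochner_Integration.integral_diff) (auto simp: m_def)
  moreover have "ln (4 * pi * \<delta>\<^sup>2) = ln (4 * pi) + ln (\<delta>\<^sup>2)" using \<delta>(1) by (simp add: ln_mult)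
  ultimately show "0 \<le> m * (- real CARD('n) - real CARD('n) / 2 * ln (4 * pi)) + (LBINT y:S'. D y) + m * ln m"
    using E(2) by (simp add: m_def algebra_simps)
qed

lemma pd_dilation:
  fixes f :: "real^'n::finite \<Rightarrow> real"
  assumes "f differentiable (at (\<delta> *\<^sub>R y))"
  shows "pd i (\<lambda>y. f (\<delta> *\<^sub>R y)) y = \<delta> * pd i f (\<delta> *\<^sub>R y)"
proof -
  have d: "((\<lambda>y::real^'n. \<delta> *\<^sub>R y) has_derivative (\<lambda>v. \<delta> *\<^sub>R v)) (at y)"
    by (rule bounded_linear_imp_has_derivative) (rule bounded_linear_scaleR_right)
  have dd: "(\<lambda>y::real^'n. \<delta> *\<^sub>R y) differentiable (at y)" using d by (auto simp: differentiable_def)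
  have "pd i (\<lambda>y. f (\<delta> *\<^sub>R y)) y = (SUM j. \<delta> * kron j i * pd j f (\<delta> *\<^sub>R y))"
    using pd_compose[where \<psi> = "\<lambda>y. \<delta> *\<^sub>R y" and f = f, OF dd assms, of i]
    by (simp add: pd_eq[OF d] axis_def)
  also have "\<dots> = (SUM j. if j = i then \<delta> * pd j f (\<delta> *\<^sub>R y) else 0)" by (intro sum.cong) auto
  finally show ?thesis by simp
qed

abbreviation logdet_defect :: "real^'n^'n::finite \<Rightarrow> real"
  where "logdet_defect R \<equiv> trace (matrix_inv R) + ln (det R) - real CARD('n)"

text \<open>The integrand of \<open>scaled_entropy\<close> for \<open>q = sqrt gauss\<close> times
  the cutoff, divided by \<open>gauss\<close> and with the mean zero function
  \<open>(norm y)^2 / 4 - n / 2\<close> subtracted. Without this subtraction the defect of the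
  metric would be hidden behind a term of order one. Where the cutoff is locally 1 only the first
  line remains.\<close>

definition gauss_integrand :: "'n::finite mfield \<Rightarrow> (real^'n \<Rightarrow> real) \<Rightarrow> real^'n^'n \<Rightarrow> real \<Rightarrow> real^'n \<Rightarrow> real"
  where "gauss_integrand G \<xi> T \<delta> y =
    (\<xi> (\<delta> *\<^sub>R y))\<^sup>2 * ((logdet_defect (rescaled G T \<delta> y)) / 2 + \<delta>\<^sup>2 * quadG G (\<delta> *\<^sub>R (T *v y)))
    + ((\<xi> (\<delta> *\<^sub>R y))\<^sup>2 - 1) * ((norm y)\<^sup>2 / 4 - real CARD('n) / 2)
    - (\<xi> (\<delta> *\<^sub>R y))\<^sup>2 * ln ((\<xi> (\<delta> *\<^sub>R y))\<^sup>2)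
    + 2 * \<delta>\<^sup>2 * (SUM i j. matrix_inv (rescaled G T \<delta> y) $ i $ j *
        (pd i \<xi> (\<delta> *\<^sub>R y) * pd j \<xi> (\<delta> *\<^sub>R y) - \<xi> (\<delta> *\<^sub>R y) * pd i (pd j \<xi>) (\<delta> *\<^sub>R y)))"

lemma gauss_norm_square: "has_bochner_integral lborel (\<lambda>y::real^'n::finite. gauss y * ((norm y)\<^sup>2 / 4 - real CARD('n) / 2)) 0"
proof -
  have n: "(norm y)\<^sup>2 = (SUM i. y $ i * y $ i)" for y :: "real^'n"
    unfolding power2_norm_eq_inner by (simp add: inner_vec_def)
  have "has_bochner_integral lborel (\<lambda>y::real^'n. (1/4) * (SUM i. gauss y * (y $ i * y $ i)) + (- real CARD('n) / 2) * gauss y)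
    ((1/4) * (\<Sum>i\<in>(UNIV::'n set). 2 * kron i i) + (- real CARD('n) / 2) * 1)"
    by (intro has_bochner_integral_add has_bochner_integral_mult_right has_bochner_integral_sum gauss_second_moment has_bochner_integral_gauss)
  then show ?thesis by (simp add: n sum_distrib_left algebra_simps sum_divide_distrib)
qed

text \<open>The subtracted function has Gaussian mean zero, and the term \<open>m * ln m\<close> is
  nonpositive because truncation only lowers the mass, so it may be discarded from the lower
  bound.\<close>

lemma gaussian_entropy:
  fixes h :: "'n::finite mfield"
  assumes U: "open U" "metric_on U h" and e: "entropy_ineq U h \<tau>" and d: "diffeo S \<psi> \<phi> U"
    and \<delta>: "0 < \<delta>" "\<delta>\<^sup>2 \<le> \<tau>" and T: "invertible T" and \<rho>: "\<rho> > 0"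
    and c\<xi>: "cutoff \<rho> \<xi>"
    and sub: "\<And>y. norm (\<delta> *\<^sub>R y) \<le> \<rho> \<Longrightarrow> \<delta> *\<^sub>R (T *v y) \<in> S"
  shows "integrable lborel (\<lambda>y. gauss y * gauss_integrand (pullback \<psi> h) \<xi> T \<delta> y)"
    "0 \<le> (LBINT y. gauss y * gauss_integrand (pullback \<psi> h) \<xi> T \<delta> y)"
proof -
  note \<xi> = cutoffD[OF c\<xi>]
  \<comment> \<open>Chosen so that \<open>u\<close> is the square root of \<open>gauss\<close>: the
    constant is the root of the normalizing factor, and the exponent changes from 1/4 to
    1/8.\<close>
  define c where "c = 1 / sqrt (sqrt (4 * pi) ^ CARD('n))"
  define u where "u y = c * exp ((- 1/8) * (norm y)\<^sup>2)" for y :: "real^'n"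
  have u2: "(u y)\<^sup>2 = gauss y" for y
    by (simp add: u_def c_def gauss_def power_mult_distrib power_divide exp_double[symmetric])
  have u0: "u y > 0" for y by (simp add: u_def c_def)
  have su: "smooth_on UNIV u" unfolding u_def[abs_def] by (intro smooth_intros smooth_on_norm_square) auto
  have du: "u differentiable (at y)" for y using smooth_onD[OF su] by blast
  have pu: "pd i u y = - (y $ i / 4) * u y" for i y
  proof -
    have "((\<lambda>t. c * exp ((- 1/8) * t)) has_real_derivative c * ((- 1/8) * exp ((- 1/8) * (norm y)\<^sup>2))) (at ((norm y)\<^sup>2))"
      by (auto intro!: derivative_eq_intros)
    from pd_compose_real(1)[OF smooth_onD[OF smooth_on_norm_square UNIV_I] this, of i]
    show ?thesis by (simp add: u_def[abs_def] pd_norm_square)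
  qed
  have sD: "smooth_on UNIV (\<lambda>y. f (\<delta> *\<^sub>R y))" if "smooth_on UNIV f" for f :: "real^'n \<Rightarrow> real"
    by (rule smooth_on_compose[OF open_UNIV open_UNIV _ _ that]) (auto intro!: smooth_intros)
  have pD: "pd i (\<lambda>y. f (\<delta> *\<^sub>R y)) y = \<delta> * pd i f (\<delta> *\<^sub>R y)" if "smooth_on UNIV f" for f :: "real^'n \<Rightarrow> real" and i y
    by (rule pd_dilation) (use smooth_onD[OF that] in blast)
  note s\<xi> = smooth_on_partial[OF \<xi>(1)]
  have dD: "(\<lambda>y. f (\<delta> *\<^sub>R y)) differentiable (at y)" if "smooth_on UNIV f" for f :: "real^'n \<Rightarrow> real" and y
    using smooth_onD[OF sD[OF that]] by blast
  define q where "q y = u y * \<xi> (\<delta> *\<^sub>R y)" for y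
  have sq: "smooth_on UNIV q" unfolding q_def[abs_def] by (intro smooth_intros su sD \<xi>) auto
  have q1: "pd j q y = u y * (\<delta> * pd j \<xi> (\<delta> *\<^sub>R y) - y $ j / 4 * \<xi> (\<delta> *\<^sub>R y))" for j y
    using pd_mult[OF du[of y] dD[OF \<xi>(1), of y], of j] by (simp add: q_def[abs_def] pu pD[OF \<xi>(1)] algebra_simps)
  have q2: "pd i (pd j q) y = - (y $ i / 4) * u y * (\<delta> * pd j \<xi> (\<delta> *\<^sub>R y) - y $ j / 4 * \<xi> (\<delta> *\<^sub>R y))
    + u y * (\<delta>\<^sup>2 * pd i (pd j \<xi>) (\<delta> *\<^sub>R y) - (1/4) * (kron i j * \<xi> (\<delta> *\<^sub>R y) + y $ j * (\<delta> * pd i \<xi> (\<delta> *\<^sub>R y))))" for i j y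
  proof -
    have a: "(\<lambda>y. \<delta> * pd j \<xi> (\<delta> *\<^sub>R y)) differentiable (at y)" "(\<lambda>y::real^'n. y $ j) differentiable (at y)"
      "(\<lambda>y. y $ j * \<xi> (\<delta> *\<^sub>R y)) differentiable (at y)" "(\<lambda>y. (1/4) * (y $ j * \<xi> (\<delta> *\<^sub>R y))) differentiable (at y)"
      by (intro smooth_onD[OF _ UNIV_I] smooth_intros open_UNIV sD s\<xi> \<xi>)+
    have "pd i (\<lambda>y. \<delta> * pd j \<xi> (\<delta> *\<^sub>R y) - (1/4) * (y $ j * \<xi> (\<delta> *\<^sub>R y))) y
      = \<delta>\<^sup>2 * pd i (pd j \<xi>) (\<delta> *\<^sub>R y) - (1/4) * (kron i j * \<xi> (\<delta> *\<^sub>R y) + y $ j * (\<delta> * pd i \<xi> (\<delta> *\<^sub>R y)))"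
      unfolding pd_diff[OF a(1,4)] pd_linear[OF bounded_linear_mult_right a(3)]
        pd_linear[OF bounded_linear_mult_right dD[OF s\<xi>]] pd_mult[OF a(2) dD[OF \<xi>(1)]]
        pD[OF s\<xi>] pD[OF \<xi>(1)] pd_coord
      by (simp add: power2_eq_square)
    moreover have "pd i (pd j q) y = u y * pd i (\<lambda>y. \<delta> * pd j \<xi> (\<delta> *\<^sub>R y) - (1/4) * (y $ j * \<xi> (\<delta> *\<^sub>R y))) y
      + pd i u y * (\<delta> * pd j \<xi> (\<delta> *\<^sub>R y) - (1/4) * (y $ j * \<xi> (\<delta> *\<^sub>R y)))"
      using pd_mult[OF du[of y] differentiable_diff[OF a(1,4)], of i] by (simp add: q1[abs_def])
    ultimately show ?thesis by (simp add: pu)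
  qed
  \<comment> \<open>Where \<open>q\<close> is positive the left side is \<open>- 2 q^2\<close> times
    the Hessian of \<open>ln q\<close>, to which Gaussian and cutoff contribute separately. The
    Gaussian has a constant Hessian and gives \<open>kron i j / 2\<close>; terms mixing
    \<open>y\<close> with derivatives of \<open>\<xi>\<close> cancel.\<close>
  have qq: "2 * pd i q y * pd j q y - 2 * q y * pd i (pd j q) y
    = gauss y * (2 * \<delta>\<^sup>2 * (pd i \<xi> (\<delta> *\<^sub>R y) * pd j \<xi> (\<delta> *\<^sub>R y) - \<xi> (\<delta> *\<^sub>R y) * pd i (pd j \<xi>) (\<delta> *\<^sub>R y)) + kron i j * (\<xi> (\<delta> *\<^sub>R y))\<^sup>2 / 2)" for i j y
    unfolding q1 q2 q_def u2[symmetric] by (simp add: power2_eq_square algebra_simps)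
  let ?K = "cball (0::real^'n) (\<rho> / \<delta>)"
  have nK: "norm (\<delta> *\<^sub>R y) \<le> \<rho> \<longleftrightarrow> y \<in> ?K" for y using \<delta>(1) by (simp add: field_simps)
  have K: "compact ?K" "?K \<subseteq> {y. \<delta> *\<^sub>R (T *v y) \<in> S}" "\<forall>y. y \<notin> ?K \<longrightarrow> q y = 0"
  proof -
    show "\<forall>y. y \<notin> ?K \<longrightarrow> q y = 0"
    proof (intro allI impI)
      fix y assume "y \<notin> ?K"
      then have "norm (\<delta> *\<^sub>R y) \<ge> \<rho>" using nK[of y] by linarith
      then show "q y = 0" using \<xi>(5) by (simp add: q_def)
    qed
  qed (use sub nK in auto)
  have qp: "\<forall>y. q y \<ge> 0" using u0 \<xi>(2) by (simp add: q_def less_imp_le)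
  define m where "m = (LBINT y. (q y)\<^sup>2)"
  have qi: "integrable lborel (\<lambda>x. (q x)\<^sup>2)"
    using integrable_compact_support(1)[OF continuous_on_power[OF smooth_on_continuous[OF sq]] K(1)] K(3) by auto
  have m1: "m \<le> 1"
  proof -
    have "m \<le> (LBINT y. gauss (y::real^'n))" unfolding m_def
    proof (rule integral_mono[OF qi])
      show "integrable lborel (gauss :: real^'n \<Rightarrow> real)" by (rule integrable.intros[OF has_bochner_integral_gauss])
      show "(q y)\<^sup>2 \<le> gauss y" for y
        unfolding q_def power_mult_distrib u2 using gauss_pos[of y] \<xi>(2,3)[of "\<delta> *\<^sub>R y"]
        by (simp add: mult_left_le power_le_one)
    qed
    then show ?thesis using has_bochner_integral_integral_eq[OF has_bochner_integral_gauss[where 'n='n]] by simp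
  qed
  \<comment> \<open>The cutoff equals 1 on a ball, which has positive measure, and \<open>u\<close>
    is positive there.\<close>
  have m0: "m > 0"
  proof (rule ccontr)
    assume "\<not> m > 0"
    moreover have "m \<ge> 0" unfolding m_def by simp
    ultimately have "m = 0" by simp
    then have "AE y in lborel. (q y)\<^sup>2 = 0" unfolding m_def using integral_nonneg_eq_0_iff_AE[OF qi] by simp
    then have ae: "AE y in lborel. q y = 0" by simp
    have "AE y in lborel. y \<notin> ball (0::real^'n) (\<rho> / (2 * \<delta>))" using ae
    proof (rule eventually_mono)
      fix y :: "real^'n" assume "q y = 0"
      then have "\<xi> (\<delta> *\<^sub>R y) \<noteq> 1" using u0[of y] by (auto simp: q_def)
      then have "\<not> norm (\<delta> *\<^sub>R y) \<le> \<rho> / 2" using \<xi>(4) by blast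
      then show "y \<notin> ball 0 (\<rho> / (2 * \<delta>))" using \<delta>(1) by (auto simp: field_simps)
    qed
    then have "ball (0::real^'n) (\<rho> / (2 * \<delta>)) \<in> null_sets lborel"
      by (subst (asm) AE_iff_null_sets[symmetric]) auto
    then have "negligible (ball (0::real^'n) (\<rho> / (2 * \<delta>)))"
      unfolding negligible_iff_null_sets by (rule null_sets_completionI)
    moreover have "\<rho> / (2 * \<delta>) > 0" using \<rho> \<delta>(1) by simp
    then have "ball (0::real^'n) (\<rho> / (2 * \<delta>)) \<noteq> {}" by (metis ball_eq_empty not_le)
    ultimately show False using open_not_negligible[OF open_ball] by blast
  qed
  let ?n = "real CARD('n)" and ?G = "pullback \<psi> h" and ?S = "{y. \<delta> *\<^sub>R (T *v y) \<in> S}"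
  note E = scaled_entropy[OF U e d \<delta> T sq qp K m0[unfolded m_def]]
  define D where "D = (\<lambda>y. (SUM i j. matrix_inv (rescaled ?G T \<delta> y) $ i $ j * (2 * pd i q y * pd j q y - 2 * q y * pd i (pd j q) y))
      + \<delta>\<^sup>2 * (q y)\<^sup>2 * quadG ?G (\<delta> *\<^sub>R (T *v y)) - (q y)\<^sup>2 * ln ((q y)\<^sup>2) + (q y)\<^sup>2 * ln (det (rescaled ?G T \<delta> y)) / 2)"
  note E = E[folded D_def]
  \<comment> \<open>On \<open>?S\<close> the constants \<open>n\<close> and
    \<open>n / 2 * ln (4 * pi)\<close> combine with the logarithm of the Gaussian. Off
    \<open>?S\<close> the cutoff and its derivatives vanish and both sides are the subtracted mean
    zero function, up to sign.\<close>
  have point: "gauss y * gauss_integrand ?G \<xi> T \<delta> y = indicator ?S y *\<^sub>R D y + (- ?n - ?n / 2 * ln (4 * pi)) * (q y)\<^sup>2 - gauss y * ((norm y)\<^sup>2 / 4 - ?n / 2)" for y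
  proof (cases "y \<in> ?S")
    case True
    let ?Q = "matrix_inv (rescaled ?G T \<delta> y)" and ?x = "\<delta> *\<^sub>R y"
    define Z where "Z = (SUM i j. ?Q $ i $ j * (pd i \<xi> ?x * pd j \<xi> ?x - \<xi> ?x * pd i (pd j \<xi>) ?x))"
    have 1: "(SUM i j. ?Q $ i $ j * (2 * pd i q y * pd j q y - 2 * q y * pd i (pd j q) y))
      = gauss y * (2 * \<delta>\<^sup>2 * Z + trace ?Q * (\<xi> ?x)\<^sup>2 / 2)"
    proof -
      have "(SUM i j. ?Q $ i $ j * (2 * pd i q y * pd j q y - 2 * q y * pd i (pd j q) y))
        = (SUM i j. (gauss y * (2 * \<delta>\<^sup>2)) * (?Q $ i $ j * (pd i \<xi> ?x * pd j \<xi> ?x - \<xi> ?x * pd i (pd j \<xi>) ?x)))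
          + (SUM i j. (gauss y * (\<xi> ?x)\<^sup>2 / 2) * (if i = j then ?Q $ i $ j else 0))"
        unfolding qq sum.distrib[symmetric] by (intro sum.cong refl) (simp add: algebra_simps)
      also have "(SUM i j. (gauss y * (\<xi> ?x)\<^sup>2 / 2) * (if i = j then ?Q $ i $ j else 0)) = (gauss y * (\<xi> ?x)\<^sup>2 / 2) * trace ?Q"
        unfolding sum_distrib_left[symmetric] trace_def by simp
      finally show ?thesis unfolding Z_def sum_distrib_left[symmetric] by (simp add: algebra_simps)
    qed
    have 2: "(q y)\<^sup>2 * ln ((q y)\<^sup>2) = gauss y * (\<xi> ?x)\<^sup>2 * (- (norm y)\<^sup>2 / 4 - ?n / 2 * ln (4 * pi)) + gauss y * ((\<xi> ?x)\<^sup>2 * ln ((\<xi> ?x)\<^sup>2))"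
    proof (cases "\<xi> ?x = 0")
      case False
      have l1: "ln (gauss y) = - (norm y)\<^sup>2 / 4 - ?n / 2 * ln (4 * pi)"
        unfolding gauss_def by (simp add: ln_div ln_realpow ln_sqrt)
      have l2: "ln ((q y)\<^sup>2) = ln (gauss y) + ln ((\<xi> ?x)\<^sup>2)"
        unfolding q_def power_mult_distrib u2 using gauss_pos[of y] False by (simp add: ln_mult)
      have l3: "(q y)\<^sup>2 = gauss y * (\<xi> ?x)\<^sup>2" by (simp add: q_def power_mult_distrib u2)
      show ?thesis unfolding l2 unfolding l1 l3 by (simp add: algebra_simps)
    qed (simp add: q_def)
    have 3: "(q y)\<^sup>2 = gauss y * (\<xi> ?x)\<^sup>2" by (simp add: q_def power_mult_distrib u2)
    have "indicator ?S y *\<^sub>R D y = gauss y * (2 * \<delta>\<^sup>2 * Z + trace ?Q * (\<xi> ?x)\<^sup>2 / 2) + \<delta>\<^sup>2 * (gauss y * (\<xi> ?x)\<^sup>2) * quadG ?G (\<delta> *\<^sub>R (T *v y))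
      - (gauss y * (\<xi> ?x)\<^sup>2 * (- (norm y)\<^sup>2 / 4 - ?n / 2 * ln (4 * pi)) + gauss y * ((\<xi> ?x)\<^sup>2 * ln ((\<xi> ?x)\<^sup>2))) + gauss y * (\<xi> ?x)\<^sup>2 * ln (det (rescaled ?G T \<delta> y)) / 2"
      using True unfolding D_def 1 2 unfolding 3 by simp
    then show ?thesis unfolding gauss_integrand_def Z_def[symmetric] 3 by (simp add: field_simps)
  next
    case False
    let ?x = "\<delta> *\<^sub>R y"
    have x: "?x \<notin> cball 0 \<rho>" using False sub[of y] by auto
    then have "\<xi> ?x = 0" using \<xi>(5)[of ?x] by auto
    moreover have "pd i \<xi> ?x = 0" for i
      by (rule pd_zero_outside[OF closed_cball[of 0 \<rho>] _ x]) (use \<xi>(5) in auto)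
    ultimately show ?thesis using False unfolding gauss_integrand_def by (simp add: q_def algebra_simps)
  qed
  have gi: "integrable lborel (\<lambda>y::real^'n. gauss y * ((norm y)\<^sup>2 / 4 - ?n / 2))" "(LBINT y. gauss (y::real^'n) * ((norm y)\<^sup>2 / 4 - ?n / 2)) = 0"
    using gauss_norm_square[where 'n='n] by (simp_all add: has_bochner_integral_iff)
  have Di: "integrable lborel (\<lambda>y. indicator ?S y *\<^sub>R D y)" using E(1) by (simp add: set_integrable_def)
  show "integrable lborel (\<lambda>y. gauss y * gauss_integrand ?G \<xi> T \<delta> y)"
    unfolding point by (intro Bochner_Integration.integrable_diff Bochner_Integration.integrable_add integrable_mult_right Di qi gi)
  have "(LBINT y. gauss y * gauss_integrand ?G \<xi> T \<delta> y) = (LBINT y:?S. D y) + (- ?n - ?n / 2 * ln (4 * pi)) * m"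
    unfolding point m_def set_lebesgue_integral_def using Di qi gi
    by (subst Bochner_Integration.integral_diff, simp, simp, subst Bochner_Integration.integral_add) simp_all
  moreover have "m * ln m \<le> 0" using m0 m1 by (simp add: mult_nonneg_nonpos)
  ultimately show "0 \<le> (LBINT y. gauss y * gauss_integrand ?G \<xi> T \<delta> y)"
    using E(2) unfolding m_def[symmetric] by (simp add: mult.commute)
qed

section \<open>The expansion of the integrand\<close>

lemma pd_metric_zero:
  assumes "open S" "metric_on S G" "x \<in> S" "\<And>i. conn G i x = 0"
  shows "pd i G x = 0"
  using conn_compat[OF assms(1-3), of i] assms(4) by (simp add: transpose_def vec_eq_iff matrix_matrix_mult_def)

text \<open>\<open>quadG\<close> is quadratic in a connection that vanishes at the origin.\<close>

lemma quadG_bound: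
  fixes G :: "'n::finite mfield"
  assumes S: "open S" "metric_on S G" "cball 0 r \<subseteq> S" and c0: "\<And>i. conn G i 0 = 0"
  shows "\<exists>C\<ge>0. \<forall>x. norm x \<le> r \<longrightarrow> \<bar>quadG G x\<bar> \<le> C * norm x ^ 2"
proof -
  obtain K where K: "K > 0" "\<And>(A::real^'n^'n) (B::real^'n^'n). norm (A ** B) \<le> norm A * norm B * K"
    using bounded_bilinear.pos_bounded[OF bounded_bilinear_matrix_mult] by blast
  obtain Tr where Tr: "Tr > 0" "\<And>A :: real^'n^'n. norm (trace A) \<le> norm A * Tr"
    using bounded_linear.pos_bounded[OF bounded_linear_trace] by blast
  have "\<exists>C\<ge>0. \<forall>i x. norm x \<le> r \<longrightarrow> norm (conn G i x) \<le> C * norm x"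
    by (rule uniform_partial_bound) (use taylor_first[OF S(3) smooth_on_conn[OF S(1,2)] c0] in auto)
  then obtain C1 where C1: "C1 \<ge> 0" "\<And>i x. norm x \<le> r \<Longrightarrow> norm (conn G i x) \<le> C1 * norm x" by blast
  obtain C2 where C2: "C2 \<ge> 0" "\<And>x. norm x \<le> r \<Longrightarrow> norm (matrix_inv (G x)) \<le> C2"
    using smooth_bounded_cball[OF S(3) smooth_on_inv_metric[OF S(1,2)]] by blast
  let ?C = "C2 * ((C1 * C1 * K) * Tr)"
  have "\<bar>quadG G x\<bar> \<le> real CARD('n) * (real CARD('n) * ?C) * norm x ^ 2" if x: "norm x \<le> r" for x
  proof -
    have "\<bar>matrix_inv (G x) $ i $ j * trace (conn G i x ** conn G j x)\<bar> \<le> ?C * norm x ^ 2" for i j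
    proof -
      have "\<bar>matrix_inv (G x) $ i $ j\<bar> \<le> C2"
        using component_le_norm_cart[of "matrix_inv (G x) $ i" j] Finite_Cartesian_Product.norm_nth_le[of "matrix_inv (G x)" i] C2(2)[OF x] by linarith
      moreover have "\<bar>trace (conn G i x ** conn G j x)\<bar> \<le> ((C1 * norm x) * (C1 * norm x) * K) * Tr"
      proof -
        have "norm (conn G i x) * norm (conn G j x) \<le> (C1 * norm x) * (C1 * norm x)"
          by (intro mult_mono C1(2) x) (auto simp: C1(1))
        then have "norm (conn G i x) * norm (conn G j x) * K \<le> (C1 * norm x) * (C1 * norm x) * K"
          using K(1) by (intro mult_right_mono) auto
        then have "norm (conn G i x ** conn G j x) \<le> (C1 * norm x) * (C1 * norm x) * K"
          using K(2) order_trans by blast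
        then have "norm (conn G i x ** conn G j x) * Tr \<le> ((C1 * norm x) * (C1 * norm x) * K) * Tr"
          using Tr(1) by (intro mult_right_mono) auto
        then show ?thesis using Tr(2)[of "conn G i x ** conn G j x"] by simp
      qed
      ultimately have "\<bar>matrix_inv (G x) $ i $ j\<bar> * \<bar>trace (conn G i x ** conn G j x)\<bar> \<le> C2 * (((C1 * norm x) * (C1 * norm x) * K) * Tr)"
        by (intro mult_mono) (auto simp: C2(1))
      then show ?thesis by (simp add: abs_mult power2_eq_square mult_ac)
    qed
    then have "\<bar>quadG G x\<bar> \<le> (\<Sum>i\<in>(UNIV::'n set). \<Sum>j\<in>(UNIV::'n set). ?C * norm x ^ 2)"
      unfolding quadG_def by (intro order_trans[OF sum_abs] sum_mono)
    then show ?thesis by (simp add: mult_ac)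
  qed
  then show ?thesis using C1(1) C2(1) K(1) Tr(1) by (intro exI[of _ "real CARD('n) * (real CARD('n) * ?C)"]) simp
qed

text \<open>
  Used with \<open>B\<^sub>i\<^sub>j = \<Sum>\<^sub>k \<partial>\<^sub>k \<partial>\<^sub>k G\<^sub>i\<^sub>j(0)\<close>, for which the terms of order \<open>\<delta>\<^sup>2\<close> of the rescaled metric have
  mean zero with respect to the Gaussian.
\<close>

definition shear :: "real^'n^'n::finite \<Rightarrow> real \<Rightarrow> real^'n^'n"
  where "shear B \<delta> = mat 1 - (\<delta>\<^sup>2 / 2) *\<^sub>R B"

lemma transpose_shear: "transpose B = B \<Longrightarrow> transpose (shear B \<delta>) = shear B \<delta>"
  by (simp add: shear_def vec_eq_iff transpose_component mat_def)

text \<open>Splits off \<open>T ** T - mat 1\<close>, written as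
  \<open>T ** (T - mat 1) + (T - mat 1)\<close>, so that the correction by the shear and the
  deviation of \<open>G\<close> are estimated separately; both are of second order.\<close>

lemma rescaled_shear:
  assumes "transpose B = B"
  shows "rescaled G (shear B \<delta>) \<delta> y - mat 1 = shear B \<delta> ** (G (\<delta> *\<^sub>R (shear B \<delta> *v y)) - mat 1) ** shear B \<delta> + (shear B \<delta> ** (shear B \<delta> - mat 1) + (shear B \<delta> - mat 1))"
  by (simp add: rescaled_def transpose_shear[OF assms] matrix_mult_diff_left matrix_mult_diff_right)

text \<open>Bounds uniform in \<delta> with polynomial growth in \<open>y\<close>, the raw material
  for dominated convergence. They are asked only for
  \<open>norm (\<delta> *\<^sub>R y) \<le> \<rho>\<close>, outside of which the cutoff
  vanishes.\<close>

definition rescaled_bounded :: "'n::finite mfield \<Rightarrow> (real \<Rightarrow> real^'n^'n) \<Rightarrow> (real^'n) set \<Rightarrow> real \<Rightarrow> real \<Rightarrow> real \<Rightarrow> bool"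
  where "rescaled_bounded G T S \<rho> \<delta>0 C \<longleftrightarrow> (\<forall>\<delta> y. 0 < \<delta> \<longrightarrow> \<delta> \<le> \<delta>0 \<longrightarrow> norm (\<delta> *\<^sub>R y) \<le> \<rho> \<longrightarrow>
    \<delta> *\<^sub>R (T \<delta> *v y) \<in> S \<and> norm (matrix_inv (rescaled G (T \<delta>) \<delta> y)) \<le> C \<and>
    \<bar>logdet_defect (rescaled G (T \<delta>) \<delta> y)\<bar> \<le> C * (\<delta> ^ 4 * (1 + norm y) ^ 4) \<and>
    \<bar>quadG G (\<delta> *\<^sub>R (T \<delta> *v y))\<bar> \<le> C * (\<delta>\<^sup>2 * (1 + norm y)\<^sup>2))"

text \<open>In normal coordinates \<open>G - 1\<close> vanishes to second order, and the shear
  differs from the identity by a multiple of \<delta>^2. So the deviation \<open>H\<close> from the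
  identity is bounded by \<delta>^2 times a quadratic polynomial in \<open>norm y\<close>, and
  \<open>logdet_expansion\<close> makes the defect quadratic in \<open>H\<close>.\<close>

lemma rescaled_bounds:
  fixes G :: "'n::finite mfield"
  assumes S: "open S" "0 \<in> S" "metric_on S G" and G0: "G 0 = mat 1" and c0: "\<And>i. conn G i 0 = 0" and B: "transpose B = B"
  obtains \<rho> \<delta>0 C where "\<rho> > 0" "\<delta>0 > 0" "C \<ge> 0"
    "\<forall>\<delta>. 0 < \<delta> \<longrightarrow> \<delta> \<le> \<delta>0 \<longrightarrow> invertible (shear B \<delta>)"
    "rescaled_bounded G (shear B) S \<rho> \<delta>0 C"
proof -
  obtain K where K: "K > 0" "\<And>(A::real^'n^'n) (B::real^'n^'n). norm (A ** B) \<le> norm A * norm B * K"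
    using bounded_bilinear.pos_bounded[OF bounded_bilinear_matrix_mult] by blast
  obtain Kv where Kv: "Kv > 0" "\<And>(A::real^'n^'n) v. norm (A *v v) \<le> norm A * norm v * Kv"
    using bounded_bilinear.pos_bounded[OF bounded_bilinear_matrix_vector_mult] by blast
  obtain Tr where Tr: "Tr > 0" "\<And>A :: real^'n^'n. norm (trace A) \<le> norm A * Tr"
    using bounded_linear.pos_bounded[OF bounded_linear_trace] by blast
  obtain \<epsilon> CL where \<epsilon>: "\<epsilon> > 0" "CL \<ge> 0" and L: "\<And>H::real^'n^'n. norm H \<le> \<epsilon> \<Longrightarrow>
     det (mat 1 + H) > 0 \<and> norm (matrix_inv (mat 1 + H)) \<le> CL \<and>
     norm (matrix_inv (mat 1 + H) - mat 1) \<le> CL * norm H \<and>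
     \<bar>trace (matrix_inv (mat 1 + H)) + ln (det (mat 1 + H)) - real CARD('n) - trace (H ** H) / 2\<bar> \<le> CL * norm H ^ 3"
    using logdet_expansion[where 'n='n] by blast
  obtain r where r: "r > 0" "cball 0 r \<subseteq> S" using S open_contains_cball by blast
  have sF: "smooth_on S (\<lambda>x. G x - mat 1)" by (intro smooth_on_diff S metric_on_smooth[OF S(3)]) simp
  have pF: "pd i (\<lambda>x. G x - mat 1) 0 = 0" for i
    using pd_diff[OF smooth_onD[OF metric_on_smooth[OF S(3)] S(2)] differentiable_const]
      pd_metric_zero[OF S(1,3,2) c0] by simp
  have "(\<lambda>x. G x - mat 1) 0 = 0" using G0 by simp
  from taylor_second[OF r(2) sF this pF]
  obtain C1 where C1: "C1 \<ge> 0" "\<And>x. norm x \<le> r \<Longrightarrow> norm (G x - mat 1) \<le> C1 * norm x ^ 2" by blast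
  obtain C4 where C4: "C4 \<ge> 0" "\<And>x. norm x \<le> r \<Longrightarrow> \<bar>quadG G x\<bar> \<le> C4 * norm x ^ 2"
    using quadG_bound[OF S(1,3) r(2) c0] by blast
  define N where "N = norm (mat 1 :: real^'n^'n) + 1"
  define b where "b = norm B + 1"
  have Nb: "N > 0" "b > 0" by (auto simp: N_def b_def add_nonneg_pos)
  define C2 where "C2 = 4 * (N * N * K * K) * C1 + N * b * K + b"
  have C2b: "C2 \<ge> b" "C2 > 0" using Nb K(1) C1(1) by (auto simp: C2_def add_nonneg_pos)
  \<comment> \<open>The reciprocal of a sum of three positive numbers, so that
    \<open>t <= \<mu>\<close> implies the three conditions in \<open>mu\<close> at once: the shear
    is bounded by \<open>N\<close>, it at most doubles norms, and \<open>H\<close> stays within the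
    radius \<open>\<epsilon>\<close> of \<open>logdet_expansion\<close>.\<close>
  define \<mu> where "\<mu> = 1 / (b + Kv * b + 2 * C2 / \<epsilon>)"
  have den: "b + Kv * b + 2 * C2 / \<epsilon> > 0" using Nb Kv(1) C2b \<epsilon>(1) by (simp add: add_pos_pos)
  have \<mu>: "\<mu> > 0" unfolding \<mu>_def using den by simp
  have mu: "t * b \<le> 1" "t * (Kv * b) \<le> 1" "C2 * (2 * t) \<le> \<epsilon>" if t: "0 \<le> t" "t \<le> \<mu>" for t
  proof -
    have "t * (b + Kv * b + 2 * C2 / \<epsilon>) \<le> 1" using t(2) den by (simp add: \<mu>_def pos_le_divide_eq)
    moreover have "0 \<le> t * b" "0 \<le> t * (Kv * b)" "0 \<le> t * (2 * C2 / \<epsilon>)" using t(1) Nb Kv(1) C2b(2) \<epsilon>(1) by simp_all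
    ultimately have *: "t * b \<le> 1" "t * (Kv * b) \<le> 1" "t * (2 * C2 / \<epsilon>) \<le> 1" by (simp_all add: distrib_left)
    then show "t * b \<le> 1" "t * (Kv * b) \<le> 1" "C2 * (2 * t) \<le> \<epsilon>" using \<epsilon>(1) by (simp_all add: field_simps)
  qed
  define \<delta>0 where "\<delta>0 = sqrt \<mu>"
  \<comment> \<open>Half of \<open>r\<close> because the shear may double the norm; the other bound
    makes \<open>norm (\<delta> *\<^sub>R y)\<close> squared at most \<open>\<mu>\<close>, as
    \<open>H\<epsilon>\<close> requires.\<close>
  define \<rho> where "\<rho> = min (r / 2) (sqrt \<mu>)"
  have pos: "\<delta>0 > 0" "\<rho> > 0" using \<mu> r(1) by (auto simp: \<delta>0_def \<rho>_def)
  have sq: "\<delta>\<^sup>2 \<le> \<mu>" if "0 < \<delta>" "\<delta> \<le> \<delta>0" for \<delta>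
    using power_mono[OF that(2), of 2] that(1) \<mu> by (simp add: \<delta>0_def)
  have T1: "norm (shear B \<delta> - mat 1) \<le> \<delta>\<^sup>2 * b" for \<delta>
    by (simp add: shear_def b_def) (smt (verit) zero_le_power2 norm_ge_zero mult_nonneg_nonneg distrib_left mult.commute)
  have TN: "norm (shear B \<delta>) \<le> N" if "0 < \<delta>" "\<delta> \<le> \<delta>0" for \<delta>
    using norm_triangle_ineq[of "mat 1" "shear B \<delta> - mat 1"] T1[of \<delta>] mu(1)[OF _ sq[OF that]] by (simp add: N_def)
  have Tinv: "invertible (shear B \<delta>)" if "0 < \<delta>" "\<delta> \<le> \<delta>0" for \<delta>
  proof -
    have "\<delta>\<^sup>2 * b \<le> \<delta>\<^sup>2 * C2" using C2b(1) by (intro mult_left_mono) auto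
    moreover have "C2 * (2 * \<delta>\<^sup>2) \<le> \<epsilon>" by (rule mu(3)[OF _ sq[OF that]]) simp
    moreover have "0 \<le> \<delta>\<^sup>2 * C2" using C2b(2) by simp
    ultimately have "norm (shear B \<delta> - mat 1) \<le> \<epsilon>" using T1[of \<delta>] by (simp add: mult_ac)
    then show ?thesis using L[of "shear B \<delta> - mat 1"] by (simp add: invertible_det_nz)
  qed
  have Tv: "norm (shear B \<delta> *v y) \<le> 2 * norm y" if "0 < \<delta>" "\<delta> \<le> \<delta>0" for \<delta> and y :: "real^'n"
  proof -
    have "shear B \<delta> *v y = y + (shear B \<delta> - mat 1) *v y" by (simp add: matrix_vector_mult_diff_rdistrib)
    then have "norm (shear B \<delta> *v y) \<le> norm y + norm ((shear B \<delta> - mat 1) *v y)" by (metis norm_triangle_ineq)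
    moreover have "norm ((shear B \<delta> - mat 1) *v y) \<le> norm (shear B \<delta> - mat 1) * norm y * Kv" by (rule Kv)
    moreover have "norm (shear B \<delta> - mat 1) * norm y * Kv \<le> (\<delta>\<^sup>2 * b) * norm y * Kv"
      using T1 Kv(1) by (intro mult_right_mono) auto
    moreover have "(\<delta>\<^sup>2 * (Kv * b)) * norm y \<le> 1 * norm y" by (intro mult_right_mono mu(2) sq that) auto
    ultimately show ?thesis by (simp add: mult_ac)
  qed
  have xb: "norm (\<delta> *\<^sub>R (shear B \<delta> *v y)) \<le> 2 * norm (\<delta> *\<^sub>R y)" if "0 < \<delta>" "\<delta> \<le> \<delta>0" for \<delta> and y :: "real^'n"
    using mult_left_mono[OF Tv[OF that, of y], of \<delta>] that(1) by simp
  have xr: "norm (\<delta> *\<^sub>R (shear B \<delta> *v y)) \<le> r" if "0 < \<delta>" "\<delta> \<le> \<delta>0" "norm (\<delta> *\<^sub>R y) \<le> \<rho>" for \<delta> and y :: "real^'n"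
    using xb[OF that(1,2), of y] that(3) by (simp add: \<rho>_def)
  define H where "H \<delta> y = rescaled G (shear B \<delta>) \<delta> y - mat 1" for \<delta> and y :: "real^'n"
  have HC: "norm (H \<delta> y) \<le> C2 * (\<delta>\<^sup>2 + (norm (\<delta> *\<^sub>R y))\<^sup>2)" if d: "0 < \<delta>" "\<delta> \<le> \<delta>0" "norm (\<delta> *\<^sub>R y) \<le> \<rho>" for \<delta> and y :: "real^'n"
  proof -
    let ?T = "shear B \<delta>" and ?x = "\<delta> *\<^sub>R (shear B \<delta> *v y)"
    note N = TN[OF d(1,2)]
    have g: "norm (G ?x - mat 1) \<le> C1 * (4 * (norm (\<delta> *\<^sub>R y))\<^sup>2)"
    proof -
      have "norm ?x ^ 2 \<le> (2 * norm (\<delta> *\<^sub>R y)) ^ 2" using xb[OF d(1,2)] by (intro power_mono) auto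
      then have "C1 * norm ?x ^ 2 \<le> C1 * (4 * (norm (\<delta> *\<^sub>R y))\<^sup>2)"
        using C1(1) by (intro mult_left_mono) (auto simp: power_mult_distrib)
      then show ?thesis using C1(2)[OF xr[OF d]] by linarith
    qed
    have "norm (?T ** (G ?x - mat 1) ** ?T) \<le> norm (?T ** (G ?x - mat 1)) * norm ?T * K" by (rule K)
    also have "\<dots> \<le> (N * (C1 * (4 * (norm (\<delta> *\<^sub>R y))\<^sup>2)) * K) * N * K"
    proof -
      have "norm ?T * norm (G ?x - mat 1) \<le> N * (C1 * (4 * (norm (\<delta> *\<^sub>R y))\<^sup>2))"
        by (intro mult_mono N g) (use Nb in auto)
      then have "norm ?T * norm (G ?x - mat 1) * K \<le> N * (C1 * (4 * (norm (\<delta> *\<^sub>R y))\<^sup>2)) * K"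
        using K(1) by (intro mult_right_mono) auto
      then have "norm (?T ** (G ?x - mat 1)) \<le> N * (C1 * (4 * (norm (\<delta> *\<^sub>R y))\<^sup>2)) * K" using K(2) order_trans by blast
      then show ?thesis using N Nb K(1) C1(1) by (intro mult_right_mono mult_mono) auto
    qed
    finally have 1: "norm (?T ** (G ?x - mat 1) ** ?T) \<le> 4 * (N * N * K * K) * C1 * (norm (\<delta> *\<^sub>R y))\<^sup>2" by (simp add: mult_ac)
    have "norm (?T ** (?T - mat 1)) \<le> norm ?T * norm (?T - mat 1) * K" by (rule K)
    also have "\<dots> \<le> N * (\<delta>\<^sup>2 * b) * K"
      using K(1) Nb by (intro mult_right_mono mult_mono N T1) auto
    finally have 2: "norm (?T ** (?T - mat 1)) \<le> (N * b * K) * \<delta>\<^sup>2" by (simp add: mult_ac)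
    have "norm (H \<delta> y) \<le> norm (?T ** (G ?x - mat 1) ** ?T) + norm (?T ** (?T - mat 1) + (?T - mat 1))"
      unfolding H_def rescaled_shear[OF B] by (rule norm_triangle_ineq)
    moreover have "norm (?T ** (?T - mat 1) + (?T - mat 1)) \<le> norm (?T ** (?T - mat 1)) + norm (?T - mat 1)" by (rule norm_triangle_ineq)
    ultimately have "norm (H \<delta> y) \<le> 4 * (N * N * K * K) * C1 * (norm (\<delta> *\<^sub>R y))\<^sup>2 + (N * b * K + b) * \<delta>\<^sup>2"
      using 1 2 T1[of \<delta>] by (simp add: distrib_right mult.commute[of b])
    moreover have "4 * (N * N * K * K) * C1 * (norm (\<delta> *\<^sub>R y))\<^sup>2 \<le> C2 * (norm (\<delta> *\<^sub>R y))\<^sup>2"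
      unfolding C2_def using Nb K(1) by (intro mult_right_mono) auto
    moreover have "(N * b * K + b) * \<delta>\<^sup>2 \<le> C2 * \<delta>\<^sup>2"
      unfolding C2_def using Nb K(1) C1(1) by (intro mult_right_mono) auto
    ultimately show ?thesis by (simp add: distrib_left)
  qed
  have H\<epsilon>: "norm (H \<delta> y) \<le> \<epsilon>" if d: "0 < \<delta>" "\<delta> \<le> \<delta>0" "norm (\<delta> *\<^sub>R y) \<le> \<rho>" for \<delta> and y :: "real^'n"
  proof -
    have "norm (\<delta> *\<^sub>R y) \<le> sqrt \<mu>" using d(3) by (simp add: \<rho>_def)
    then have "(norm (\<delta> *\<^sub>R y))\<^sup>2 \<le> (sqrt \<mu>)\<^sup>2" by (intro power_mono) auto
    then have "\<delta>\<^sup>2 + (norm (\<delta> *\<^sub>R y))\<^sup>2 \<le> 2 * \<mu>" using sq[OF d(1,2)] \<mu> by simp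
    then have "C2 * (\<delta>\<^sup>2 + (norm (\<delta> *\<^sub>R y))\<^sup>2) \<le> C2 * (2 * \<mu>)" using C2b(2) by (intro mult_left_mono) auto
    then show ?thesis using HC[OF d] mu(3)[of \<mu>] \<mu> by linarith
  qed
  have RH: "rescaled G (shear B \<delta>) \<delta> y = mat 1 + H \<delta> y" for \<delta> y by (simp add: H_def)
  \<comment> \<open>One factor of the cubic remainder is bounded by \<open>\<epsilon>\<close>,
    leaving a bound quadratic in \<open>H\<close>.\<close>
  define C5 where "C5 = Tr * K / 2 + CL * \<epsilon>"
  have C5: "C5 \<ge> 0" using Tr(1) K(1) \<epsilon> by (simp add: C5_def)
  define C where "C = CL + C5 * C2\<^sup>2 + 4 * C4"
  have Cge: "CL \<le> C" "C5 * C2\<^sup>2 \<le> C" "4 * C4 \<le> C" "C \<ge> 0" using \<epsilon>(2) C5 C4(1) by (auto simp: C_def)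
  show thesis
  proof (rule that[OF pos(2,1) Cge(4)], blast intro: Tinv, unfold rescaled_bounded_def, intro allI impI conjI)
    fix \<delta> and y :: "real^'n" assume d: "0 < \<delta>" "\<delta> \<le> \<delta>0" "norm (\<delta> *\<^sub>R y) \<le> \<rho>"
    show "\<delta> *\<^sub>R (shear B \<delta> *v y) \<in> S" using xr[OF d] r(2) by (auto simp: subset_iff)
    note Ly = L[OF H\<epsilon>[OF d]]
    show "norm (matrix_inv (rescaled G (shear B \<delta>) \<delta> y)) \<le> C" using Ly Cge(1) unfolding RH by linarith
    have ny: "0 \<le> norm y" by simp
    show "\<bar>logdet_defect (rescaled G (shear B \<delta>) \<delta> y)\<bar> \<le> C * (\<delta> ^ 4 * (1 + norm y) ^ 4)"
    proof -
      let ?h = "norm (H \<delta> y)"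
      have t: "\<bar>trace (H \<delta> y ** H \<delta> y)\<bar> \<le> Tr * K * ?h\<^sup>2"
      proof -
        have "norm (H \<delta> y ** H \<delta> y) * Tr \<le> (?h * ?h * K) * Tr" using K(2) Tr(1) by (intro mult_right_mono) auto
        then show ?thesis using Tr(2)[of "H \<delta> y ** H \<delta> y"] by (simp add: power2_eq_square mult_ac)
      qed
      have t3: "CL * ?h ^ 3 \<le> CL * \<epsilon> * ?h\<^sup>2"
      proof -
        have "?h * ?h\<^sup>2 \<le> \<epsilon> * ?h\<^sup>2" by (intro mult_right_mono H\<epsilon> d) auto
        then have "CL * (?h * ?h\<^sup>2) \<le> CL * (\<epsilon> * ?h\<^sup>2)" using \<epsilon>(2) by (intro mult_left_mono) auto
        then show ?thesis by (simp add: power3_eq_cube power2_eq_square mult_ac)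
      qed
      have "\<bar>trace (matrix_inv (mat 1 + H \<delta> y)) + ln (det (mat 1 + H \<delta> y)) - real CARD('n)\<bar> \<le> C5 * ?h\<^sup>2"
        using Ly t t3 by (simp add: C5_def distrib_right) linarith
      moreover have "?h\<^sup>2 \<le> C2\<^sup>2 * (\<delta> ^ 4 * (1 + norm y) ^ 4)"
      proof -
        have "\<delta>\<^sup>2 + (norm (\<delta> *\<^sub>R y))\<^sup>2 = \<delta>\<^sup>2 * (1 + (norm y)\<^sup>2)" by (simp add: power_mult_distrib distrib_left)
        also have "\<dots> \<le> \<delta>\<^sup>2 * (1 + norm y)\<^sup>2" using ny by (intro mult_left_mono) (auto simp: power2_sum)
        finally have "C2 * (\<delta>\<^sup>2 + (norm (\<delta> *\<^sub>R y))\<^sup>2) \<le> C2 * (\<delta>\<^sup>2 * (1 + norm y)\<^sup>2)" using C2b(2) by (intro mult_left_mono) auto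
        then have "?h \<le> C2 * (\<delta>\<^sup>2 * (1 + norm y)\<^sup>2)" using HC[OF d] by linarith
        then have "?h\<^sup>2 \<le> (C2 * (\<delta>\<^sup>2 * (1 + norm y)\<^sup>2))\<^sup>2" by (intro power_mono) auto
        then show ?thesis by (simp add: power_mult_distrib flip: power_mult)
      qed
      then have "C5 * ?h\<^sup>2 \<le> C5 * (C2\<^sup>2 * (\<delta> ^ 4 * (1 + norm y) ^ 4))" using C5 by (rule mult_left_mono)
      moreover have "(C5 * C2\<^sup>2) * (\<delta> ^ 4 * (1 + norm y) ^ 4) \<le> C * (\<delta> ^ 4 * (1 + norm y) ^ 4)"
        by (intro mult_right_mono Cge(2)) simp
      ultimately show ?thesis unfolding RH by (simp add: mult.assoc)
    qed
    show "\<bar>quadG G (\<delta> *\<^sub>R (shear B \<delta> *v y))\<bar> \<le> C * (\<delta>\<^sup>2 * (1 + norm y)\<^sup>2)"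
    proof -
      have "norm (\<delta> *\<^sub>R (shear B \<delta> *v y)) ^ 2 \<le> (2 * norm (\<delta> *\<^sub>R y)) ^ 2" using xb[OF d(1,2)] by (intro power_mono) auto
      also have "\<dots> = 4 * (\<delta>\<^sup>2 * (norm y)\<^sup>2)" by (simp add: power_mult_distrib)
      also have "\<dots> \<le> 4 * (\<delta>\<^sup>2 * (1 + norm y)\<^sup>2)" by (intro mult_left_mono power_mono) auto
      finally have "C4 * norm (\<delta> *\<^sub>R (shear B \<delta> *v y)) ^ 2 \<le> C4 * (4 * (\<delta>\<^sup>2 * (1 + norm y)\<^sup>2))"
        using C4(1) by (intro mult_left_mono) auto
      moreover have "(4 * C4) * (\<delta>\<^sup>2 * (1 + norm y)\<^sup>2) \<le> C * (\<delta>\<^sup>2 * (1 + norm y)\<^sup>2)" by (intro mult_right_mono Cge(3)) simp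
      ultimately show ?thesis using C4(2)[OF xr[OF d]] by (simp add: mult_ac)
    qed
  qed
qed

lemma pd_constant_inside:
  assumes "open W" "\<And>x. x \<in> W \<Longrightarrow> f x = c" "x \<in> W"
  shows "pd i f x = 0"
proof -
  have "pd i f x = pd i (\<lambda>x. c) x"
    by (rule pd_cong_open[OF assms(1,3)]) (auto simp: assms(2))
  then show ?thesis by simp
qed

lemma gauss_integrand_inner:
  fixes \<xi> :: "real^'n::finite \<Rightarrow> real"
  assumes \<xi>: "\<And>x. norm x \<le> \<rho>/2 \<Longrightarrow> \<xi> x = 1" and y: "norm (\<delta> *\<^sub>R y) < \<rho> / 2"
  shows "gauss_integrand G \<xi> T \<delta> y = (logdet_defect (rescaled G T \<delta> y)) / 2 + \<delta>\<^sup>2 * quadG G (\<delta> *\<^sub>R (T *v y))"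
proof -
  have p1: "pd i \<xi> x = 0" if "x \<in> ball 0 (\<rho>/2)" for i x
    by (rule pd_constant_inside[OF open_ball _ that]) (use \<xi> in auto)
  have "pd i (pd j \<xi>) (\<delta> *\<^sub>R y) = 0" for i j
    by (rule pd_constant_inside[where W = "ball 0 (\<rho>/2)", OF open_ball p1]) (use y in auto)
  moreover have "pd i \<xi> (\<delta> *\<^sub>R y) = 0" for i using p1[of "\<delta> *\<^sub>R y"] y by simp
  ultimately show ?thesis using \<xi>[of "\<delta> *\<^sub>R y"] y by (simp add: gauss_integrand_def)
qed

text \<open>In the inner region the bound is that of \<open>rescaled_bounded\<close>. Where the
  cutoff is not locally 1, \<open>norm (\<delta> *\<^sub>R y)\<close> is at least
  \<open>\<rho> / 2\<close>, so \<open>1 <= (2 / \<rho> * norm (\<delta> *\<^sub>R y)) ^ 4\<close>.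
  This buys the factor \<delta>^4 at the price of four powers of \<open>norm y\<close>, on top of
  the two from the quadratic term; hence the exponent 6.\<close>

lemma integrand_bound:
  fixes \<xi> :: "real^'n::finite \<Rightarrow> real"
  assumes \<rho>: "\<rho> > 0" and \<delta>0: "\<delta>0 > 0" and C: "C \<ge> 0" and c\<xi>: "cutoff \<rho> \<xi>" and bd: "rescaled_bounded G T S \<rho> \<delta>0 C"
  shows "\<exists>C'. \<forall>\<delta> y. 0 < \<delta> \<longrightarrow> \<delta> \<le> \<delta>0 \<longrightarrow> \<bar>gauss_integrand G \<xi> (T \<delta>) \<delta> y\<bar> \<le> \<delta> ^ 4 * (C' * (1 + norm y) ^ 6)"
proof -
  note \<xi> = cutoffD[OF c\<xi>] and bd = bd[unfolded rescaled_bounded_def, rule_format]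
  let ?n = "real CARD('n)"
  have out: "pd i \<xi> x = 0" if "norm x > \<rho>" for i x
    by (rule pd_zero_outside[OF closed_cball[of 0 \<rho>]]) (use \<xi>(5) that in auto)
  obtain D where D: "D \<ge> 0" "\<And>i j x. norm x \<le> \<rho> \<Longrightarrow> \<bar>pd i \<xi> x * pd j \<xi> x - \<xi> x * pd i (pd j \<xi>) x\<bar> \<le> D"
  proof -
    let ?F = "\<lambda>(ij::'n \<times> 'n) x. pd (fst ij) \<xi> x * pd (snd ij) \<xi> x - \<xi> x * pd (fst ij) (pd (snd ij) \<xi>) x"
    have "smooth_on UNIV (?F ij)" for ij by (intro smooth_intros \<xi>) auto
    then have "\<exists>D\<ge>0. \<forall>x. norm x \<le> \<rho> \<longrightarrow> norm (?F ij x) \<le> D * 1" for ij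
      using smooth_bounded_cball[of \<rho> UNIV "?F ij"] by simp
    then have "\<exists>D\<ge>0. \<forall>ij x. norm x \<le> \<rho> \<longrightarrow> norm (?F ij x) \<le> D * 1"
      by (rule uniform_partial_bound) simp
    then show thesis using that by fastforce
  qed
  \<comment> \<open>Collects the terms due to the cutoff: \<open>1/4 + ?n / 2\<close> for the mean
    zero function, \<open>4\<close> for the logarithm of the cutoff, and the last summand for its
    derivatives.\<close>
  define A where "A = 1/4 + ?n / 2 + 4 + 2 * \<delta>0\<^sup>2 * (?n * (?n * (C * D)))"
  have A: "A \<ge> 0" "1/4 + ?n/2 \<le> A" using C D(1) by (auto simp: A_def)
  define C' where "C' = 2 * C + A * (2 / \<rho>) ^ 4"
  have C': "0 \<le> C'" "2 * C \<le> C'" "A * (2/\<rho>)^4 \<le> C'" using C A(1) \<rho> by (auto simp: C'_def)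
  have bound: "\<bar>gauss_integrand G \<xi> (T \<delta>) \<delta> y\<bar> \<le> \<delta> ^ 4 * (C' * (1 + norm y) ^ 6)" if d: "0 < \<delta>" "\<delta> \<le> \<delta>0" for \<delta> y
  proof -
    let ?x = "\<delta> *\<^sub>R y" and ?R = "rescaled G (T \<delta>) \<delta> y"
    let ?Q = "matrix_inv ?R"
    define M where "M = (trace ?Q + ln (det ?R) - ?n) / 2 + \<delta>\<^sup>2 * quadG G (\<delta> *\<^sub>R (T \<delta> *v y))"
    have y1: "1 \<le> 1 + norm y" by simp
    have pw: "(1 + norm y) ^ k \<le> (1 + norm y) ^ 6" if "k \<le> 6" for k using that by (intro power_increasing) auto
    have M: "\<bar>M\<bar> \<le> \<delta> ^ 4 * (2 * C * (1 + norm y) ^ 6)" if x: "norm ?x \<le> \<rho>"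
    proof -
      have "\<bar>M\<bar> \<le> \<bar>trace ?Q + ln (det ?R) - ?n\<bar> / 2 + \<delta>\<^sup>2 * \<bar>quadG G (\<delta> *\<^sub>R (T \<delta> *v y))\<bar>"
        unfolding M_def by (rule order_trans[OF abs_triangle_ineq]) (simp add: abs_mult)
      also have "\<dots> \<le> C * (\<delta> ^ 4 * (1 + norm y) ^ 4) / 2 + \<delta>\<^sup>2 * (C * (\<delta>\<^sup>2 * (1 + norm y)\<^sup>2))"
        by (intro add_mono divide_right_mono mult_left_mono bd[OF d x, THEN conjunct2, THEN conjunct2, THEN conjunct1] bd[OF d x, THEN conjunct2, THEN conjunct2, THEN conjunct2]) auto
      also have "\<dots> = C * \<delta> ^ 4 * ((1 + norm y) ^ 4 / 2 + (1 + norm y)\<^sup>2)"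
        by (simp add: algebra_simps flip: power_add)
      also have "\<dots> \<le> C * \<delta> ^ 4 * (2 * (1 + norm y) ^ 6)"
      proof -
        have "0 \<le> (1 + norm y) ^ 6" by simp
        then have "(1 + norm y) ^ 4 / 2 + (1 + norm y)\<^sup>2 \<le> 2 * (1 + norm y) ^ 6" using pw[of 4, simplified] pw[of 2, simplified] by linarith
        then show ?thesis using C by (intro mult_left_mono) auto
      qed
      finally show ?thesis by (simp add: mult_ac)
    qed
    have Cy: "\<delta> ^ 4 * (2 * C * (1 + norm y) ^ 6) \<le> \<delta> ^ 4 * (C' * (1 + norm y) ^ 6)"
      by (intro mult_left_mono mult_right_mono C'(2)) auto
    have tail: "A * (1 + norm y)\<^sup>2 \<le> \<delta> ^ 4 * ((A * (2/\<rho>)^4) * (1 + norm y) ^ 6)" if x: "norm ?x \<ge> \<rho> / 2"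
    proof -
      have "1 \<le> (2 / \<rho>) * norm ?x" using x \<rho> by (simp add: field_simps)
      then have "1 \<le> ((2 / \<rho>) * norm ?x) ^ 4" by (rule one_le_power)
      also have "\<dots> = (2 / \<rho>) ^ 4 * (\<delta> ^ 4 * norm y ^ 4)" using d(1) by (simp add: power_mult_distrib power_divide)
      also have "\<dots> \<le> (2 / \<rho>) ^ 4 * (\<delta> ^ 4 * (1 + norm y) ^ 4)"
        using \<rho> by (intro mult_left_mono power_mono) auto
      finally have "(A * (1 + norm y)\<^sup>2) * 1 \<le> (A * (1 + norm y)\<^sup>2) * ((2 / \<rho>) ^ 4 * (\<delta> ^ 4 * (1 + norm y) ^ 4))"
        using A(1) by (intro mult_left_mono) auto
      also have "\<dots> = \<delta> ^ 4 * ((A * (2/\<rho>)^4) * ((1 + norm y)\<^sup>2 * (1 + norm y) ^ 4))" by (simp only: mult_ac)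
      finally show ?thesis by (simp flip: power_add)
    qed
    have CA: "\<delta> ^ 4 * ((A * (2/\<rho>)^4) * (1 + norm y) ^ 6) \<le> \<delta> ^ 4 * (C' * (1 + norm y) ^ 6)"
      by (intro mult_left_mono mult_right_mono C'(3)) auto
    have g: "\<bar>(norm y)\<^sup>2 / 4 - ?n / 2\<bar> \<le> (1/4 + ?n/2) * (1 + norm y)\<^sup>2"
    proof -
      have "\<bar>(norm y)\<^sup>2 / 4 - ?n / 2\<bar> \<le> (norm y)\<^sup>2 / 4 + ?n / 2 * 1" by (rule order_trans[OF abs_triangle_ineq4]) simp
      also have "\<dots> \<le> (1 + norm y)\<^sup>2 / 4 + ?n / 2 * (1 + norm y)\<^sup>2"
        by (intro add_mono divide_right_mono mult_left_mono power_mono one_le_power) auto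
      finally show ?thesis by (simp add: algebra_simps)
    qed
    consider "norm ?x < \<rho> / 2" | "\<rho> / 2 \<le> norm ?x" "norm ?x \<le> \<rho>" | "norm ?x > \<rho>" by linarith
    then show ?thesis
    proof cases
      case 1
      have "gauss_integrand G \<xi> (T \<delta>) \<delta> y = M" unfolding M_def by (rule gauss_integrand_inner[OF \<xi>(4) 1])
      then show ?thesis using M 1 \<rho> Cy by simp
    next
      case 3
      then have z: "\<xi> ?x = 0" "pd i \<xi> ?x = 0" for i using \<xi>(5)[of ?x] out by auto
      have "\<bar>gauss_integrand G \<xi> (T \<delta>) \<delta> y\<bar> = \<bar>(norm y)\<^sup>2 / 4 - ?n / 2\<bar>" by (simp add: gauss_integrand_def z abs_minus_commute)
      also have "\<dots> \<le> A * (1 + norm y)\<^sup>2" using g A(2) by (rule order_trans[OF _ mult_right_mono]) simp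
      finally show ?thesis using tail 3 \<rho> CA by linarith
    next
      case 2
      let ?t = "\<xi> ?x"
      define Z where "Z = (SUM i j. ?Q $ i $ j * (pd i \<xi> ?x * pd j \<xi> ?x - \<xi> ?x * pd i (pd j \<xi>) ?x))"
      have E: "gauss_integrand G \<xi> (T \<delta>) \<delta> y = ?t\<^sup>2 * M + (?t\<^sup>2 - 1) * ((norm y)\<^sup>2 / 4 - ?n / 2) - ?t\<^sup>2 * ln (?t\<^sup>2) + 2 * \<delta>\<^sup>2 * Z"
        by (simp add: gauss_integrand_def M_def Z_def)
      have t: "0 \<le> ?t" "?t \<le> 1" "0 \<le> ?t\<^sup>2" "?t\<^sup>2 \<le> 1" using \<xi>(2,3)[of ?x] by (auto simp: power_le_one)
      have e1: "\<bar>?t\<^sup>2 * M\<bar> \<le> \<bar>M\<bar>" using t by (simp add: abs_mult mult_le_cancel_right1 mult_left_le_one_le)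
      have e2: "\<bar>(?t\<^sup>2 - 1) * ((norm y)\<^sup>2 / 4 - ?n / 2)\<bar> \<le> (1/4 + ?n/2) * (1 + norm y)\<^sup>2"
        unfolding abs_mult using t g by (intro order_trans[OF mult_left_le_one_le g]) auto
      have e3: "\<bar>?t\<^sup>2 * ln (?t\<^sup>2)\<bar> \<le> 4"
      proof -
        have "\<bar>?t\<^sup>2 * ln ?t\<bar> \<le> ?t + ?t ^ 3" by (rule abs_square_ln_le[OF t(1)])
        also have "\<dots> \<le> 2" using t(2) power_le_one[OF t(1,2), of 3] by linarith
        finally have t2: "\<bar>?t\<^sup>2 * ln ?t\<bar> \<le> 2" .
        show ?thesis
        proof (cases "?t = 0")
          case False
          then have "ln (?t\<^sup>2) = 2 * ln ?t" using t(1) by (simp add: ln_realpow)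
          then show ?thesis using t2 by (simp add: abs_mult mult_ac)
        qed simp
      qed
      have "\<bar>Z\<bar> \<le> (\<Sum>i\<in>(UNIV::'n set). \<Sum>j\<in>(UNIV::'n set). C * D)"
        unfolding Z_def
      proof (intro order_trans[OF sum_abs] sum_mono)
        fix i j
        have "\<bar>?Q $ i $ j\<bar> \<le> C"
          using component_le_norm_cart[of "?Q $ i" j] Finite_Cartesian_Product.norm_nth_le[of ?Q i] bd[OF d 2(2)] by linarith
        then show "\<bar>?Q $ i $ j * (pd i \<xi> ?x * pd j \<xi> ?x - \<xi> ?x * pd i (pd j \<xi>) ?x)\<bar> \<le> C * D"
          unfolding abs_mult[of "?Q $ i $ j"] using D(2)[OF 2(2)] C by (intro mult_mono) auto
      qed
      then have Z: "\<bar>Z\<bar> \<le> ?n * (?n * (C * D))" by simp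
      have e4: "\<bar>2 * \<delta>\<^sup>2 * Z\<bar> \<le> 2 * \<delta>0\<^sup>2 * (?n * (?n * (C * D)))"
      proof -
        have "\<delta>\<^sup>2 \<le> \<delta>0\<^sup>2" using d by (intro power_mono) auto
        then have "(2 * \<delta>\<^sup>2) * \<bar>Z\<bar> \<le> (2 * \<delta>0\<^sup>2) * (?n * (?n * (C * D)))" using Z by (intro mult_mono) auto
        then show ?thesis by (simp add: abs_mult)
      qed
      define B2 where "B2 = 2 * \<delta>0\<^sup>2 * (?n * (?n * (C * D)))"
      have B2: "B2 \<ge> 0" using C D(1) by (simp add: B2_def)
      have "1 \<le> (1 + norm y)\<^sup>2" by (rule one_le_power) simp
      then have "4 + B2 \<le> (4 + B2) * (1 + norm y)\<^sup>2" using B2 by (simp add: mult_le_cancel_left1)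
      then have "\<bar>(?t\<^sup>2 - 1) * ((norm y)\<^sup>2 / 4 - ?n / 2)\<bar> + \<bar>?t\<^sup>2 * ln (?t\<^sup>2)\<bar> + \<bar>2 * \<delta>\<^sup>2 * Z\<bar> \<le> A * (1 + norm y)\<^sup>2"
        using e2 e3 e4 unfolding A_def B2_def[symmetric] by (simp add: distrib_right)
      then have "\<bar>gauss_integrand G \<xi> (T \<delta>) \<delta> y\<bar> \<le> \<bar>M\<bar> + A * (1 + norm y)\<^sup>2" unfolding E using e1 by linarith
      also have "\<dots> \<le> \<delta> ^ 4 * (2 * C * (1 + norm y) ^ 6) + \<delta> ^ 4 * ((A * (2/\<rho>)^4) * (1 + norm y) ^ 6)"
        by (intro add_mono M tail 2)
      also have "\<dots> = \<delta> ^ 4 * (C' * (1 + norm y) ^ 6)" by (simp add: C'_def algebra_simps)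
      finally show ?thesis .
    qed
  qed
  then show ?thesis by blast
qed

lemma tendsto_matrix_mult: "(A \<longlongrightarrow> A') F \<Longrightarrow> (B \<longlongrightarrow> B') F \<Longrightarrow> ((\<lambda>x. A x ** (B x :: real^'n::finite^'n)) \<longlongrightarrow> A' ** B') F"
  by (rule bounded_bilinear.tendsto[OF bounded_bilinear_matrix_mult])

lemma tendsto_trace: "(A \<longlongrightarrow> A') F \<Longrightarrow> ((\<lambda>x. trace (A x :: real^'n::finite^'n)) \<longlongrightarrow> trace A') F"
  by (rule bounded_linear.tendsto[OF bounded_linear_trace])

text \<open>Divided by \<delta>^2, the deviation of the rescaled metric converges to
  \<open>P\<close>, its second order Taylor polynomial minus its mean;
  \<open>logdet_expansion\<close> then gives \<open>trace (P ** P) / 4\<close> for half of the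
  defect. Divided by \<delta>, the connection converges to its linear part \<open>\<Gamma>\<close>.
  The cutoff is eventually 1 near the fixed point and does not contribute.\<close>

lemma integrand_limit:
  fixes G :: "'n::finite mfield" and \<xi> :: "real^'n \<Rightarrow> real" and y :: "real^'n"
  assumes S: "open S" "0 \<in> S" "metric_on S G" and G0: "G 0 = mat 1" and c0: "\<And>i. conn G i 0 = 0" and B: "transpose B = B"
    and \<rho>: "\<rho> > 0" and \<xi>: "\<And>x. norm x \<le> \<rho>/2 \<Longrightarrow> \<xi> x = 1" and \<delta>: "\<delta> \<longlonglongrightarrow> 0" "\<And>n. \<delta> n > 0"
  defines "b \<equiv> \<lambda>i j k l. pd k (pd l G) 0 $ i $ j"
    and "t \<equiv> \<lambda>l i a c. pd l (conn G i) 0 $ a $ c"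
  defines "P \<equiv> (\<chi> i j. (1/2) * (SUM k l. b i j k l * (y $ k * y $ l))) - B"
    and "\<Gamma> \<equiv> \<lambda>i. \<chi> a c. SUM l. t l i a c * y $ l"
  shows "(\<lambda>n. gauss_integrand G \<xi> (shear B (\<delta> n)) (\<delta> n) y / \<delta> n ^ 4) \<longlonglongrightarrow> (1/4) * trace (P ** P) + (SUM i. trace (\<Gamma> i ** \<Gamma> i))"
proof -
  define T where "T n = shear B (\<delta> n)" for n
  define v where "v n = T n *v y" for n
  have T: "T \<longlonglongrightarrow> mat 1"
  proof -
    have "(\<lambda>n. mat 1 - ((\<delta> n)\<^sup>2 / 2) *\<^sub>R B) \<longlonglongrightarrow> mat 1 - (0\<^sup>2 / 2) *\<^sub>R B" by (intro tendsto_intros \<delta>) auto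
    then show ?thesis by (simp add: T_def[abs_def] shear_def)
  qed
  have v: "v \<longlonglongrightarrow> y"
    using bounded_bilinear.tendsto[OF bounded_bilinear_matrix_vector_mult T tendsto_const, of y] by (simp add: v_def[abs_def])
  have sG: "smooth_on S G" by (rule metric_on_smooth[OF S(3)])
  have pG: "pd i (\<lambda>x. G x $ a $ c) x = pd i G x $ a $ c" if "x \<in> S" for i a c x
    by (rule pd_matrix_component[OF smooth_onD[OF sG that]])
  let ?P0 = "\<chi> i j. (1/2) * (SUM k l. b i j k l * (y $ k * y $ l))"
  have Gl: "(\<lambda>n. (1 / (\<delta> n)\<^sup>2) *\<^sub>R (G (\<delta> n *\<^sub>R v n) - mat 1)) \<longlonglongrightarrow> ?P0"
  proof (intro vec_tendstoI)
    fix i j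
    let ?F = "\<lambda>x. G x $ i $ j - mat 1 $ i $ j"
    have sF: "smooth_on S ?F" by (intro smooth_intros S sG)
    have dF: "pd l ?F x = pd l G x $ i $ j" if "x \<in> S" for l x
      using pd_diff[OF smooth_onD[OF smooth_on_matrix_component[OF S(1) sG] that] differentiable_const] pG[OF that] by simp
    have ddF: "pd k (pd l ?F) 0 = b i j k l" for k l
    proof -
      have sp: "smooth_on S (\<lambda>x. pd l G x $ i $ j)" by (intro smooth_intros S sG)
      have "pd k (pd l ?F) 0 = pd k (\<lambda>x. pd l G x $ i $ j) 0"
        by (rule pd_cong_open[OF S(1,2) _ smooth_onD[OF sp S(2)]]) (simp add: dF)
      then show ?thesis unfolding b_def
        using pd_matrix_component[OF smooth_onD[OF smooth_on_partial[OF sG] S(2)]] by simp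
    qed
    have "(\<lambda>n. ?F (\<delta> n *\<^sub>R v n) / (\<delta> n)\<^sup>2) \<longlonglongrightarrow> (1/2) * (SUM k l. pd k (pd l ?F) 0 * (y $ k * y $ l))"
      by (rule taylor_second_limit[OF S(1,2) sF _ _ \<delta> v])
        (use G0 dF[OF S(2)] pd_metric_zero[OF S(1,3,2) c0] in simp_all)
    then show "(\<lambda>n. ((1 / (\<delta> n)\<^sup>2) *\<^sub>R (G (\<delta> n *\<^sub>R v n) - mat 1)) $ i $ j) \<longlonglongrightarrow> ?P0 $ i $ j"
      by (simp add: ddF)
  qed
  define H where "H n = rescaled G (T n) (\<delta> n) y - mat 1" for n
  define H' where "H' n = (1 / (\<delta> n)\<^sup>2) *\<^sub>R H n" for n
  have HH': "H n = (\<delta> n)\<^sup>2 *\<^sub>R H' n" for n using \<delta>(2)[of n] by (simp add: H'_def)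
  have H': "H' \<longlonglongrightarrow> P"
  proof -
    \<comment> \<open>The decomposition \<open>rescaled_shear\<close>, divided by \<delta>^2. The
      quotient \<open>(T n - mat 1) / \<delta>^2\<close> is the constant \<open>- B / 2\<close>, and
      since the shear acts on both sides of the metric the limit contains
      \<open>- B\<close>.\<close>
    have "(\<lambda>n. T n ** ((1 / (\<delta> n)\<^sup>2) *\<^sub>R (G (\<delta> n *\<^sub>R v n) - mat 1)) ** T n + (T n ** ((-1/2) *\<^sub>R B) + (-1/2) *\<^sub>R B))
      \<longlonglongrightarrow> mat 1 ** ?P0 ** mat 1 + (mat 1 ** ((-1/2) *\<^sub>R B) + (-1/2) *\<^sub>R B)"
      by (intro tendsto_add tendsto_matrix_mult T Gl tendsto_const)
    moreover have "mat 1 ** ?P0 ** mat 1 + (mat 1 ** ((-1/2) *\<^sub>R B) + (-1/2) *\<^sub>R B) = P"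
    proof -
      have "(-1/2) *\<^sub>R B + (-1/2) *\<^sub>R B = - B" by (simp flip: scaleR_left.add)
      then show ?thesis by (simp add: P_def)
    qed
    moreover have "T n ** ((1 / (\<delta> n)\<^sup>2) *\<^sub>R (G (\<delta> n *\<^sub>R v n) - mat 1)) ** T n + (T n ** ((-1/2) *\<^sub>R B) + (-1/2) *\<^sub>R B) = H' n" for n
    proof -
      have "(1 / (\<delta> n)\<^sup>2) *\<^sub>R (T n - mat 1) = (-1/2) *\<^sub>R B" using \<delta>(2)[of n] by (simp add: T_def shear_def)
      then show ?thesis
        unfolding H'_def H_def T_def rescaled_shear[OF B] v_def
        by (simp add: scaleR_add_right matrix_mult_scaleR_left matrix_mult_scaleR_right flip: T_def) (metis matrix_mult_scaleR_right)
    qed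
    ultimately show ?thesis by simp
  qed
  have H: "H \<longlonglongrightarrow> 0" unfolding HH'[abs_def] using tendsto_scaleR[OF tendsto_power[OF \<delta>(1), of 2] H'] by simp
  obtain \<epsilon> CL where \<epsilon>: "\<epsilon> > 0" "CL \<ge> 0" and L: "\<And>H::real^'n^'n. norm H \<le> \<epsilon> \<Longrightarrow>
     \<bar>trace (matrix_inv (mat 1 + H)) + ln (det (mat 1 + H)) - real CARD('n) - trace (H ** H) / 2\<bar> \<le> CL * norm H ^ 3"
    using logdet_expansion[where 'n='n] by blast
  define X where "X n = logdet_defect (rescaled G (T n) (\<delta> n) y)" for n
  have RH: "rescaled G (T n) (\<delta> n) y = mat 1 + H n" for n by (simp add: H_def)
  have X: "(\<lambda>n. X n / \<delta> n ^ 4) \<longlonglongrightarrow> trace (P ** P) / 2"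
  proof -
    have "(\<lambda>n. X n / \<delta> n ^ 4 - trace (H' n ** H' n) / 2) \<longlonglongrightarrow> 0"
    proof (rule Lim_null_comparison)
      have "\<forall>\<^sub>F n in sequentially. dist (H n) 0 < \<epsilon>" by (rule tendstoD[OF H \<epsilon>(1)])
      then show "\<forall>\<^sub>F n in sequentially. norm (X n / \<delta> n ^ 4 - trace (H' n ** H' n) / 2) \<le> CL * ((\<delta> n)\<^sup>2 * norm (H' n) ^ 3)"
      proof (rule eventually_mono)
        fix n assume "dist (H n) 0 < \<epsilon>"
        then have l: "\<bar>X n - trace (H n ** H n) / 2\<bar> \<le> CL * norm (H n) ^ 3" unfolding X_def RH by (intro L) simp
        have th: "trace (H n ** H n) = \<delta> n ^ 4 * trace (H' n ** H' n)"
          unfolding HH' matrix_mult_scaleR_left matrix_mult_scaleR_right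
          by (simp add: linear_scale[OF bounded_linear.linear[OF bounded_linear_trace]] flip: mult.assoc power_add)
        have nh: "norm (H n) ^ 3 = \<delta> n ^ 4 * ((\<delta> n)\<^sup>2 * norm (H' n) ^ 3)"
          unfolding HH' by (simp add: power_mult_distrib flip: mult.assoc power_add power_mult)
        have p: "\<delta> n ^ 4 > 0" using \<delta>(2)[of n] by simp
        have "X n / \<delta> n ^ 4 - trace (H' n ** H' n) / 2 = (X n - trace (H n ** H n) / 2) / \<delta> n ^ 4"
          unfolding th using p by (simp add: diff_divide_distrib)
        then have "norm (X n / \<delta> n ^ 4 - trace (H' n ** H' n) / 2) = \<bar>X n - trace (H n ** H n) / 2\<bar> / \<delta> n ^ 4"
          using p by simp
        also have "\<dots> \<le> CL * norm (H n) ^ 3 / \<delta> n ^ 4" using l p by (intro divide_right_mono) auto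
        also have "\<dots> = CL * ((\<delta> n)\<^sup>2 * norm (H' n) ^ 3)"
        proof -
          have "CL * (u * w) / u = CL * w" if "u > 0" for u w :: real using that by simp
          then show ?thesis unfolding nh using p by blast
        qed
        finally show "norm (X n / \<delta> n ^ 4 - trace (H' n ** H' n) / 2) \<le> CL * ((\<delta> n)\<^sup>2 * norm (H' n) ^ 3)" .
      qed
      have "(\<lambda>n. CL * ((\<delta> n)\<^sup>2 * norm (H' n) ^ 3)) \<longlonglongrightarrow> CL * (0\<^sup>2 * norm P ^ 3)" by (intro tendsto_intros \<delta> H')
      then show "(\<lambda>n. CL * ((\<delta> n)\<^sup>2 * norm (H' n) ^ 3)) \<longlonglongrightarrow> 0" by simp
    qed
    moreover have "(\<lambda>n. trace (H' n ** H' n) / 2) \<longlonglongrightarrow> trace (P ** P) / 2"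
      by (intro tendsto_divide tendsto_trace tendsto_matrix_mult H' tendsto_const) simp
    ultimately show ?thesis using tendsto_add by fastforce
  qed
  define Y where "Y n = quadG G (\<delta> n *\<^sub>R v n)" for n
  have x0: "(\<lambda>n. \<delta> n *\<^sub>R v n) \<longlonglongrightarrow> 0" using tendsto_scaleR[OF \<delta>(1) v] by simp
  have Y: "(\<lambda>n. Y n / (\<delta> n)\<^sup>2) \<longlonglongrightarrow> (SUM i. trace (\<Gamma> i ** \<Gamma> i))"
  proof -
    define C where "C i n = (1 / \<delta> n) *\<^sub>R conn G i (\<delta> n *\<^sub>R v n)" for i n
    have C: "C i \<longlonglongrightarrow> \<Gamma> i" for i
    proof (intro vec_tendstoI)
      fix a c
      have sc: "smooth_on S (\<lambda>x. conn G i x $ a $ c)" by (intro smooth_intros S)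
      have "(\<lambda>n. conn G i (\<delta> n *\<^sub>R v n) $ a $ c / \<delta> n) \<longlonglongrightarrow> (SUM l. pd l (\<lambda>x. conn G i x $ a $ c) 0 * y $ l)"
        by (rule taylor_first_limit[OF S(1,2) sc _ \<delta> v]) (simp add: c0)
      then show "(\<lambda>n. C i n $ a $ c) \<longlonglongrightarrow> \<Gamma> i $ a $ c"
        by (simp add: C_def \<Gamma>_def t_def pd_matrix_component[OF smooth_onD[OF smooth_on_conn[OF S(1,3)] S(2)]])
    qed
    have "isCont (\<lambda>x. matrix_inv (G x)) 0"
      using smooth_on_continuous[OF smooth_on_inv_metric[OF S(1,3)]] S(1,2) continuous_on_eq_continuous_at by blast
    then have I: "(\<lambda>n. matrix_inv (G (\<delta> n *\<^sub>R v n))) \<longlonglongrightarrow> mat 1"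
      using isCont_tendsto_compose[OF _ x0] by (fastforce simp: G0 matrix_inv_mat_1)
    have "(\<lambda>n. SUM i j. matrix_inv (G (\<delta> n *\<^sub>R v n)) $ i $ j * trace (C i n ** C j n))
      \<longlonglongrightarrow> (SUM i j. (mat 1 :: real^'n^'n) $ i $ j * trace (\<Gamma> i ** \<Gamma> j))"
      by (intro tendsto_sum tendsto_mult tendsto_vec_nth I tendsto_trace tendsto_matrix_mult C)
    moreover have "(SUM i j. (mat 1 :: real^'n^'n) $ i $ j * trace (\<Gamma> i ** \<Gamma> j)) = (SUM i. trace (\<Gamma> i ** \<Gamma> i))"
    proof -
      have "(mat 1 :: real^'n^'n) $ i $ j * trace (\<Gamma> i ** \<Gamma> j) = (if i = j then trace (\<Gamma> i ** \<Gamma> j) else 0)" for i j by (simp add: mat_def)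
      then show ?thesis by simp
    qed
    moreover have "(SUM i j. matrix_inv (G (\<delta> n *\<^sub>R v n)) $ i $ j * trace (C i n ** C j n)) = Y n / (\<delta> n)\<^sup>2" for n
      unfolding Y_def quadG_def C_def matrix_mult_scaleR_left matrix_mult_scaleR_right sum_divide_distrib
      by (intro sum.cong refl) (simp add: linear_scale[OF bounded_linear.linear[OF bounded_linear_trace]] power2_eq_square)
    ultimately show ?thesis by simp
  qed
  have "(\<lambda>n. \<delta> n *\<^sub>R y) \<longlonglongrightarrow> 0" using tendsto_scaleR[OF \<delta>(1) tendsto_const[of y]] by simp
  then have "\<forall>\<^sub>F n in sequentially. dist (\<delta> n *\<^sub>R y) 0 < \<rho> / 2" by (rule tendstoD) (use \<rho> in simp)
  then have ev: "\<forall>\<^sub>F n in sequentially. (1/2) * (X n / \<delta> n ^ 4) + Y n / (\<delta> n)\<^sup>2 = gauss_integrand G \<xi> (shear B (\<delta> n)) (\<delta> n) y / \<delta> n ^ 4"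
  proof (rule eventually_mono)
    fix n assume "dist (\<delta> n *\<^sub>R y) 0 < \<rho> / 2"
    then have n: "norm (\<delta> n *\<^sub>R y) < \<rho> / 2" by simp
    have E: "gauss_integrand G \<xi> (shear B (\<delta> n)) (\<delta> n) y = X n / 2 + (\<delta> n)\<^sup>2 * Y n"
      using gauss_integrand_inner[OF \<xi> n] by (simp add: X_def Y_def v_def T_def)
    have "(\<delta> n)\<^sup>2 * Y n / \<delta> n ^ 4 = Y n / (\<delta> n)\<^sup>2" using \<delta>(2)[of n] by (simp add: power2_eq_square power4_eq_xxxx)
    then show "(1/2) * (X n / \<delta> n ^ 4) + Y n / (\<delta> n)\<^sup>2 = gauss_integrand G \<xi> (shear B (\<delta> n)) (\<delta> n) y / \<delta> n ^ 4"
      unfolding E by (simp add: add_divide_distrib)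
  qed
  have "(\<lambda>n. (1/2) * (X n / \<delta> n ^ 4) + Y n / (\<delta> n)\<^sup>2) \<longlonglongrightarrow> (1/2) * (trace (P ** P) / 2) + (SUM i. trace (\<Gamma> i ** \<Gamma> i))"
    by (intro tendsto_intros X Y)
  from Lim_transform_eventually[OF this ev] show ?thesis by simp
qed

section \<open>Flatness\<close>

lemma trace_square: "trace (A ** A) = (SUM i j. A $ i $ j * A $ j $ i)" for A :: "real^'n::finite^'n"
  by (simp add: trace_def matrix_matrix_mult_def)

text \<open>The Gaussian entropies divided by \<delta>^4 are nonnegative and converge, by dominated
  convergence, to the Gaussian mean of the limit integrand. This mean equals \<open>-1/2\<close>
  times the sum of all squared second derivatives of the metric at the origin, so these vanish; the
  derivatives of the connection are among them up to sign.\<close>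

lemma normal_jet_zero:
  fixes h :: "'n::finite mfield"
  assumes U: "open U" "metric_on U h" and e: "entropy_ineq U h \<tau>" "\<tau> > 0" and d: "diffeo S \<psi> \<phi> U" and S0: "0 \<in> S"
  defines "G \<equiv> pullback \<psi> h"
  assumes G0: "G 0 = mat 1" and c0: "\<And>i. conn G i 0 = 0"
    and cyc: "\<And>l i a b. pd l (conn G i) 0 $ a $ b + pd i (conn G b) 0 $ a $ l + pd b (conn G l) 0 $ a $ i = 0"
  shows "pd l (conn G i) 0 = 0"
proof -
  note D = diffeoD[OF d]
  have mG: "metric_on S G" unfolding G_def by (rule metric_on_pullback[OF D(1) U(1) D(4,3,7) U(2)])
  note S = D(1) S0 mG
  have sG: "smooth_on S G" by (rule metric_on_smooth[OF mG])
  have dC: "conn G i differentiable (at 0)" for i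
    by (rule smooth_onD[OF smooth_on_conn[OF S(1,3)] S(2)])
  have dG: "G differentiable (at 0)" by (rule smooth_onD[OF sG S(2)])
  define b where "b i j k l = pd k (pd l G) 0 $ i $ j" for i j k l
  define t where "t l i a c = pd l (conn G i) 0 $ a $ c" for l i a c
  have cyc': "t l i a j + t i j a l + t j l a i = 0" for l i a j using cyc[of l i a j] by (simp add: t_def)
  have ts: "t l i a j = t l j a i" for l i a j
  proof -
    have "pd l (\<lambda>y. conn G i y $ a $ j) 0 = pd l (\<lambda>y. conn G j y $ a $ i) 0"
      by (rule pd_cong_open[OF S(1,2) conn_sym[OF S(1,3)]])
        (auto intro!: smooth_onD[OF _ S(2)] smooth_intros S)
    then show ?thesis by (simp add: t_def pd_matrix_component[OF dC])
  qed
  have bt: "b a c k l = t k l c a + t k l a c" for a c k l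
  proof -
    have dT: "(\<lambda>y. transpose (conn G l y)) differentiable (at 0)"
      by (intro differentiable_bounded_linear[OF bounded_linear_transpose] dC)
    have "pd k (pd l G) 0 = pd k (\<lambda>y. transpose (conn G l y) ** G y + G y ** conn G l y) 0"
      by (rule pd_cong_open[OF S(1,2)])
        (simp add: conn_compat[OF S(1,3)], intro differentiable_add differentiable_matrix_mult dT dG dC)
    also have "\<dots> = transpose (pd k (conn G l) 0) + pd k (conn G l) 0"
    proof -
      have "transpose (0 :: real^'n^'n) = 0" by (simp add: vec_eq_iff transpose_component)
      then show ?thesis
        by (simp add: pd_add differentiable_matrix_mult dT dG dC pd_matrix_mult c0 G0
            pd_linear[OF bounded_linear_transpose dC])
    qed
    finally show ?thesis by (simp add: b_def t_def transpose_component)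
  qed
  have pG: "pd k (pd l (\<lambda>x. G x $ i $ j)) 0 = b i j k l" for i j k l
  proof -
    have sp: "smooth_on S (\<lambda>x. pd l G x $ i $ j)" by (intro smooth_intros S sG)
    have "pd k (pd l (\<lambda>x. G x $ i $ j)) 0 = pd k (\<lambda>x. pd l G x $ i $ j) 0"
      by (rule pd_cong_open[OF S(1,2) _ smooth_onD[OF sp S(2)]])
        (simp add: pd_matrix_component[OF smooth_onD[OF sG]])
    then show ?thesis unfolding b_def
      using pd_matrix_component[OF smooth_onD[OF smooth_on_partial[OF sG] S(2)]] by simp
  qed
  have bs: "b i j k l = b i j l k" for i j k l
    using pd_commute_real[OF S(1) smooth_on_matrix_component[OF S(1) sG] S(2)] by (simp flip: pG)
  have bss: "b i j k l = b j i k l" for i j k l by (simp add: bt)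
  have ts2: "t l i a c + t l i c a = t i l a c + t i l c a" for l i a c
    using bs[of a c l i] by (simp add: bt add.commute)
  \<comment> \<open>In normal coordinates the derivative of the connection is minus a single second
    derivative of the metric. This turns \<open>trace (\<Gamma> ** \<Gamma>)\<close> into sums to
    which \<open>cyclic_sum_square\<close> applies.\<close>
  have tb: "t l i m k = - b i k m l" for l i m k
    using jet_algebra(1)[of t, OF ts cyc' ts2, of l i m k] by (simp add: bt)
  have bc: "b i m k l + b i k l m + b i l m k = 0" for i m k l
    using jet_algebra(2)[of t, OF ts cyc' ts2, of k l i m] by (simp add: bt)
  define B where "B = (\<chi> i j. SUM k. b i j k k)"
  have B: "transpose B = B" by (simp add: B_def vec_eq_iff transpose_component bss)
  obtain \<rho> \<delta>0 C where \<rho>: "\<rho> > 0" and \<delta>0: "\<delta>0 > 0" and C: "C \<ge> 0"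
    and Ti: "\<forall>\<delta>. 0 < \<delta> \<longrightarrow> \<delta> \<le> \<delta>0 \<longrightarrow> invertible (shear B \<delta>)"
    and bd: "rescaled_bounded G (shear B) S \<rho> \<delta>0 C"
    by (rule rescaled_bounds[OF S G0 c0 B])
  obtain \<xi> :: "real^'n \<Rightarrow> real" where \<xi>: "cutoff \<rho> \<xi>" using cutoff_exists[OF \<rho>] by blast
  obtain C' where C': "\<And>\<delta> y. 0 < \<delta> \<Longrightarrow> \<delta> \<le> \<delta>0 \<Longrightarrow> \<bar>gauss_integrand G \<xi> (shear B \<delta>) \<delta> y\<bar> \<le> \<delta> ^ 4 * (C' * (1 + norm y) ^ 6)"
    using integrand_bound[OF \<rho> \<delta>0 C \<xi> bd] by blast
  \<comment> \<open>Any positive null sequence would do that stays below \<open>\<delta>0\<close>,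
    for the bounds, and below \<open>sqrt \<tau>\<close>, so that
    \<open>s = (\<delta> n)\<^sup>2\<close> is admissible in the entropy.\<close>
  define \<delta> where "\<delta> n = min \<delta>0 (sqrt \<tau>) / (real n + 1)" for n
  have \<delta>: "\<delta> n > 0" "\<delta> n \<le> \<delta>0" "(\<delta> n)\<^sup>2 \<le> \<tau>" for n
  proof -
    have m: "min \<delta>0 (sqrt \<tau>) > 0" using \<delta>0 e(2) by simp
    then show "\<delta> n > 0" by (simp add: \<delta>_def)
    have "\<delta> n \<le> min \<delta>0 (sqrt \<tau>)" unfolding \<delta>_def using divide_left_mono[of 1 "real n + 1" "min \<delta>0 (sqrt \<tau>)"] m by simp
    then show "\<delta> n \<le> \<delta>0" and 1: "(\<delta> n)\<^sup>2 \<le> \<tau>"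
      using power_mono[of "\<delta> n" "sqrt \<tau>" 2] \<open>\<delta> n > 0\<close> e(2) by auto
  qed
  have \<delta>l: "\<delta> \<longlonglongrightarrow> 0"
    using tendsto_mult[OF tendsto_const[of "min \<delta>0 (sqrt \<tau>)"] LIMSEQ_inverse_real_of_nat] by (simp add: \<delta>_def[abs_def] divide_inverse add.commute)
  define P where "P y = (\<chi> i j. (1/2) * (SUM k l. b i j k l * (y $ k * y $ l))) - B" for y
  define \<Gamma> where "\<Gamma> y i = (\<chi> a c. SUM l. t l i a c * y $ l)" for y i
  define g where "g y = gauss y * ((1/4) * trace (P y ** P y) + (SUM i. trace (\<Gamma> y i ** \<Gamma> y i)))" for y
  define f where "f n y = gauss y * gauss_integrand G \<xi> (shear B (\<delta> n)) (\<delta> n) y / \<delta> n ^ 4" for n y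
  have fl: "(\<lambda>n. f n y) \<longlonglongrightarrow> g y" for y
  proof -
    have "(\<lambda>n. gauss_integrand G \<xi> (shear B (\<delta> n)) (\<delta> n) y / \<delta> n ^ 4) \<longlonglongrightarrow> (1/4) * trace (P y ** P y) + (SUM i. trace (\<Gamma> y i ** \<Gamma> y i))"
      using integrand_limit[where y = y, OF S G0 c0 B \<rho> cutoffD(4)[OF \<xi>] \<delta>l \<delta>(1)] unfolding P_def \<Gamma>_def b_def t_def .
    from tendsto_mult[OF tendsto_const[of "gauss y"] this] show ?thesis by (simp add: f_def g_def)
  qed
  have E: "integrable lborel (\<lambda>y. gauss y * gauss_integrand G \<xi> (shear B (\<delta> n)) (\<delta> n) y)"
    "0 \<le> (LBINT y. gauss y * gauss_integrand G \<xi> (shear B (\<delta> n)) (\<delta> n) y)" for n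
    using gaussian_entropy[OF U e(1) d \<delta>(1,3) Ti[rule_format, OF \<delta>(1,2)] \<rho> \<xi>, of n] bd \<delta>[of n] unfolding G_def rescaled_bounded_def by blast+
  have fi: "integrable lborel (f n)" "0 \<le> (LBINT y. f n y)" for n
    using E[of n] \<delta>(1)[of n] by (simp_all add: f_def[abs_def])
  have fb: "norm (f n y) \<le> gauss y * (C' * (1 + norm y) ^ 6)" for n y
  proof -
    have p: "\<delta> n ^ 4 > 0" using \<delta>(1)[of n] by simp
    have "\<bar>gauss_integrand G \<xi> (shear B (\<delta> n)) (\<delta> n) y\<bar> / \<delta> n ^ 4 \<le> C' * (1 + norm y) ^ 6"
      using C'[OF \<delta>(1)[of n] \<delta>(2)[of n], of y] p by (simp add: divide_le_eq mult.commute)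
    then have "gauss y * (\<bar>gauss_integrand G \<xi> (shear B (\<delta> n)) (\<delta> n) y\<bar> / \<delta> n ^ 4) \<le> gauss y * (C' * (1 + norm y) ^ 6)"
      using gauss_pos[of y] by (intro mult_left_mono) auto
    then show ?thesis using gauss_pos[of y] p by (simp add: f_def abs_mult)
  qed
  have gm: "g \<in> borel_measurable lborel" by (rule borel_measurable_LIMSEQ_real[OF fl]) (use fi in auto)
  have "(\<lambda>n. \<integral>y. f n y \<partial>lborel) \<longlonglongrightarrow> (LBINT y. g y)"
    by (rule integral_dominated_convergence[OF gm _ integrable_gauss_power[of C' 6]]) (use fi fl fb in auto)
  then have g0: "0 \<le> (LBINT y. g y)" by (rule LIMSEQ_le_const) (use fi(2) in auto)
  define N where "N i = (SUM j k l. (b i j k l)\<^sup>2)" for i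
  have tP: "trace (P y ** P y) = (SUM i j. ((1/2) * (SUM k l. b i j k l * (y $ k * y $ l)) - (SUM k. b i j k k))\<^sup>2)" for y
  proof -
    have "P y $ j $ i = P y $ i $ j" for i j by (simp add: P_def B_def bss[of j i])
    then show ?thesis unfolding trace_square by (simp add: power2_eq_square) (simp add: P_def B_def)
  qed
  have t\<Gamma>: "trace (\<Gamma> y i ** \<Gamma> y i) = (SUM a c. (SUM l. t l i a c * y $ l) * (SUM l. t l i c a * y $ l))" for y i
    by (simp add: trace_square \<Gamma>_def)
  have "has_bochner_integral lborel (\<lambda>y. (1/4) * (SUM i j. gauss y * ((1/2) * (SUM k l. b i j k l * (y $ k * y $ l)) - (SUM k. b i j k k))\<^sup>2)
      + (SUM i a c. gauss y * ((SUM l. t l i a c * y $ l) * (SUM l. t l i c a * y $ l))))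
    ((1/4) * (SUM i j. 2 * (SUM k l. (b i j k l)\<^sup>2)) + (SUM i a c. 2 * (SUM l. t l i a c * t l i c a)))"
    by (intro has_bochner_integral_add has_bochner_integral_mult_right has_bochner_integral_sum gauss_quadratic_variance gauss_linear_product bs)
  moreover have "(\<lambda>y. (1/4) * (SUM i j. gauss y * ((1/2) * (SUM k l. b i j k l * (y $ k * y $ l)) - (SUM k. b i j k k))\<^sup>2)
      + (SUM i a c. gauss y * ((SUM l. t l i a c * y $ l) * (SUM l. t l i c a * y $ l)))) = g"
    unfolding g_def tP t\<Gamma> fun_eq_iff by (simp only: sum_distrib_left[symmetric]) (simp add: distrib_left)
  \<comment> \<open>The variance part gives \<open>1/4 * 2 = 1/2\<close> times the sum of the
    \<open>N i\<close>, the connection part \<open>-1\<close> times it.\<close>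
  moreover have "(1/4) * (SUM i j. 2 * (SUM k l. (b i j k l)\<^sup>2)) + (SUM i a c. 2 * (SUM l. t l i a c * t l i c a))
    = - (1/2) * (SUM i. N i)"
  proof -
    have "(SUM a c. 2 * (SUM l. t l i a c * t l i c a)) = - N i" for i
      using cyclic_sum_square[of "b i", OF bs bc] by (simp add: tb N_def sum_distrib_left)
    then show ?thesis by (simp add: N_def[symmetric] sum_negf flip: sum_distrib_left)
  qed
  ultimately have "(LBINT y. g y) = - (1/2) * (SUM i. N i)" by (simp add: has_bochner_integral_iff)
  then have "(SUM i. N i) \<le> 0" using g0 by simp
  moreover have "N i \<ge> 0" for i unfolding N_def by (intro sum_nonneg) auto
  ultimately have "N i = 0" for i using sum_nonneg_eq_0_iff[of UNIV N] sum_nonneg[of UNIV N] by auto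
  then have "b i j k l = 0" for i j k l
    unfolding N_def by (simp add: sum_nonneg_eq_0_iff sum_nonneg)
  then show ?thesis using tb by (simp add: vec_eq_iff t_def)
qed

text \<open>At the origin of normal coordinates the connection and its derivatives vanish, hence so
  does the curvature of the pullback. Curvature is a tensor, so this carries over to the original
  coordinates.\<close>

lemma entropy_ineq_flat:
  fixes h :: "'n::finite mfield"
  assumes U: "open U" "y0 \<in> U" and h: "metric_on U h" and e: "entropy_ineq U h \<tau>" "\<tau> > 0"
  shows "curv h i j y0 = 0"
proof -
  obtain S \<psi> \<phi> where S: "0 \<in> S" "diffeo S \<psi> \<phi> U" "\<psi> 0 = y0" "pullback \<psi> h 0 = mat 1" "\<And>i. conn (pullback \<psi> h) i 0 = 0"
    "\<And>l i a b. pd l (conn (pullback \<psi> h) i) 0 $ a $ b + pd i (conn (pullback \<psi> h) b) 0 $ a $ l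
      + pd b (conn (pullback \<psi> h) l) 0 $ a $ i = 0"
    using normal_coordinates[OF U h] by blast
  note D = diffeoD[OF S(2)]
  define J where "J = jac \<psi> 0"
  have J: "invertible J" unfolding J_def by (rule D(7)[OF S(1)])
  have z: "curv (pullback \<psi> h) i j 0 = 0" for i j
    by (simp add: curv_def S(5) normal_jet_zero[OF U(1) h e S(2,1,4,5,6)])
  have 0: "(SUM p q. (J $ p $ i * J $ q $ j) *\<^sub>R curv h p q y0) = 0" for i j
  proof -
    have "(SUM p q. (J $ p $ i * J $ q $ j) *\<^sub>R curv h p q y0) ** J = 0"
      using curv_pullback[OF D(1) U(1) D(4,3,7) h S(1), of i j] by (simp add: z J_def S(3))
    then have "(SUM p q. (J $ p $ i * J $ q $ j) *\<^sub>R curv h p q y0) ** J ** matrix_inv J = 0" by simp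
    then show ?thesis by (simp add: matrix_mul_assoc[symmetric] matrix_inv_right[OF J])
  qed
  have JJ: "(SUM i. J $ p $ i * matrix_inv J $ i $ a) = kron p a" for p a
  proof -
    have "(J ** matrix_inv J) $ p $ a = kron p a" by (simp add: matrix_inv_right[OF J] mat_def)
    then show ?thesis by (simp add: matrix_matrix_mult_def)
  qed
  \<comment> \<open>Contracting both form indices with the inverse Jacobian isolates a single
    curvature matrix.\<close>
  have "0 = (SUM a b. (matrix_inv J $ a $ i * matrix_inv J $ b $ j) *\<^sub>R (SUM p q. (J $ p $ a * J $ q $ b) *\<^sub>R curv h p q y0))"
    by (simp add: 0)
  also have "\<dots> = (SUM a b. SUM p q. ((J $ p $ a * matrix_inv J $ a $ i) * (J $ q $ b * matrix_inv J $ b $ j)) *\<^sub>R curv h p q y0)"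
    unfolding scaleR_sum_right by (simp add: mult_ac)
  also have "\<dots> = (SUM p q. SUM a b. ((J $ p $ a * matrix_inv J $ a $ i) * (J $ q $ b * matrix_inv J $ b $ j)) *\<^sub>R curv h p q y0)"
    by (rule sum_rot4)
  also have "\<dots> = (SUM p q. (kron p i * kron q j) *\<^sub>R curv h p q y0)"
    by (simp only: scaleR_sum_left[symmetric] sum_product[symmetric] JJ)
  also have "\<dots> = (SUM p. if p = i then (SUM q. if q = j then curv h p q y0 else 0) else 0)"
  proof (intro sum.cong refl)
    fix p
    have "(kron p i * kron q j) *\<^sub>R curv h p q y0 = (if p = i then if q = j then curv h p q y0 else 0 else 0)" for q by simp
    then show "(SUM q. (kron p i * kron q j) *\<^sub>R curv h p q y0) = (if p = i then (SUM q. if q = j then curv h p q y0 else 0) else 0)"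
      by (cases "p = i") simp_all
  qed
  also have "\<dots> = curv h i j y0" by simp
  finally show ?thesis by simp
qed

theorem theorem1p4:
  fixes M V :: "'m::{t2_space, second_countable_topology} set"
    and A :: "('m, 'n::finite) chart set"
    and h\<^sub>0 :: "('m, 'n) metric"
    and \<tau>\<^sub>0 :: real
  assumes "smooth_manifold M A"
    and "riemannian_metric A h\<^sub>0"
    and "open V" and "V \<subseteq> M"
    and "\<tau>\<^sub>0 > 0"
    and "nu_entropy A V h\<^sub>0 \<tau>\<^sub>0 \<ge> 0"
  shows "flat_on A h\<^sub>0 V"
  unfolding flat_on_def
proof (intro ballI allI)
  fix c p l k i j
  assume c: "c \<in> A" and p: "p \<in> V \<inter> chart_dom c"
  let ?U = "chart_map c ` (V \<inter> chart_dom c)" and ?h = "metric_in_chart h\<^sub>0 c"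
  have U: "open ?U" "chart_map c p \<in> ?U"
    using open_chart_image[OF assms(1,2) c assms(3)] p by auto
  have h: "metric_on ?U ?h"
    by (rule metric_on_subset[OF metric_on_chart[OF assms(1,2) c]]) blast
  have "curv ?h i j (chart_map c p) = 0"
    by (rule entropy_ineq_flat[OF U h entropy_ineq_chart[OF assms(1-4) c assms(6)] assms(5)])
  then show "riemann_component h\<^sub>0 c l k i j (chart_map c p) = 0"
    using riemann_component_eq_curv[OF U(1) h U(2)] by simp
qed

end
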